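(* Let $\hbar>0$ and let $K:L^2(\mathbb R)\to L^2(\mathbb R)$ be the operator $Kf(z)=\int_{-\infty}^{\infty} f(x)\,\Phi^\hbar(x)\exp\left(\frac{-xz}{2\pi i\hbar}\right)dx$, where $\Phi^\hbar$ is the quantum dilogarithm. Then there is a complex number $\lambda$ with $|\lambda|=1$ such that $$\left((2\pi\sqrt{\hbar})^{-1}K\right)^5=\lambda\cdot \mathrm{Id}.$$
   Context: The quantum dilogarithm is $\Phi^\hbar(z)=\exp\left(-\frac14\int_{\Omega}\frac{e^{-ipz}}{\mathrm{sh}(\pi p)\,\mathrm{sh}(\pi\hbar p)}\frac{dp}{p}\right)$, where $\mathrm{sh}(p)=\frac{e^p-e^{-p}}{2}$ and $\Omega$ is the path from $-\infty$ to $+\infty$ along the real axis that bypasses $0$ along a small half circle above $0$. The integral converges for $|\mathrm{Im}\,z|<\pi(1+\hbar)$ (in particular for real $z$), and $\Phi^\hbar$ extends to a meromorphic function on $\mathbb C$. One has $|\Phi^\hbar(x)|=1$ for real $x$. The integral defining $K$ is understood as multiplication by $\Phi^\hbar$ followed by a rescaled Fourier transform on $L^2(\mathbb R)$. *)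

theory Defs
  imports "HOL-Analysis.Analysis" "HOL-Complex_Analysis.Contour_Integration"
begin

section \<open>The quantum dilogarithm\<close>

definition qdilog_integrand :: "real \<Rightarrow> complex \<Rightarrow> complex \<Rightarrow> complex" where
  "qdilog_integrand h z p =
     exp (- \<i> * p * z) / (sinh (of_real pi * p) * sinh (of_real pi * of_real h * p)) / p"

text \<open>
  The poles of the integrand other than \<open>0\<close> lie at \<open>\<i> * n\<close> and \<open>\<i> * n / h\<close> for integers
  \<open>n \<noteq> 0\<close>, so a half circle around \<open>0\<close> is small if its radius is less than \<open>min 1 (1 / h)\<close>.
  By Cauchy's theorem all such radii give the same integral; half the bound is one choice.
\<close>

definition bypass_radius :: "real \<Rightarrow> real" where
  "bypass_radius h = min 1 (1 / h) / 2"

text \<open>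
  \<open>part_circlepath 0 r pi 0\<close> runs clockwise from \<open>- r\<close> to \<open>r\<close> through the upper half plane.
\<close>

definition qdilog_integral :: "real \<Rightarrow> complex \<Rightarrow> complex" where
  "qdilog_integral h z =
     (let r = bypass_radius h in
        (LINT p:{..- r}|lborel. qdilog_integrand h z (of_real p))
      + contour_integral (part_circlepath 0 r pi 0) (qdilog_integrand h z)
      + (LINT p:{r..}|lborel. qdilog_integrand h z (of_real p)))"

text \<open>
  This is the quantum dilogarithm on the strip \<open>\<bar>Im z\<bar> < pi * (1 + h)\<close>, where the integral
  converges; it does not describe the meromorphic continuation outside of this strip.
\<close>

definition qdilog :: "real \<Rightarrow> complex \<Rightarrow> complex" where
  "qdilog h z = exp (- (1 / 4) * qdilog_integral h z)"


section \<open>The space of square-integrable functions modulo equality almost everywhere\<close>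

definition square_integrable :: "(real \<Rightarrow> complex) \<Rightarrow> bool" where
  "square_integrable f \<longleftrightarrow>
     f \<in> borel_measurable lborel \<and> integrable lborel (\<lambda>x. (cmod (f x))\<^sup>2)"

definition l2_eq :: "(real \<Rightarrow> complex) \<Rightarrow> (real \<Rightarrow> complex) \<Rightarrow> bool" where
  "l2_eq f g \<longleftrightarrow> square_integrable f \<and> square_integrable g \<and> (AE x in lborel. f x = g x)"

lemma square_integrable_zero: "square_integrable (\<lambda>x. 0)"
  by (simp add: square_integrable_def)

lemma part_equivp_l2_eq: "part_equivp l2_eq"
proof (rule part_equivpI)
  show "\<exists>f. l2_eq f f"
    using square_integrable_zero by (auto simp: l2_eq_def)
  show "symp l2_eq"
    by (auto simp: symp_def l2_eq_def elim: eventually_mono)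
  show "transp l2_eq"
  proof (rule transpI)
    fix f g k assume "l2_eq f g" "l2_eq g k"
    moreover have "AE x in lborel. f x = k x"
      if "AE x in lborel. f x = g x" "AE x in lborel. g x = k x"
      using that by eventually_elim simp
    ultimately show "l2_eq f k" by (auto simp: l2_eq_def)
  qed
qed

quotient_type l2 = "real \<Rightarrow> complex" / partial: l2_eq
  by (rule part_equivp_l2_eq)

lift_definition scale_l2 :: "complex \<Rightarrow> l2 \<Rightarrow> l2" is "\<lambda>c f x. c * f x"
  by (auto simp: l2_eq_def square_integrable_def norm_mult power_mult_distrib)


section \<open>The operator\<close>

text \<open>
  Multiplication by a function \<open>u\<close>, to be used only if \<open>u\<close> is measurable and essentially bounded:
  otherwise \<open>abs_l2\<close> may be applied to a function that is not square-integrable.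
\<close>

definition mult_l2 :: "(real \<Rightarrow> complex) \<Rightarrow> l2 \<Rightarrow> l2" where
  "mult_l2 u f = abs_l2 (\<lambda>x. u x * rep_l2 f x)"

definition truncated_fourier :: "real \<Rightarrow> nat \<Rightarrow> (real \<Rightarrow> complex) \<Rightarrow> real \<Rightarrow> complex" where
  "truncated_fourier h n f z =
     (LINT x:{- real n..real n}|lborel.
        f x * exp (of_real (- x * z) / (2 * of_real pi * \<i> * of_real h)))"

text \<open>
  The Fourier integral of a square-integrable function is the limit in the \<open>L\<close>-two norm of the
  integrals over \<open>[- n, n]\<close> (these converge absolutely).  The squared distance is an
  extended nonnegative integral, so convergence to \<open>0\<close> forces it to be finite eventually.
\<close>

definition fourier_l2 :: "real \<Rightarrow> l2 \<Rightarrow> l2" where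
  "fourier_l2 h f =
     (THE g. (\<lambda>n. \<integral>\<^sup>+ z. ennreal ((cmod (truncated_fourier h n (rep_l2 f) z - rep_l2 g z))\<^sup>2)
                \<partial>lborel) \<longlonglongrightarrow> 0)"

definition K_op :: "real \<Rightarrow> l2 \<Rightarrow> l2" where
  "K_op h f = fourier_l2 h (mult_l2 (\<lambda>x. qdilog h (of_real x)) f)"

end

theory Submission
  imports Defs "HOL-Complex_Analysis.Complex_Analysis" "HOL-Probability.Probability"
begin

text \<open>
  Let \<open>X\<close> be multiplication by \<open>exp (x / c)\<close> and \<open>P\<close> the shift \<open>f x \<mapsto> f (x + 2 * pi * \<i> * b)\<close>, where
  \<open>b = min 1 h\<close> and \<open>c = max 1 h\<close>.  The functional equation of the quantum dilogarithm and contour shifts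
  give, on analytic functions that decay fast enough, \<open>B K = K A\<close> for five pairs \<open>A\<close>, \<open>B\<close> of consecutive elements
  in a cycle of five operators.  Hence \<open>S = K\<^sup>5\<close> commutes with \<open>X\<close> there,
  and, since \<open>(1 + X) f\<close> runs through a dense subspace, with multiplication by the bounded function \<open>1 / (1 + X)\<close>
  on the whole space.  By Weierstrass approximation \<open>S\<close> commutes with multiplication by all bounded continuous functions,
  in particular with that by the quantum dilogarithm.  As \<open>K\<close> commutes with \<open>S\<close>, so does the Fourier transform, hence
  all translations, and \<open>S\<close> is a scalar.  It is unimodular because the normalised \<open>K\<close> is isometric by Plancherel.
\<close>

section \<open>The Hilbert space of square-integrable functions\<close>

text \<open>The cycle is a quantum form of the pentagon recurrence x_(i-1) x_(i+1) = 1 + x_i, which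
  has period five. Starting from P^-1 and X, and up to the order of factors and powers of q, it
  produces (1 + X) P, X^-1 (1 + P + X P), X^-1 (1 + P^-1), and then P^-1 again. Two obstacles shape
  the argument. The operators of the cycle are unbounded, so the relations are proved for functions
  on a strip whose decay is preserved by K, and only the bounded function 1 / (1 + X) is carried
  over to the whole space; it separates the points of the line, hence polynomials in it reach every
  bounded continuous multiplier. Secondly, the integral gives \<Phi> only in the strip |Im z| < pi
  (1 + h) = pi (b + c). A shift by 2 pi b stays strictly inside, with room for exponential decay,
  exactly if b < c. This is why the smaller period belongs to the shift, and why h = 1 is reached by
  a limit, in which the isometry of the normalised operators replaces a majorant.\<close>

lemma square_integrable_measurable: "square_integrable f \<Longrightarrow> f \<in> borel_measurable borel"
  by (simp add: square_integrable_def)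

lemma square_integrable_integrable:
  "square_integrable f \<Longrightarrow> integrable lborel (\<lambda>x. (cmod (f x))\<^sup>2)"
  by (simp add: square_integrable_def)

lemma square_integrable_bound:
  assumes "square_integrable f" "g \<in> borel_measurable borel"
    and "AE x in lborel. cmod (g x) \<le> C * cmod (f x)"
  shows "square_integrable g"
  unfolding square_integrable_def
proof
  show "g \<in> borel_measurable lborel" using assms by simp
  have "integrable lborel (\<lambda>x. C\<^sup>2 * (cmod (f x))\<^sup>2)"
    using assms by (simp add: square_integrable_def)
  then show "integrable lborel (\<lambda>x. (cmod (g x))\<^sup>2)"
  proof (rule Bochner_Integration.integrable_bound)
    show "AE x in lborel. norm ((cmod (g x))\<^sup>2) \<le> norm (C\<^sup>2 * (cmod (f x))\<^sup>2)"
      using assms(3)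
    proof eventually_elim
      case (elim x)
      then have "(cmod (g x))\<^sup>2 \<le> (C * cmod (f x))\<^sup>2"
        by (intro power_mono) auto
      then show ?case by (simp add: power_mult_distrib)
    qed
  qed (use assms in simp)
qed

lemma square_integrable_mult:
  assumes "square_integrable f" "u \<in> borel_measurable borel" "\<And>x. cmod (u x) \<le> C"
  shows "square_integrable (\<lambda>x. u x * f x)"
  by (rule square_integrable_bound[OF assms(1), of _ C])
     (use assms square_integrable_measurable[OF assms(1)] in
       \<open>auto simp: norm_mult intro!: mult_right_mono AE_I2\<close>)

lemma square_integrable_add:
  assumes "square_integrable f" "square_integrable g"
  shows "square_integrable (\<lambda>x. f x + g x)"
  unfolding square_integrable_def
proof
  note [measurable] = square_integrable_measurable[OF assms(1)] square_integrable_measurable[OF assms(2)]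
  show "(\<lambda>x. f x + g x) \<in> borel_measurable lborel" by simp
  have "integrable lborel (\<lambda>x. 2 * (cmod (f x))\<^sup>2 + 2 * (cmod (g x))\<^sup>2)"
    using assms by (simp add: square_integrable_def)
  then show "integrable lborel (\<lambda>x. (cmod (f x + g x))\<^sup>2)"
  proof (rule Bochner_Integration.integrable_bound)
    have "(cmod (f x + g x))\<^sup>2 \<le> 2 * (cmod (f x))\<^sup>2 + 2 * (cmod (g x))\<^sup>2" for x
    proof -
      have "(cmod (f x + g x))\<^sup>2 \<le> (cmod (f x) + cmod (g x))\<^sup>2"
        by (intro power_mono norm_triangle_ineq) auto
      also have "\<dots> \<le> 2 * (cmod (f x))\<^sup>2 + 2 * (cmod (g x))\<^sup>2"
        using zero_le_power2[of "cmod (f x) - cmod (g x)"] by (simp add: power2_eq_square algebra_simps)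
      finally show ?thesis .
    qed
    then show "AE x in lborel. norm ((cmod (f x + g x))\<^sup>2) \<le> norm (2 * (cmod (f x))\<^sup>2 + 2 * (cmod (g x))\<^sup>2)"
      by (intro AE_I2) simp
  qed simp
qed

lemma square_integrable_cmult: "square_integrable f \<Longrightarrow> square_integrable (\<lambda>x. c * f x)"
  by (rule square_integrable_mult[of f "\<lambda>_. c" "cmod c"]) auto

lemma square_integrable_uminus: "square_integrable f \<Longrightarrow> square_integrable (\<lambda>x. - f x)"
  using square_integrable_cmult[of f "-1"] by simp

lemma square_integrable_diff:
  "square_integrable f \<Longrightarrow> square_integrable g \<Longrightarrow> square_integrable (\<lambda>x. f x - g x)"
  using square_integrable_add[OF _ square_integrable_uminus, of f g] by simp

lemma integrable_mult_square_integrable: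
  assumes "square_integrable f" "square_integrable g"
  shows "integrable lborel (\<lambda>x. f x * g x)"
proof -
  note [measurable] = square_integrable_measurable[OF assms(1)] square_integrable_measurable[OF assms(2)]
  have "integrable lborel (\<lambda>x. (cmod (f x))\<^sup>2 + (cmod (g x))\<^sup>2)"
    using assms by (simp add: square_integrable_def)
  then show ?thesis
  proof (rule Bochner_Integration.integrable_bound)
    have "cmod (f x) * cmod (g x) \<le> (cmod (f x))\<^sup>2 + (cmod (g x))\<^sup>2" for x
    proof -
      have "2 * (cmod (f x) * cmod (g x)) \<le> (cmod (f x))\<^sup>2 + (cmod (g x))\<^sup>2"
        using zero_le_power2[of "cmod (f x) - cmod (g x)"] by (simp add: power2_eq_square algebra_simps)
      then show ?thesis using mult_nonneg_nonneg[OF norm_ge_zero norm_ge_zero, of "f x" "g x"] by linarith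
    qed
    then show "AE x in lborel. norm (f x * g x) \<le> norm ((cmod (f x))\<^sup>2 + (cmod (g x))\<^sup>2)"
      by (intro AE_I2) (simp add: norm_mult)
  qed simp
qed

lemma integrable_inner_square_integrable:
  assumes "square_integrable f" "square_integrable g"
  shows "integrable lborel (\<lambda>x. f x \<bullet> g x)"
proof -
  note [measurable] = square_integrable_measurable[OF assms(1)] square_integrable_measurable[OF assms(2)]
  show ?thesis
    by (rule Bochner_Integration.integrable_bound[OF integrable_mult_square_integrable[OF assms]])
       (auto simp: norm_mult intro!: AE_I2 Cauchy_Schwarz_ineq2[THEN order_trans])
qed

section \<open>Passing between functions and their classes\<close>

lemma l2_eq_refl: "square_integrable f \<Longrightarrow> l2_eq f f"
  by (simp add: l2_eq_def)

lemma square_integrable_rep_l2: "square_integrable (rep_l2 u)"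
  using Quotient_rep_reflp[OF Quotient_l2, of u] by (simp add: l2_eq_def)

lemma abs_rep_l2: "abs_l2 (rep_l2 u) = u"
  by (rule Quotient_abs_rep[OF Quotient_l2])

lemma abs_l2_eqI: 
  assumes "square_integrable f" "square_integrable g" "AE x in lborel. f x = g x"
  shows "abs_l2 f = abs_l2 g"
  using assms by (intro Quotient_rel_abs[OF Quotient_l2]) (simp add: l2_eq_def)

lemma rep_abs_l2: "square_integrable f \<Longrightarrow> AE x in lborel. rep_l2 (abs_l2 f) x = f x"
  using Quotient_rep_abs[OF Quotient_l2 l2_eq_refl, of f] by (simp add: l2_eq_def)

lemma abs_l2_eq_iff:
  "square_integrable f \<Longrightarrow> square_integrable g \<Longrightarrow> abs_l2 f = abs_l2 g \<longleftrightarrow> (AE x in lborel. f x = g x)"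
  using Quotient_rel[OF Quotient_l2, of f g] by (auto simp: l2_eq_def)

lemma l2_cases: obtains f where "u = abs_l2 f" "square_integrable f"
  using abs_rep_l2 square_integrable_rep_l2 by metis

lemma scale_abs_l2: "square_integrable f \<Longrightarrow> scale_l2 c (abs_l2 f) = abs_l2 (\<lambda>x. c * f x)"
  using scale_l2.abs_eq[OF l2_eq_refl] by simp

text \<open>The inner product is the real part of the Hermitian one, and the vector space is taken
  over the reals. Complex scalars act through \<open>scale_l2\<close>; complex linearity is
  therefore a separate property, as in the locale \<open>l2_operator\<close>.\<close>

instantiation l2 :: real_inner
begin

definition "0 = abs_l2 (\<lambda>x. 0)"
definition "u + v = abs_l2 (\<lambda>x. rep_l2 u x + rep_l2 v x)"
definition "- u = abs_l2 (\<lambda>x. - rep_l2 u x)"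
definition "u - v = abs_l2 (\<lambda>x. rep_l2 u x - rep_l2 v x)"
definition "scaleR c u = abs_l2 (\<lambda>x. of_real c * rep_l2 u x)"
definition "inner u v = (LINT x|lborel. rep_l2 u x \<bullet> rep_l2 v x)"
definition "norm (u :: l2) = sqrt (inner u u)"
definition "sgn (u :: l2) = scaleR (inverse (norm u)) u"
definition "dist (u :: l2) v = norm (u - v)"
definition "(uniformity :: (l2 \<times> l2) filter) = (INF e\<in>{0<..}. principal {(x, y). dist x y < e})"
definition "open (U :: l2 set) = (\<forall>x\<in>U. \<forall>\<^sub>F (x', y) in uniformity. x' = x \<longrightarrow> y \<in> U)"

lemma plus_abs_l2:
  assumes "square_integrable f" "square_integrable g"
  shows "abs_l2 f + abs_l2 g = abs_l2 (\<lambda>x. f x + g x)"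
  unfolding plus_l2_def
  using rep_abs_l2[OF assms(1)] rep_abs_l2[OF assms(2)]
  by (intro abs_l2_eqI square_integrable_add square_integrable_rep_l2 assms)
     (erule eventually_elim2, assumption, simp)

lemma minus_abs_l2:
  assumes "square_integrable f" "square_integrable g"
  shows "abs_l2 f - abs_l2 g = abs_l2 (\<lambda>x. f x - g x)"
  unfolding minus_l2_def
  using rep_abs_l2[OF assms(1)] rep_abs_l2[OF assms(2)]
  by (intro abs_l2_eqI square_integrable_diff square_integrable_rep_l2 assms)
     (erule eventually_elim2, assumption, simp)

lemma uminus_abs_l2:
  assumes "square_integrable f"
  shows "- abs_l2 f = abs_l2 (\<lambda>x. - f x)"
  unfolding uminus_l2_def
  using rep_abs_l2[OF assms(1)]
  by (intro abs_l2_eqI square_integrable_uminus square_integrable_rep_l2 assms)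
     (elim eventually_mono, simp)

lemma scaleR_abs_l2:
  assumes "square_integrable f"
  shows "scaleR c (abs_l2 f) = abs_l2 (\<lambda>x. of_real c * f x)"
  unfolding scaleR_l2_def
  using rep_abs_l2[OF assms(1)]
  by (intro abs_l2_eqI square_integrable_cmult square_integrable_rep_l2 assms)
     (elim eventually_mono, simp)

lemma inner_abs_l2:
  assumes "square_integrable f" "square_integrable g"
  shows "inner (abs_l2 f) (abs_l2 g) = (LINT x|lborel. f x \<bullet> g x)"
proof -
  note [measurable] = square_integrable_measurable[OF assms(1)] square_integrable_measurable[OF assms(2)]
    square_integrable_measurable[OF square_integrable_rep_l2]
  show ?thesis
    unfolding inner_l2_def
    using rep_abs_l2[OF assms(1)] rep_abs_l2[OF assms(2)]
    by (intro integral_cong_AE) (measurable, erule eventually_elim2, assumption, simp)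
qed

instance
proof
  fix u v w :: l2 and a b :: real
  obtain f where f: "u = abs_l2 f" "square_integrable f" by (rule l2_cases)
  obtain g where g: "v = abs_l2 g" "square_integrable g" by (rule l2_cases)
  obtain k where k: "w = abs_l2 k" "square_integrable k" by (rule l2_cases)
  note si = f g k square_integrable_add square_integrable_diff square_integrable_uminus
    square_integrable_cmult square_integrable_zero
  note ops = plus_abs_l2 minus_abs_l2 uminus_abs_l2 scaleR_abs_l2 inner_abs_l2 zero_l2_def
  show "u + v + w = u + (v + w)" by (simp add: si ops add.assoc)
  show "u + v = v + u" by (simp add: si ops add.commute)
  show "0 + u = u" by (simp add: si ops)
  show "- u + u = 0" by (simp add: si ops)
  show "u - v = u + - v" by (simp add: si ops)
  show "a *\<^sub>R (u + v) = a *\<^sub>R u + a *\<^sub>R v" by (simp add: si ops algebra_simps)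
  show "(a + b) *\<^sub>R u = a *\<^sub>R u + b *\<^sub>R u" by (simp add: si ops algebra_simps)
  show "a *\<^sub>R b *\<^sub>R u = (a * b) *\<^sub>R u" by (simp add: si ops algebra_simps)
  show "1 *\<^sub>R u = u" by (simp add: si ops)
  show "dist u v = norm (u - v)" by (simp add: dist_l2_def)
  show "sgn u = inverse (norm u) *\<^sub>R u" by (simp add: sgn_l2_def)
  show "(uniformity :: (l2 \<times> l2) filter) = (INF e\<in>{0<..}. principal {(x, y). dist x y < e})"
    by (rule uniformity_l2_def)
  show "open U = (\<forall>x\<in>U. \<forall>\<^sub>F (x', y) in uniformity. x' = x \<longrightarrow> y \<in> U)" for U :: "l2 set"
    by (rule open_l2_def)
  show "norm u = sqrt (u \<bullet> u)" by (simp add: norm_l2_def)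
  show "u \<bullet> v = v \<bullet> u" by (simp add: si ops inner_commute)
  show "(u + v) \<bullet> w = u \<bullet> w + v \<bullet> w"
    by (simp add: si ops inner_add_left integrable_inner_square_integrable)
  show "(a *\<^sub>R u) \<bullet> v = a * (u \<bullet> v)"
    by (simp add: si ops inner_scaleR_left[where 'a=complex, unfolded scaleR_conv_of_real] integrable_inner_square_integrable)
  show "0 \<le> u \<bullet> u" by (simp add: si ops)
  have "u \<bullet> u = 0 \<longleftrightarrow> (AE x in lborel. f x \<bullet> f x = 0)"
    unfolding f(1) inner_abs_l2[OF f(2) f(2)]
    by (intro integral_nonneg_eq_0_iff_AE integrable_inner_square_integrable f AE_I2) simp
  also have "\<dots> \<longleftrightarrow> u = 0"
    by (simp add: f(1) zero_l2_def abs_l2_eq_iff si)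
  finally show "u \<bullet> u = 0 \<longleftrightarrow> u = 0" .
qed

end

lemma norm_abs_l2_power2: "square_integrable f \<Longrightarrow> (norm (abs_l2 f))\<^sup>2 = (LINT x|lborel. (cmod (f x))\<^sup>2)"
  by (simp add: power2_norm_eq_inner inner_abs_l2)

lemma nn_integral_square_integrable:
  "square_integrable f \<Longrightarrow> (\<integral>\<^sup>+ x. ennreal ((cmod (f x))\<^sup>2) \<partial>lborel) = ennreal ((norm (abs_l2 f))\<^sup>2)"
  by (simp add: norm_abs_l2_power2 nn_integral_eq_integral square_integrable_integrable)

lemma square_integrableI_nn:
  assumes "f \<in> borel_measurable borel" "(\<integral>\<^sup>+ x. ennreal ((cmod (f x))\<^sup>2) \<partial>lborel) < \<infinity>"
  shows "square_integrable f"
  using assms by (auto simp: square_integrable_def integrable_iff_bounded)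

section \<open>Complex scalars and bounded multipliers\<close>

lemma scale_l2_add: "scale_l2 c (u + v) = scale_l2 c u + scale_l2 c v"
  by (rule l2_cases[of u], rule l2_cases[of v])
     (simp add: plus_abs_l2 scale_abs_l2 square_integrable_add square_integrable_cmult algebra_simps)

lemma scale_l2_scale: "scale_l2 c (scale_l2 d u) = scale_l2 (c * d) u"
  by (rule l2_cases[of u]) (simp add: scale_abs_l2 square_integrable_cmult mult.assoc)

lemma scale_l2_scaleR: "scale_l2 c (r *\<^sub>R u) = r *\<^sub>R scale_l2 c u"
  by (rule l2_cases[of u]) (simp add: scale_abs_l2 scaleR_abs_l2 square_integrable_cmult mult.left_commute)

lemma scaleR_eq_scale_l2: "r *\<^sub>R u = scale_l2 (of_real r) u"
  by (rule l2_cases[of u]) (simp add: scale_abs_l2 scaleR_abs_l2)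

lemma scale_l2_one [simp]: "scale_l2 1 u = u"
  by (rule l2_cases[of u]) (simp add: scale_abs_l2)

lemma scale_l2_diff_left: "scale_l2 (c - d) u = scale_l2 c u - scale_l2 d u"
  by (rule l2_cases[of u])
     (simp add: minus_abs_l2 scale_abs_l2 square_integrable_cmult algebra_simps)

lemma norm_scale_l2: "norm (scale_l2 c u) = cmod c * norm u"
proof (rule l2_cases[of u])
  fix f assume f: "u = abs_l2 f" "square_integrable f"
  have "(norm (scale_l2 c u))\<^sup>2 = (cmod c * norm u)\<^sup>2"
    by (simp add: f scale_abs_l2 norm_abs_l2_power2 square_integrable_cmult norm_mult power_mult_distrib)
  then show ?thesis by (simp add: power2_eq_iff_nonneg)
qed

lemma bounded_linear_scale_l2: "bounded_linear (scale_l2 c)"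
  by (rule bounded_linear_intro[of _ "cmod c"])
     (simp_all add: scale_l2_add scale_l2_scaleR norm_scale_l2 mult.commute)

lemma mult_abs_l2:
  assumes "square_integrable f" "u \<in> borel_measurable borel" "\<And>x. cmod (u x) \<le> C"
  shows "mult_l2 u (abs_l2 f) = abs_l2 (\<lambda>x. u x * f x)"
  unfolding mult_l2_def
  using rep_abs_l2[OF assms(1)]
  by (intro abs_l2_eqI square_integrable_mult[OF _ assms(2,3)] square_integrable_rep_l2 assms(1))
     (elim eventually_mono, simp)

lemma bounded_linear_mult_l2:
  assumes "u \<in> borel_measurable borel" "\<And>x. cmod (u x) \<le> C"
  shows "bounded_linear (mult_l2 u)"
proof (rule bounded_linear_intro[of _ C])
  note mu = mult_abs_l2[OF _ assms] square_integrable_mult[OF _ assms]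
  fix v w :: l2 and r
  obtain f where f: "v = abs_l2 f" "square_integrable f" by (rule l2_cases)
  obtain g where g: "w = abs_l2 g" "square_integrable g" by (rule l2_cases)
  show "mult_l2 u (v + w) = mult_l2 u v + mult_l2 u w"
    by (simp add: f g mu plus_abs_l2 square_integrable_add distrib_left)
  show "mult_l2 u (r *\<^sub>R v) = r *\<^sub>R mult_l2 u v"
    by (simp add: f mu scaleR_abs_l2 square_integrable_cmult mult.left_commute)
  have C: "0 \<le> C" using norm_ge_zero assms(2) order_trans by blast
  have "(norm (mult_l2 u v))\<^sup>2 = (LINT x|lborel. (cmod (u x * f x))\<^sup>2)"
    by (simp add: f mu norm_abs_l2_power2)
  also have "\<dots> \<le> (LINT x|lborel. C\<^sup>2 * (cmod (f x))\<^sup>2)"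
  proof (intro integral_mono)
    fix x
    have "(cmod (u x * f x))\<^sup>2 \<le> (C * cmod (f x))\<^sup>2"
      using assms(2)[of x] by (intro power_mono) (auto simp: norm_mult mult_right_mono)
    then show "(cmod (u x * f x))\<^sup>2 \<le> C\<^sup>2 * (cmod (f x))\<^sup>2" by (simp add: power_mult_distrib)
  qed (use mu(2)[OF f(2)] f in \<open>auto simp: square_integrable_def\<close>)
  also have "\<dots> = (norm v * C)\<^sup>2" by (simp add: f norm_abs_l2_power2 power_mult_distrib)
  finally show "norm (mult_l2 u v) \<le> norm v * C"
    by (rule power2_le_imp_le) (use C in simp)
qed

text \<open>Dominated convergence for |F n - f|^2, which is at most 4 |w|^2. Truncations, cutoffs
  and mollifications are passed to the limit with this lemma.\<close>

lemma tendsto_l2_dominated: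
  fixes w :: "real \<Rightarrow> complex"
  assumes w: "square_integrable w"
    and [measurable]: "\<And>n. F n \<in> borel_measurable borel" "f \<in> borel_measurable borel"
    and bd: "\<And>n. AE x in lborel. cmod (F n x) \<le> cmod (w x)"
    and lim: "AE x in lborel. (\<lambda>n. F n x) \<longlonglongrightarrow> f x"
  shows "\<And>n. square_integrable (F n)" "square_integrable f"
    "(\<lambda>n. abs_l2 (F n)) \<longlonglongrightarrow> abs_l2 f"
proof -
  show F: "square_integrable (F n)" for n
    by (rule square_integrable_bound[OF w, of _ 1]) (use bd in auto)
  have "AE x in lborel. \<forall>n. cmod (F n x) \<le> cmod (w x)"
    using bd by (simp add: AE_all_countable)
  then have fw: "AE x in lborel. cmod (f x) \<le> cmod (w x)"
    using lim
  proof eventually_elim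
    case (elim x)
    then show ?case by (intro tendsto_upperbound[OF tendsto_norm[OF elim(2)]]) auto
  qed
  then show f: "square_integrable f"
    by (intro square_integrable_bound[OF w, of _ 1]) auto
  have w2: "integrable lborel (\<lambda>x. 4 * (cmod (w x))\<^sup>2)"
    using w by (simp add: square_integrable_def)
  have "(\<lambda>n. LINT x|lborel. (cmod (F n x - f x))\<^sup>2) \<longlonglongrightarrow> (LINT (x::real)|lborel. (0::real))"
  proof (rule integral_dominated_convergence[where f = "\<lambda>x. 0" and s = "\<lambda>n x. (cmod (F n x - f x))\<^sup>2" and w = "\<lambda>x. 4 * (cmod (w x))\<^sup>2"])
    show "AE x in lborel. (\<lambda>n. (cmod (F n x - f x))\<^sup>2) \<longlonglongrightarrow> 0"
      using lim
    proof eventually_elim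
      case (elim x)
      then have "(\<lambda>n. (cmod (F n x - f x))\<^sup>2) \<longlonglongrightarrow> (cmod (f x - f x))\<^sup>2"
        by (intro tendsto_intros)
      then show ?case by simp
    qed
    show "AE x in lborel. norm ((cmod (F n x - f x))\<^sup>2) \<le> 4 * (cmod (w x))\<^sup>2" for n
      using bd[of n] fw
    proof eventually_elim
      case (elim x)
      have "cmod (F n x - f x) \<le> 2 * cmod (w x)"
        using norm_triangle_ineq4[of "F n x" "f x"] elim by linarith
      then have "(cmod (F n x - f x))\<^sup>2 \<le> (2 * cmod (w x))\<^sup>2" by (intro power_mono) auto
      then show ?case by simp
    qed
  qed (use w2 in measurable)
  then have "(\<lambda>n. (norm (abs_l2 (F n) - abs_l2 f))\<^sup>2) \<longlonglongrightarrow> 0"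
    using F f by (simp add: minus_abs_l2 norm_abs_l2_power2 square_integrable_diff)
  from tendsto_real_sqrt[OF this] have "(\<lambda>n. norm (abs_l2 (F n) - abs_l2 f)) \<longlonglongrightarrow> 0"
    by simp
  then show "(\<lambda>n. abs_l2 (F n)) \<longlonglongrightarrow> abs_l2 f"
    by (rule LIM_zero_cancel[OF tendsto_norm_zero_cancel])
qed

lemma norm_abs_l2_le:
  assumes [measurable]: "f \<in> borel_measurable borel" and "0 \<le> c"
    and "(\<integral>\<^sup>+ x. ennreal ((cmod (f x))\<^sup>2) \<partial>lborel) \<le> ennreal (c\<^sup>2)"
  shows "square_integrable f" "norm (abs_l2 f) \<le> c"
proof -
  show f: "square_integrable f"
    using assms(3) by (intro square_integrableI_nn) (auto simp: le_less_trans)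
  have "(norm (abs_l2 f))\<^sup>2 \<le> c\<^sup>2"
    using assms(3) nn_integral_square_integrable[OF f] by (simp add: ennreal_le_iff)
  then show "norm (abs_l2 f) \<le> c" using assms(2) by (rule power2_le_imp_le)
qed

text \<open>Riesz--Fischer: a rapidly converging subsequence converges almost everywhere.\<close>

instance l2 :: complete_space
proof
  fix X :: "nat \<Rightarrow> l2" assume X: "Cauchy X"
  then have "\<forall>k. \<exists>N. \<forall>m\<ge>N. \<forall>n\<ge>N. dist (X m) (X n) < (1/4)^k"
    unfolding Cauchy_def by simp
  then obtain N where N: "\<And>k m n. m \<ge> N k \<Longrightarrow> n \<ge> N k \<Longrightarrow> dist (X m) (X n) < (1/4)^k"
    by metis
  \<comment> \<open>The sum makes \<open>r m\<close> at least \<open>N k\<close> for every k up to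
    m, and the summand \<open>k\<close> makes \<open>r\<close> strictly increasing.\<close>
  define r where "r k = (\<Sum>i\<le>k. N i) + k" for k
  have r: "strict_mono r" by (rule strict_monoI_Suc) (simp add: r_def)
  have rN: "r m \<ge> N k" if "k \<le> m" for k m
  proof -
    have "N k \<le> (\<Sum>i\<le>m. N i)" by (rule member_le_sum) (use that in auto)
    then show ?thesis by (simp add: r_def)
  qed
  define f where "f k = rep_l2 (X (r k))" for k
  have f: "square_integrable (f k)" "abs_l2 (f k) = X (r k)" for k
    by (simp_all add: f_def square_integrable_rep_l2 abs_rep_l2)
  note [measurable] = f(1)[THEN square_integrable_measurable]
  have fd: "(\<integral>\<^sup>+ x. ennreal ((cmod (f m x - f n x))\<^sup>2) \<partial>lborel) \<le> ennreal (((1/4)^k)\<^sup>2)"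
    if "k \<le> m" "k \<le> n" for k m n
  proof -
    have "norm (X (r m) - X (r n)) \<le> (1/4)^k"
      using N[OF rN[OF that(1)] rN[OF that(2)]] by (simp add: dist_norm)
    then have "(norm (abs_l2 (\<lambda>x. f m x - f n x)))\<^sup>2 \<le> ((1/4)^k)\<^sup>2"
      by (intro power_mono) (simp_all add: f minus_abs_l2[symmetric])
    then show ?thesis
      by (simp add: nn_integral_square_integrable f square_integrable_diff)
  qed
  \<comment> \<open>Squared distances of successive terms are at most 16^-k, so the weight 4^k still
    leaves a convergent series. Conversely, finiteness of S at x forces the increments at x below a
    constant times 2^-k.\<close>
  define S where "S x = (\<Sum>k. ennreal (4^k * (cmod (f (Suc k) x - f k x))\<^sup>2))" for x
  have "(\<integral>\<^sup>+ x. S x \<partial>lborel) = (\<Sum>k. \<integral>\<^sup>+ x. ennreal (4^k * (cmod (f (Suc k) x - f k x))\<^sup>2) \<partial>lborel)"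
    unfolding S_def by (rule nn_integral_suminf) measurable
  also have "\<dots> \<le> (\<Sum>k. ennreal ((1/4)^k))"
  proof (intro suminf_le)
    fix k
    have "(\<integral>\<^sup>+ x. ennreal (4^k * (cmod (f (Suc k) x - f k x))\<^sup>2) \<partial>lborel)
        = ennreal (4^k) * (\<integral>\<^sup>+ x. ennreal ((cmod (f (Suc k) x - f k x))\<^sup>2) \<partial>lborel)"
      by (subst nn_integral_cmult[symmetric]) (measurable, simp add: ennreal_mult)
    also have "\<dots> \<le> ennreal (4^k) * ennreal (((1/4)^k)\<^sup>2)"
      by (intro mult_left_mono fd) auto
    also have "\<dots> = ennreal ((1/4)^k)"
      by (simp add: ennreal_mult[symmetric] power2_eq_square power_mult_distrib[symmetric])
    finally show "(\<integral>\<^sup>+ x. ennreal (4^k * (cmod (f (Suc k) x - f k x))\<^sup>2) \<partial>lborel) \<le> ennreal ((1/4)^k)" .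
  qed auto
  also have "\<dots> = ennreal (\<Sum>k. (1/4)^k)"
    by (rule suminf_ennreal2) (auto simp: summable_geometric)
  also have "\<dots> < \<infinity>" by simp
  finally have "AE x in lborel. S x \<noteq> \<infinity>"
    by (intro nn_integral_PInf_AE) (auto simp: S_def)
  then have conv: "AE x in lborel. (\<lambda>k. f k x) \<longlonglongrightarrow> lim (\<lambda>k. f k x)"
  proof eventually_elim
    case (elim x)
    then obtain M where M: "S x = ennreal M" "0 \<le> M" by (cases "S x") auto
    have "cmod (f (Suc k) x - f k x) \<le> sqrt M * (1/2)^k" for k
    proof -
      have le: "g k \<le> suminf g" for g :: "nat \<Rightarrow> ennreal"
        using sum_le_suminf[of g "{k}"] by simp
      have two: "((2::real)^k)\<^sup>2 = 4^k"
        by (simp add: power2_eq_square power_mult_distrib[symmetric])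
      have "ennreal (4^k * (cmod (f (Suc k) x - f k x))\<^sup>2) \<le> S x"
        unfolding S_def by (rule le)
      then have "4^k * (cmod (f (Suc k) x - f k x))\<^sup>2 \<le> M"
        using M by (simp add: ennreal_le_iff)
      then have "(2^k * cmod (f (Suc k) x - f k x))\<^sup>2 \<le> (sqrt M)\<^sup>2"
        using M two by (simp add: power_mult_distrib)
      then have "2^k * cmod (f (Suc k) x - f k x) \<le> sqrt M"
        by (rule power2_le_imp_le) (use M in simp)
      then show ?thesis by (simp add: field_simps power_divide)
    qed
    then have "summable (\<lambda>k. f (Suc k) x - f k x)"
      by (intro summable_comparison_test'[OF summable_mult[OF summable_geometric[of "1/2::real"]], of 0 _ "sqrt M"])
         simp_all
    then have "convergent (\<lambda>n. \<Sum>k<n. f (Suc k) x - f k x)"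
      using summable_iff_convergent by blast
    then have "convergent (\<lambda>n. f n x - f 0 x)"
      by (simp add: sum_lessThan_telescope[of "\<lambda>k. f k x"])
    from convergent_add[OF this convergent_const[of "f 0 x"]]
    have "convergent (\<lambda>n. f n x)" by simp
    then show ?case by (simp add: convergent_LIMSEQ_iff)
  qed
  define g where "g x = lim (\<lambda>k. f k x)" for x
  have [measurable]: "g \<in> borel_measurable borel"
    unfolding g_def by (rule borel_measurable_lim_metric) simp
  \<comment> \<open>Fatou's lemma along the subsequence: the pointwise limit inherits the bounds on
    the distances.\<close>
  have gf: "(\<integral>\<^sup>+ x. ennreal ((cmod (g x - f k x))\<^sup>2) \<partial>lborel) \<le> ennreal (((1/4)^k)\<^sup>2)" for k
  proof -
    have "(\<integral>\<^sup>+ x. ennreal ((cmod (g x - f k x))\<^sup>2) \<partial>lborel)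
        \<le> (\<integral>\<^sup>+ x. liminf (\<lambda>m. ennreal ((cmod (f m x - f k x))\<^sup>2)) \<partial>lborel)"
      using conv
    proof (intro nn_integral_mono_AE, eventually_elim)
      case (elim x)
      then have "(\<lambda>m. ennreal ((cmod (f m x - f k x))\<^sup>2)) \<longlonglongrightarrow> ennreal ((cmod (g x - f k x))\<^sup>2)"
        unfolding g_def by (intro tendsto_intros)
      from lim_imp_Liminf[OF trivial_limit_sequentially this] show ?case by simp
    qed
    also have "\<dots> \<le> liminf (\<lambda>m. \<integral>\<^sup>+ x. ennreal ((cmod (f m x - f k x))\<^sup>2) \<partial>lborel)"
      by (rule nn_integral_liminf) measurable
    also have "\<dots> \<le> ennreal (((1/4)^k)\<^sup>2)"
    proof (rule Liminf_le)
      show "\<forall>\<^sub>F m in sequentially. (\<integral>\<^sup>+ x. ennreal ((cmod (f m x - f k x))\<^sup>2) \<partial>lborel) \<le> ennreal (((1/4)^k)\<^sup>2)"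
        using eventually_ge_at_top[of k] by eventually_elim (intro fd, auto)
    qed simp
    finally show ?thesis .
  qed
  have gf': "square_integrable (\<lambda>x. g x - f k x)" "norm (abs_l2 (\<lambda>x. g x - f k x)) \<le> (1/4)^k" for k
    using norm_abs_l2_le[OF _ _ gf] by auto
  have g: "square_integrable g"
    using square_integrable_add[OF gf'(1) f(1), of 0 0] by simp
  have "norm (X (r k) - abs_l2 g) \<le> (1/4)^k" for k
    using gf'(2)[of k] f g by (simp add: minus_abs_l2[symmetric] norm_minus_commute)
  then have "(\<lambda>k. norm (X (r k) - abs_l2 g)) \<longlonglongrightarrow> 0"
    by (intro real_tendsto_sandwich[OF _ _ tendsto_const LIMSEQ_power_zero[of "1/4::real"]]) auto
  then have "(X \<circ> r) \<longlonglongrightarrow> abs_l2 g"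
    unfolding o_def by (rule LIM_zero_cancel[OF tendsto_norm_zero_cancel])
  then have "X \<longlonglongrightarrow> abs_l2 g"
    using Cauchy_converges_subseq[OF X r] by blast
  then show "convergent X" by (auto simp: convergent_def)
qed

section \<open>Density of continuous functions with compact support\<close>

definition compactly_supported_continuous :: "(real \<Rightarrow> complex) set" where
  "compactly_supported_continuous =
     {k. continuous_on UNIV k \<and> (\<exists>R. \<forall>x. R < \<bar>x\<bar> \<longrightarrow> k x = 0)}"

lemma square_integrable_bounded_support:
  assumes "f \<in> borel_measurable borel" "\<And>x. cmod (f x) \<le> C" "\<And>x. R < \<bar>x\<bar> \<Longrightarrow> f x = 0"
  shows "square_integrable f"
proof (rule square_integrable_bound)
  have "square_integrable (\<lambda>x. of_real (indicator {-R..R} x))"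
    by (simp add: square_integrable_def power2_eq_square integrable_indicator_iff emeasure_lborel_Icc_eq
        flip: indicator_inter_arith)
       
  then show "square_integrable (\<lambda>x. of_real (indicator {-R..R} x))" .
  show "AE x in lborel. cmod (f x) \<le> C * cmod (of_real (indicator {-R..R} x))"
    using assms(2,3) by (intro AE_I2) (auto simp: indicator_def)
qed (use assms in auto)

lemma bounded_compactly_supported_continuous:
  assumes "k \<in> compactly_supported_continuous"
  obtains C R where "\<And>x. cmod (k x) \<le> C" "\<And>x. R < \<bar>x\<bar> \<Longrightarrow> k x = 0" "R > 0" "C > 0"
proof -
  obtain R where k: "continuous_on UNIV k" and R: "\<And>x. R < \<bar>x\<bar> \<Longrightarrow> k x = 0"
    using assms by (auto simp: compactly_supported_continuous_def)
  have "bounded (k ` {-R..R})"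
    by (intro compact_imp_bounded compact_continuous_image continuous_on_subset[OF k]) auto
  then obtain C where C: "\<forall>x\<in>{-R..R}. cmod (k x) \<le> C"
    by (auto simp: bounded_iff)
  have "cmod (k x) \<le> max C 1" for x
    using C R[of x] by (cases "\<bar>x\<bar> \<le> R") (auto simp: abs_le_iff max.coboundedI1)
  then show ?thesis
    by (intro that[of "max C 1" "max R 1"]) (use R in auto)
qed

lemma square_integrable_compactly_supported_continuous:
  assumes "k \<in> compactly_supported_continuous"
  shows "square_integrable k"
proof -
  obtain C R where "\<And>x. cmod (k x) \<le> C" "\<And>x. R < \<bar>x\<bar> \<Longrightarrow> k x = 0"
    using bounded_compactly_supported_continuous[OF assms] by metis
  then show ?thesis
    using assms by (intro square_integrable_bounded_support[of k C R] borel_measurable_continuous_onI)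
      (auto simp: compactly_supported_continuous_def)
qed

text \<open>A bounded function of bounded support is an almost everywhere limit of continuous
  functions; these are modified to have a common bound and a common support, so that dominated
  convergence applies. General functions are first truncated in argument and value.\<close>

lemma dense_compactly_supported_continuous:
  "closure (abs_l2 ` compactly_supported_continuous) = UNIV"
proof -
  let ?S = "closure (abs_l2 ` compactly_supported_continuous)"
  have bounded: "abs_l2 f \<in> ?S"
    if f [measurable]: "f \<in> borel_measurable borel" and M: "\<And>x. cmod (f x) \<le> M" "M > 0"
      and R: "\<And>x. R < \<bar>x\<bar> \<Longrightarrow> f x = 0" for f M R
  proof -
    have "f \<in> borel_measurable lebesgue"
      using f by (simp add: measurable_completion)
    then have "f measurable_on UNIV"
      by (rule lebesgue_measurable_imp_measurable_on) simp
    then obtain N g where N: "negligible N" and g: "\<And>n. continuous_on UNIV (g n)"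
      and lim: "\<And>x. x \<notin> N \<Longrightarrow> (\<lambda>n. g n x) \<longlonglongrightarrow> f x"
      unfolding measurable_on_def by auto
    \<comment> \<open>The cutoff \<open>c\<close> equals 1 on [-R, R] and vanishes beyond R + 1. The
      factor M / max M |g| caps the modulus at M and is 1 wherever the modulus is at most M, so
      neither modification changes the limit f.\<close>
    define c :: "real \<Rightarrow> real" where "c x = max 0 (min 1 (R + 1 - \<bar>x\<bar>))" for x
    define k where "k n x = of_real (c x * (M / max M (cmod (g n x)))) * g n x" for n x
    have pos: "max M y \<noteq> 0" for y using M(2) by linarith
    have kcont: "continuous_on UNIV (k n)" for n
      unfolding k_def c_def by (intro continuous_intros g) (simp add: pos)
    have kzero: "k n x = 0" if "R + 1 < \<bar>x\<bar>" for n x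
      using that by (simp add: k_def c_def)
    have k: "k n \<in> compactly_supported_continuous" for n
      using kcont kzero unfolding compactly_supported_continuous_def by blast
    have kM: "cmod (k n x) \<le> M" for n x
    proof -
      have "\<bar>M / max M (cmod (g n x))\<bar> * cmod (g n x) \<le> M"
        using M(2) by (auto simp: max_def field_simps)
      moreover have "\<bar>c x\<bar> \<le> 1" by (auto simp: c_def)
      ultimately have "\<bar>c x\<bar> * (\<bar>M / max M (cmod (g n x))\<bar> * cmod (g n x)) \<le> 1 * M"
        using M(2) by (intro mult_mono) auto
      then show ?thesis by (simp only: k_def norm_mult norm_of_real abs_mult mult.assoc mult_1)
    qed
    have w: "square_integrable (\<lambda>x. of_real (M * indicator {-R-1..R+1} x))"
      by (rule square_integrable_bounded_support[of _ M "R+1"]) (use M in \<open>auto simp: indicator_def\<close>)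
    have "(\<lambda>n. abs_l2 (k n)) \<longlonglongrightarrow> abs_l2 f"
    proof (rule tendsto_l2_dominated[OF w])
      show "k n \<in> borel_measurable borel" for n
        by (rule borel_measurable_continuous_onI[OF kcont])
      show "AE x in lborel. cmod (k n x) \<le> cmod (complex_of_real (M * indicat_real {-R-1..R+1} x))" for n
        using kM[of n] kzero M by (intro AE_I2) (auto simp: indicator_def)
      have "AE x in lebesgue. x \<notin> N"
        using N by (simp add: AE_not_in negligible_iff_null_sets)
      then have "AE x in lborel. x \<notin> N"
        by (simp add: AE_completion_iff) 
      then show "AE x in lborel. (\<lambda>n. k n x) \<longlonglongrightarrow> f x"
      proof eventually_elim
        case (elim x)
        have "max M (cmod (f x)) \<noteq> 0" using M(2) by auto
        then have "(\<lambda>n. k n x) \<longlonglongrightarrow> of_real (c x * (M / max M (cmod (f x)))) * f x"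
          unfolding k_def using lim[OF elim] by (intro tendsto_intros)
        also have "of_real (c x * (M / max M (cmod (f x)))) * f x = f x"
          using M(2) M(1)[of x] R[of x] by (cases "\<bar>x\<bar> \<le> R") (auto simp: c_def max_def)
        finally show ?case .
      qed
    qed simp
    then show ?thesis
      using k by (auto simp: closure_sequential intro!: exI[of _ "\<lambda>n. abs_l2 (k n)"])
  qed
  have "u \<in> ?S" for u
  proof -
    obtain f where f: "u = abs_l2 f" "square_integrable f" by (rule l2_cases)
    note [measurable] = square_integrable_measurable[OF f(2)]
    define F where "F n x = (if \<bar>x\<bar> \<le> real n \<and> cmod (f x) \<le> real n then f x else 0)" for n x
    have [measurable]: "F n \<in> borel_measurable borel" for n unfolding F_def by measurable
    have lim: "(\<lambda>n. abs_l2 (F n)) \<longlonglongrightarrow> abs_l2 f"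
    proof (rule tendsto_l2_dominated[OF f(2)])
      have "(\<lambda>n. F n x) \<longlonglongrightarrow> f x" for x
      proof (rule tendsto_eventually)
        obtain m where m: "max \<bar>x\<bar> (cmod (f x)) \<le> real m" using real_arch_simple by blast
        show "\<forall>\<^sub>F n in sequentially. F n x = f x"
          using eventually_ge_at_top[of m] by eventually_elim (use m in \<open>auto simp: F_def\<close>)
      qed
      then show "AE x in lborel. (\<lambda>n. F n x) \<longlonglongrightarrow> f x" by simp
    qed (auto simp: F_def)
    have "abs_l2 (F n) \<in> ?S" for n
      by (rule bounded[of _ "real n + 1" "real n"]) (auto simp: F_def)
    then show "u \<in> ?S"
      using closed_sequentially[OF closed_closure _ lim] f by blast
  qed
  then show ?thesis by auto
qed

section \<open>The Fourier transform of integrable functions\<close>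

text \<open>The argument is complex: the transform is later continued to a strip, and its values at
  distance s from the real axis enter the intertwining relations.\<close>

definition fourier :: "real \<Rightarrow> (real \<Rightarrow> complex) \<Rightarrow> complex \<Rightarrow> complex" where
  "fourier a f z = (LINT x|lborel. f x * exp (\<i> * of_real (a * x) * z))"

lemma measurable_cnj [measurable]: "cnj \<in> borel_measurable borel"
  by (intro borel_measurable_continuous_onI continuous_intros)

lemma measurable_fourier [measurable]:
  assumes [measurable]: "f \<in> borel_measurable borel"
  shows "(\<lambda>z. fourier a f (of_real z)) \<in> borel_measurable borel"
  unfolding fourier_def by measurable

lemma integrable_fourier:
  assumes "integrable lborel f"
  shows "integrable lborel (\<lambda>x. f x * exp (\<i> * of_real (a * x) * of_real z))"
proof -
  note [measurable] = borel_measurable_integrable[OF assms, simplified]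
  show ?thesis
    by (rule Bochner_Integration.integrable_bound[OF assms]) (auto simp: norm_mult)
qed

lemma norm_fourier_le:
  assumes "integrable lborel f"
  shows "cmod (fourier a f (of_real z)) \<le> (LINT x|lborel. cmod (f x))"
  unfolding fourier_def
  by (rule order_trans[OF integral_norm_bound]) (simp add: norm_mult)

text \<open>The kernel is symmetric in x and z, so Fubini's theorem moves the transform from one
  factor to the other; for integrable functions the double integral converges absolutely.\<close>

lemma integral_mult_fourier:
  assumes "integrable lborel f" "integrable lborel g"
  shows "(LINT z|lborel. g z * fourier a f (of_real z)) = (LINT x|lborel. f x * fourier a g (of_real x))"
proof -
  note [measurable] = assms[THEN borel_measurable_integrable, simplified]
  define F where "F x z = f x * g z * exp (\<i> * of_real (a * x) * of_real z)" for x z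
  have nF: "cmod (F x z) = cmod (f x) * cmod (g z)" for x z
    by (simp add: F_def norm_mult)
  have "integrable (lborel \<Otimes>\<^sub>M lborel) (case_prod F)"
  proof (rule lborel_pair.Fubini_integrable)
    show "case_prod F \<in> borel_measurable (lborel \<Otimes>\<^sub>M lborel)"
      unfolding F_def by measurable
    show "integrable lborel (\<lambda>x. LINT y|lborel. cmod (case (x, y) of (x, y) \<Rightarrow> F x y))"
      using assms by (simp add: nF)
    show "AE x in lborel. integrable lborel (\<lambda>y. case (x, y) of (x, y) \<Rightarrow> F x y)"
    proof (rule AE_I2)
      fix x
      have "integrable lborel (\<lambda>y. f x * (g y * exp (\<i> * of_real (a * y) * of_real x)))"
        using assms by (intro integrable_mult_right integrable_fourier)
      then show "integrable lborel (\<lambda>y. case (x, y) of (x, y) \<Rightarrow> F x y)"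
        by (simp add: F_def mult_ac)
    qed
  qed
  from lborel_pair.Fubini_integral[OF this]
  have "(LINT y|lborel. LINT x|lborel. F x y) = (LINT x|lborel. LINT y|lborel. F x y)"
    by simp
  moreover have "(LINT x|lborel. F x y) = g y * fourier a f (of_real y)" for y
    by (simp add: F_def fourier_def mult_ac flip: integral_mult_right_zero)
  moreover have "(LINT y|lborel. F x y) = f x * fourier a g (of_real x)" for x
    by (simp add: F_def fourier_def mult_ac flip: integral_mult_right_zero)
  ultimately show ?thesis by simp
qed

section \<open>Gaussians and the Plancherel formula\<close>

lemma integral_std_normal_exp:
  "integrable lborel (\<lambda>x. of_real (std_normal_density x) * exp (\<i> * of_real t * of_real x))"
  "(LINT x|lborel. of_real (std_normal_density x) * exp (\<i> * of_real t * of_real x)) = exp (- ((of_real t)\<^sup>2) / 2)"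
proof -
  have int: "integrable lborel (\<lambda>x. complex_of_real (std_normal_density x))"
    using integrable_std_normal_moment[of 0] by simp
  show 1: "integrable lborel (\<lambda>x. of_real (std_normal_density x) * exp (\<i> * of_real t * of_real x))"
    by (rule Bochner_Integration.integrable_bound[OF int]) (auto simp: norm_mult)
  have "exp (- ((of_real t)\<^sup>2) / 2) = char std_normal_distribution t"
    by (simp add: char_std_normal_distribution exp_of_real[symmetric])
  also have "\<dots> = (LINT x|lborel. std_normal_density x *\<^sub>R iexp (t * x))"
    unfolding char_def by (subst integral_density) (auto simp: normal_density_nonneg)
  also have "\<dots> = (LINT x|lborel. of_real (std_normal_density x) * exp (\<i> * of_real t * of_real x))"
    by (simp add: scaleR_conv_of_real mult.assoc)
  finally show "(LINT x|lborel. of_real (std_normal_density x) * exp (\<i> * of_real t * of_real x)) = exp (- ((of_real t)\<^sup>2) / 2)"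
    by simp
qed

definition gauss :: "real \<Rightarrow> real \<Rightarrow> real" where
  "gauss e x = exp (- (e * x)\<^sup>2 / 2)"

lemma gauss_measurable [measurable]: "gauss e \<in> borel_measurable borel"
  unfolding gauss_def by measurable

lemma gauss_eq: "gauss e x = sqrt (2 * pi) * std_normal_density (e * x)"
  by (simp add: gauss_def std_normal_density_def)

lemma gauss_pos [simp]: "0 < gauss e x"
  by (simp add: gauss_def)

text \<open>The value is left as a multiple of a normal density because it will serve as a
  convolution kernel: for a > 0 it has, as a function of t, total mass 2 pi / a and width of order
  e.\<close>

lemma fourier_gauss:
  assumes "e > 0"
  shows "integrable lborel (\<lambda>x. gauss e x)"
    and "fourier a (\<lambda>x. of_real (gauss e x)) (of_real t) = of_real (2 * pi / e * std_normal_density (a * t / e))"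
proof -
  have 1: "integrable lborel std_normal_density"
    using integrable_std_normal_moment[of 0] by simp
  show "integrable lborel (\<lambda>x. gauss e x)"
    unfolding gauss_eq using assms lborel_integrable_real_affine[OF 1, of e 0] by simp
  have "fourier a (\<lambda>x. of_real (gauss e x)) (of_real t) =
      \<bar>1/e\<bar> *\<^sub>R (LINT x|lborel. of_real (gauss e (0 + 1/e * x)) * exp (\<i> * of_real (a * (0 + 1/e * x)) * of_real t))"
    unfolding fourier_def by (rule lborel_integral_real_affine) (use assms in simp)
  also have "\<dots> = of_real (sqrt (2*pi) / e) *
     (LINT x|lborel. of_real (std_normal_density x) * exp (\<i> * of_real (a * t / e) * of_real x))"
    using assms
    by (simp add: gauss_eq scaleR_conv_of_real mult_ac flip: integral_mult_right_zero integral_mult_left_zero)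
  also have "\<dots> = of_real (sqrt (2*pi) / e) * of_real (exp (- (a * t / e)\<^sup>2 / 2))"
    by (subst integral_std_normal_exp) (simp add: exp_of_real[symmetric])
  also have "\<dots> = of_real (2 * pi / e * std_normal_density (a * t / e))"
  proof -
    have "2 * pi / e * std_normal_density (a * t / e) = 2 * pi / sqrt (2 * pi) / e * exp (- (a * t / e)\<^sup>2 / 2)"
      by (simp add: std_normal_density_def)
    also have "2 * pi / sqrt (2 * pi) = sqrt (2 * pi)" by (rule real_div_sqrt) simp
    finally show ?thesis by (simp only: of_real_mult)
  qed
  finally show "fourier a (\<lambda>x. of_real (gauss e x)) (of_real t) = of_real (2 * pi / e * std_normal_density (a * t / e))" .
qed

text \<open>For a function that is merely integrable, |F f|^2 need not be integrable, so it is
  weighted with a Gaussian. Everything then converges absolutely, and two applications of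
  \<open>integral_mult_fourier\<close> turn the weight into a narrow normal kernel between f and its
  conjugate.\<close>

lemma regularised_plancherel:
  fixes f :: "real \<Rightarrow> complex"
  assumes f: "integrable lborel f" and e: "e > 0" 
  shows "integrable lborel (\<lambda>z. gauss e z * (cmod (fourier a f (of_real z)))\<^sup>2)"
    and "of_real (LINT z|lborel. gauss e z * (cmod (fourier a f (of_real z)))\<^sup>2)
      = (LINT y|lborel. cnj (f y) * (LINT x|lborel. f x * of_real (2 * pi / e * std_normal_density (a * (x - y) / e))))"
proof -
  note [measurable] = borel_measurable_integrable[OF f, simplified]
  note gi = fourier_gauss(1)[OF e]
  define B where "B = (LINT x|lborel. cmod (f x))"
  have B: "cmod (fourier a f (of_real z)) \<le> B" for z
    unfolding B_def by (rule norm_fourier_le[OF f])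
  have B0: "0 \<le> B" by (simp add: B_def)
  show 1: "integrable lborel (\<lambda>z. gauss e z * (cmod (fourier a f (of_real z)))\<^sup>2)"
  proof (rule Bochner_Integration.integrable_bound[of _ "\<lambda>z. B\<^sup>2 * gauss e z"])
    show "AE z in lborel. norm (gauss e z * (cmod (fourier a f (of_real z)))\<^sup>2) \<le> norm (B\<^sup>2 * gauss e z)"
      using B by (intro AE_I2) (auto simp: abs_mult mult.commute intro!: mult_left_mono power_mono)
  qed (use gi in simp_all)
  have gc: "integrable lborel (\<lambda>z. of_real (gauss e z) * exp (\<i> * of_real (- a * y) * of_real z))" for y
    by (rule Bochner_Integration.integrable_bound[OF gi]) (auto simp: norm_mult)
  define G where "G z = of_real (gauss e z) * fourier a f (of_real z)" for z
  have G: "integrable lborel G"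
  proof (rule Bochner_Integration.integrable_bound[of _ "\<lambda>z. B * gauss e z"])
    show "AE z in lborel. norm (G z) \<le> norm (B * gauss e z)"
      using B B0 by (intro AE_I2) (auto simp: G_def norm_mult abs_mult mult.commute[of B] intro!: mult_left_mono)
  qed (use gi in \<open>simp_all add: G_def[abs_def]\<close>)
  \<comment> \<open>The conjugate of a transform is a transform with reversed frequency; this
    prepares the second application of \<open>integral_mult_fourier\<close>.\<close>
  have cf: "cnj (fourier a f (of_real z)) = fourier (- a) (\<lambda>x. cnj (f x)) (of_real z)" for z
  proof -
    have "fourier (- a) (\<lambda>x. cnj (f x)) (of_real z) = (LINT x|lborel. cnj (f x * exp (\<i> * of_real (a * x) * of_real z)))"
      unfolding fourier_def by (intro Bochner_Integration.integral_cong refl) (simp add: exp_cnj)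
    also have "\<dots> = cnj (fourier a f (of_real z))"
      unfolding fourier_def by (rule Bochner_Integration.integral_cnj)
    finally show ?thesis by (rule sym)
  qed
  have "fourier (- a) G (of_real y) = (LINT x|lborel. f x * of_real (2 * pi / e * std_normal_density (a * (x - y) / e)))" for y
  proof -
    have "fourier (- a) G (of_real y)
      = (LINT z|lborel. (of_real (gauss e z) * exp (\<i> * of_real (- a * y) * of_real z)) * fourier a f (of_real z))"
      unfolding fourier_def[of "- a"] G_def by (simp add: mult_ac)
    also have "\<dots> = (LINT x|lborel. f x * fourier a (\<lambda>z. of_real (gauss e z) * exp (\<i> * of_real (- a * y) * of_real z)) (of_real x))"
      by (rule integral_mult_fourier[OF f gc])
    also have "(\<lambda>x. fourier a (\<lambda>z. of_real (gauss e z) * exp (\<i> * of_real (- a * y) * of_real z)) (of_real x))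
       = (\<lambda>x. fourier a (\<lambda>z. of_real (gauss e z)) (of_real (x - y)))"
      by (simp add: fourier_def mult.assoc exp_add[symmetric] algebra_simps)
    finally show ?thesis unfolding fourier_gauss(2)[OF e] .
  qed
  moreover have "of_real (LINT z|lborel. gauss e z * (cmod (fourier a f (of_real z)))\<^sup>2)
      = (LINT z|lborel. G z * fourier (- a) (\<lambda>x. cnj (f x)) (of_real z))"
    unfolding integral_complex_of_real[symmetric]
    by (intro Bochner_Integration.integral_cong refl)
       (simp only: G_def cf[symmetric] of_real_mult complex_norm_square mult.assoc)
  moreover have "\<dots> = (LINT y|lborel. cnj (f y) * fourier (- a) G (of_real y))"
    by (rule integral_mult_fourier) (use f G in auto)
  ultimately show "of_real (LINT z|lborel. gauss e z * (cmod (fourier a f (of_real z)))\<^sup>2)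
      = (LINT y|lborel. cnj (f y) * (LINT x|lborel. f x * of_real (2 * pi / e * std_normal_density (a * (x - y) / e))))"
    by simp
qed

lemma nn_integral_std_normal_density: "(\<integral>\<^sup>+ x. ennreal (std_normal_density x) \<partial>lborel) = 1"
  using integrable_std_normal_moment[of 0] integral_std_normal_moment_even[of 0]
  by (subst nn_integral_eq_integral) (auto simp: normal_density_nonneg)

lemma nn_integral_scaled_normal:
  assumes "a > 0" "e > 0"
  shows "(\<integral>\<^sup>+ x. ennreal (2 * pi / e * std_normal_density (a * (x - y) / e)) \<partial>lborel) = ennreal (2 * pi / a)"
    and "(\<integral>\<^sup>+ x. ennreal (2 * pi / e * std_normal_density (a * (y - x) / e)) \<partial>lborel) = ennreal (2 * pi / a)"
proof -
  have *: "(\<integral>\<^sup>+ x. ennreal (2 * pi / e * std_normal_density (c * (x - y) / e)) \<partial>lborel) = ennreal (2 * pi / a)"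
    if "\<bar>c\<bar> = a" for c
  proof -
    have "1 = (\<integral>\<^sup>+ x. ennreal (std_normal_density x) \<partial>lborel)"
      by (simp add: nn_integral_std_normal_density)
    also have "\<dots> = ennreal \<bar>c/e\<bar> * (\<integral>\<^sup>+ x. ennreal (std_normal_density (- c * y / e + c/e * x)) \<partial>lborel)"
      by (rule nn_integral_real_affine) (use assms that in auto)
    finally have 1: "1 = ennreal (a/e) * (\<integral>\<^sup>+ x. ennreal (std_normal_density (c * (x - y) / e)) \<partial>lborel)"
      using that assms by (simp add: diff_divide_distrib algebra_simps)
    have "(\<integral>\<^sup>+ x. ennreal (2 * pi / e * std_normal_density (c * (x - y) / e)) \<partial>lborel)
       = ennreal (2 * pi / e) * (\<integral>\<^sup>+ x. ennreal (std_normal_density (c * (x - y) / e)) \<partial>lborel)"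
    proof -
      have "ennreal (2 * pi / e * s) = ennreal (2 * pi / e) * ennreal s" for s
        by (rule ennreal_mult') (use assms in simp)
      then show ?thesis by (simp only:) (rule nn_integral_cmult, measurable)
    qed
    also have "ennreal (2 * pi / e) = ennreal (2 * pi / a) * ennreal (a/e)"
      using assms by (simp add: ennreal_mult[symmetric])
    also have "\<dots> * (\<integral>\<^sup>+ x. ennreal (std_normal_density (c * (x - y) / e)) \<partial>lborel) = ennreal (2 * pi / a)"
      using 1 by (simp add: mult.assoc)
    finally show ?thesis .
  qed
  show "(\<integral>\<^sup>+ x. ennreal (2 * pi / e * std_normal_density (a * (x - y) / e)) \<partial>lborel) = ennreal (2 * pi / a)"
    by (rule *) (use assms in simp)
  show "(\<integral>\<^sup>+ x. ennreal (2 * pi / e * std_normal_density (a * (y - x) / e)) \<partial>lborel) = ennreal (2 * pi / a)"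
    using *[of "- a"] assms by (simp add: algebra_simps)
qed

lemma ennreal_norm_integral_le:
  fixes f :: "'a \<Rightarrow> 'b::{banach, second_countable_topology}"
  shows "ennreal (norm (integral\<^sup>L M f)) \<le> (\<integral>\<^sup>+ x. ennreal (norm (f x)) \<partial>M)"
  by (cases "integrable M f") (auto simp: integral_norm_bound_ennreal not_integrable_integral_eq)

text \<open>The kernel of \<open>regularised_plancherel\<close> has mass 2 pi / a in each variable,
  and 2 |f x| |f y| \<le> |f x|^2 + |f y|^2 then bounds the quadratic form, as in Schur's test.
  Fatou's lemma removes the Gaussian weight as e tends to 0.\<close>

lemma plancherel_le:
  fixes f :: "real \<Rightarrow> complex"
  assumes f: "integrable lborel f" and a: "a > 0" 
  shows "(\<integral>\<^sup>+ z. ennreal ((cmod (fourier a f (of_real z)))\<^sup>2) \<partial>lborel)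
    \<le> ennreal (2 * pi / a) * (\<integral>\<^sup>+ x. ennreal ((cmod (f x))\<^sup>2) \<partial>lborel)"
proof -
  note [measurable] = borel_measurable_integrable[OF f, simplified]
  have reg: "(\<integral>\<^sup>+ z. ennreal (gauss e z * (cmod (fourier a f (of_real z)))\<^sup>2) \<partial>lborel)
      \<le> ennreal (2 * pi / a) * (\<integral>\<^sup>+ x. ennreal ((cmod (f x))\<^sup>2) \<partial>lborel)" (is "?L \<le> ?R") if e: "e > 0" for e
  proof -
    define k where "k x y = 2 * pi / e * std_normal_density (a * (x - y) / e)" for x y
    have [measurable]: "(\<lambda>x. k (fst x) (snd x)) \<in> borel_measurable (borel \<Otimes>\<^sub>M borel)" 
      "(\<lambda>x. k x y) \<in> borel_measurable borel" "(\<lambda>x. k y x) \<in> borel_measurable borel" for y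
      unfolding k_def by measurable
    have k0: "0 \<le> k x y" for x y using e by (simp add: k_def normal_density_nonneg)
    have k1: "(\<integral>\<^sup>+ x. ennreal (k x y) \<partial>lborel) = ennreal (2 * pi / a)"
      and k2: "(\<integral>\<^sup>+ x. ennreal (k y x) \<partial>lborel) = ennreal (2 * pi / a)" for y
      unfolding k_def using nn_integral_scaled_normal[OF a e] by auto
    have "?L = ennreal (LINT z|lborel. gauss e z * (cmod (fourier a f (of_real z)))\<^sup>2)"
      by (rule nn_integral_eq_integral[OF regularised_plancherel(1)[OF f e]]) (simp add: less_imp_le)
    also have "\<dots> \<le> ennreal (cmod (of_real (LINT z|lborel. gauss e z * (cmod (fourier a f (of_real z)))\<^sup>2)))"
      by (simp add: ennreal_leI)
    also have "\<dots> = ennreal (cmod (LINT y|lborel. cnj (f y) * (LINT x|lborel. f x * of_real (k x y))))"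
      unfolding regularised_plancherel(2)[OF f e] k_def ..
    also have "\<dots> \<le> (\<integral>\<^sup>+ y. ennreal (cmod (cnj (f y) * (LINT x|lborel. f x * of_real (k x y)))) \<partial>lborel)"
      by (rule ennreal_norm_integral_le)
    also have "\<dots> \<le> (\<integral>\<^sup>+ y. \<integral>\<^sup>+ x. ennreal ((cmod (f x))\<^sup>2 / 2 * k x y) + ennreal ((cmod (f y))\<^sup>2 / 2 * k x y) \<partial>lborel \<partial>lborel)"
    proof (rule nn_integral_mono)
      fix y
      have "ennreal (cmod (cnj (f y) * (LINT x|lborel. f x * of_real (k x y))))
          = ennreal (cmod (f y)) * ennreal (cmod (LINT x|lborel. f x * of_real (k x y)))"
        by (simp add: norm_mult ennreal_mult)
      also have "\<dots> \<le> ennreal (cmod (f y)) * (\<integral>\<^sup>+ x. ennreal (cmod (f x * of_real (k x y))) \<partial>lborel)"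
        by (intro mult_left_mono ennreal_norm_integral_le) auto
      also have "\<dots> = (\<integral>\<^sup>+ x. ennreal (cmod (f y) * (cmod (f x) * k x y)) \<partial>lborel)"
        by (subst nn_integral_cmult[symmetric]) (auto simp: norm_mult ennreal_mult k0)
      also have "\<dots> \<le> (\<integral>\<^sup>+ x. ennreal ((cmod (f x))\<^sup>2 / 2 * k x y) + ennreal ((cmod (f y))\<^sup>2 / 2 * k x y) \<partial>lborel)"
      proof (rule nn_integral_mono)
        fix x
        have "cmod (f y) * cmod (f x) \<le> (cmod (f x))\<^sup>2 / 2 + (cmod (f y))\<^sup>2 / 2"
          using zero_le_power2[of "cmod (f x) - cmod (f y)"] by (simp add: power2_eq_square algebra_simps)
        from mult_right_mono[OF this k0[of x y]]
        have "cmod (f y) * (cmod (f x) * k x y) \<le> (cmod (f x))\<^sup>2 / 2 * k x y + (cmod (f y))\<^sup>2 / 2 * k x y"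
          by (simp add: algebra_simps)
        then show "ennreal (cmod (f y) * (cmod (f x) * k x y)) \<le> ennreal ((cmod (f x))\<^sup>2 / 2 * k x y) + ennreal ((cmod (f y))\<^sup>2 / 2 * k x y)"
          using k0[of x y] by (simp add: ennreal_leI flip: ennreal_plus)
      qed
      finally show "ennreal (cmod (cnj (f y) * (LINT x|lborel. f x * of_real (k x y))))
        \<le> (\<integral>\<^sup>+ x. ennreal ((cmod (f x))\<^sup>2 / 2 * k x y) + ennreal ((cmod (f y))\<^sup>2 / 2 * k x y) \<partial>lborel)" .
    qed
    also have "\<dots> = (\<integral>\<^sup>+ y. \<integral>\<^sup>+ x. ennreal ((cmod (f x))\<^sup>2 / 2 * k x y) \<partial>lborel \<partial>lborel)
       + (\<integral>\<^sup>+ y. \<integral>\<^sup>+ x. ennreal ((cmod (f y))\<^sup>2 / 2 * k x y) \<partial>lborel \<partial>lborel)"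
      by (subst nn_integral_add[symmetric]; simp add: nn_integral_add k_def)
    also have "(\<integral>\<^sup>+ y. \<integral>\<^sup>+ x. ennreal ((cmod (f x))\<^sup>2 / 2 * k x y) \<partial>lborel \<partial>lborel)
       = (\<integral>\<^sup>+ x. \<integral>\<^sup>+ y. ennreal ((cmod (f x))\<^sup>2 / 2 * k x y) \<partial>lborel \<partial>lborel)"
      by (rule lborel_pair.Fubini') (simp add: k_def)
    also have "\<dots> = (\<integral>\<^sup>+ x. ennreal ((cmod (f x))\<^sup>2 / 2) * ennreal (2 * pi / a) \<partial>lborel)"
      by (intro nn_integral_cong, subst ennreal_mult) (auto simp: k0 nn_integral_cmult k2)
    also have "(\<integral>\<^sup>+ y. \<integral>\<^sup>+ x. ennreal ((cmod (f y))\<^sup>2 / 2 * k x y) \<partial>lborel \<partial>lborel)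
       = (\<integral>\<^sup>+ x. ennreal ((cmod (f x))\<^sup>2 / 2) * ennreal (2 * pi / a) \<partial>lborel)"
      by (intro nn_integral_cong, subst ennreal_mult) (auto simp: k0 nn_integral_cmult k1)
    also have "(\<integral>\<^sup>+ x. ennreal ((cmod (f x))\<^sup>2 / 2) * ennreal (2 * pi / a) \<partial>lborel)
       + (\<integral>\<^sup>+ x. ennreal ((cmod (f x))\<^sup>2 / 2) * ennreal (2 * pi / a) \<partial>lborel)
       = (\<integral>\<^sup>+ x. ennreal (2 * pi / a) * ennreal ((cmod (f x))\<^sup>2) \<partial>lborel)"
      using a by (subst nn_integral_add[symmetric])
        (auto simp: ennreal_mult[symmetric] algebra_simps simp flip: ennreal_plus intro!: nn_integral_cong)
    also have "\<dots> = ?R" by (rule nn_integral_cmult) measurable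
    finally show ?thesis .
  qed
  have "(\<integral>\<^sup>+ z. ennreal ((cmod (fourier a f (of_real z)))\<^sup>2) \<partial>lborel)
     = (\<integral>\<^sup>+ z. liminf (\<lambda>n. ennreal (gauss (inverse (real (Suc n))) z * (cmod (fourier a f (of_real z)))\<^sup>2)) \<partial>lborel)"
  proof (rule nn_integral_cong)
    fix z
    have "(\<lambda>n. ennreal (gauss (inverse (real (Suc n))) z * (cmod (fourier a f (of_real z)))\<^sup>2))
        \<longlonglongrightarrow> ennreal (exp (- (0 * z)\<^sup>2 / 2) * (cmod (fourier a f (of_real z)))\<^sup>2)"
      unfolding gauss_def by (intro tendsto_intros LIMSEQ_inverse_real_of_nat) simp_all
    from lim_imp_Liminf[OF trivial_limit_sequentially this]
    show "ennreal ((cmod (fourier a f (of_real z)))\<^sup>2) =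
      liminf (\<lambda>n. ennreal (gauss (inverse (real (Suc n))) z * (cmod (fourier a f (of_real z)))\<^sup>2))" by simp
  qed
  also have "\<dots> \<le> liminf (\<lambda>n. \<integral>\<^sup>+ z. ennreal (gauss (inverse (real (Suc n))) z * (cmod (fourier a f (of_real z)))\<^sup>2) \<partial>lborel)"
    by (rule nn_integral_liminf) measurable
  also have "\<dots> \<le> ennreal (2 * pi / a) * (\<integral>\<^sup>+ x. ennreal ((cmod (f x))\<^sup>2) \<partial>lborel)"
    by (rule Liminf_le) (use reg in \<open>auto intro!: always_eventually\<close>)
  finally show ?thesis .
qed

text \<open>The weighted integrals are bounded by the unweighted one, since \<open>gauss\<close> is
  at most 1, and they converge to the right-hand side: for bounded continuous f the averages
  \<open>g n\<close> tend to f at every point.\<close>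

lemma plancherel_eq:
  fixes f :: "real \<Rightarrow> complex"
  assumes f: "integrable lborel f" and cont: "continuous_on UNIV f" and bd: "\<And>x. cmod (f x) \<le> C" and a: "a > 0" 
  shows "(\<integral>\<^sup>+ z. ennreal ((cmod (fourier a f (of_real z)))\<^sup>2) \<partial>lborel)
    = ennreal (2 * pi / a) * (\<integral>\<^sup>+ x. ennreal ((cmod (f x))\<^sup>2) \<partial>lborel)"
proof (rule antisym[OF plancherel_le[OF f a]])
  note [measurable] = borel_measurable_integrable[OF f, simplified]
  have C: "0 \<le> C" using bd[of 0] norm_ge_zero order_trans by blast
  define e where "e n = inverse (real (Suc n))" for n
  have e: "e n > 0" for n by (simp add: e_def)
  have e0: "e \<longlonglongrightarrow> 0" unfolding e_def by (rule LIMSEQ_inverse_real_of_nat)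
  define D where "D s = complex_of_real (std_normal_density s)" for s
  have D: "integrable lborel D" "(LINT s|lborel. D s) = 1"
    unfolding D_def using integral_std_normal_exp[of 0] by auto
  have [measurable]: "D \<in> borel_measurable borel" unfolding D_def by measurable
  \<comment> \<open>The average of f against the normal kernel around y, after the substitution x =
    y + e n / a * s, which makes the density independent of n.\<close>
  define g where "g n y = (LINT s|lborel. f (y + e n / a * s) * D s)" for n y
  have [measurable]: "g n \<in> borel_measurable borel" for n unfolding g_def by measurable
  have fD: "cmod (f x * D s) \<le> C * cmod (D s)" for x s
    by (simp add: norm_mult bd mult_right_mono)
  have gC: "cmod (g n y) \<le> C" for n y
  proof -
    have "cmod (g n y) \<le> (LINT s|lborel. C * cmod (D s))"
      unfolding g_def
    proof (rule order_trans[OF integral_norm_bound integral_mono])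
      show "integrable lborel (\<lambda>s. cmod (f (y + e n / a * s) * D s))"
        by (rule Bochner_Integration.integrable_bound[OF integrable_mult_right[OF D(1), of "of_real C"]])
           (use fD C in \<open>auto simp: norm_mult\<close>)
    qed (use D fD in auto)
    also have "\<dots> = C * (LINT s|lborel. std_normal_density s)"
      by (simp add: D_def normal_density_nonneg)
    also have "\<dots> = C" using integral_std_normal_moment_even[of 0] by simp
    finally show ?thesis .
  qed
  have glim: "(\<lambda>n. g n y) \<longlonglongrightarrow> f y" for y
  proof -
    have "(\<lambda>n. LINT s|lborel. f (y + e n / a * s) * D s) \<longlonglongrightarrow> (LINT s|lborel. f y * D s)"
    proof (rule integral_dominated_convergence[where w = "\<lambda>s. C * cmod (D s)"])
      show "AE s in lborel. (\<lambda>n. f (y + e n / a * s) * D s) \<longlonglongrightarrow> f y * D s"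
      proof (rule AE_I2)
        fix s
        have "(\<lambda>n. y + e n / a * s) \<longlonglongrightarrow> y + 0 / a * s"
          by (intro tendsto_intros e0) (use a in auto)
        then have "(\<lambda>n. f (y + e n / a * s)) \<longlonglongrightarrow> f y"
          by (intro continuous_on_tendsto_compose[OF cont]) auto
        then show "(\<lambda>n. f (y + e n / a * s) * D s) \<longlonglongrightarrow> f y * D s"
          by (intro tendsto_intros)
      qed
    qed (use D fD in auto)
    then show ?thesis by (simp add: g_def D)
  qed
  have "(\<lambda>n. LINT y|lborel. cnj (f y) * g n y) \<longlonglongrightarrow> (LINT y|lborel. cnj (f y) * f y)"
  proof (rule integral_dominated_convergence[where w = "\<lambda>s. cmod (f s) * C"])
    show "AE y in lborel. (\<lambda>n. cnj (f y) * g n y) \<longlonglongrightarrow> cnj (f y) * f y"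
      by (intro AE_I2 tendsto_intros glim)
    show "AE y in lborel. cmod (cnj (f y) * g n y) \<le> cmod (f y) * C" for n
      by (intro AE_I2) (auto simp: norm_mult gC intro!: mult_left_mono)
  qed (use f in auto)
  then have lim: "(\<lambda>n. 2 * pi / a * (LINT y|lborel. cnj (f y) * g n y)) \<longlonglongrightarrow> 2 * pi / a * (LINT y|lborel. cnj (f y) * f y)"
    by (intro tendsto_intros)
  have Sn: "of_real (LINT z|lborel. gauss (e n) z * (cmod (fourier a f (of_real z)))\<^sup>2)
      = 2 * pi / a * (LINT y|lborel. cnj (f y) * g n y)" for n
  proof -
    have "(LINT x|lborel. f x * of_real (2 * pi / e n * std_normal_density (a * (x - y) / e n)))
        = \<bar>e n / a\<bar> *\<^sub>R (LINT s|lborel. f (y + e n / a * s) * of_real (2 * pi / e n * std_normal_density (a * ((y + e n / a * s) - y) / e n)))" for y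
      by (rule lborel_integral_real_affine) (use a e[of n] in auto)
    also have "\<dots> y = 2 * pi / a * g n y" for y
    proof -
      have "f (y + e n / a * s) * of_real (2 * pi / e n * std_normal_density (a * ((y + e n / a * s) - y) / e n))
          = of_real (2 * pi / e n) * (f (y + e n / a * s) * D s)" for s
      proof -
        have arg: "a * ((y + e n / a * s) - y) / e n = s" using a e[of n] by simp
        show ?thesis unfolding arg D_def by simp
      qed
      then show ?thesis
        using a e[of n] by (simp only: g_def integral_mult_right_zero) (simp add: scaleR_conv_of_real)
    qed
    finally show ?thesis
      unfolding regularised_plancherel(2)[OF f e]
      by (simp add: mult_ac flip: integral_mult_right_zero integral_mult_left_zero)
  qed
  have l2: "2 * pi / a * (LINT y|lborel. cnj (f y) * f y) = of_real (2 * pi / a * (LINT y|lborel. (cmod (f y))\<^sup>2))"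
  proof -
    have "(LINT y|lborel. cnj (f y) * f y) = (LINT y|lborel. of_real ((cmod (f y))\<^sup>2))"
      by (intro Bochner_Integration.integral_cong refl) (simp only: complex_norm_square mult.commute)
    then show ?thesis by (simp only: integral_complex_of_real) simp
  qed
  have sqi: "integrable lborel (\<lambda>x. (cmod (f x))\<^sup>2)"
    by (rule Bochner_Integration.integrable_bound[OF integrable_mult_right[OF f, of "of_real C"]])
       (use C in \<open>auto simp: norm_mult power2_eq_square intro!: mult_right_mono bd\<close>)
  have "(\<lambda>n. LINT z|lborel. gauss (e n) z * (cmod (fourier a f (of_real z)))\<^sup>2)
     \<longlonglongrightarrow> 2 * pi / a * (LINT y|lborel. (cmod (f y))\<^sup>2)"
    using lim unfolding Sn[symmetric] l2 by (simp only: tendsto_of_real_iff)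
  then have "(\<lambda>n. ennreal (LINT z|lborel. gauss (e n) z * (cmod (fourier a f (of_real z)))\<^sup>2))
     \<longlonglongrightarrow> ennreal (2 * pi / a * (LINT y|lborel. (cmod (f y))\<^sup>2))"
    by (rule tendsto_ennrealI)
  moreover have "ennreal (LINT z|lborel. gauss (e n) z * (cmod (fourier a f (of_real z)))\<^sup>2)
      \<le> (\<integral>\<^sup>+ z. ennreal ((cmod (fourier a f (of_real z)))\<^sup>2) \<partial>lborel)" for n
  proof -
    have "ennreal (LINT z|lborel. gauss (e n) z * (cmod (fourier a f (of_real z)))\<^sup>2)
      = (\<integral>\<^sup>+ z. ennreal (gauss (e n) z * (cmod (fourier a f (of_real z)))\<^sup>2) \<partial>lborel)"
      by (rule nn_integral_eq_integral[OF regularised_plancherel(1)[OF f e], symmetric]) (simp add: less_imp_le)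
    also have "\<dots> \<le> (\<integral>\<^sup>+ z. ennreal ((cmod (fourier a f (of_real z)))\<^sup>2) \<partial>lborel)"
      by (intro nn_integral_mono ennreal_leI mult_left_le_one_le) (auto simp: gauss_def)
    finally show ?thesis .
  qed
  ultimately have "ennreal (2 * pi / a * (LINT y|lborel. (cmod (f y))\<^sup>2)) \<le> (\<integral>\<^sup>+ z. ennreal ((cmod (fourier a f (of_real z)))\<^sup>2) \<partial>lborel)"
    by (intro LIMSEQ_le_const2) auto
  then show "ennreal (2 * pi / a) * (\<integral>\<^sup>+ x. ennreal ((cmod (f x))\<^sup>2) \<partial>lborel) \<le> (\<integral>\<^sup>+ z. ennreal ((cmod (fourier a f (of_real z)))\<^sup>2) \<partial>lborel)"
    using a sqi by (subst (asm) ennreal_mult) (simp_all add: nn_integral_eq_integral)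
qed

section \<open>The Fourier transform of square-integrable functions\<close>

text \<open>The kernel exp (- x z / (2 pi i h)) of the operator is exp (i freq h x z).\<close>

definition freq :: "real \<Rightarrow> real" where "freq h = 1 / (2 * pi * h)"

lemma freq_pos: "h > 0 \<Longrightarrow> freq h > 0"
  by (simp add: freq_def)

text \<open>The Plancherel constant is the square of the normalising factor in the theorem.\<close>

lemma two_pi_freq: "h > 0 \<Longrightarrow> 2 * pi / freq h = (2 * pi * sqrt h)\<^sup>2"
  by (simp add: freq_def power2_eq_square)

lemma truncated_fourier_eq:
  assumes "h > 0"
  shows "truncated_fourier h n f z = fourier (freq h) (\<lambda>x. indicator {- real n..real n} x *\<^sub>R f x) (of_real z)"
proof -
  have "of_real (- x * z) / (2 * of_real pi * \<i> * of_real h) = \<i> * of_real (freq h * x) * of_real z" for x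
    using assms by (simp add: freq_def field_simps)
  then show ?thesis
    by (simp add: truncated_fourier_def fourier_def set_lebesgue_integral_def del: of_real_minus of_real_mult)
qed

lemma square_integrable_indicator_scaleR:
  "square_integrable f \<Longrightarrow> square_integrable (\<lambda>x. indicator {- real n..real n} x *\<^sub>R f x)"
  using square_integrable_mult[of f "\<lambda>x. of_real (indicator {- real n..real n} x)" 1]
  by (simp add: scaleR_conv_of_real indicator_def)

lemma integrable_indicator_scaleR:
  assumes "square_integrable f"
  shows "integrable lborel (\<lambda>x. indicator {- real n..real n} x *\<^sub>R f x)"
proof -
  have "square_integrable (\<lambda>x. of_real (indicator {- real n..real n} x))"
    by (rule square_integrable_bounded_support[of _ 1 "real n"]) (auto simp: indicator_def)
  from integrable_mult_square_integrable[OF this assms] show ?thesis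
    by (simp add: scaleR_conv_of_real)
qed

lemma tendsto_indicator_scaleR:
  assumes "square_integrable f"
  shows "(\<lambda>n. abs_l2 (\<lambda>x. indicator {- real n..real n} x *\<^sub>R f x)) \<longlonglongrightarrow> abs_l2 f"
proof (rule tendsto_l2_dominated[OF assms])
  note [measurable] = square_integrable_measurable[OF assms]
  show "(\<lambda>x. indicator {- real n..real n} x *\<^sub>R f x) \<in> borel_measurable borel" for n by measurable
  show "f \<in> borel_measurable borel" by measurable
  show "AE x in lborel. cmod (indicator {- real n..real n} x *\<^sub>R f x) \<le> cmod (f x)" for n
    by (intro AE_I2) (simp add: indicator_def)
  have "(\<lambda>n. indicator {- real n..real n} x *\<^sub>R f x) \<longlonglongrightarrow> f x" for x
  proof (rule tendsto_eventually)
    obtain m where m: "\<bar>x\<bar> \<le> real m" using real_arch_simple by blast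
    show "\<forall>\<^sub>F n in sequentially. indicator {- real n..real n} x *\<^sub>R f x = f x"
      using eventually_ge_at_top[of m] by eventually_elim (use m in \<open>auto simp: indicator_def\<close>)
  qed
  then show "AE x in lborel. (\<lambda>n. indicator {- real n..real n} x *\<^sub>R f x) \<longlonglongrightarrow> f x" by simp
qed

lemma fourier_diff:
  assumes "integrable lborel f" "integrable lborel g"
  shows "fourier a (\<lambda>x. f x - g x) (of_real z) = fourier a f (of_real z) - fourier a g (of_real z)"
  using integrable_fourier[OF assms(1)] integrable_fourier[OF assms(2)]
  by (simp add: fourier_def left_diff_distrib)

context
  fixes h :: real
  assumes h: "h > 0"
begin

lemma fourier_square_integrable:
  assumes f: "square_integrable f" "integrable lborel f"
  shows "square_integrable (\<lambda>z. fourier (freq h) f (of_real z))"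
    and "norm (abs_l2 (\<lambda>z. fourier (freq h) f (of_real z))) \<le> 2 * pi * sqrt h * norm (abs_l2 f)"
proof -
  note [measurable] = square_integrable_measurable[OF f(1)]
  have "(\<integral>\<^sup>+ z. ennreal ((cmod (fourier (freq h) f (of_real z)))\<^sup>2) \<partial>lborel)
      \<le> ennreal (2 * pi / freq h) * (\<integral>\<^sup>+ x. ennreal ((cmod (f x))\<^sup>2) \<partial>lborel)"
    by (rule plancherel_le[OF f(2) freq_pos[OF h]])
  also have "\<dots> = ennreal ((2 * pi * sqrt h * norm (abs_l2 f))\<^sup>2)"
    unfolding two_pi_freq[OF h] nn_integral_square_integrable[OF f(1)]
    by (simp add: power_mult_distrib ennreal_mult)
  finally have *: "(\<integral>\<^sup>+ z. ennreal ((cmod (fourier (freq h) f (of_real z)))\<^sup>2) \<partial>lborel)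
    \<le> ennreal ((2 * pi * sqrt h * norm (abs_l2 f))\<^sup>2)" .
  show "square_integrable (\<lambda>z. fourier (freq h) f (of_real z))"
    "norm (abs_l2 (\<lambda>z. fourier (freq h) f (of_real z))) \<le> 2 * pi * sqrt h * norm (abs_l2 f)"
    using norm_abs_l2_le[OF _ _ *] h by auto
qed

lemma norm_fourier_eq:
  assumes f: "integrable lborel f" "continuous_on UNIV f" "\<And>x. cmod (f x) \<le> C"
  shows "norm (abs_l2 (\<lambda>z. fourier (freq h) f (of_real z))) = 2 * pi * sqrt h * norm (abs_l2 f)"
proof -
  have C: "0 \<le> C" using f(3)[of 0] norm_ge_zero order_trans by blast
  note [measurable] = borel_measurable_integrable[OF f(1), simplified]
  have "integrable lborel (\<lambda>x. (cmod (f x))\<^sup>2)"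
    by (rule Bochner_Integration.integrable_bound[OF integrable_mult_right[OF f(1), of "of_real C"]])
       (use C in \<open>auto simp: norm_mult power2_eq_square intro!: mult_right_mono f(3)\<close>)
  then have sf: "square_integrable f" by (simp add: square_integrable_def)
  have "ennreal ((norm (abs_l2 (\<lambda>z. fourier (freq h) f (of_real z))))\<^sup>2)
     = ennreal ((2 * pi * sqrt h * norm (abs_l2 f))\<^sup>2)"
    using plancherel_eq[OF f freq_pos[OF h]]
    unfolding two_pi_freq[OF h] nn_integral_square_integrable[OF sf]
      nn_integral_square_integrable[OF fourier_square_integrable(1)[OF sf f(1)]]
    by (simp add: power_mult_distrib ennreal_mult)
  then have "(norm (abs_l2 (\<lambda>z. fourier (freq h) f (of_real z))))\<^sup>2 = (2 * pi * sqrt h * norm (abs_l2 f))\<^sup>2"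
    by simp
  then show ?thesis using h by (subst (asm) power2_eq_iff_nonneg) auto
qed

abbreviation trunc :: "nat \<Rightarrow> (real \<Rightarrow> complex) \<Rightarrow> real \<Rightarrow> complex" where
  "trunc n f \<equiv> (\<lambda>x. indicator {- real n..real n} x *\<^sub>R f x)"

lemma truncated_fourier_square_integrable:
  assumes "square_integrable f"
  shows "square_integrable (truncated_fourier h n f)"
  using fourier_square_integrable(1)[OF square_integrable_indicator_scaleR[OF assms] integrable_indicator_scaleR[OF assms]]
  by (simp add: truncated_fourier_eq[OF h, abs_def])

text \<open>With an arbitrary integrable g the estimate compares two truncations of f, for the
  Cauchy property, as well as a truncation with an integrable f itself.\<close>

lemma norm_truncated_fourier_diff_le:
  assumes f: "square_integrable f" and g: "square_integrable g" "integrable lborel g"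
  shows "norm (abs_l2 (truncated_fourier h n f) - abs_l2 (\<lambda>z. fourier (freq h) g (of_real z)))
    \<le> 2 * pi * sqrt h * norm (abs_l2 (trunc n f) - abs_l2 g)"
proof -
  note f' = square_integrable_indicator_scaleR[OF f] integrable_indicator_scaleR[OF f]
  have "abs_l2 (truncated_fourier h n f) - abs_l2 (\<lambda>z. fourier (freq h) g (of_real z))
      = abs_l2 (\<lambda>z. fourier (freq h) (\<lambda>x. trunc n f x - g x) (of_real z))"
    using f' g by (simp add: minus_abs_l2 truncated_fourier_square_integrable f fourier_square_integrable
        truncated_fourier_eq[OF h, abs_def] fourier_diff)
  also have "norm \<dots> \<le> 2 * pi * sqrt h * norm (abs_l2 (\<lambda>x. trunc n f x - g x))"
    by (rule fourier_square_integrable(2)) (use f' g in \<open>auto intro: square_integrable_diff\<close>)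
  finally show ?thesis using f' g by (simp add: minus_abs_l2)
qed

lemma truncated_fourier_rep:
  assumes "square_integrable f"
  shows "truncated_fourier h n (rep_l2 (abs_l2 f)) = truncated_fourier h n f"
proof
  fix z
  note [measurable] = square_integrable_measurable[OF assms] square_integrable_measurable[OF square_integrable_rep_l2]
  show "truncated_fourier h n (rep_l2 (abs_l2 f)) z = truncated_fourier h n f z"
    unfolding truncated_fourier_def set_lebesgue_integral_def
  proof (rule integral_cong_AE)
    show "AE x in lborel. indicator {- real n..real n} x *\<^sub>R (rep_l2 (abs_l2 f) x * exp (of_real (- x * z) / (2 * of_real pi * \<i> * of_real h)))
      = indicator {- real n..real n} x *\<^sub>R (f x * exp (of_real (- x * z) / (2 * of_real pi * \<i> * of_real h)))"
      using rep_abs_l2[OF assms] by eventually_elim simp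
  qed measurable
qed

text \<open>The Plancherel bound turns convergence of the truncated functions into the Cauchy
  property of their transforms, and completeness gives a limit. Its uniqueness makes the definite
  description in \<open>fourier_l2_def\<close> denote it.\<close>

lemma fourier_l2_tendsto: 
  "(\<lambda>n. abs_l2 (truncated_fourier h n (rep_l2 u))) \<longlonglongrightarrow> fourier_l2 h u"
proof -
  define f where "f = rep_l2 u"
  have f: "square_integrable f" unfolding f_def by (rule square_integrable_rep_l2)
  note f' = square_integrable_indicator_scaleR[OF f] integrable_indicator_scaleR[OF f]
  note si = truncated_fourier_square_integrable[OF f]
  have "Cauchy (\<lambda>n. abs_l2 (truncated_fourier h n f))"
  proof (rule metric_CauchyI)
    fix e :: real assume e: "e > 0"
    define c where "c = 2 * pi * sqrt h"
    have c: "c > 0" using h by (simp add: c_def)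
    have "Cauchy (\<lambda>n. abs_l2 (trunc n f))"
      using tendsto_indicator_scaleR[OF f] by (rule LIMSEQ_imp_Cauchy)
    from metric_CauchyD[OF this, of "e / c"] e c obtain M where
      M: "\<And>m n. m \<ge> M \<Longrightarrow> n \<ge> M \<Longrightarrow> dist (abs_l2 (trunc m f)) (abs_l2 (trunc n f)) < e / c" by auto
    have "dist (abs_l2 (truncated_fourier h m f)) (abs_l2 (truncated_fourier h n f)) < e" if "m \<ge> M" "n \<ge> M" for m n
    proof -
      have "dist (abs_l2 (truncated_fourier h m f)) (abs_l2 (truncated_fourier h n f))
         \<le> c * norm (abs_l2 (trunc m f) - abs_l2 (trunc n f))"
        using norm_truncated_fourier_diff_le[OF f f', of m n]
        by (simp add: dist_norm c_def truncated_fourier_eq[OF h, abs_def])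
      also have "\<dots> < e" using M[OF that] c by (simp add: dist_norm field_simps)
      finally show ?thesis .
    qed
    then show "\<exists>M. \<forall>m\<ge>M. \<forall>n\<ge>M. dist (abs_l2 (truncated_fourier h m f)) (abs_l2 (truncated_fourier h n f)) < e"
      by blast
  qed
  then obtain g where g: "(\<lambda>n. abs_l2 (truncated_fourier h n f)) \<longlonglongrightarrow> g"
    using Cauchy_convergent convergent_def by blast
  \<comment> \<open>The criterion in \<open>fourier_l2_def\<close>, an extended nonnegative
    integral, is convergence in norm, because all functions involved are square-integrable.\<close>
  have iff: "((\<lambda>n. \<integral>\<^sup>+ z. ennreal ((cmod (truncated_fourier h n f z - rep_l2 v z))\<^sup>2) \<partial>lborel) \<longlonglongrightarrow> 0)
      \<longleftrightarrow> (\<lambda>n. abs_l2 (truncated_fourier h n f)) \<longlonglongrightarrow> v" for v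
  proof -
    have "(\<integral>\<^sup>+ z. ennreal ((cmod (truncated_fourier h n f z - rep_l2 v z))\<^sup>2) \<partial>lborel)
        = ennreal ((norm (abs_l2 (truncated_fourier h n f) - v))\<^sup>2)" for n
      using si[of n] square_integrable_rep_l2[of v] minus_abs_l2[OF si square_integrable_rep_l2, of n v]
      by (simp add: nn_integral_square_integrable square_integrable_diff abs_rep_l2)
    then have "((\<lambda>n. \<integral>\<^sup>+ z. ennreal ((cmod (truncated_fourier h n f z - rep_l2 v z))\<^sup>2) \<partial>lborel) \<longlonglongrightarrow> 0)
      \<longleftrightarrow> (\<lambda>n. ennreal ((norm (abs_l2 (truncated_fourier h n f) - v))\<^sup>2)) \<longlonglongrightarrow> ennreal 0"
      by simp
    also have "\<dots> \<longleftrightarrow> (\<lambda>n. (norm (abs_l2 (truncated_fourier h n f) - v))\<^sup>2) \<longlonglongrightarrow> 0"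
      by (intro tendsto_ennreal_iff) auto
    also have "\<dots> \<longleftrightarrow> (\<lambda>n. norm (abs_l2 (truncated_fourier h n f) - v)) \<longlonglongrightarrow> 0"
    proof
      assume "(\<lambda>n. (norm (abs_l2 (truncated_fourier h n f) - v))\<^sup>2) \<longlonglongrightarrow> 0"
      from tendsto_real_sqrt[OF this]
      show "(\<lambda>n. norm (abs_l2 (truncated_fourier h n f) - v)) \<longlonglongrightarrow> 0" by simp
    next
      assume "(\<lambda>n. norm (abs_l2 (truncated_fourier h n f) - v)) \<longlonglongrightarrow> 0"
      from tendsto_power[OF this, of 2]
      show "(\<lambda>n. (norm (abs_l2 (truncated_fourier h n f) - v))\<^sup>2) \<longlonglongrightarrow> 0" by simp
    qed
    also have "\<dots> \<longleftrightarrow> (\<lambda>n. abs_l2 (truncated_fourier h n f)) \<longlonglongrightarrow> v"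
      unfolding tendsto_norm_zero_iff by (rule LIM_zero_iff)
    finally show ?thesis .
  qed
  have "fourier_l2 h u = g"
    unfolding fourier_l2_def f_def[symmetric] iff
    using g by (rule the_equality) (use g LIMSEQ_unique in blast)
  then show ?thesis using g by (simp add: f_def)
qed

lemma fourier_l2_abs_tendsto:
  assumes "square_integrable f"
  shows "(\<lambda>n. abs_l2 (truncated_fourier h n f)) \<longlonglongrightarrow> fourier_l2 h (abs_l2 f)"
  using fourier_l2_tendsto[of "abs_l2 f"] by (simp add: truncated_fourier_rep[OF assms])

lemma fourier_l2_eqI:
  assumes "square_integrable f" "(\<lambda>n. abs_l2 (truncated_fourier h n f)) \<longlonglongrightarrow> v"
  shows "fourier_l2 h (abs_l2 f) = v"
  using LIMSEQ_unique[OF fourier_l2_abs_tendsto[OF assms(1)] assms(2)] .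

text \<open>This connects the operator with convergent integrals, on which contours can be
  moved.\<close>

lemma fourier_l2_integrable:
  assumes f: "square_integrable f" "integrable lborel f"
  shows "fourier_l2 h (abs_l2 f) = abs_l2 (\<lambda>z. fourier (freq h) f (of_real z))"
proof (rule fourier_l2_eqI[OF f(1)])
  have "(\<lambda>n. 2 * pi * sqrt h * norm (abs_l2 (trunc n f) - abs_l2 f)) \<longlonglongrightarrow> 2 * pi * sqrt h * 0"
    by (intro tendsto_intros tendsto_norm_zero LIM_zero tendsto_indicator_scaleR f)
  then have lim: "(\<lambda>n. 2 * pi * sqrt h * norm (abs_l2 (trunc n f) - abs_l2 f)) \<longlonglongrightarrow> 0"
    by simp
  have "(\<lambda>n. abs_l2 (truncated_fourier h n f) - abs_l2 (\<lambda>z. fourier (freq h) f (of_real z))) \<longlonglongrightarrow> 0"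
    by (rule Lim_null_comparison[OF always_eventually lim]) (intro allI norm_truncated_fourier_diff_le f)
  then show "(\<lambda>n. abs_l2 (truncated_fourier h n f)) \<longlonglongrightarrow> abs_l2 (\<lambda>z. fourier (freq h) f (of_real z))"
    by (rule LIM_zero_cancel)
qed

lemma set_integrable_truncated:
  assumes "square_integrable f"
  shows "integrable lborel (\<lambda>x. indicator {- real n..real n} x *\<^sub>R (f x * exp (of_real (- x * z) / (2 * of_real pi * \<i> * of_real h))))"
proof -
  note [measurable] = square_integrable_measurable[OF assms]
  have "cmod (exp (of_real (- x * z) / (2 * of_real pi * \<i> * of_real h))) = 1" for x
    by (simp add: Re_divide)
  then show ?thesis
    by (intro Bochner_Integration.integrable_bound[OF integrable_indicator_scaleR[OF assms, of n]])
       (auto simp: norm_mult indicator_def)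
qed

lemma truncated_fourier_add:
  assumes "square_integrable f" "square_integrable g"
  shows "truncated_fourier h n (\<lambda>x. f x + g x) z = truncated_fourier h n f z + truncated_fourier h n g z"
  using set_integrable_truncated[OF assms(1), of n z] set_integrable_truncated[OF assms(2), of n z]
  unfolding truncated_fourier_def set_lebesgue_integral_def distrib_right scaleR_add_right
  by (rule Bochner_Integration.integral_add)

lemma truncated_fourier_cmult:
  "truncated_fourier h n (\<lambda>x. c * f x) z = c * truncated_fourier h n f z"
  unfolding truncated_fourier_def set_lebesgue_integral_def mult.assoc mult_scaleR_right[symmetric]
  by (rule integral_mult_right_zero)

lemma fourier_l2_add: "fourier_l2 h (u + v) = fourier_l2 h u + fourier_l2 h v"
proof -
  obtain f where f: "u = abs_l2 f" "square_integrable f" by (rule l2_cases)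
  obtain g where g: "v = abs_l2 g" "square_integrable g" by (rule l2_cases)
  have "(\<lambda>n. abs_l2 (truncated_fourier h n (\<lambda>x. f x + g x))) \<longlonglongrightarrow> fourier_l2 h u + fourier_l2 h v"
    using tendsto_add[OF fourier_l2_abs_tendsto[OF f(2)] fourier_l2_abs_tendsto[OF g(2)]] f g
    by (simp add: plus_abs_l2 truncated_fourier_square_integrable truncated_fourier_add[OF f(2) g(2), abs_def])
  from fourier_l2_eqI[OF square_integrable_add[OF f(2) g(2)] this] show ?thesis
    by (simp add: f g plus_abs_l2)
qed

lemma fourier_l2_scale: "fourier_l2 h (scale_l2 c u) = scale_l2 c (fourier_l2 h u)"
proof -
  obtain f where f: "u = abs_l2 f" "square_integrable f" by (rule l2_cases)
  have "(\<lambda>n. abs_l2 (truncated_fourier h n (\<lambda>x. c * f x))) \<longlonglongrightarrow> scale_l2 c (fourier_l2 h u)"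
    using bounded_linear.tendsto[OF bounded_linear_scale_l2[of c] fourier_l2_abs_tendsto[OF f(2)]] f
    by (simp add: scale_abs_l2 truncated_fourier_square_integrable truncated_fourier_cmult[abs_def])
  from fourier_l2_eqI[OF square_integrable_cmult[OF f(2)] this] show ?thesis
    by (simp add: f scale_abs_l2)
qed

lemma norm_fourier_l2_le: "norm (fourier_l2 h u) \<le> 2 * pi * sqrt h * norm u"
proof -
  obtain f where f: "u = abs_l2 f" "square_integrable f" by (rule l2_cases)
  have "norm (abs_l2 (truncated_fourier h n f)) \<le> 2 * pi * sqrt h * norm (abs_l2 (trunc n f))" for n
    using fourier_square_integrable(2)[OF square_integrable_indicator_scaleR[OF f(2)] integrable_indicator_scaleR[OF f(2)], of n]
    by (simp add: truncated_fourier_eq[OF h, abs_def])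
  moreover have "(\<lambda>n. norm (abs_l2 (truncated_fourier h n f))) \<longlonglongrightarrow> norm (fourier_l2 h u)"
    unfolding f(1) by (intro tendsto_norm fourier_l2_abs_tendsto f)
  moreover have "(\<lambda>n. 2 * pi * sqrt h * norm (abs_l2 (trunc n f))) \<longlonglongrightarrow> 2 * pi * sqrt h * norm u"
    unfolding f(1) by (intro tendsto_intros tendsto_indicator_scaleR f)
  ultimately show ?thesis by (intro LIMSEQ_le) auto
qed

lemma bounded_linear_fourier_l2: "bounded_linear (fourier_l2 h)"
proof (rule bounded_linear_intro[of _ "2 * pi * sqrt h"])
  show "norm (fourier_l2 h u) \<le> norm u * (2 * pi * sqrt h)" for u
    using norm_fourier_l2_le[of u] by (simp only: mult.commute)
  show "fourier_l2 h (r *\<^sub>R u) = r *\<^sub>R fourier_l2 h u" for r u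
    unfolding scaleR_eq_scale_l2 by (rule fourier_l2_scale)
qed (rule fourier_l2_add)

section \<open>Translations and modulations\<close>

lemma square_integrable_shift:
  assumes "square_integrable f"
  shows "square_integrable (\<lambda>x. f (x + s))" "norm (abs_l2 (\<lambda>x. f (x + s))) = norm (abs_l2 f)"
proof -
  note [measurable] = square_integrable_measurable[OF assms]
  have "integrable lborel (\<lambda>x. (cmod (f (s + 1 * x)))\<^sup>2)"
    using lborel_integrable_real_affine[of "\<lambda>x. (cmod (f x))\<^sup>2" 1 s] assms
    by (simp add: square_integrable_def)
  then show *: "square_integrable (\<lambda>x. f (x + s))"
    by (simp add: square_integrable_def add.commute)
  have "(norm (abs_l2 (\<lambda>x. f (x + s))))\<^sup>2 = (norm (abs_l2 f))\<^sup>2"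
    using lborel_integral_real_affine[of 1 "\<lambda>x. (cmod (f x))\<^sup>2" s]
    by (simp add: norm_abs_l2_power2 * assms add.commute)
  then show "norm (abs_l2 (\<lambda>x. f (x + s))) = norm (abs_l2 f)"
    by (subst (asm) power2_eq_iff_nonneg) auto
qed

text \<open>For truncated transforms the relation is exact, because modulation commutes with
  restriction to an interval; the passage to the limit uses that translations are isometric.\<close>

lemma fourier_l2_modulate:
  assumes f: "square_integrable f" and g: "square_integrable g" and fg: "fourier_l2 h (abs_l2 f) = abs_l2 g"
  shows "fourier_l2 h (abs_l2 (\<lambda>x. exp (\<i> * of_real (freq h * x) * of_real s) * f x)) = abs_l2 (\<lambda>z. g (z + s))"
proof (rule fourier_l2_eqI)
  show "square_integrable (\<lambda>x. exp (\<i> * of_real (freq h * x) * of_real s) * f x)"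
    by (rule square_integrable_mult[OF f, of _ 1]) auto
  have "truncated_fourier h n (\<lambda>x. exp (\<i> * of_real (freq h * x) * of_real s) * f x) z = truncated_fourier h n f (z + s)" for n z
    unfolding truncated_fourier_eq[OF h] fourier_def
    by (intro Bochner_Integration.integral_cong refl) (simp add: distrib_left exp_add mult_ac)
  then have eq: "truncated_fourier h n (\<lambda>x. exp (\<i> * of_real (freq h * x) * of_real s) * f x) = (\<lambda>z. truncated_fourier h n f (z + s))" for n
    by blast
  note si = truncated_fourier_square_integrable[OF f]
  have "norm (abs_l2 (\<lambda>z. truncated_fourier h n f (z + s)) - abs_l2 (\<lambda>z. g (z + s)))
      = norm (abs_l2 (truncated_fourier h n f) - abs_l2 g)" for n
    using square_integrable_shift(2)[OF square_integrable_diff[OF si[of n] g], of s]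
      square_integrable_shift(1)[OF si[of n], of s] square_integrable_shift(1)[OF g, of s] si[of n] g
    by (simp add: minus_abs_l2)
  moreover have "(\<lambda>n. norm (abs_l2 (truncated_fourier h n f) - abs_l2 g)) \<longlonglongrightarrow> 0"
    using fourier_l2_abs_tendsto[OF f] unfolding fg by (intro tendsto_norm_zero LIM_zero)
  ultimately have "(\<lambda>n. norm (abs_l2 (\<lambda>z. truncated_fourier h n f (z + s)) - abs_l2 (\<lambda>z. g (z + s)))) \<longlonglongrightarrow> 0"
    by simp
  then show "(\<lambda>n. abs_l2 (truncated_fourier h n (\<lambda>x. exp (\<i> * of_real (freq h * x) * of_real s) * f x))) \<longlonglongrightarrow> abs_l2 (\<lambda>z. g (z + s))"
    unfolding eq by (rule LIM_zero_cancel[OF tendsto_norm_zero_cancel])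
qed

end

section \<open>Integrals along horizontal lines\<close>

lemma integrable_exp_minus_abs:
  assumes "d > 0"
  shows "integrable lborel (\<lambda>x::real. exp (- d * \<bar>x\<bar>))"
proof -
  define F where "F x = indicator {0<..} x *\<^sub>R exp (- (x * d))" for x :: real
  have 1: "integrable lborel F"
    using integrable_I0i_exp_mscale[OF assms] by (simp add: set_integrable_def F_def[abs_def])
  have "integrable lborel (\<lambda>x. F x + F (0 + -1 * x))"
    by (intro Bochner_Integration.integrable_add 1 lborel_integrable_real_affine) simp
  moreover have "AE x in lborel. F x + F (0 + -1 * x) = exp (- d * \<bar>x\<bar>)"
    using AE_lborel_singleton[of "0::real"]
    by eventually_elim (auto simp: F_def indicator_def mult.commute)
  ultimately show ?thesis
    using 1 by (subst (asm) integrable_cong_AE) (auto simp: F_def[abs_def])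
qed

text \<open>A second-order Taylor remainder of the exponential, uniform in t. Half of the margin d
  |t| absorbs exp |Re u|, and the other half absorbs t^2 by y^2 / 2 \<le> exp y for y = d |t| / 2;
  hence the constant 8 / d^2.\<close>

lemma integral_exp_deriv_bound:
  fixes g :: "real \<Rightarrow> complex" and c z w :: complex
  assumes d: "d > 0" and w: "cmod (w - z) * cmod c \<le> d / 2"
  shows "cmod (g t * exp (c * t * w) - g t * exp (c * t * z) - (w - z) * (g t * (c * t) * exp (c * t * z)))
     \<le> cmod (g t) * exp (Re (c * t * z) + d * \<bar>t\<bar>) * (8 * (cmod c)\<^sup>2 / d\<^sup>2 * (cmod (w - z))\<^sup>2)"
proof -
  define u where "u = c * t * (w - z)"
  have nu: "cmod u = cmod c * \<bar>t\<bar> * cmod (w - z)" by (simp add: u_def norm_mult)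
  have "cmod u = (cmod (w - z) * cmod c) * \<bar>t\<bar>" by (simp add: nu)
  also have "\<dots> \<le> d / 2 * \<bar>t\<bar>" using w by (intro mult_right_mono) auto
  finally have u: "cmod u \<le> d / 2 * \<bar>t\<bar>" .
  have "cmod (exp u - (\<Sum>k\<le>1. u ^ k / fact k)) \<le> exp \<bar>Re u\<bar> * cmod u ^ Suc 1 / fact 1"
    by (rule Taylor_exp)
  then have "cmod (exp u - 1 - u) \<le> exp \<bar>Re u\<bar> * (cmod u)\<^sup>2"
    by (simp add: power2_eq_square diff_diff_eq)
  also have "\<dots> \<le> exp (d / 2 * \<bar>t\<bar>) * (cmod u)\<^sup>2"
    using u abs_Re_le_cmod[of u] by (intro mult_right_mono) auto
  also have "(cmod u)\<^sup>2 = (cmod c)\<^sup>2 * (cmod (w - z))\<^sup>2 * t\<^sup>2"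
    by (simp add: nu power_mult_distrib)
  also have "t\<^sup>2 \<le> 8 / d\<^sup>2 * exp (d / 2 * \<bar>t\<bar>)"
  proof -
    have "(d / 2 * \<bar>t\<bar>)\<^sup>2 / 2 \<le> exp (d / 2 * \<bar>t\<bar>)"
      using exp_lower_Taylor_quadratic[of "d / 2 * \<bar>t\<bar>"] d mult_nonneg_nonneg[of "d / 2" "\<bar>t\<bar>"] by linarith
    then show ?thesis using d by (simp add: power_mult_distrib power_divide field_simps)
  qed
  finally have e: "cmod (exp u - 1 - u) \<le> exp (d / 2 * \<bar>t\<bar>) * ((cmod c)\<^sup>2 * (cmod (w - z))\<^sup>2 * (8 / d\<^sup>2 * exp (d / 2 * \<bar>t\<bar>)))"
    by (simp add: mult_left_mono)
  have "g t * exp (c * t * w) - g t * exp (c * t * z) - (w - z) * (g t * (c * t) * exp (c * t * z))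
      = g t * exp (c * t * z) * (exp u - 1 - u)"
  proof -
    have "exp (c * t * w) = exp (c * t * z) * exp u"
      by (simp add: u_def exp_add[symmetric] algebra_simps)
    then show ?thesis by (simp add: u_def algebra_simps)
  qed
  also have "cmod \<dots> = cmod (g t) * exp (Re (c * t * z)) * cmod (exp u - 1 - u)"
    by (simp add: norm_mult)
  also have "\<dots> \<le> cmod (g t) * exp (Re (c * t * z)) * (exp (d / 2 * \<bar>t\<bar>) * ((cmod c)\<^sup>2 * (cmod (w - z))\<^sup>2 * (8 / d\<^sup>2 * exp (d / 2 * \<bar>t\<bar>))))"
    by (intro mult_left_mono e) auto
  also have "\<dots> = cmod (g t) * (exp (Re (c * t * z)) * (exp (d / 2 * \<bar>t\<bar>) * exp (d / 2 * \<bar>t\<bar>))) * (8 * (cmod c)\<^sup>2 / d\<^sup>2 * (cmod (w - z))\<^sup>2)"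
    by simp
  also have "exp (Re (c * t * z)) * (exp (d / 2 * \<bar>t\<bar>) * exp (d / 2 * \<bar>t\<bar>)) = exp (Re (c * t * z) + d * \<bar>t\<bar>)"
    by (simp add: exp_add[symmetric])
  finally show ?thesis .
qed

text \<open>Integrating the remainder estimate bounds the error of the difference quotient by a
  constant times |w - z|. Integrals that depend holomorphically on a parameter are brought to this
  kernel exp (c t z) throughout.\<close>

lemma integral_exp_has_derivative:
  fixes g :: "real \<Rightarrow> complex" and c z :: complex
  assumes [measurable]: "g \<in> borel_measurable borel" and d: "d > 0"
    and int: "integrable lborel (\<lambda>t. cmod (g t) * exp (Re (c * t * z) + d * \<bar>t\<bar>))"
  shows "((\<lambda>w. LINT t|lborel. g t * exp (c * t * w)) has_field_derivative
           (LINT t|lborel. g t * (c * t) * exp (c * t * z))) (at z)"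
    and "integrable lborel (\<lambda>t. g t * exp (c * t * z))"
    and "integrable lborel (\<lambda>t. g t * (c * t) * exp (c * t * z))"
proof -
  define M where "M = (LINT t|lborel. cmod (g t) * exp (Re (c * t * z) + d * \<bar>t\<bar>))"
  have dom: "integrable lborel f" if "\<And>t :: real. cmod (f t) \<le> B * (cmod (g t) * exp (Re (c * t * z) + d * \<bar>t\<bar>))" 
     "f \<in> borel_measurable borel" for f :: "real \<Rightarrow> complex" and B
  proof (rule Bochner_Integration.integrable_bound[OF integrable_mult_right[OF int, of B]])
    show "AE t in lborel. cmod (f t) \<le> norm (B * (cmod (g t) * exp (Re (c * t * z) + d * \<bar>t\<bar>)))"
      using that(1) by (intro AE_I2) (smt (verit) real_norm_def)
  qed (use that in simp)
  have Iz: "integrable lborel (\<lambda>t. g t * exp (c * t * z))"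
  proof (rule dom[of _ 1])
    fix t :: real
    show "cmod (g t * exp (c * t * z)) \<le> 1 * (cmod (g t) * exp (Re (c * t * z) + d * \<bar>t\<bar>))"
      using d by (simp add: norm_mult mult_left_mono)
  qed measurable
  then show "integrable lborel (\<lambda>t. g t * exp (c * t * z))" .
  have Id: "integrable lborel (\<lambda>t. g t * (c * t) * exp (c * t * z))"
  proof (rule dom[of _ "cmod c / d"])
    fix t :: real
    have "d * \<bar>t\<bar> \<le> exp (d * \<bar>t\<bar>)" using exp_ge_add_one_self[of "d * \<bar>t\<bar>"] by linarith
    then have "\<bar>t\<bar> \<le> 1 / d * exp (d * \<bar>t\<bar>)" using d by (simp add: field_simps)
    from mult_left_mono[OF this, of "cmod (g t) * exp (Re (c * t * z)) * cmod c"]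
    have "cmod (g t) * exp (Re (c * t * z)) * cmod c * \<bar>t\<bar> \<le> cmod (g t) * exp (Re (c * t * z)) * cmod c * (1 / d * exp (d * \<bar>t\<bar>))"
      by simp
    then show "cmod (g t * (c * t) * exp (c * t * z)) \<le> cmod c / d * (cmod (g t) * exp (Re (c * t * z) + d * \<bar>t\<bar>))"
      by (simp add: norm_mult exp_add mult_ac)
  qed measurable
  then show "integrable lborel (\<lambda>t. g t * (c * t) * exp (c * t * z))" .
  have Iw: "integrable lborel (\<lambda>t. g t * exp (c * t * w))" if w: "cmod (w - z) * cmod c \<le> d / 2" for w
  proof (rule dom[of _ 1])
    fix t :: real
    have "Re (c * t * w) = Re (c * t * z) + Re (c * t * (w - z))" by (simp add: algebra_simps)
    moreover have "Re (c * t * (w - z)) \<le> cmod (c * t * (w - z))" by (rule complex_Re_le_cmod)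
    moreover have "cmod (c * t * (w - z)) \<le> d / 2 * \<bar>t\<bar>"
      using mult_right_mono[OF w, of "\<bar>t\<bar>"] by (simp add: norm_mult mult_ac)
    moreover have "0 \<le> d / 2 * \<bar>t\<bar>" using d by simp
    ultimately have "Re (c * t * w) \<le> Re (c * t * z) + d * \<bar>t\<bar>" by (simp add: algebra_simps)
    then show "cmod (g t * exp (c * t * w)) \<le> 1 * (cmod (g t) * exp (Re (c * t * z) + d * \<bar>t\<bar>))"
      by (simp add: norm_mult mult_left_mono)
  qed measurable
  define F where "F w = (LINT t|lborel. g t * exp (c * t * w))" for w
  define D where "D = (LINT t|lborel. g t * (c * t) * exp (c * t * z))"
  define B where "B = 8 * (cmod c)\<^sup>2 / d\<^sup>2 * M"
  have key: "cmod (F w - F z - (w - z) * D) \<le> B * (cmod (w - z))\<^sup>2" if w: "cmod (w - z) * cmod c \<le> d / 2" for w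
  proof -
    have eq: "F w - F z - (w - z) * D = (LINT t|lborel. g t * exp (c * t * w) - g t * exp (c * t * z) - (w - z) * (g t * (c * t) * exp (c * t * z)))"
    proof -
      have "(w - z) * D = (LINT t|lborel. (w - z) * (g t * (c * t) * exp (c * t * z)))"
        unfolding D_def by (rule integral_mult_right_zero[symmetric])
      then show ?thesis
        unfolding F_def using Iw[OF w] Iz integrable_mult_right[OF Id, of "w - z"]
        by (simp only: Bochner_Integration.integral_diff Bochner_Integration.integrable_diff)
    qed
    have "cmod (F w - F z - (w - z) * D) \<le> (LINT t|lborel. cmod (g t) * exp (Re (c * t * z) + d * \<bar>t\<bar>) * (8 * (cmod c)\<^sup>2 / d\<^sup>2 * (cmod (w - z))\<^sup>2))"
      unfolding eq
      by (rule Bochner_Integration.integral_norm_bound_integral[OF _ _ integral_exp_deriv_bound[OF d w]])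
         (intro Bochner_Integration.integrable_diff integrable_mult_right Iw[OF w] Iz Id, intro integrable_mult_left int)
    also have "\<dots> = M * (8 * (cmod c)\<^sup>2 / d\<^sup>2 * (cmod (w - z))\<^sup>2)"
      unfolding M_def by (rule integral_mult_left_zero)
    also have "\<dots> = B * (cmod (w - z))\<^sup>2"
      by (simp add: B_def)
    finally show ?thesis .
  qed
  have "((\<lambda>w. (F w - F z) / (w - z) - D) \<longlongrightarrow> 0) (at z)"
  proof (rule Lim_null_comparison)
    have "((\<lambda>w. B * cmod (w - z)) \<longlongrightarrow> B * cmod (z - z)) (at z)" by (intro tendsto_intros)
    then show "((\<lambda>w. B * cmod (w - z)) \<longlongrightarrow> 0) (at z)" by simp
    have "((\<lambda>w. cmod (w - z) * cmod c) \<longlongrightarrow> cmod (z - z) * cmod c) (at z)" by (intro tendsto_intros)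
    then have "\<forall>\<^sub>F w in at z. cmod (w - z) * cmod c < d / 2"
      using d by (intro order_tendstoD(2)[of _ "cmod (z - z) * cmod c"]) auto
    moreover have "\<forall>\<^sub>F w in at z. w \<noteq> z" by (simp add: eventually_at_filter)
    ultimately show "\<forall>\<^sub>F w in at z. cmod ((F w - F z) / (w - z) - D) \<le> B * cmod (w - z)"
    proof eventually_elim
      case (elim w)
      have "(F w - F z) / (w - z) - D = (F w - F z - (w - z) * D) / (w - z)"
        using elim by (simp add: field_simps)
      then have "cmod ((F w - F z) / (w - z) - D) = cmod (F w - F z - (w - z) * D) / cmod (w - z)"
        by (simp add: norm_divide)
      also have "\<dots> \<le> B * (cmod (w - z))\<^sup>2 / cmod (w - z)"
        using key[of w] elim by (intro divide_right_mono) auto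
      also have "\<dots> = B * cmod (w - z)" using elim by (simp add: power2_eq_square)
      finally show ?case .
    qed
  qed
  then have "((\<lambda>w. (F w - F z) / (w - z)) \<longlongrightarrow> D) (at z)" by (rule LIM_zero_cancel)
  then show "((\<lambda>w. LINT t|lborel. g t * exp (c * t * w)) has_field_derivative
           (LINT t|lborel. g t * (c * t) * exp (c * t * z))) (at z)"
    by (simp add: has_field_derivative_iff F_def D_def)
qed

section \<open>Contour integrals over long rectangles\<close>

lemma contour_integral_linepath_same_Im:
  assumes ab: "a < b" and cont: "continuous_on {a..b} (\<lambda>x. f (Complex x s))"
  shows "contour_integral (linepath (Complex a s) (Complex b s)) f = (LINT x:{a..b}|lborel. f (Complex x s))"
proof -
  define g where "g x = f (Complex x s)" for x
  have lp: "linepath (Complex a s) (Complex b s) x = Complex (a + (b - a) * x) s" for x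
    by (simp add: linepath_def complex_eq_iff algebra_simps)
  have ci: "contour_integral (linepath p q) f = (q - p) * integral {0..1} (\<lambda>x. f (linepath p q x))" for p q
    by (simp add: contour_integral_integral)
  have "contour_integral (linepath (Complex a s) (Complex b s)) f
      = of_real (b - a) * integral {0..1} (\<lambda>x. g (a + (b - a) * x))"
    unfolding ci lp g_def by (simp add: complex_eq_iff)
  also have "integral {0..1} (\<lambda>x. g (a + (b - a) * x)) = (LINT x:{0..1}|lborel. g (a + (b - a) * x))"
  proof (rule set_borel_integral_eq_integral(2)[symmetric])
    have "continuous_on {0..1} (\<lambda>x. g (a + (b - a) * x))"
    proof (rule continuous_on_compose2[of "{a..b}" g])
      show "continuous_on {a..b} g" using cont by (simp add: g_def[abs_def])
      show "(\<lambda>x. a + (b - a) * x) ` {0..1} \<subseteq> {a..b}"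
        using ab by (auto intro!: mult_left_le simp: le_diff_eq[symmetric])
           (smt (verit, best) mult_left_le)
    qed (intro continuous_intros)
    then show "set_integrable lborel {0..1} (\<lambda>x. g (a + (b - a) * x))"
      by (rule borel_integrable_compact[OF compact_Icc, folded set_integrable_def])
  qed
  also have "of_real (b - a) * \<dots> = (LINT x:{a..b}|lborel. g x)"
  proof -
    have "(LINT x:{a..b}|lborel. g x) = \<bar>b - a\<bar> *\<^sub>R (LINT x|lborel. indicator {a..b} (a + (b - a) * x) *\<^sub>R g (a + (b - a) * x))"
      unfolding set_lebesgue_integral_def by (rule lborel_integral_real_affine) (use ab in simp)
    also have "(\<lambda>x. indicator {a..b} (a + (b - a) * x) *\<^sub>R g (a + (b - a) * x)) = (\<lambda>x. indicator {0..1} x *\<^sub>R g (a + (b - a) * x))"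
    proof
      fix x
      have "a + (b - a) * x \<in> {a..b} \<longleftrightarrow> x \<in> {0..1}"
      proof -
        have "a \<le> a + (b - a) * x \<longleftrightarrow> 0 \<le> x" using ab by (simp add: zero_le_mult_iff)
        moreover have "a + (b - a) * x \<le> b \<longleftrightarrow> (b - a) * x \<le> (b - a) * 1" by (auto simp: algebra_simps)
        moreover have "\<dots> \<longleftrightarrow> x \<le> 1" using ab by (intro mult_le_cancel_left_pos) simp
        ultimately show ?thesis by simp
      qed
      then show "indicator {a..b} (a + (b - a) * x) *\<^sub>R g (a + (b - a) * x) = indicator {0..1} x *\<^sub>R g (a + (b - a) * x)"
        by (simp add: indicator_def)
    qed
    finally show ?thesis using ab by (simp add: set_lebesgue_integral_def scaleR_conv_of_real)
  qed
  finally show ?thesis by (simp add: g_def)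
qed

lemma tendsto_truncated_integral:
  fixes f :: "real \<Rightarrow> complex"
  assumes f: "integrable lborel f"
  shows "(\<lambda>n. LINT x:{- real n..real n}|lborel. f x) \<longlonglongrightarrow> (LINT x|lborel. f x)"
proof -
  note [measurable] = borel_measurable_integrable[OF f, simplified]
  have lim: "(\<lambda>n. indicator {- real n..real n} x *\<^sub>R f x) \<longlonglongrightarrow> f x" for x
  proof (rule tendsto_eventually)
    obtain m where m: "\<bar>x\<bar> \<le> real m" using real_arch_simple by blast
    show "\<forall>\<^sub>F n in sequentially. indicator {- real n..real n} x *\<^sub>R f x = f x"
      using eventually_ge_at_top[of m] by eventually_elim (use m in \<open>auto simp: indicator_def\<close>)
  qed
  show ?thesis
    unfolding set_lebesgue_integral_def
    by (rule integral_dominated_convergence[where w = "\<lambda>x. cmod (f x)"])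
       (use f lim in \<open>auto simp: indicator_def\<close>)
qed

text \<open>The vertical sides are of order exp (- d n) and disappear in the limit. The value R is
  left open so that the same argument covers a pole at 0 and a holomorphic integrand; the horizontal
  sides avoid 0 in both cases.\<close>

lemma rectpath_limit:
  fixes f :: "complex \<Rightarrow> complex"
  assumes s: "s1 < s2" and d: "d > 0"
    and cont: "continuous_on ({z. Im z \<in> {s1..s2}} - {0}) f" and s0: "s1 \<noteq> 0" "s2 \<noteq> 0"
    and bd: "\<And>x y. 1 \<le> \<bar>x\<bar> \<Longrightarrow> y \<in> {s1..s2} \<Longrightarrow> cmod (f (Complex x y)) \<le> C * exp (- d * \<bar>x\<bar>)"
    and int: "integrable lborel (\<lambda>x. f (Complex x s1))" "integrable lborel (\<lambda>x. f (Complex x s2))"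
    and R: "\<And>n. n \<ge> 1 \<Longrightarrow> contour_integral (rectpath (Complex (- real n) s1) (Complex (real n) s2)) f = R"
  shows "(LINT x|lborel. f (Complex x s1)) - (LINT x|lborel. f (Complex x s2)) = R"
proof -
  have C: "0 \<le> C"
    using order_trans[OF norm_ge_zero bd[of 1 s1]] s by (simp add: zero_le_mult_iff)
  define V where "V x = contour_integral (linepath (Complex x s1) (Complex x s2)) f" for x
  have cint: "f contour_integrable_on linepath p q" if "closed_segment p q \<subseteq> {z. Im z \<in> {s1..s2}} - {0}" for p q
    by (intro contour_integrable_continuous_linepath continuous_on_subset[OF cont] that)
  have segv: "closed_segment (Complex x s1) (Complex x s2) = {z. Re z = x \<and> Im z \<in> {s1..s2}}" for x
    using s by (simp add: closed_segment_same_Re closed_segment_eq_real_ivl)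
  have segh: "closed_segment (Complex (- real n) y) (Complex (real n) y) = {z. Im z = y \<and> Re z \<in> {- real n..real n}}" for n y
    by (auto simp: closed_segment_same_Im closed_segment_eq_real_ivl)
  have segh': "closed_segment (Complex (real n) y) (Complex (- real n) y) = {z. Im z = y \<and> Re z \<in> {- real n..real n}}" for n y
    by (auto simp: closed_segment_same_Im closed_segment_eq_real_ivl)
  have segv': "closed_segment (Complex x s2) (Complex x s1) = {z. Re z = x \<and> Im z \<in> {s1..s2}}" for x
    using s by (simp add: closed_segment_same_Re closed_segment_eq_real_ivl)
  have v: "cmod (V x) \<le> C * exp (- d * \<bar>x\<bar>) * (s2 - s1)" if x: "1 \<le> \<bar>x\<bar>" for x
  proof -
    have "cmod (V x) \<le> C * exp (- d * \<bar>x\<bar>) * cmod (Complex x s2 - Complex x s1)"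
      unfolding V_def
    proof (rule contour_integral_bound_linepath)
      show "f contour_integrable_on linepath (Complex x s1) (Complex x s2)"
        by (rule cint) (use x in \<open>auto simp: segv\<close>)
      show "cmod (f w) \<le> C * exp (- d * \<bar>x\<bar>)" if "w \<in> closed_segment (Complex x s1) (Complex x s2)" for w
        using that bd[OF x, of "Im w"] by (auto simp: segv complex_eq_iff)
    qed (use C in simp)
    also have "Complex x s2 - Complex x s1 = \<i> * of_real (s2 - s1)" by (simp add: complex_eq_iff)
    also have "cmod \<dots> = s2 - s1" using s by (simp only: norm_mult norm_of_real) simp
    finally show ?thesis .
  qed
  have eq: "(LINT x:{- real n..real n}|lborel. f (Complex x s1)) + V (real n)
      - (LINT x:{- real n..real n}|lborel. f (Complex x s2)) - V (- real n) = R" if n: "n \<ge> 1" for n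
  proof -
    have h: "contour_integral (linepath (Complex (- real n) y) (Complex (real n) y)) f = (LINT x:{- real n..real n}|lborel. f (Complex x y))"
      and hi: "f contour_integrable_on linepath (Complex (- real n) y) (Complex (real n) y)"
        "f contour_integrable_on linepath (Complex (real n) y) (Complex (- real n) y)"
      if "y = s1 \<or> y = s2" for y
    proof -
      show "contour_integral (linepath (Complex (- real n) y) (Complex (real n) y)) f = (LINT x:{- real n..real n}|lborel. f (Complex x y))"
      proof (rule contour_integral_linepath_same_Im)
        show "continuous_on {- real n..real n} (\<lambda>x. f (Complex x y))"
          by (rule continuous_on_compose2[OF cont])
             (use that s s0 in \<open>auto intro!: continuous_intros simp: complex_eq_iff\<close>)
      qed (use n in simp)
      show "f contour_integrable_on linepath (Complex (- real n) y) (Complex (real n) y)"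
        "f contour_integrable_on linepath (Complex (real n) y) (Complex (- real n) y)"
        using that s s0 by (auto intro!: cint simp: segh segh')
    qed
    have vi: "f contour_integrable_on linepath (Complex x s1) (Complex x s2)" 
       "f contour_integrable_on linepath (Complex x s2) (Complex x s1)" if "x \<noteq> 0" for x
      by (auto intro!: cint simp: segv segv' that)
    have "R = contour_integral (rectpath (Complex (- real n) s1) (Complex (real n) s2)) f"
      using R[OF n] by simp
    also have "\<dots> = contour_integral (linepath (Complex (- real n) s1) (Complex (real n) s1)) f
       + (V (real n) + (contour_integral (linepath (Complex (real n) s2) (Complex (- real n) s2)) f
       + contour_integral (linepath (Complex (- real n) s2) (Complex (- real n) s1)) f))"
      using n hi vi by (simp add: rectpath_def V_def Let_def)
    also have "contour_integral (linepath (Complex (real n) s2) (Complex (- real n) s2)) f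
        = - contour_integral (linepath (Complex (- real n) s2) (Complex (real n) s2)) f"
      using contour_integral_reversepath[of "linepath (Complex (- real n) s2) (Complex (real n) s2)" f] by simp
    also have "contour_integral (linepath (Complex (- real n) s2) (Complex (- real n) s1)) f = - V (- real n)"
      using contour_integral_reversepath[of "linepath (Complex (- real n) s1) (Complex (- real n) s2)" f] by (simp add: V_def)
    finally show ?thesis by (simp add: h)
  qed
  have V0: "(\<lambda>n. V (\<sigma> * real n)) \<longlonglongrightarrow> 0" if "\<bar>\<sigma>\<bar> = 1" for \<sigma>
  proof (rule Lim_null_comparison)
    show "\<forall>\<^sub>F n in sequentially. cmod (V (\<sigma> * real n)) \<le> C * exp (- d * real n) * (s2 - s1)"
      using eventually_ge_at_top[of 1]
    proof eventually_elim
      case (elim n)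
      then show ?case using v[of "\<sigma> * real n"] that by (simp add: abs_mult)
    qed
    show "(\<lambda>n. C * exp (- d * real n) * (s2 - s1)) \<longlonglongrightarrow> 0"
      using d by real_asymp
  qed
  have "(\<lambda>n. (LINT x:{- real n..real n}|lborel. f (Complex x s1)) + V (1 * real n)
      - (LINT x:{- real n..real n}|lborel. f (Complex x s2)) - V (- 1 * real n))
      \<longlonglongrightarrow> (LINT x|lborel. f (Complex x s1)) + 0 - (LINT x|lborel. f (Complex x s2)) - 0"
    by (intro tendsto_intros tendsto_truncated_integral int V0) auto
  moreover have "(\<lambda>n. (LINT x:{- real n..real n}|lborel. f (Complex x s1)) + V (1 * real n)
      - (LINT x:{- real n..real n}|lborel. f (Complex x s2)) - V (- 1 * real n)) \<longlonglongrightarrow> R"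
    by (rule tendsto_eventually) (use eventually_ge_at_top[of 1] in eventually_elim, simp add: eq)
  ultimately show ?thesis using LIMSEQ_unique by fastforce
qed

lemma open_strip: "open {z. lo < Im z \<and> Im z < hi}"
  by (intro open_Collect_conj open_Collect_less continuous_intros)

lemma convex_strip: "convex {z. lo < Im z \<and> Im z < hi}"
proof -
  have "{z. lo < Im z \<and> Im z < hi} = {z. Im z > lo} \<inter> {z. Im z < hi}" by auto
  then show ?thesis by (simp add: convex_Int convex_halfspace_Im_gt convex_halfspace_Im_lt)
qed

lemma integrable_exp_bound:
  fixes f :: "real \<Rightarrow> complex"
  assumes "continuous_on UNIV f" "d > 0" "\<And>x. cmod (f x) \<le> C * exp (- d * \<bar>x\<bar>)"
  shows "integrable lborel f"
proof (rule Bochner_Integration.integrable_bound[OF integrable_mult_right[OF integrable_exp_minus_abs[OF assms(2)], of C]])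
  show "AE x in lborel. cmod (f x) \<le> norm (C * exp (- d * \<bar>x\<bar>))"
    using assms(3) by (intro AE_I2) (smt (verit) real_norm_def)
qed (use borel_measurable_continuous_onI[OF assms(1)] in simp)

lemma integral_strip_residue:
  fixes f :: "complex \<Rightarrow> complex"
  assumes s: "lo < s1" "s1 < 0" "0 < s2" "s2 < hi" and d: "d > 0"
    and holo: "f holomorphic_on {z. lo < Im z \<and> Im z < hi} - {0}"
    and bd: "\<And>x y. 1 \<le> \<bar>x\<bar> \<Longrightarrow> y \<in> {s1..s2} \<Longrightarrow> cmod (f (Complex x y)) \<le> C * exp (- d * \<bar>x\<bar>)"
    and int: "integrable lborel (\<lambda>x. f (Complex x s1))" "integrable lborel (\<lambda>x. f (Complex x s2))"
  shows "(LINT x|lborel. f (Complex x s1)) - (LINT x|lborel. f (Complex x s2)) = 2 * pi * \<i> * residue f 0"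
proof (rule rectpath_limit[OF _ d _ _ _ bd int])
  show "continuous_on ({z. Im z \<in> {s1..s2}} - {0}) f"
    by (rule continuous_on_subset[OF holomorphic_on_imp_continuous_on[OF holo]]) (use s in auto)
  fix n :: nat assume n: "1 \<le> n"
  let ?g = "rectpath (Complex (- real n) s1) (Complex (real n) s2)"
  have pim: "path_image ?g \<subseteq> cbox (Complex (- real n) s1) (Complex (real n) s2) - box (Complex (- real n) s1) (Complex (real n) s2)"
    using s by (subst path_image_rectpath_cbox_minus_box) auto
  have "contour_integral ?g f = 2 * pi * \<i> * (\<Sum>p\<in>{0}. winding_number ?g p * residue f p)"
  proof (rule Residue_theorem[OF open_strip[of lo hi] _ _ holo])
    show "connected {z. lo < Im z \<and> Im z < hi}" by (intro convex_connected convex_strip)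
    show "path_image ?g \<subseteq> {z. lo < Im z \<and> Im z < hi} - {0}"
      using pim s n by (auto simp: in_cbox_complex_iff in_box_complex_iff)
    show "\<forall>z. z \<notin> {z. lo < Im z \<and> Im z < hi} \<longrightarrow> winding_number ?g z = 0"
      using s n by (auto intro!: winding_number_rectpath_outside simp: in_cbox_complex_iff)
  qed auto
  moreover have "winding_number ?g 0 = 1"
    by (rule winding_number_rectpath) (use s n in \<open>auto simp: in_box_complex_iff\<close>)
  ultimately show "contour_integral ?g f = 2 * pi * \<i> * residue f 0" by simp
qed (use s in auto)

lemma integral_strip_shift:
  fixes f :: "complex \<Rightarrow> complex"
  assumes s: "lo < s1" "s1 \<le> s2" "s2 < hi" and d: "d > 0"
    and holo: "f holomorphic_on {z. lo < Im z \<and> Im z < hi}"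
    and bd: "\<And>x y. y \<in> {s1..s2} \<Longrightarrow> cmod (f (Complex x y)) \<le> C * exp (- d * \<bar>x\<bar>)"
  shows "(LINT x|lborel. f (Complex x s1)) = (LINT x|lborel. f (Complex x s2))"
proof (cases "s1 = s2")
  case False
  then have s12: "s1 < s2" using s by simp
  \<comment> \<open>The strip is translated so that its lower line has imaginary part 1, because
    \<open>rectpath_limit\<close> excludes lines through 0.\<close>
  define k where "k = 1 - s1"
  have k: "s1 + k \<noteq> 0" "s2 + k \<noteq> 0" using s12 by (auto simp: k_def)
  define g where "g z = f (z - \<i> * of_real k)" for z
  have gC: "g (Complex x (y + k)) = f (Complex x y)" for x y
    by (simp add: g_def complex_eq_iff Complex_eq algebra_simps)
  have gholo: "g holomorphic_on {z. lo + k < Im z \<and> Im z < hi + k}"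
    unfolding g_def by (rule holomorphic_on_compose_gen[OF _ holo, unfolded o_def]) (auto intro!: holomorphic_intros)
  have gbd: "cmod (g (Complex x y)) \<le> C * exp (- d * \<bar>x\<bar>)" if "y \<in> {s1 + k..s2 + k}" for x y
    using bd[of "y - k" x] gC[of x "y - k"] that by (simp add: algebra_simps)
  have gcont: "continuous_on {z. lo + k < Im z \<and> Im z < hi + k} g"
    by (rule holomorphic_on_imp_continuous_on[OF gholo])
  have int: "integrable lborel (\<lambda>x. g (Complex x y))" if "y \<in> {s1 + k..s2 + k}" for y
    by (rule integrable_exp_bound[OF _ d gbd[OF that]], rule continuous_on_compose2[OF gcont])
       (use that s in \<open>auto intro!: continuous_intros\<close>)
  have "(LINT x|lborel. g (Complex x (s1 + k))) - (LINT x|lborel. g (Complex x (s2 + k))) = 0"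
  proof (rule rectpath_limit[OF _ d _ k gbd int int])
    show "continuous_on ({z. Im z \<in> {s1 + k..s2 + k}} - {0}) g"
      by (rule continuous_on_subset[OF gcont]) (use s in auto)
    fix n :: nat assume n: "1 \<le> n"
    let ?g = "rectpath (Complex (- real n) (s1 + k)) (Complex (real n) (s2 + k))"
    have "path_image ?g \<subseteq> cbox (Complex (- real n) (s1 + k)) (Complex (real n) (s2 + k))"
      using s by (intro path_image_rectpath_subset_cbox) auto
    also have "\<dots> \<subseteq> {z. lo + k < Im z \<and> Im z < hi + k}"
      using s by (auto simp: in_cbox_complex_iff)
    finally show "contour_integral ?g g = 0"
      by (intro contour_integral_unique Cauchy_theorem_convex_simple[OF gholo convex_strip]) auto
  qed (use s12 in auto)
  then show ?thesis by (simp add: gC)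
qed simp

section \<open>Properties of the quantum dilogarithm\<close>

lemma sinh_Complex: "sinh (Complex u v) = Complex (sinh u * cos v) (cosh u * sin v)"
  by (simp add: sinh_def cosh_def complex_eq_iff Re_exp Im_exp field_simps)

lemma norm_sinh_power2: "(cmod (sinh w))\<^sup>2 = (sinh (Re w))\<^sup>2 + (sin (Im w))\<^sup>2"
proof -
  have "(cmod (sinh w))\<^sup>2 = (sinh (Re w))\<^sup>2 * (cos (Im w))\<^sup>2 + (cosh (Re w))\<^sup>2 * (sin (Im w))\<^sup>2"
    using sinh_Complex[of "Re w" "Im w"] by (simp add: cmod_def power_mult_distrib)
  also have "\<dots> = (sinh (Re w))\<^sup>2 * ((cos (Im w))\<^sup>2 + (sin (Im w))\<^sup>2) + (sin (Im w))\<^sup>2"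
    by (simp only: cosh_square_eq algebra_simps)
  finally show ?thesis by simp
qed

lemma norm_sinh_ge_sinh: "sinh \<bar>Re w\<bar> \<le> cmod (sinh w)"
proof (rule power2_le_imp_le)
  show "(sinh \<bar>Re w\<bar>)\<^sup>2 \<le> (cmod (sinh w))\<^sup>2"
    unfolding norm_sinh_power2 by (simp add: abs_if)
qed simp

lemma norm_sinh_ge_sin: "\<bar>sin (Im w)\<bar> \<le> cmod (sinh w)"
proof (rule power2_le_imp_le)
  show "\<bar>sin (Im w)\<bar>\<^sup>2 \<le> (cmod (sinh w))\<^sup>2"
    unfolding norm_sinh_power2 by simp
qed simp

lemma sinh_ge_exp:
  assumes "u0 \<le> u" "0 \<le> u0"
  shows "(1 - exp (- 2 * u0)) / 2 * exp u \<le> sinh (u :: real)"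
proof -
  have "exp (- u) \<le> exp (- 2 * u0) * exp u"
    using assms by (simp add: exp_add[symmetric])
  then show ?thesis by (simp add: sinh_def field_simps)
qed

lemma norm_sinh_ge_exp:
  assumes "u0 \<le> \<bar>Re w\<bar>" "0 \<le> u0"
  shows "(1 - exp (- 2 * u0)) / 2 * exp \<bar>Re w\<bar> \<le> cmod (sinh w)"
  using sinh_ge_exp[OF assms] norm_sinh_ge_sinh[of w] by linarith

lemma exp_minus_2_le: "exp (- 2) \<le> (1/2 :: real)"
proof -
  have "2 \<le> exp (1::real)" using exp_ge_add_one_self[of 1] by simp
  also have "\<dots> \<le> exp (2::real)" by simp
  finally show ?thesis by (simp add: exp_minus field_simps)
qed

text \<open>For |Re w| \<ge> 1 the exponential dominates; for |Re w| < 1 the sine alone suffices,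
  because exp 1 \<le> 4. A single bound thus holds along a whole horizontal line that avoids the
  zeros.\<close>

lemma norm_sinh_ge_sin_exp: "\<bar>sin (Im w)\<bar> / 4 * exp \<bar>Re w\<bar> \<le> cmod (sinh w)"
proof (cases "1 \<le> \<bar>Re w\<bar>")
  case True
  have "\<bar>sin (Im w)\<bar> / 4 * exp \<bar>Re w\<bar> \<le> (1 - exp (- 2 * 1)) / 2 * exp \<bar>Re w\<bar>"
  proof (rule mult_right_mono)
    have arith: "s / 4 \<le> (1 - E) / 2" if "E \<le> 1/2" "s \<le> 1" for E s :: real
      using that by (simp add: field_simps)
    have "exp (- 2 * 1) \<le> (1/2 :: real)" using exp_minus_2_le by simp
    then show "\<bar>sin (Im w)\<bar> / 4 \<le> (1 - exp (- 2 * 1)) / 2"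
      using abs_sin_le_one[of "Im w"] arith by blast
  qed simp
  also have "\<dots> \<le> cmod (sinh w)" by (rule norm_sinh_ge_exp[OF True]) simp
  finally show ?thesis .
next
  case False
  then have "exp \<bar>Re w\<bar> \<le> exp 1" by simp
  also have "exp 1 \<le> (4 :: real)" using e_less_272 by simp
  finally have "\<bar>sin (Im w)\<bar> / 4 * exp \<bar>Re w\<bar> \<le> \<bar>sin (Im w)\<bar> / 4 * 4"
    by (intro mult_left_mono) auto
  also have "\<dots> \<le> cmod (sinh w)" using norm_sinh_ge_sin[of w] by simp
  finally show ?thesis .
qed

lemma sinh_pi_mult_nonzero:
  assumes "c > 0" "\<bar>Im p\<bar> < 1 / c" "p \<noteq> 0"
  shows "sinh (of_real (pi * c) * p) \<noteq> 0"
proof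
  assume "sinh (of_real (pi * c) * p) = 0"
  then have "(sinh (pi * c * Re p))\<^sup>2 + (sin (pi * c * Im p))\<^sup>2 = 0"
    using norm_sinh_power2[of "of_real (pi * c) * p"] by simp
  then have z: "sinh (pi * c * Re p) = 0" "sin (pi * c * Im p) = 0"
    using zero_le_power2[of "sinh (pi * c * Re p)"] zero_le_power2[of "sin (pi * c * Im p)"]
    by (auto simp: add_nonneg_eq_0_iff)
  from z(1) assms(1) have "Re p = 0" by (simp add: sinh_real_zero_iff)
  moreover have "Im p = 0"
  proof -
    have "\<bar>pi * c * Im p\<bar> < pi"
      using assms by (simp add: abs_mult field_simps)
    then have "- pi < pi * c * Im p" "pi * c * Im p < pi" by linarith+
    from sin_eq_0_pi[OF this z(2)] have "pi * c * Im p = 0" .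
    then show ?thesis using assms by simp
  qed
  ultimately show False using assms(3) by (simp add: complex_eq_iff)
qed


lemma exp_eq_minus_one_iff:
  assumes "\<bar>Im w\<bar> < pi" shows "exp w \<noteq> - 1"
proof
  assume "exp w = - 1"
  then have "w = Ln (- 1)" using Ln_exp[of w] assms by simp
  then show False using assms by simp
qed

lemma integrable_real_exp_bound:
  fixes g :: "real \<Rightarrow> complex"
  assumes "g \<in> borel_measurable borel" "0 < d" "\<And>t. cmod (g t) \<le> C * exp (- d * \<bar>t\<bar>)"
  shows "integrable lborel g"
proof (rule Bochner_Integration.integrable_bound[OF integrable_mult_right[OF integrable_exp_minus_abs[OF assms(2)], of C]])
  show "AE x in lborel. cmod (g x) \<le> norm (C * exp (- d * \<bar>x\<bar>))"
    using assms(3) by (intro AE_I2) (smt (verit) real_norm_def)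
qed (use assms in simp)

lemma cmod_exp_line:
  "cmod (exp (- \<i> * Complex x y * z)) = exp (x * Im z + y * Re z)"
  by simp

lemma exp_line_le:
  assumes "\<bar>Im z\<bar> \<le> b"
  shows "exp (x * Im z + y * Re z) \<le> exp (y * Re z) * exp (b * \<bar>x\<bar>)"
proof -
  have "x * Im z \<le> \<bar>x\<bar> * b"
    using assms abs_le_D1[OF order_refl, of "x * Im z"] mult_left_mono[of "\<bar>Im z\<bar>" b "\<bar>x\<bar>"] by (simp add: abs_mult)
  then show ?thesis by (simp add: exp_add[symmetric] algebra_simps)
qed

lemma norm_inverse_sinh_le:
  assumes c: "c > 0" and "\<bar>sin (pi * c * y)\<bar> \<ge> s" "s > 0"
  shows "cmod (1 / sinh (of_real (pi * c) * Complex t y)) \<le> 4 / s * exp (- (pi * c) * \<bar>t\<bar>)"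
proof -
  have pc: "\<bar>pi * c * t\<bar> = pi * c * \<bar>t\<bar>" using c by (simp add: abs_mult)
  have "s / 4 * exp (pi * c * \<bar>t\<bar>) \<le> \<bar>sin (pi * c * y)\<bar> / 4 * exp \<bar>pi * c * t\<bar>"
    unfolding pc using assms by (intro mult_right_mono) auto
  also have "\<dots> \<le> cmod (sinh (of_real (pi * c) * Complex t y))"
    using norm_sinh_ge_sin_exp[of "of_real (pi * c) * Complex t y"] by simp
  finally have *: "s / 4 * exp (pi * c * \<bar>t\<bar>) \<le> cmod (sinh (of_real (pi * c) * Complex t y))" .
  have pos: "0 < s / 4 * exp (pi * c * \<bar>t\<bar>)" using assms by simp
  have "1 / cmod (sinh (of_real (pi * c) * Complex t y)) \<le> 1 / (s / 4 * exp (pi * c * \<bar>t\<bar>))"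
    by (rule divide_left_mono[OF * _ mult_pos_pos[OF less_le_trans[OF pos *] pos]]) simp
  also have "\<dots> = 4 / s * exp (- (pi * c) * \<bar>t\<bar>)"
    by (simp add: exp_minus field_simps)
  finally show ?thesis by (simp add: norm_divide)
qed

text \<open>All zeros lie on the imaginary axis, so at distance x0 from it the bound is uniform in
  y. It serves for vertical sides of contours, which pass the heights of poles.\<close>

lemma norm_inverse_sinh_far_le:
  assumes c: "c > 0" and x: "x0 \<le> \<bar>x\<bar>" "x0 > 0"
  shows "cmod (1 / sinh (of_real (pi * c) * Complex x y)) \<le> 2 / (1 - exp (- 2 * (pi * c * x0))) * exp (- (pi * c) * \<bar>x\<bar>)"
proof -
  define K where "K = 2 / (1 - exp (- 2 * (pi * c * x0)))"
  have absx: "\<bar>Re (of_real (pi * c) * Complex x y)\<bar> = pi * c * \<bar>x\<bar>" using c by (simp add: abs_mult)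
  have K0: "K > 0" using c x by (simp add: K_def)
  have "(1 - exp (- 2 * (pi * c * x0))) / 2 * exp (pi * c * \<bar>x\<bar>) \<le> cmod (sinh (of_real (pi * c) * Complex x y))"
    using norm_sinh_ge_exp[of "pi * c * x0" "of_real (pi * c) * Complex x y"] c x
    unfolding absx by (simp add: mult_left_mono)
  then have *: "1 / K * exp (pi * c * \<bar>x\<bar>) \<le> cmod (sinh (of_real (pi * c) * Complex x y))"
    by (simp add: K_def)
  have pos: "0 < 1 / K * exp (pi * c * \<bar>x\<bar>)" using K0 by simp
  have "1 / cmod (sinh (of_real (pi * c) * Complex x y)) \<le> 1 / (1 / K * exp (pi * c * \<bar>x\<bar>))"
    by (rule divide_left_mono[OF * _ mult_pos_pos[OF less_le_trans[OF pos *] pos]]) simp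
  also have "\<dots> = K * exp (- (pi * c) * \<bar>x\<bar>)" by (simp add: exp_minus field_simps)
  finally show ?thesis by (simp add: norm_divide K_def)
qed

text \<open>
  The functional equation comes from the integral \<open>line_integral\<close> below:  shifting the contour
  by \<open>1 / c\<close> multiplies \<open>exp (- \<i> * p * z) / sinh (pi * c * p)\<close> by \<open>- exp (- z / c)\<close>.
\<close>

context
  fixes c d :: real
  assumes c: "c > 0" and d: "0 < d" "d < 1 / c"
begin

definition line_integral :: "complex \<Rightarrow> complex" where
  "line_integral z = (LINT t|lborel. exp (- \<i> * Complex t d * z) / (sinh (of_real (pi * c) * Complex t d) * Complex t d))"

lemma sin_pos_line: "sin (pi * c * d) > 0"
  by (rule sin_gt_zero) (use c d in \<open>simp_all add: field_simps\<close>)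

lemma norm_line_integrand_le:
  assumes "\<bar>Im z\<bar> \<le> b"
  shows "cmod (exp (- \<i> * Complex t d * z) / (sinh (of_real (pi * c) * Complex t d) * Complex t d))
    \<le> 4 / (sin (pi * c * d) * d) * exp (d * Re z) * exp (- (pi * c - b) * \<bar>t\<bar>)"
proof -
  have "cmod (exp (- \<i> * Complex t d * z)) \<le> exp (d * Re z) * exp (b * \<bar>t\<bar>)"
    unfolding cmod_exp_line by (rule exp_line_le[OF assms])
  moreover have "cmod (1 / sinh (of_real (pi * c) * Complex t d)) \<le> 4 / sin (pi * c * d) * exp (- (pi * c) * \<bar>t\<bar>)"
    by (rule norm_inverse_sinh_le[OF c]) (use sin_pos_line in auto)
  moreover have "cmod (1 / Complex t d) \<le> 1 / d"
  proof -
    have "d \<le> cmod (Complex t d)" using d abs_Im_le_cmod[of "Complex t d"] by simp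
    from divide_left_mono[OF this, of 1] d(1) show ?thesis
      by (simp add: norm_divide complex_eq_iff)
  qed
  ultimately have "cmod (exp (- \<i> * Complex t d * z)) * (cmod (1 / sinh (of_real (pi * c) * Complex t d)) * cmod (1 / Complex t d))
     \<le> (exp (d * Re z) * exp (b * \<bar>t\<bar>)) * (4 / sin (pi * c * d) * exp (- (pi * c) * \<bar>t\<bar>) * (1 / d))"
    using sin_pos_line by (intro mult_mono) auto
  also have "\<dots> = 4 / (sin (pi * c * d) * d) * exp (d * Re z) * (exp (b * \<bar>t\<bar>) * exp (- (pi * c) * \<bar>t\<bar>))"
    by (simp add: mult_ac)
  also have "exp (b * \<bar>t\<bar>) * exp (- (pi * c) * \<bar>t\<bar>) = exp (- (pi * c - b) * \<bar>t\<bar>)"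
    by (simp add: exp_add[symmetric] algebra_simps)
  finally show ?thesis by (simp add: norm_mult norm_divide)
qed

definition line_kernel :: "real \<Rightarrow> complex" where
  "line_kernel t = 1 / (sinh (of_real (pi * c) * Complex t d) * Complex t d)"

lemma line_kernel_measurable [measurable]: "line_kernel \<in> borel_measurable borel"
  unfolding line_kernel_def Complex_eq sinh_def by measurable

lemma line_integrand_eq:
  fixes z :: complex
  shows "exp (- \<i> * Complex t d * z) / (sinh (of_real (pi * c) * Complex t d) * Complex t d)
    = exp (d * z) * (line_kernel t * exp (- \<i> * t * z))"
proof -
  have "- \<i> * Complex t d * z = d * z + (- \<i> * t * z)" by (simp add: Complex_eq algebra_simps)
  then show ?thesis unfolding line_kernel_def by (simp only: exp_add) simp
qed

lemma integrable_line_kernel: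
  assumes z: "\<bar>Im z\<bar> < pi * c"
  obtains e where "e > 0" "integrable lborel (\<lambda>t. cmod (line_kernel t) * exp (Re (- \<i> * t * z) + e * \<bar>t\<bar>))"
proof
  \<comment> \<open>Half of the gap between |Im z| and the critical rate is the margin for
    differentiation; the other half keeps the integral convergent.\<close>
  define e where "e = (pi * c - \<bar>Im z\<bar>) / 2"
  show e: "e > 0" using z by (simp add: e_def)
  define K where "K = 4 / (sin (pi * c * d) * d)"
  have K: "cmod (line_kernel t) \<le> K * exp (- (pi * c) * \<bar>t\<bar>)" for t
    using norm_line_integrand_le[of 0 0 t] by (simp add: line_kernel_def K_def)
  have "integrable lborel (\<lambda>t. of_real (cmod (line_kernel t) * exp (Re (- \<i> * t * z) + e * \<bar>t\<bar>)) :: complex)"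
  proof (rule integrable_real_exp_bound[OF _ e, of _ K])
    fix t :: real
    have "Re (- \<i> * t * z) \<le> \<bar>Im z\<bar> * \<bar>t\<bar>"
      using abs_le_D1[OF order_refl, of "t * Im z"] by (simp add: abs_mult mult.commute)
    then have "exp (Re (- \<i> * t * z) + e * \<bar>t\<bar>) \<le> exp (\<bar>Im z\<bar> * \<bar>t\<bar> + e * \<bar>t\<bar>)" by simp
    then have "cmod (line_kernel t) * exp (Re (- \<i> * t * z) + e * \<bar>t\<bar>)
       \<le> (K * exp (- (pi * c) * \<bar>t\<bar>)) * exp (\<bar>Im z\<bar> * \<bar>t\<bar> + e * \<bar>t\<bar>)"
      using K by (intro mult_mono) (auto intro: order_trans[OF norm_ge_zero])
    also have "\<dots> = K * exp (- e * \<bar>t\<bar>)"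
    proof -
      have "pi * c = \<bar>Im z\<bar> + 2 * e" by (simp add: e_def diff_divide_distrib)
      then have "- (pi * c) * \<bar>t\<bar> + (\<bar>Im z\<bar> * \<bar>t\<bar> + e * \<bar>t\<bar>) = - e * \<bar>t\<bar>"
        by (simp add: algebra_simps)
      then show ?thesis by (simp only: mult.assoc exp_add[symmetric])
    qed
    finally show "cmod (of_real (cmod (line_kernel t) * exp (Re (- \<i> * t * z) + e * \<bar>t\<bar>)) :: complex) \<le> K * exp (- e * \<bar>t\<bar>)"
      by (simp add: norm_mult)
  qed measurable
  then show "integrable lborel (\<lambda>t. cmod (line_kernel t) * exp (Re (- \<i> * t * z) + e * \<bar>t\<bar>))"
    by (simp only: complex_of_real_integrable_eq)
qed

lemma line_integral_eq:
  fixes z :: complex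
  shows "line_integral z = exp (d * z) * (LINT t|lborel. line_kernel t * exp (- \<i> * t * z))"
  unfolding line_integral_def line_integrand_eq by (rule integral_mult_right_zero)

text \<open>Differentiation brings down - i p, which cancels the factor 1 / p of the kernel. With p
  = t + i d, the factor exp (d z) in front contributes d and the integral - i t, which add up to - i
  p.\<close>

lemma line_integral_has_derivative:
  assumes z: "\<bar>Im z\<bar> < pi * c"
  shows "(line_integral has_field_derivative
     - \<i> * (LINT t|lborel. exp (- \<i> * Complex t d * z) / sinh (of_real (pi * c) * Complex t d))) (at z)"
proof -
  obtain e where e: "e > 0" "integrable lborel (\<lambda>t. cmod (line_kernel t) * exp (Re (- \<i> * t * z) + e * \<bar>t\<bar>))"
    using integrable_line_kernel[OF z] by blast
  note der = integral_exp_has_derivative[OF line_kernel_measurable e]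
  define H where "H = (LINT t|lborel. exp (- \<i> * Complex t d * z) / sinh (of_real (pi * c) * Complex t d))"
  define F where "F w = (LINT t|lborel. line_kernel t * exp (- \<i> * t * w))" for w
  define F' where "F' = (LINT t|lborel. line_kernel t * (- \<i> * t) * exp (- \<i> * t * z))"
  have F: "(F has_field_derivative F') (at z)"
    using der(1) by (simp add: F_def[abs_def] F'_def)
  have "exp (d * z) * F' = - \<i> * H - d * (exp (d * z) * F z)"
  proof -
    have "- \<i> * H = (LINT t|lborel. - \<i> * (exp (- \<i> * Complex t d * z) / sinh (of_real (pi * c) * Complex t d)))"
      unfolding H_def by (rule integral_mult_right_zero[symmetric])
    also have "\<dots> = (LINT t|lborel. exp (d * z) * (d * (line_kernel t * exp (- \<i> * t * z)) + line_kernel t * (- \<i> * t) * exp (- \<i> * t * z)))"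
    proof (intro Bochner_Integration.integral_cong refl)
      fix t :: real
      have p: "Complex t d \<noteq> 0" "- \<i> * Complex t d = d + (- \<i> * t)"
        using d by (simp_all add: complex_eq_iff)
      have "- \<i> * (exp (- \<i> * Complex t d * z) / sinh (of_real (pi * c) * Complex t d))
         = (- \<i> * Complex t d) * (exp (- \<i> * Complex t d * z) / (sinh (of_real (pi * c) * Complex t d) * Complex t d))"
        using p(1) by simp
      also have "\<dots> = (- \<i> * Complex t d) * (exp (d * z) * (line_kernel t * exp (- \<i> * t * z)))"
        by (simp only: line_integrand_eq)
      also have "\<dots> = (d + (- \<i> * t)) * (exp (d * z) * (line_kernel t * exp (- \<i> * t * z)))"
        by (simp only: p(2))
      finally show "- \<i> * (exp (- \<i> * Complex t d * z) / sinh (of_real (pi * c) * Complex t d))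
         = exp (d * z) * (d * (line_kernel t * exp (- \<i> * t * z)) + line_kernel t * (- \<i> * t) * exp (- \<i> * t * z))"
        by (simp add: algebra_simps)
    qed
    also have "\<dots> = exp (d * z) * (d * F z + F')"
      unfolding F_def F'_def
      by (subst integral_mult_right_zero, subst Bochner_Integration.integral_add)
         (use der(2,3) in \<open>simp_all add: integrable_mult_right\<close>)
    finally have "- \<i> * H = exp (d * z) * (d * F z + F')" .
    then show ?thesis by (simp add: algebra_simps)
  qed
  then have "((\<lambda>w. exp (d * w) * F w) has_field_derivative - \<i> * H) (at z)"
    by (auto intro!: derivative_eq_intros F simp: algebra_simps)
  then show ?thesis by (simp add: line_integral_eq[abs_def] F_def[abs_def] H_def)
qed

text \<open>Between the lines Im p = d - 1 / c and Im p = d the only pole is 0, with residue 1 / (pi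
  c). As the integral over the lower line is a multiple of the original one, the residue theorem
  becomes a linear equation for it.\<close>

lemma integral_exp_div_sinh:
  assumes z: "\<bar>Im z\<bar> < pi * c"
  shows "(1 + exp (- z / c)) * (LINT t|lborel. exp (- \<i> * Complex t d * z) / sinh (of_real (pi * c) * Complex t d))
    = - 2 * \<i> / c"
proof -
  define f where "f p = exp (- \<i> * p * z) / sinh (of_real (pi * c) * p)" for p
  define H where "H = (LINT t|lborel. f (Complex t d))"
  define b where "b = \<bar>Im z\<bar>"
  have b: "b < pi * c" using z by (simp add: b_def)
  have holo_sinh: "(\<lambda>p. sinh (of_real (pi * c) * p)) holomorphic_on S" for S
    unfolding sinh_def scaleR_conv_of_real by (intro holomorphic_intros)
  have fexp: "cmod (f (Complex x y)) \<le> exp (\<bar>Re z\<bar> / c) * exp (b * \<bar>x\<bar>) * (K * exp (- (pi * c) * \<bar>x\<bar>))"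
    if K: "cmod (1 / sinh (of_real (pi * c) * Complex x y)) \<le> K * exp (- (pi * c) * \<bar>x\<bar>)" and y: "\<bar>y\<bar> \<le> 1 / c" for x y K
  proof -
    have "y * Re z \<le> 1 / c * \<bar>Re z\<bar>"
      using mult_right_mono[OF y, of "\<bar>Re z\<bar>"] abs_le_D1[OF order_refl, of "y * Re z"] by (simp add: abs_mult)
    then have "exp (y * Re z) \<le> exp (\<bar>Re z\<bar> / c)" by simp
    then have 1: "cmod (exp (- \<i> * Complex x y * z)) \<le> exp (\<bar>Re z\<bar> / c) * exp (b * \<bar>x\<bar>)"
      unfolding cmod_exp_line
      by (rule order_trans[OF exp_line_le[of z b] mult_right_mono, rotated]) (simp_all add: b_def)
    have "cmod (f (Complex x y)) = cmod (exp (- \<i> * Complex x y * z)) * cmod (1 / sinh (of_real (pi * c) * Complex x y))"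
      by (simp add: f_def norm_divide)
    also have "\<dots> \<le> exp (\<bar>Re z\<bar> / c) * exp (b * \<bar>x\<bar>) * (K * exp (- (pi * c) * \<bar>x\<bar>))"
      by (intro mult_mono 1 K) auto
    finally show ?thesis .
  qed
  have exps: "exp (\<bar>Re z\<bar> / c) * exp (b * \<bar>x\<bar>) * (K * exp (- (pi * c) * \<bar>x\<bar>)) = exp (\<bar>Re z\<bar> / c) * K * exp (- (pi * c - b) * \<bar>x\<bar>)" for K x
    by (simp add: exp_add[symmetric] algebra_simps)
  have int: "integrable lborel (\<lambda>x. f (Complex x y))" if y: "\<bar>y\<bar> \<le> 1 / c" "\<bar>sin (pi * c * y)\<bar> > 0" for y
  proof (rule integrable_real_exp_bound)
    show "(\<lambda>x. f (Complex x y)) \<in> borel_measurable borel"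
      unfolding f_def Complex_eq sinh_def by measurable
    show "cmod (f (Complex x y)) \<le> exp (\<bar>Re z\<bar> / c) * (4 / \<bar>sin (pi * c * y)\<bar>) * exp (- (pi * c - b) * \<bar>x\<bar>)" for x
      using fexp[OF norm_inverse_sinh_le[OF c order_refl y(2)] y(1)] unfolding exps .
  qed (use b in simp)
  \<comment> \<open>The two heights differ by half a period of the sine, so the same lower bound for
    sinh holds on both lines.\<close>
  have sind: "sin (pi * c * (d - 1 / c)) = - sin (pi * c * d)"
  proof -
    have "pi * c * (d - 1 / c) = pi * c * d - pi" using c by (simp add: algebra_simps)
    then show ?thesis by (simp add: sin_diff)
  qed
  have absd: "\<bar>d - 1 / c\<bar> \<le> 1 / c" "\<bar>d\<bar> \<le> 1 / c" using d by auto
  define K where "K = 2 / (1 - exp (- 2 * (pi * c)))"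
  have "(LINT t|lborel. f (Complex t (d - 1 / c))) - (LINT t|lborel. f (Complex t d)) = 2 * pi * \<i> * residue f 0"
  proof (rule integral_strip_residue[where lo = "- 1 / c" and hi = "1 / c"])
    show "f holomorphic_on {z. - 1 / c < Im z \<and> Im z < 1 / c} - {0}"
      unfolding f_def
      by (intro holomorphic_intros holo_sinh) (use sinh_pi_mult_nonzero[OF c] in \<open>auto simp: abs_less_iff minus_less_iff\<close>)
    show "0 < pi * c - b" using b by simp
    show "cmod (f (Complex x y)) \<le> exp (\<bar>Re z\<bar> / c) * K * exp (- (pi * c - b) * \<bar>x\<bar>)" if x: "1 \<le> \<bar>x\<bar>" and y: "y \<in> {d - 1 / c..d}" for x y
    proof -
      have "cmod (1 / sinh (of_real (pi * c) * Complex x y)) \<le> K * exp (- (pi * c) * \<bar>x\<bar>)"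
        using norm_inverse_sinh_far_le[OF c x] by (simp add: K_def)
      moreover have "\<bar>y\<bar> \<le> 1 / c" using y d by auto
      ultimately show ?thesis unfolding exps[symmetric] by (rule fexp)
    qed
  qed (use c d int[OF absd(1)] int[OF absd(2)] sind sin_pos_line in auto)
  moreover have "residue f 0 = 1 / (pi * c)"
  proof -
    have "residue f 0 = exp (- \<i> * 0 * z) / of_real (pi * c)"
      unfolding f_def
    proof (rule residue_simple_pole_deriv[where s = UNIV])
      show "((\<lambda>p. sinh (of_real (pi * c) * p)) has_field_derivative of_real (pi * c)) (at 0)"
        by (auto intro!: derivative_eq_intros)
    qed (use c holo_sinh[of UNIV] in \<open>auto intro!: holomorphic_intros\<close>)
    then show ?thesis by simp
  qed
  moreover have "(LINT t|lborel. f (Complex t (d - 1 / c))) = - exp (- z / c) * H"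
  proof -
    have "f (Complex t (d - 1 / c)) = - exp (- z / c) * f (Complex t d)" for t
    proof -
      have p: "Complex t (d - 1 / c) = Complex t d - \<i> / c" by (simp add: complex_eq_iff)
      have "- \<i> * Complex t (d - 1 / c) * z = - z / c + (- \<i> * Complex t d * z)"
        unfolding p by (simp add: algebra_simps)
      moreover have "sinh (of_real (pi * c) * Complex t (d - 1 / c)) = - sinh (of_real (pi * c) * Complex t d)"
      proof -
        have "of_real (pi * c) * Complex t (d - 1 / c) = of_real (pi * c) * Complex t d - \<i> * of_real pi"
          unfolding p using c by (simp add: algebra_simps)
        moreover have "sinh (X - \<i> * of_real pi) = - sinh X" for X :: complex
        proof -
          have 1: "exp (X - \<i> * of_real pi) = - exp X" by (simp add: exp_diff)
          have "exp (- (X - \<i> * of_real pi)) = exp (- X + \<i> * of_real pi)" by simp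
          also have "\<dots> = - exp (- X)" by (simp only: exp_add) simp
          finally have 2: "exp (- (X - \<i> * of_real pi)) = - exp (- X)" .
          show ?thesis unfolding sinh_def 1 2 by (simp flip: scaleR_minus_right)
        qed
        ultimately show ?thesis by simp
      qed
      ultimately show ?thesis unfolding f_def by (simp only: exp_add) simp
    qed
    then show ?thesis unfolding H_def by (simp only: integral_mult_right_zero)
  qed
  ultimately have "- exp (- z / c) * H - H = 2 * pi * \<i> * (1 / (pi * c))" by (simp add: H_def)
  moreover have "(1 + exp (- z / c)) * H = - (- exp (- z / c) * H - H)" by (simp add: algebra_simps)
  ultimately have "(1 + exp (- z / c)) * H = - (2 * pi * \<i> * (1 / (pi * c)))" by (simp only:)
  then have "(1 + exp (- z / c)) * H = - 2 * \<i> / c" by simp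
  then show ?thesis by (simp add: H_def f_def)
qed

lemma norm_line_integral_le:
  assumes "\<bar>Im z\<bar> \<le> b" "b < pi * c"
  shows "cmod (line_integral z) \<le> 4 / (sin (pi * c * d) * d) * (LINT t|lborel. exp (- (pi * c - b) * \<bar>t\<bar>)) * exp (d * Re z)"
proof -
  have "cmod (line_integral z) \<le> (LINT t|lborel. 4 / (sin (pi * c * d) * d) * exp (d * Re z) * exp (- (pi * c - b) * \<bar>t\<bar>))"
    unfolding line_integral_def
  proof (rule Bochner_Integration.integral_norm_bound_integral[OF _ _ norm_line_integrand_le[OF assms(1)]])
    show i: "integrable lborel (\<lambda>t. 4 / (sin (pi * c * d) * d) * exp (d * Re z) * exp (- (pi * c - b) * \<bar>t\<bar>))"
      by (intro integrable_mult_right integrable_exp_minus_abs) (use assms in simp)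
    show "integrable lborel (\<lambda>t. exp (- \<i> * Complex t d * z) / (sinh (of_real (pi * c) * Complex t d) * Complex t d))"
      by (rule integrable_real_exp_bound[OF _ _ norm_line_integrand_le[OF assms(1)]])
         (use assms in \<open>simp_all add: Complex_eq sinh_def\<close>)
  qed
  then show ?thesis by (simp add: mult_ac)
qed

text \<open>The quotient of the two sides has derivative zero on the strip; working with the
  quotient avoids a choice of logarithm. Far to the left on the real axis both sides tend to 1,
  which fixes the constant.\<close>

lemma exp_line_integral:
  assumes z: "\<bar>Im z\<bar> < pi * c"
  shows "exp (- (line_integral z / 2)) = 1 + exp (z / c)"
proof -
  define S where "S = {z. - (pi * c) < Im z \<and> Im z < pi * c}"
  have S: "z \<in> S \<longleftrightarrow> \<bar>Im z\<bar> < pi * c" for z by (auto simp: S_def)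
  have nz: "1 + exp (w / c) \<noteq> 0" if "w \<in> S" for w
  proof -
    have "\<bar>Im (w / c)\<bar> < pi" using that c by (simp add: S field_simps)
    from exp_eq_minus_one_iff[OF this] show ?thesis by (metis add_eq_0_iff)
  qed
  define E where "E w = exp (- (line_integral w / 2)) / (1 + exp (w / c))" for w
  have "(E has_field_derivative 0) (at w)" if w: "w \<in> S" for w
  proof -
    define H where "H = (LINT t|lborel. exp (- \<i> * Complex t d * w) / sinh (of_real (pi * c) * Complex t d))"
    have L: "(line_integral has_field_derivative - \<i> * H) (at w)"
      using line_integral_has_derivative[of w] w by (simp add: S H_def)
    have H: "(1 + exp (- w / c)) * H = - 2 * \<i> / c"
      using integral_exp_div_sinh[of w] w by (simp add: S H_def)
    have "exp (w / c) * ((1 + exp (- w / c)) * H) = (1 + exp (w / c)) * H"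
      by (simp add: algebra_simps exp_minus)
    then have "(1 + exp (w / c)) * H = - 2 * \<i> / c * exp (w / c)" unfolding H by (simp add: mult.commute)
    then have "\<i> * ((1 + exp (w / c)) * H) = \<i> * (- 2 * \<i> / c * exp (w / c))" by (rule arg_cong)
    also have "\<dots> = 2 * (exp (w / c) / c)" by (auto simp: complex_eq_iff)
    finally have H2: "\<i> * H * (1 + exp (w / c)) = 2 * (exp (w / c) / c)"
      by (simp only: mult_ac)
    have "(E has_field_derivative
       (exp (- (line_integral w / 2)) * (- ((- \<i> * H) / 2)) * (1 + exp (w / c)) - exp (- (line_integral w / 2)) * (exp (w / c) * (1 / c)))
        / ((1 + exp (w / c)) * (1 + exp (w / c)))) (at w)"
      unfolding E_def
    proof (rule DERIV_divide)
      show "((\<lambda>w. exp (- (line_integral w / 2))) has_field_derivative exp (- (line_integral w / 2)) * (- ((- \<i> * H) / 2))) (at w)"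
        by (intro DERIV_fun_exp DERIV_minus DERIV_cdivide L)
      show "((\<lambda>w. 1 + exp (w / c)) has_field_derivative exp (w / c) * (1 / c)) (at w)"
        using c by (auto intro!: derivative_eq_intros)
    qed (rule nz[OF w])
    moreover have "exp (- (line_integral w / 2)) * (- ((- \<i> * H) / 2)) * (1 + exp (w / c)) - exp (- (line_integral w / 2)) * (exp (w / c) * (1 / c))
      = exp (- (line_integral w / 2)) * (\<i> * H * (1 + exp (w / c)) / 2 - exp (w / c) / c)"
      by (simp add: algebra_simps)
    ultimately show ?thesis unfolding H2 by simp
  qed
  then obtain e where e: "\<And>w. w \<in> S \<Longrightarrow> E w = e"
    using has_field_derivative_zero_constant[of S E] convex_strip[of "- (pi * c)" "pi * c"]
    unfolding S_def by (metis (no_types, lifting) has_field_derivative_at_within)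
  have real: "of_real x \<in> S" for x using c by (simp add: S)
  have "(\<lambda>n. line_integral (of_real (- real n))) \<longlonglongrightarrow> 0"
  proof (rule Lim_null_comparison[OF always_eventually])
    define A where "A = 4 / (sin (pi * c * d) * d) * (LINT t|lborel. exp (- (pi * c - 0) * \<bar>t\<bar>))"
    show "\<forall>n. cmod (line_integral (of_real (- real n))) \<le> A * exp (d * (- real n))"
      using norm_line_integral_le[of "of_real (- real n)" 0 for n] c by (simp add: A_def)
    show "(\<lambda>n. A * exp (d * (- real n))) \<longlonglongrightarrow> 0" using d(1) by real_asymp
  qed
  moreover have "(\<lambda>n. exp (of_real (- real n) / of_real c) :: complex) \<longlonglongrightarrow> 0"
  proof -
    have "(\<lambda>n. exp (- real n / c)) \<longlonglongrightarrow> 0" using c by real_asymp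
    from tendsto_of_real[OF this, where 'a = complex] show ?thesis by (simp flip: exp_of_real)
  qed
  ultimately have "(\<lambda>n. E (of_real (- real n))) \<longlonglongrightarrow> exp (- (0 / 2)) / (1 + 0)"
    unfolding E_def by (intro tendsto_intros) auto
  then have "e = 1" unfolding e[OF real] by (simp add: LIMSEQ_const_iff)
  then have "E z = 1" using e[of z] z by (simp add: S)
  then show ?thesis using nz[of z] z by (simp add: S E_def)
qed

end

section \<open>Estimates of the integrand and change of contour\<close>

lemma qdilog_integrand_split:
  "qdilog_integrand h z p = exp (- \<i> * p * z) * (1 / sinh (of_real (pi * 1) * p)) * (1 / sinh (of_real (pi * h) * p)) * (1 / p)"
  by (simp add: qdilog_integrand_def)

lemma norm_qdilog_integrand_le:
  assumes "cmod (1 / sinh (of_real (pi * 1) * Complex x y)) \<le> K1 * exp (- (pi * 1) * \<bar>x\<bar>)"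
    and "cmod (1 / sinh (of_real (pi * h) * Complex x y)) \<le> K2 * exp (- (pi * h) * \<bar>x\<bar>)"
    and "0 < \<rho>" "\<rho> \<le> cmod (Complex x y)" and z: "\<bar>Im z\<bar> \<le> b"
  shows "cmod (qdilog_integrand h z (Complex x y)) \<le> exp (y * Re z) * (K1 * K2 / \<rho>) * exp (- (pi * (1 + h) - b) * \<bar>x\<bar>)"
proof -
  have K: "0 \<le> K1 * exp (- (pi * 1) * \<bar>x\<bar>)" "0 \<le> K2 * exp (- (pi * h) * \<bar>x\<bar>)"
    using assms(1,2) norm_ge_zero order_trans by blast+
  then have K': "0 \<le> K1" "0 \<le> K2" by (simp_all add: zero_le_mult_iff)
  have 1: "cmod (1 / Complex x y) \<le> 1 / \<rho>"
    using assms(3,4) by (simp add: norm_divide frac_le)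
  have 2: "cmod (exp (- \<i> * Complex x y * z)) \<le> exp (y * Re z) * exp (b * \<bar>x\<bar>)"
    unfolding cmod_exp_line by (rule exp_line_le[OF z])
  have "cmod (qdilog_integrand h z (Complex x y))
     \<le> (exp (y * Re z) * exp (b * \<bar>x\<bar>)) * (K1 * exp (- (pi * 1) * \<bar>x\<bar>)) * (K2 * exp (- (pi * h) * \<bar>x\<bar>)) * (1 / \<rho>)"
    unfolding qdilog_integrand_split norm_mult using K' assms(1,2)
    by (intro mult_mono 1 2 mult_nonneg_nonneg) auto
  also have "\<dots> = exp (y * Re z) * (K1 * K2 / \<rho>) * (exp (b * \<bar>x\<bar>) * exp (- (pi * 1) * \<bar>x\<bar>) * exp (- (pi * h) * \<bar>x\<bar>))"
    by (simp add: mult_ac)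
  also have "exp (b * \<bar>x\<bar>) * exp (- (pi * 1) * \<bar>x\<bar>) * exp (- (pi * h) * \<bar>x\<bar>) = exp (- (pi * (1 + h) - b) * \<bar>x\<bar>)"
    by (simp only: exp_add[symmetric]) (simp add: algebra_simps)
  finally show ?thesis .
qed

lemma measurable_qdilog_integrand_line [measurable]:
  "(\<lambda>x. qdilog_integrand h z (Complex x y)) \<in> borel_measurable borel"
  unfolding qdilog_integrand_def Complex_eq sinh_def by measurable

context
  fixes h :: real
  assumes h: "h > 0"
begin

lemma qdilog_integrand_far:
  assumes x: "x0 \<le> \<bar>x\<bar>" "0 < x0" and z: "\<bar>Im z\<bar> \<le> b"
  shows "cmod (qdilog_integrand h z (Complex x y)) \<le>
    exp (y * Re z) * (2 / (1 - exp (- 2 * (pi * 1 * x0))) * (2 / (1 - exp (- 2 * (pi * h * x0)))) / x0) * exp (- (pi * (1 + h) - b) * \<bar>x\<bar>)"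
proof (rule norm_qdilog_integrand_le[OF _ _ x(2) _ z])
  show "x0 \<le> cmod (Complex x y)"
    using abs_Re_le_cmod[of "Complex x y"] x by simp
qed (rule norm_inverse_sinh_far_le[OF _ x], use h in simp)+

lemma sin_line_pos:
  assumes "0 < \<bar>y\<bar>" "\<bar>y\<bar> < min 1 (1 / h)"
  shows "\<bar>sin (pi * 1 * y)\<bar> > 0" "\<bar>sin (pi * h * y)\<bar> > 0"
proof -
  have *: "sin (pi * c * y) \<noteq> 0" if c: "c > 0" "\<bar>y\<bar> < 1 / c" for c
  proof
    assume s: "sin (pi * c * y) = 0"
    have "\<bar>pi * c * y\<bar> < pi" using c by (simp add: abs_mult field_simps)
    then have "- pi < pi * c * y" "pi * c * y < pi" by linarith+
    from sin_eq_0_pi[OF this s] show False using c assms(1) by simp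
  qed
  show "\<bar>sin (pi * 1 * y)\<bar> > 0" "\<bar>sin (pi * h * y)\<bar> > 0"
    using *[of 1] *[of h] assms h by auto
qed

lemma qdilog_integrand_line:
  assumes y: "0 < \<bar>y\<bar>" "\<bar>y\<bar> < min 1 (1 / h)" and z: "\<bar>Im z\<bar> \<le> b"
  shows "cmod (qdilog_integrand h z (Complex x y)) \<le>
    exp (y * Re z) * (4 / \<bar>sin (pi * 1 * y)\<bar> * (4 / \<bar>sin (pi * h * y)\<bar>) / \<bar>y\<bar>) * exp (- (pi * (1 + h) - b) * \<bar>x\<bar>)"
proof (rule norm_qdilog_integrand_le[OF _ _ y(1) _ z])
  show "\<bar>y\<bar> \<le> cmod (Complex x y)" using abs_Im_le_cmod[of "Complex x y"] by simp
qed (rule norm_inverse_sinh_le[OF zero_less_one order_refl sin_line_pos(1)[OF y]]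
       norm_inverse_sinh_le[OF h order_refl sin_line_pos(2)[OF y]])+

lemma integrable_qdilog_line:
  assumes "0 < \<bar>y\<bar>" "\<bar>y\<bar> < min 1 (1 / h)" and z: "\<bar>Im z\<bar> < pi * (1 + h)"
  shows "integrable lborel (\<lambda>x. qdilog_integrand h z (Complex x y))"
  by (rule integrable_real_exp_bound[OF _ _ qdilog_integrand_line[OF assms(1,2) order_refl]]) (use z in auto)

lemma qdilog_integrand_holomorphic:
  "qdilog_integrand h z holomorphic_on {p. \<bar>Im p\<bar> < min 1 (1 / h)} - {0}"
proof -
  have holo_sinh: "(\<lambda>p. sinh (of_real (pi * c) * p)) holomorphic_on S" for c S
    unfolding sinh_def scaleR_conv_of_real by (intro holomorphic_intros)
  show ?thesis
    unfolding qdilog_integrand_split[abs_def]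
    by (intro holomorphic_intros holo_sinh sinh_pi_mult_nonzero) (use h in auto)
qed

text \<open>
  Both contours lie in the strip with the negative imaginary half-axis removed, which is starlike,
  so that the integrand has a primitive there.
\<close>

lemma qdilog_integral_eq_line:
  assumes d: "0 < d" "d < min 1 (1 / h)" and z: "\<bar>Im z\<bar> < pi * (1 + h)"
  shows "qdilog_integral h z = (LINT x|lborel. qdilog_integrand h z (Complex x d))"
proof -
  define m where "m = min 1 (1 / h)"
  define r where "r = bypass_radius h"
  have m: "m > 0" using h by (simp add: m_def)
  have "r = m / 2" by (simp add: r_def bypass_radius_def m_def)
  then have r: "0 < r" "r < m" using m by simp_all
  define f where "f = qdilog_integrand h z"
  define S where "S = {p. \<bar>Im p\<bar> < m} - {p. Re p = 0 \<and> Im p \<le> 0}"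
  define b where "b = \<bar>Im z\<bar>"
  have b: "b < pi * (1 + h)" using z by (simp add: b_def)
  have "open {p. \<bar>Im p\<bar> < m}" by (intro open_Collect_less continuous_intros)
  moreover have "closed {p. Re p = 0 \<and> Im p \<le> 0}"
    by (intro closed_Collect_conj closed_Collect_eq closed_Collect_le continuous_intros)
  ultimately have openS: "open S" unfolding S_def by (rule open_Diff)
  have holo: "f holomorphic_on S"
    unfolding f_def by (rule holomorphic_on_subset[OF qdilog_integrand_holomorphic]) (auto simp: S_def m_def)
  have "starlike S"
    unfolding starlike_def
  proof (intro bexI ballI)
    show "\<i> * of_real r \<in> S" using r by (simp add: S_def)
    fix p assume p: "p \<in> S"
    show "closed_segment (\<i> * of_real r) p \<subseteq> S"
    proof
      fix q assume "q \<in> closed_segment (\<i> * of_real r) p"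
      then obtain u where u: "0 \<le> u" "u \<le> 1" and q: "q = (1 - u) *\<^sub>R (\<i> * of_real r) + u *\<^sub>R p"
        by (auto simp: in_segment)
      have Re: "Re q = u * Re p" and Im: "Im q = (1 - u) * r + u * Im p" by (simp_all add: q)
      have "\<bar>Im q\<bar> \<le> (1 - u) * r + u * \<bar>Im p\<bar>"
        unfolding Im using u r by (intro order_trans[OF abs_triangle_ineq]) (simp add: abs_mult)
      also have "\<dots> < m"
      proof (cases "u = 0")
        case False
        then have "u * \<bar>Im p\<bar> < u * m" using p u by (intro mult_strict_left_mono) (auto simp: S_def)
        moreover have "(1 - u) * r \<le> (1 - u) * m" using u r by (intro mult_left_mono) auto
        ultimately have "(1 - u) * r + u * \<bar>Im p\<bar> < (1 - u) * m + u * m" by linarith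
        then show ?thesis by (simp add: algebra_simps)
      qed (use r in simp)
      finally have 1: "\<bar>Im q\<bar> < m" .
      moreover have "\<not> (Re q = 0 \<and> Im q \<le> 0)"
      proof
        assume *: "Re q = 0 \<and> Im q \<le> 0"
        show False
        proof (cases "u = 0")
          case True
          then show ?thesis using * Im r by simp
        next
          case False
          then have "Re p = 0" using * Re by simp
          then have "Im p > 0" using p by (auto simp: S_def)
          then have "u * Im p > 0" using False u by simp
          moreover have "(1 - u) * r \<ge> 0" using u r by simp
          ultimately show False using * Im by linarith
        qed
      qed
      ultimately show "q \<in> S" by (simp add: S_def)
    qed
  qed
  then have "\<exists>g. \<forall>p\<in>S. (g has_field_derivative f p) (at p)"
    using holo openS
    by (intro holomorphic_starlike_primitive[where k = "{}"])
       (auto intro: holomorphic_on_imp_continuous_on holomorphic_on_imp_differentiable_at)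
  then obtain G where G: "\<And>p. p \<in> S \<Longrightarrow> (G has_field_derivative f p) (at p)" by blast
  have GS: "\<And>p. p \<in> S \<Longrightarrow> (G has_field_derivative f p) (at p within S)"
    using G by (rule has_field_derivative_at_within)
  have cont: "continuous_on S f" by (rule holomorphic_on_imp_continuous_on[OF holo])
  have seg: "has_bochner_integral lborel (\<lambda>x. indicator {a..b} x *\<^sub>R f (Complex x y)) (G (Complex b y) - G (Complex a y))"
    if "a \<le> b" and sub: "\<And>x. x \<in> {a..b} \<Longrightarrow> Complex x y \<in> S" for a b y
  proof (rule has_bochner_integral_FTC_Icc[OF that(1)])
    fix x assume x: "a \<le> x" "x \<le> b"
    have "((\<lambda>x. Complex x y) has_vector_derivative 1) (at x within {a..b})"
      unfolding Complex_eq by (auto intro!: derivative_eq_intros)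
    from field_vector_diff_chain_within[OF this, of G "f (Complex x y)"]
    show "((\<lambda>x. G (Complex x y)) has_vector_derivative f (Complex x y)) (at x within {a..b})"
      using G[OF sub, of x] x by (simp add: o_def has_field_derivative_at_within)
  next
    show "continuous_on {a..b} (\<lambda>x. f (Complex x y))"
      by (rule continuous_on_compose2[OF cont]) (use sub in \<open>auto intro!: continuous_intros\<close>)
  qed
  have circle: "contour_integral (part_circlepath 0 r pi 0) f = G (of_real r) - G (of_real (- r))"
  proof -
    have "path_image (part_circlepath 0 r pi 0) \<subseteq> S"
    proof
      fix p assume "p \<in> path_image (part_circlepath 0 r pi 0)"
      then obtain t where t: "t \<in> closed_segment pi 0" and p: "p = of_real r * cis t"
        by (auto simp: path_image_part_circlepath')
      have t': "0 \<le> t" "t \<le> pi" using t pi_gt_zero by (auto simp: closed_segment_eq_real_ivl split: if_splits)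
      have "0 \<le> Im p" using r t' by (simp add: p sin_ge_zero)
      moreover have "\<bar>Im p\<bar> \<le> cmod p" by (rule abs_Im_le_cmod)
      moreover have "cmod p = r" using r by (simp add: p norm_mult)
      moreover have "p \<noteq> 0" using \<open>cmod p = r\<close> r by auto
      ultimately show "p \<in> S" using r by (auto simp: S_def complex_eq_iff)
    qed
    from contour_integral_primitive[OF GS _ this]
    have "(f has_contour_integral G (pathfinish (part_circlepath 0 r pi 0)) - G (pathstart (part_circlepath 0 r pi 0))) (part_circlepath 0 r pi 0)"
      by simp
    then show ?thesis by (simp add: contour_integral_unique)
  qed
  have cr: "complex_of_real x = Complex x 0" for x by (simp add: complex_eq_iff)
  have realS: "Complex x 0 \<in> S" if "x \<noteq> 0" for x using that m by (simp add: S_def)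
  have lineS: "Complex x d \<in> S" for x using d by (simp add: S_def m_def)
  \<comment> \<open>The two rays of the definition, extended by zero across the gap; the half circle
    supplies the increment of the primitive over the gap.\<close>
  define f' where "f' x = indicator ({..- r} \<union> {r..}) x *\<^sub>R f (Complex x 0)" for x
  define C where "C = 2 / (1 - exp (- 2 * (pi * 1 * r))) * (2 / (1 - exp (- 2 * (pi * h * r)))) / r"
  have C0: "C > 0" using r h by (simp add: C_def)
  have far: "cmod (f (Complex x 0)) \<le> C * exp (- (pi * (1 + h) - b) * \<bar>x\<bar>)" if "r \<le> \<bar>x\<bar>" for x
    using qdilog_integrand_far[OF that r(1), of z b 0] by (simp add: f_def C_def b_def)
  have m0 [measurable]: "(\<lambda>x. f (Complex x 0)) \<in> borel_measurable borel" unfolding f_def by measurable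
  have intA: "integrable lborel (\<lambda>x. indicator A x *\<^sub>R f (Complex x 0))" if "A \<subseteq> {..- r} \<union> {r..}" "A \<in> sets borel" for A
  proof (rule integrable_real_exp_bound)
    show "0 < pi * (1 + h) - b" using b by simp
    show "cmod (indicator A x *\<^sub>R f (Complex x 0)) \<le> C * exp (- (pi * (1 + h) - b) * \<bar>x\<bar>)" for x
      using far[of x] that(1) C0 by (cases "x \<in> A") auto
    show "(\<lambda>x. indicator A x *\<^sub>R f (Complex x 0)) \<in> borel_measurable borel" using that(2) by measurable
  qed
  have ind: "indicat_real ({..- r} \<union> {r..}) x = indicat_real {..- r} x + indicat_real {r..} x" for x
    using r by (auto simp: indicator_def)
  have total: "(LINT x:{..- r}|lborel. f (of_real x)) + (LINT x:{r..}|lborel. f (of_real x)) = (LINT x|lborel. f' x)"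
    unfolding f'_def ind scaleR_add_left set_lebesgue_integral_def cr
    by (rule Bochner_Integration.integral_add[symmetric]) (auto intro!: intA)
  have f'int: "integrable lborel f'" unfolding f'_def by (rule intA) auto
  have trunc: "(LINT x:{- real n..real n}|lborel. f' x)
     = (G (Complex (- r) 0) - G (Complex (- real n) 0)) + (G (Complex (real n) 0) - G (Complex r 0))" if n: "real n \<ge> r" for n
  proof -
    have "has_bochner_integral lborel (\<lambda>x. indicator {- real n..- r} x *\<^sub>R f (Complex x 0) + indicator {r..real n} x *\<^sub>R f (Complex x 0))
      ((G (Complex (- r) 0) - G (Complex (- real n) 0)) + (G (Complex (real n) 0) - G (Complex r 0)))"
      by (intro has_bochner_integral_add seg realS) (use n r in auto)
    moreover have "indicator {- real n..- r} x *\<^sub>R f (Complex x 0) + indicator {r..real n} x *\<^sub>R f (Complex x 0) = indicator {- real n..real n} x *\<^sub>R f' x" for x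
      using r n by (auto simp: f'_def indicator_def)
    ultimately show ?thesis
      by (simp add: set_lebesgue_integral_def has_bochner_integral_integral_eq)
  qed
  have line: "(LINT x:{- real n..real n}|lborel. f (Complex x d)) = G (Complex (real n) d) - G (Complex (- real n) d)" for n
    unfolding set_lebesgue_integral_def
    by (rule has_bochner_integral_integral_eq[OF seg]) (auto intro: lineS)
  \<comment> \<open>Increments of the primitive along vertical segments. They account for the
    difference of the truncated integrals and vanish far out.\<close>
  define V where "V x = G (Complex x d) - G (Complex x 0)" for x
  have V: "cmod (V x) \<le> exp (d * \<bar>Re z\<bar>) * C * exp (- (pi * (1 + h) - b) * \<bar>x\<bar>) * d" if x: "r \<le> \<bar>x\<bar>" for x
  proof -
    have sg: "closed_segment (Complex x 0) (Complex x d) = {p. Re p = x \<and> Im p \<in> {0..d}}"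
      using d by (simp add: closed_segment_same_Re closed_segment_eq_real_ivl)
    have "(f has_contour_integral V x) (linepath (Complex x 0) (Complex x d))"
    proof -
      have "path_image (linepath (Complex x 0) (Complex x d)) \<subseteq> S"
        using x r d by (auto simp: sg S_def m_def)
      from contour_integral_primitive[OF GS _ this] show ?thesis by (simp add: V_def)
    qed
    then have "cmod (V x) \<le> exp (d * \<bar>Re z\<bar>) * C * exp (- (pi * (1 + h) - b) * \<bar>x\<bar>) * cmod (Complex x d - Complex x 0)"
    proof (rule has_contour_integral_bound_linepath)
      show "0 \<le> exp (d * \<bar>Re z\<bar>) * C * exp (- (pi * (1 + h) - b) * \<bar>x\<bar>)" using C0 by simp
      fix p assume "p \<in> closed_segment (Complex x 0) (Complex x d)"
      then have p: "p = Complex x (Im p)" "0 \<le> Im p" "Im p \<le> d" by (auto simp: sg complex_eq_iff)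
      have "Im p * Re z \<le> d * \<bar>Re z\<bar>"
        using p by (intro order_trans[OF mult_left_mono[OF abs_ge_self] mult_right_mono]) auto
      then have "exp (Im p * Re z) * C \<le> exp (d * \<bar>Re z\<bar>) * C" using C0 by simp
      moreover have "cmod (f p) \<le> exp (Im p * Re z) * C * exp (- (pi * (1 + h) - b) * \<bar>x\<bar>)"
        using qdilog_integrand_far[OF x r(1), of z b "Im p"] p(1) by (simp add: f_def C_def b_def)
      ultimately show "cmod (f p) \<le> exp (d * \<bar>Re z\<bar>) * C * exp (- (pi * (1 + h) - b) * \<bar>x\<bar>)"
        by (meson exp_ge_zero mult_right_mono order_trans)
    qed
    also have "Complex x d - Complex x 0 = \<i> * of_real d" by (simp add: complex_eq_iff)
    also have "cmod \<dots> = d" using d by (simp add: norm_mult)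
    finally show ?thesis .
  qed
  have V0: "(\<lambda>n. V (\<sigma> * real n)) \<longlonglongrightarrow> 0" if "\<bar>\<sigma>\<bar> = 1" for \<sigma>
  proof (rule Lim_null_comparison)
    obtain N where N: "r \<le> real N" using real_arch_simple by blast
    show "\<forall>\<^sub>F n in sequentially. cmod (V (\<sigma> * real n)) \<le> exp (d * \<bar>Re z\<bar>) * C * exp (- (pi * (1 + h) - b) * real n) * d"
      using eventually_ge_at_top[of N]
    proof eventually_elim
      case (elim n)
      then show ?case using V[of "\<sigma> * real n"] that N by (simp add: abs_mult)
    qed
    have "(\<lambda>n. exp (- e * real n)) \<longlonglongrightarrow> 0" if "e > 0" for e :: real using that by real_asymp
    from tendsto_mult_left[OF this[of "pi * (1 + h) - b"], of "exp (d * \<bar>Re z\<bar>) * C"] 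
    have "(\<lambda>n. exp (d * \<bar>Re z\<bar>) * C * exp (- (pi * (1 + h) - b) * real n)) \<longlonglongrightarrow> 0" using b by simp
    from tendsto_mult_right[OF this, of d]
    show "(\<lambda>n. exp (d * \<bar>Re z\<bar>) * C * exp (- (pi * (1 + h) - b) * real n) * d) \<longlonglongrightarrow> 0" by simp
  qed
  have lint: "integrable lborel (\<lambda>x. f (Complex x d))"
    unfolding f_def using integrable_qdilog_line[of d z] d z by simp
  have L1: "(\<lambda>n. (LINT x:{- real n..real n}|lborel. f' x) - (LINT x:{- real n..real n}|lborel. f (Complex x d)))
    \<longlonglongrightarrow> (LINT x|lborel. f' x) - (LINT x|lborel. f (Complex x d))"
    by (intro tendsto_diff tendsto_truncated_integral f'int lint)
  have "(\<lambda>n. G (Complex (- r) 0) - G (Complex r 0) - V (1 * real n) + V (- 1 * real n)) \<longlonglongrightarrow> G (Complex (- r) 0) - G (Complex r 0) - 0 + 0"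
    by (intro tendsto_intros V0) auto
  moreover have "\<forall>\<^sub>F n in sequentially. G (Complex (- r) 0) - G (Complex r 0) - V (1 * real n) + V (- 1 * real n)
      = (LINT x:{- real n..real n}|lborel. f' x) - (LINT x:{- real n..real n}|lborel. f (Complex x d))"
  proof -
    obtain N where N: "r \<le> real N" using real_arch_simple by blast
    show ?thesis using eventually_ge_at_top[of N]
    proof eventually_elim
      case (elim n)
      then have "real n \<ge> r" using N by linarith
      from trunc[OF this] show ?case unfolding line V_def by simp
    qed
  qed
  ultimately have "(\<lambda>n. (LINT x:{- real n..real n}|lborel. f' x) - (LINT x:{- real n..real n}|lborel. f (Complex x d)))
    \<longlonglongrightarrow> G (Complex (- r) 0) - G (Complex r 0)"
    using Lim_transform_eventually by force
  from LIMSEQ_unique[OF L1 this]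
  have "(LINT x|lborel. f' x) + (G (Complex r 0) - G (Complex (- r) 0)) = (LINT x|lborel. f (Complex x d))"
    by (simp add: algebra_simps)
  moreover have "qdilog_integral h z = (LINT x|lborel. f' x) + contour_integral (part_circlepath 0 r pi 0) f"
    using total by (simp add: qdilog_integral_def Let_def f_def r_def algebra_simps)
  ultimately show ?thesis using circle by (simp add: f_def cr)
qed

end

section \<open>Holomorphy, modulus, reflection and functional equation\<close>

context
  fixes h :: real
  assumes h: "h > 0"
begin

abbreviation width :: real where "width \<equiv> pi * (1 + h)"

lemma bypass_radius: "0 < bypass_radius h" "bypass_radius h < min 1 (1 / h)"
proof -
  define m where "m = min 1 (1 / h)"
  have "m > 0" "bypass_radius h = m / 2" using h by (simp_all add: m_def bypass_radius_def)
  then show "0 < bypass_radius h" "bypass_radius h < min 1 (1 / h)" by (simp_all flip: m_def)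
qed

lemma bypass_radius_less: "bypass_radius h < 1" "bypass_radius h < 1 / h"
  using bypass_radius by auto

lemma abs_bypass_radius: "0 < \<bar>bypass_radius h\<bar>" "\<bar>bypass_radius h\<bar> < min 1 (1 / h)"
  "0 < \<bar>- bypass_radius h\<bar>" "\<bar>- bypass_radius h\<bar> < min 1 (1 / h)"
  using bypass_radius by auto

lemma qdilog_integral_line:
  "\<bar>Im z\<bar> < width \<Longrightarrow> qdilog_integral h z = (LINT x|lborel. qdilog_integrand h z (Complex x (bypass_radius h)))"
  by (rule qdilog_integral_eq_line[OF h bypass_radius])

text \<open>On the line Im p = d the factor exp (- i p z) contributes exp (d Re z), so the bound is
  good for Re z \<le> 0. The other half plane is reached through
  \<open>qdilog_integral_reflection\<close>.\<close>

lemma norm_qdilog_integral_le: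
  assumes "b < width"
  obtains M where "\<And>z :: complex. \<bar>Im z\<bar> \<le> b \<Longrightarrow> cmod (qdilog_integral h z) \<le> M * exp (bypass_radius h * Re z)"
proof
  define d where "d = bypass_radius h"
  define C where "C = 4 / \<bar>sin (pi * 1 * d)\<bar> * (4 / \<bar>sin (pi * h * d)\<bar>) / \<bar>d\<bar>"
  fix z :: complex assume z: "\<bar>Im z\<bar> \<le> b"
  have "cmod (LINT x|lborel. qdilog_integrand h z (Complex x d)) \<le> (LINT x|lborel. exp (d * Re z) * C * exp (- (pi * (1 + h) - b) * \<bar>x\<bar>))"
  proof (rule Bochner_Integration.integral_norm_bound_integral)
    show "cmod (qdilog_integrand h z (Complex x d)) \<le> exp (d * Re z) * C * exp (- (pi * (1 + h) - b) * \<bar>x\<bar>)" for x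
      unfolding C_def d_def by (rule qdilog_integrand_line[OF h abs_bypass_radius(1,2) z])
    show "integrable lborel (\<lambda>x. exp (d * Re z) * C * exp (- (pi * (1 + h) - b) * \<bar>x\<bar>))"
      by (intro integrable_mult_right integrable_exp_minus_abs) (use assms in simp)
    show "integrable lborel (\<lambda>x. qdilog_integrand h z (Complex x d))"
      unfolding d_def by (rule integrable_qdilog_line[OF h abs_bypass_radius(1,2)]) (use z assms in simp)
  qed
  also have "\<dots> = exp (d * Re z) * C * (LINT x|lborel. exp (- (pi * (1 + h) - b) * \<bar>x\<bar>))"
    by (rule integral_mult_right_zero)
  finally show "cmod (qdilog_integral h z) \<le> (C * (LINT x|lborel. exp (- (pi * (1 + h) - b) * \<bar>x\<bar>))) * exp (bypass_radius h * Re z)"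
    using z assms by (simp add: qdilog_integral_line d_def mult_ac)
qed

text \<open>On the line Im p = d the factor exp (d z) leaves the integral, and there remains an
  integral against exp (- i t z) with a kernel independent of z, to which
  \<open>integral_exp_has_derivative\<close> applies.\<close>

lemma qdilog_holomorphic: "qdilog h holomorphic_on {z. - width < Im z \<and> Im z < width}"
proof -
  define d where "d = bypass_radius h"
  define g where "g t = qdilog_integrand h 0 (Complex t d)" for t
  define C where "C = exp (d * Re 0) * (4 / \<bar>sin (pi * 1 * d)\<bar> * (4 / \<bar>sin (pi * h * d)\<bar>) / \<bar>d\<bar>)"
  have g: "cmod (g t) \<le> C * exp (- width * \<bar>t\<bar>)" for t
    using qdilog_integrand_line[OF h abs_bypass_radius(1,2), of 0 0 t] by (simp add: g_def C_def d_def)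
  have C0: "0 \<le> C" by (simp add: C_def)
  have [measurable]: "g \<in> borel_measurable borel" unfolding g_def by measurable
  define J where "J z = exp (d * z) * (LINT t|lborel. g t * exp (- \<i> * t * z))" for z :: complex
  have eq: "qdilog_integral h z = J z" if "\<bar>Im z\<bar> < width" for z :: complex
  proof -
    have "qdilog_integrand h z (Complex t d) = exp (d * z) * (g t * exp (- \<i> * t * z))" for t
    proof -
      have "- \<i> * Complex t d * z = d * z + (- \<i> * t * z)" by (simp add: Complex_eq algebra_simps)
      then have "exp (- \<i> * Complex t d * z) = exp (d * z) * exp (- \<i> * t * z)" by (simp only: exp_add)
      then show ?thesis by (simp add: g_def qdilog_integrand_def)
    qed
    then show ?thesis using qdilog_integral_line[OF that] by (simp add: d_def[symmetric] J_def)
  qed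
  have J: "J field_differentiable (at z)" if z: "\<bar>Im z\<bar> < width" for z :: complex
  proof -
    define e where "e = (width - \<bar>Im z\<bar>) / 2"
    have e: "e > 0" using z by (simp add: e_def)
    have w: "width = \<bar>Im z\<bar> + 2 * e" by (simp add: e_def diff_divide_distrib)
    have "integrable lborel (\<lambda>t. of_real (cmod (g t) * exp (Re (- \<i> * t * z) + e * \<bar>t\<bar>)) :: complex)"
    proof (rule integrable_real_exp_bound[OF _ e, of _ C])
      fix t :: real
      have "Re (- \<i> * t * z) \<le> \<bar>Im z\<bar> * \<bar>t\<bar>"
        using abs_le_D1[OF order_refl, of "t * Im z"] by (simp add: abs_mult mult.commute)
      then have "exp (Re (- \<i> * t * z) + e * \<bar>t\<bar>) \<le> exp (\<bar>Im z\<bar> * \<bar>t\<bar> + e * \<bar>t\<bar>)" by simp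
      then have "cmod (g t) * exp (Re (- \<i> * t * z) + e * \<bar>t\<bar>)
         \<le> (C * exp (- width * \<bar>t\<bar>)) * exp (\<bar>Im z\<bar> * \<bar>t\<bar> + e * \<bar>t\<bar>)"
        using g C0 by (intro mult_mono) auto
      also have "\<dots> = C * exp (- e * \<bar>t\<bar>)"
      proof -
        have "- width * \<bar>t\<bar> + (\<bar>Im z\<bar> * \<bar>t\<bar> + e * \<bar>t\<bar>) = - e * \<bar>t\<bar>"
          unfolding w by (simp add: algebra_simps)
        then show ?thesis by (simp only: mult.assoc exp_add[symmetric])
      qed
      finally show "cmod (of_real (cmod (g t) * exp (Re (- \<i> * t * z) + e * \<bar>t\<bar>)) :: complex) \<le> C * exp (- e * \<bar>t\<bar>)"
        by (simp add: norm_mult)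
    qed measurable
    then have "integrable lborel (\<lambda>t. cmod (g t) * exp (Re (- \<i> * t * z) + e * \<bar>t\<bar>))"
      by (simp only: complex_of_real_integrable_eq)
    note der = integral_exp_has_derivative(1)[OF _ e this]
    have "((\<lambda>z. exp (of_real d * z)) has_field_derivative exp (d * z) * d) (at z)"
      by (auto intro!: derivative_eq_intros)
    from DERIV_mult[OF this der] show ?thesis
      unfolding field_differentiable_def J_def by auto
  qed
  have "(\<lambda>z. exp (- (1 / 4) * J z)) holomorphic_on {z. - width < Im z \<and> Im z < width}"
  proof -
    have "J holomorphic_on {z. - width < Im z \<and> Im z < width}"
      by (rule holomorphic_onI, rule field_differentiable_at_within, rule J) auto
    then show ?thesis by (intro holomorphic_intros)
  qed
  then show ?thesis
    by (rule holomorphic_transform) (auto simp: qdilog_def eq)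
qed

text \<open>Conjugation followed by p -> - p maps the line of integration to itself, and the three
  odd factors of the denominator give the sign. On the real axis the integral is therefore purely
  imaginary.\<close>

lemma cnj_qdilog_integral:
  assumes z: "\<bar>Im z\<bar> < width"
  shows "cnj (qdilog_integral h z) = - qdilog_integral h (cnj z)"
proof -
  define d where "d = bypass_radius h"
  have "cnj (qdilog_integral h z) = (LINT x|lborel. cnj (qdilog_integrand h z (Complex x d)))"
    unfolding qdilog_integral_line[OF z] d_def by (rule Bochner_Integration.integral_cnj[symmetric])
  also have "\<dots> = (LINT x|lborel. - qdilog_integrand h (cnj z) (Complex (0 + (- 1) * x) d))"
  proof (intro Bochner_Integration.integral_cong refl)
    fix x
    define p where "p = Complex (- x) d"
    have p: "cnj (Complex x d) = - p" by (simp add: p_def complex_eq_iff)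
    have cs: "cnj (sinh w) = sinh (cnj w)" for w by (simp add: sinh_def exp_cnj)
    show "cnj (qdilog_integrand h z (Complex x d)) = - qdilog_integrand h (cnj z) (Complex (0 + (- 1) * x) d)"
      by (simp add: qdilog_integrand_def exp_cnj cs p flip: p_def)
  qed
  also have "\<dots> = - (LINT x|lborel. qdilog_integrand h (cnj z) (Complex (0 + (- 1) * x) d))" by simp
  also have "(LINT x|lborel. qdilog_integrand h (cnj z) (Complex (0 + (- 1) * x) d)) = (LINT x|lborel. qdilog_integrand h (cnj z) (Complex x d))"
    using lborel_integral_real_affine[of "- 1" "\<lambda>x. qdilog_integrand h (cnj z) (Complex x d)" 0] by simp
  finally show ?thesis using z by (simp add: qdilog_integral_line d_def)
qed

lemma norm_qdilog_real: "cmod (qdilog h (of_real x)) = 1"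
proof -
  have "cnj (qdilog_integral h (of_real x)) = - qdilog_integral h (of_real x)"
    using cnj_qdilog_integral[of "of_real x"] h by simp
  then have "Re (qdilog_integral h (of_real x)) = 0" by (simp add: complex_eq_iff)
  then show ?thesis by (simp add: qdilog_def)
qed

text \<open>The pole at 0 has order three, so the residue is quadratic in z. Only the leading
  coefficient is made explicit: the linear one will vanish by symmetry, and the constant one affects
  only constants in the estimates.\<close>

lemma residue_qdilog_integrand:
  obtains A B where "\<And>z :: complex. residue (qdilog_integrand h z) 0 = A + B * z - z\<^sup>2 / (2 * pi\<^sup>2 * h)"
proof -
  define m where "m = min 1 (1 / h)"
  have m: "m > 0" using h by (simp add: m_def)
  define S where "S = {p. - m < Im p \<and> Im p < m}"
  have S: "open S" "0 \<in> S" using m by (auto simp: S_def open_strip)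
  \<comment> \<open>\<open>k c p\<close> is sinh (pi c p) / p with the removable singularity filled
    in by the derivative.\<close>
  define k where "k c p = (if p = 0 then deriv (\<lambda>p. sinh (of_real (pi * c) * p)) 0
    else (sinh (of_real (pi * c) * p) - sinh (of_real (pi * c) * 0)) / (p - 0))" for c :: real and p :: complex
  have holo_sinh: "(\<lambda>p. sinh (of_real (pi * c) * p)) holomorphic_on U" for c U
    unfolding sinh_def scaleR_conv_of_real by (intro holomorphic_intros)
  have kh: "k c holomorphic_on S" for c
    unfolding k_def by (rule pole_lemma_open[OF holo_sinh S(1)])
  have k0: "k c 0 = of_real (pi * c)" for c
  proof -
    have "((\<lambda>p. sinh (complex_of_real (pi * c) * p)) has_field_derivative of_real (pi * c)) (at 0)"
      by (auto intro!: derivative_eq_intros)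
    then show ?thesis by (simp only: k_def DERIV_imp_deriv if_True refl)
  qed
  have knz: "k c p \<noteq> 0" if "p \<in> S" "c = 1 \<or> c = h" for c p
  proof (cases "p = 0")
    case True
    then show ?thesis using that h by (auto simp: k0)
  next
    case False
    have "\<bar>Im p\<bar> < 1 / c" "c > 0" using that h by (auto simp: S_def m_def)
    from sinh_pi_mult_nonzero[OF this(2,1) False] False show ?thesis by (simp add: k_def)
  qed
  define s where "s p = 1 / (k 1 p * k h p)" for p
  have sh: "s holomorphic_on S" unfolding s_def by (intro holomorphic_intros kh) (use knz in auto)
  have s0: "s 0 = 1 / (pi\<^sup>2 * h)" by (simp add: s_def k0 power2_eq_square)
  \<comment> \<open>Two of the three powers of p come from the hyperbolic sines.\<close>
  have eq: "qdilog_integrand h z p = (exp (- \<i> * z * p) * s p) / p ^ Suc 2" if "p \<noteq> 0" for z p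
    using that by (simp add: qdilog_integrand_def s_def k_def field_simps power3_eq_cube)
  have dexp: "(deriv ^^ n) (\<lambda>p. exp (c * p)) = (\<lambda>p. c ^ n * exp (c * p))" for n and c :: complex
  proof (induction n)
    case (Suc n)
    have "((\<lambda>p. c ^ n * exp (c * p)) has_field_derivative c ^ n * (exp (c * p) * (c * 1))) (at p)" for p
      by (intro DERIV_cmult DERIV_fun_exp DERIV_ident)
    from DERIV_imp_deriv[OF this] show ?case by (simp add: Suc fun_eq_iff)
  qed simp
  show ?thesis
  proof (rule that)
    fix z :: complex
    have "residue (qdilog_integrand h z) 0 = residue (\<lambda>p. (exp (- \<i> * z * p) * s p) / p ^ Suc 2) 0"
      by (rule residue_cong) (auto simp: eventually_at_filter eq)
    also have "\<dots> = (deriv ^^ 2) (\<lambda>p. exp (- \<i> * z * p) * s p) 0 / fact 2"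
      by (rule residue_holomorphic_over_power'[OF S]) (intro holomorphic_intros sh)
    also have "(deriv ^^ 2) (\<lambda>p. exp (- \<i> * z * p) * s p) 0
       = (\<Sum>i=0..2. of_nat (2 choose i) * (deriv ^^ i) (\<lambda>p. exp (- \<i> * z * p)) 0 * (deriv ^^ (2 - i)) s 0)"
      by (rule higher_deriv_mult[OF _ sh S]) (intro holomorphic_intros)
    also have "\<dots> = (deriv ^^ 2) s 0 + 2 * (- \<i> * z) * deriv s 0 + (- \<i> * z)\<^sup>2 * s 0"
      unfolding dexp by (simp add: numeral_2_eq_2)
    also have "\<dots> / fact 2 = (deriv ^^ 2) s 0 / 2 + (- \<i> * deriv s 0) * z - z\<^sup>2 / (2 * pi\<^sup>2 * h)"
      by (simp add: s0 power_mult_distrib field_simps)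
    finally show "residue (qdilog_integrand h z) 0 = (deriv ^^ 2) s 0 / 2 + (- \<i> * deriv s 0) * z - z\<^sup>2 / (2 * pi\<^sup>2 * h)" .
  qed
qed

text \<open>Under p -> - p the integral for - z becomes minus the integral for z over the line Im p
  = - d, so the sum is given by the residue at 0. This is the inversion relation: the product of
  \<Phi> at z and - z is a constant times exp (z^2 / (4 pi i h)).\<close>

lemma qdilog_integral_reflection:
  obtains A where "\<And>z :: complex. \<bar>Im z\<bar> < width \<Longrightarrow> qdilog_integral h z + qdilog_integral h (- z) = A + \<i> * z\<^sup>2 / (pi * h)"
proof -
  define d where "d = bypass_radius h"
  define m where "m = min 1 (1 / h)"
  have d: "- m < - d" "- d < 0" "0 < d" "d < m" using bypass_radius by (auto simp: d_def m_def)
  obtain A B where res: "\<And>z :: complex. residue (qdilog_integrand h z) 0 = A + B * z - z\<^sup>2 / (2 * pi\<^sup>2 * h)"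
    using residue_qdilog_integrand by blast
  have key: "qdilog_integral h z + qdilog_integral h (- z) = - 2 * pi * \<i> * (A + B * z - z\<^sup>2 / (2 * pi\<^sup>2 * h))"
    if z: "\<bar>Im z\<bar> < width" for z :: complex
  proof -
    have "(LINT x|lborel. qdilog_integrand h z (Complex x (- d))) - (LINT x|lborel. qdilog_integrand h z (Complex x d))
        = 2 * pi * \<i> * residue (qdilog_integrand h z) 0"
    proof (rule integral_strip_residue[OF d])
      show "pi * (1 + h) - \<bar>Im z\<bar> > 0" using z by simp
      show "qdilog_integrand h z holomorphic_on {p. - m < Im p \<and> Im p < m} - {0}"
        by (rule holomorphic_on_subset[OF qdilog_integrand_holomorphic[OF h]]) (auto simp: m_def)
      define C where "C = 2 / (1 - exp (- 2 * (pi * 1 * 1))) * (2 / (1 - exp (- 2 * (pi * h * 1)))) / 1"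
      have C: "0 \<le> C" using h by (simp add: C_def)
      show "cmod (qdilog_integrand h z (Complex x y)) \<le> exp (d * \<bar>Re z\<bar>) * C * exp (- (pi * (1 + h) - \<bar>Im z\<bar>) * \<bar>x\<bar>)"
        if "1 \<le> \<bar>x\<bar>" "y \<in> {- d..d}" for x y
      proof -
        have "y * Re z \<le> \<bar>y\<bar> * \<bar>Re z\<bar>" using abs_le_D1[OF order_refl, of "y * Re z"] by (simp add: abs_mult)
        also have "\<dots> \<le> d * \<bar>Re z\<bar>" using that by (intro mult_right_mono) auto
        finally have "exp (y * Re z) * C \<le> exp (d * \<bar>Re z\<bar>) * C" using C by (intro mult_right_mono) simp_all
        then show ?thesis
          using qdilog_integrand_far[OF h that(1) zero_less_one order_refl, of z y]
          unfolding C_def[symmetric] by (meson exp_ge_zero mult_right_mono order_trans)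
      qed
      show "integrable lborel (\<lambda>x. qdilog_integrand h z (Complex x (- d)))"
           "integrable lborel (\<lambda>x. qdilog_integrand h z (Complex x d))"
        unfolding d_def by (rule integrable_qdilog_line[OF h _ _ z]; use abs_bypass_radius in simp)+
    qed
    moreover have "(LINT x|lborel. qdilog_integrand h z (Complex x (- d))) = - qdilog_integral h (- z)"
    proof -
      have "qdilog_integrand h z (Complex x (- d)) = - qdilog_integrand h (- z) (Complex (0 + (- 1) * x) d)" for x
      proof -
        define p where "p = Complex (- x) d"
        have p: "Complex x (- d) = - p" by (simp add: p_def complex_eq_iff)
        show ?thesis by (simp add: qdilog_integrand_def p flip: p_def)
      qed
      then have "(LINT x|lborel. qdilog_integrand h z (Complex x (- d))) = - (LINT x|lborel. qdilog_integrand h (- z) (Complex (0 + (- 1) * x) d))"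
        by simp
      also have "(LINT x|lborel. qdilog_integrand h (- z) (Complex (0 + (- 1) * x) d)) = (LINT x|lborel. qdilog_integrand h (- z) (Complex x d))"
        using lborel_integral_real_affine[of "- 1" "\<lambda>x. qdilog_integrand h (- z) (Complex x d)" 0] by simp
      finally show ?thesis using z by (simp add: qdilog_integral_line d_def)
    qed
    ultimately have "- qdilog_integral h (- z) - qdilog_integral h z = 2 * pi * \<i> * residue (qdilog_integrand h z) 0"
      using qdilog_integral_line[OF z] by (simp add: d_def)
    moreover have "qdilog_integral h z + qdilog_integral h (- z) = - (- qdilog_integral h (- z) - qdilog_integral h z)"
      by simp
    ultimately show ?thesis by (simp only: res) simp
  qed
  \<comment> \<open>The sum is even in z; equality of its values at 1 and -1 removes the linear
    term.\<close>
  have "\<bar>Im 1\<bar> < width" "\<bar>Im (- 1)\<bar> < width" using h by simp_all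
  from key[OF this(1)] key[OF this(2)] have "B = 0" by (simp add: add.commute)
  have "qdilog_integral h z + qdilog_integral h (- z) = - 2 * pi * \<i> * A + \<i> * z\<^sup>2 / (pi * h)" if z: "\<bar>Im z\<bar> < width" for z :: complex
    unfolding key[OF z] \<open>B = 0\<close> using h by (simp add: field_simps power2_eq_square)
  then show ?thesis by (rule that)
qed

text \<open>To the left the integral is bounded. To the right the reflection formula leaves a
  Gaussian of modulus exp (freq h Re z Im z); this is the source of the asymmetric growth in the
  strip.\<close>

lemma norm_qdilog_le:
  assumes "b < width"
  obtains C where "\<And>z :: complex. \<bar>Im z\<bar> \<le> b \<Longrightarrow> cmod (qdilog h z) \<le> C * exp (freq h * Im z * max (Re z) 0)"
proof -
  obtain M where M: "\<And>z :: complex. \<bar>Im z\<bar> \<le> b \<Longrightarrow> cmod (qdilog_integral h z) \<le> M * exp (bypass_radius h * Re z)"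
    using norm_qdilog_integral_le[OF assms] by blast
  obtain A where A: "\<And>z :: complex. \<bar>Im z\<bar> < width \<Longrightarrow> qdilog_integral h z + qdilog_integral h (- z) = A + \<i> * z\<^sup>2 / (pi * h)"
    using qdilog_integral_reflection by blast
  have left: "cmod (qdilog_integral h z) \<le> \<bar>M\<bar>" if "\<bar>Im z\<bar> \<le> b" "Re z \<le> 0" for z :: complex
  proof -
    have "cmod (qdilog_integral h z) \<le> \<bar>M\<bar> * exp (bypass_radius h * Re z)"
      using M[OF that(1)] by (smt (verit) exp_ge_zero mult_right_mono)
    also have "\<dots> \<le> \<bar>M\<bar> * 1"
      using that bypass_radius(1) by (intro mult_left_mono) (auto simp: mult_nonneg_nonpos)
    finally show ?thesis by simp
  qed
  show ?thesis
  proof (rule that)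
    fix z :: complex assume z: "\<bar>Im z\<bar> \<le> b"
    have n: "cmod (qdilog h z) = exp (- Re (qdilog_integral h z) / 4)" by (simp add: qdilog_def)
    show "cmod (qdilog h z) \<le> exp (\<bar>M\<bar> / 4 + cmod A / 4) * exp (freq h * Im z * max (Re z) 0)"
    proof (cases "Re z \<le> 0")
      case True
      have "- Re (qdilog_integral h z) \<le> \<bar>M\<bar>"
        using left[OF z True] abs_Re_le_cmod[of "qdilog_integral h z"] by linarith
      then have "- Re (qdilog_integral h z) / 4 \<le> \<bar>M\<bar> / 4 + cmod A / 4" by (simp add: add_increasing2)
      then show ?thesis using True by (simp add: n)
    next
      case False
      have "cmod (qdilog_integral h (- z)) \<le> \<bar>M\<bar>" by (rule left) (use z False in auto)
      then have 1: "Re (qdilog_integral h (- z)) \<le> \<bar>M\<bar>"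
        using complex_Re_le_cmod[of "qdilog_integral h (- z)"] by linarith
      have "qdilog_integral h z = A + \<i> * z\<^sup>2 / (pi * h) - qdilog_integral h (- z)"
        using A[of z] z assms by (simp add: algebra_simps)
      then have "Re (qdilog_integral h z) = Re A - 2 * (Re z * Im z) / (pi * h) - Re (qdilog_integral h (- z))"
        by (simp add: Re_divide_of_real Im_power2 mult.assoc flip: of_real_mult)
      then have "- Re (qdilog_integral h z) / 4 = - Re A / 4 + Re (qdilog_integral h (- z)) / 4 + freq h * Im z * Re z"
        by (simp add: freq_def field_simps)
      also have "\<dots> \<le> \<bar>M\<bar> / 4 + cmod A / 4 + freq h * Im z * max (Re z) 0"
        using 1 abs_Re_le_cmod[of A] False by simp
      finally show ?thesis by (simp add: n exp_add[symmetric])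
    qed
  qed
qed

text \<open>The two exponentials in the difference of the integrals combine to - 2 sinh (pi a p) exp
  (- i p z), which cancels one of the hyperbolic sines and leaves \<open>line_integral\<close> for
  the other period.\<close>

lemma qdilog_functional_equation:
  assumes ac: "a = 1 \<and> c = h \<or> a = h \<and> c = 1" and z: "\<bar>Im z\<bar> < pi * c"
  shows "qdilog h (z + \<i> * pi * a) = qdilog h (z - \<i> * pi * a) * (1 + exp (z / c))"
proof -
  define d where "d = bypass_radius h"
  have c: "c > 0" "a > 0" using ac h by auto
  have d: "0 < d" "d < 1 / c" "d < 1 / a" using bypass_radius(1) bypass_radius_less ac by (auto simp: d_def)
  have w: "\<bar>Im (z - \<i> * pi * a)\<bar> < width" "\<bar>Im (z + \<i> * pi * a)\<bar> < width"
  proof -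
    have "width = pi * c + pi * a" using ac by (auto simp: algebra_simps)
    moreover have "0 < pi * a" using c by simp
    ultimately have "\<bar>Im z - pi * a\<bar> < width" "\<bar>Im z + pi * a\<bar> < width" using z by linarith+
    then show "\<bar>Im (z - \<i> * pi * a)\<bar> < width" "\<bar>Im (z + \<i> * pi * a)\<bar> < width" by simp_all
  qed
  note int = integrable_qdilog_line[OF h abs_bypass_radius(1,2), folded d_def]
  have "qdilog_integral h (z - \<i> * pi * a) - qdilog_integral h (z + \<i> * pi * a)
     = (LINT x|lborel. qdilog_integrand h (z - \<i> * pi * a) (Complex x d) - qdilog_integrand h (z + \<i> * pi * a) (Complex x d))"
    unfolding qdilog_integral_line[OF w(1)] qdilog_integral_line[OF w(2)] d_def[symmetric]
    by (rule Bochner_Integration.integral_diff[symmetric]) (intro int w)+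
  also have "\<dots> = (LINT t|lborel. - 2 * (exp (- \<i> * Complex t d * z) / (sinh (of_real (pi * c) * Complex t d) * Complex t d)))"
  proof (intro Bochner_Integration.integral_cong refl)
    fix t
    define p where "p = Complex t d"
    have p: "p \<noteq> 0" "\<bar>Im p\<bar> < 1 / a" using d by (auto simp: p_def complex_eq_iff)
    note nz = sinh_pi_mult_nonzero[OF c(2) p(2,1)]
    define sa where "sa = sinh (of_real (pi * a) * p)"
    define sc where "sc = sinh (of_real (pi * c) * p)"
    have f: "qdilog_integrand h v p = exp (- \<i> * p * v) / (sa * sc) / p" for v
      using ac by (auto simp: qdilog_integrand_def sa_def sc_def mult_ac)
    have e1: "exp (- \<i> * p * (z - \<i> * pi * a)) = exp (- \<i> * p * z) * exp (- (of_real (pi * a) * p))"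
      by (simp add: exp_add[symmetric] algebra_simps)
    have e2: "exp (- \<i> * p * (z + \<i> * pi * a)) = exp (- \<i> * p * z) * exp (of_real (pi * a) * p)"
      by (simp add: exp_add[symmetric] algebra_simps)
    have "2 * sa = exp (of_real (pi * a) * p) - exp (- (of_real (pi * a) * p))"
      by (simp add: sa_def sinh_def scaleR_conv_of_real)
    then have e3: "exp (- (of_real (pi * a) * p)) - exp (of_real (pi * a) * p) = - 2 * sa" by simp
    have "qdilog_integrand h (z - \<i> * pi * a) p - qdilog_integrand h (z + \<i> * pi * a) p
       = exp (- \<i> * p * z) * (exp (- (of_real (pi * a) * p)) - exp (of_real (pi * a) * p)) / (sa * sc) / p"
      unfolding f e1 e2 by (simp add: diff_divide_distrib right_diff_distrib)
    also have "\<dots> = - 2 * (exp (- \<i> * p * z) / (sc * p))"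
      unfolding e3 using nz p(1) by (simp add: sa_def)
    finally show "qdilog_integrand h (z - \<i> * pi * a) (Complex t d) - qdilog_integrand h (z + \<i> * pi * a) (Complex t d)
      = - 2 * (exp (- \<i> * Complex t d * z) / (sinh (of_real (pi * c) * Complex t d) * Complex t d))"
      by (simp only: p_def sc_def)
  qed
  also have "\<dots> = - 2 * line_integral c d z"
    unfolding line_integral_def[OF c(1) d(1,2)] by (rule integral_mult_right_zero)
  finally have "- (1 / 4) * qdilog_integral h (z + \<i> * pi * a) = - (1 / 4) * qdilog_integral h (z - \<i> * pi * a) + - (line_integral c d z / 2)"
    by (simp add: algebra_simps)
  then show ?thesis
    unfolding qdilog_def using exp_line_integral[OF c(1) d(1,2) z] by (simp only: exp_add)
qed

end

section \<open>Intertwining relations\<close>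

text \<open>
  Writing \<open>X\<close> for multiplication by \<open>exp (a * s * x)\<close> and \<open>P\<close> for the shift \<open>f x \<mapsto> f (x + \<i> * s)\<close>,
  the five operators \<open>A1 = X\<close>, \<open>A2 = (1 + q X) P\<close>, \<open>A3 = X\<^sup>-\<^sup>1 + q\<^sup>-\<^sup>1 X\<^sup>-\<^sup>1 P + P\<close>,
  \<open>A4 = X\<^sup>-\<^sup>1 (1 + q P\<^sup>-\<^sup>1)\<close> and \<open>A0 = P\<^sup>-\<^sup>1\<close> are permuted cyclically by conjugation with \<open>K\<close>.
\<close>

locale quantum_dilogarithm =
  fixes a s w :: real and q :: complex and \<Phi> :: "complex \<Rightarrow> complex"
  assumes a: "a > 0" and s: "0 < s" and sw: "s < w"
    and q_def: "q = exp (\<i> * of_real (a * s\<^sup>2 / 2))"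
    and holo: "\<Phi> holomorphic_on {z. - w < Im z \<and> Im z < w}"
    and bound: "\<And>b. b < w \<Longrightarrow> \<exists>C. \<forall>z. \<bar>Im z\<bar> \<le> b \<longrightarrow> cmod (\<Phi> z) \<le> C * exp (a * Im z * max (Re z) 0)"
    and functional: "\<And>z. - w < Im z \<Longrightarrow> Im z < w - s \<Longrightarrow> \<Phi> (z + \<i> * s) = (1 + q * exp (of_real (a * s) * z)) * \<Phi> z"
    and unitary: "\<And>x. cmod (\<Phi> (of_real x)) = 1"
begin

section \<open>Decay on the strip and on the real line\<close>

definition strip :: "complex set" where "strip = {z. - w < Im z \<and> Im z < w}"

lemma w: "0 < w" using s sw by simp

lemma strip_Complex [simp]: "Complex x y \<in> strip \<longleftrightarrow> \<bar>y\<bar> < w"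
  by (auto simp: strip_def)

text \<open>The weight is chosen to be preserved by K. For x > 0 the modulus of \<Phi> at x + i y is
  at most of order exp (a x y), so multiplication by \<Phi> exchanges the growth allowed for y < 0
  for growth for y > 0, and the Fourier transform reverses this. The rate b runs through all values
  below w, since every estimate gives up a little of it.\<close>

definition decaying :: "(complex \<Rightarrow> complex) set" where
  "decaying = {f. f holomorphic_on strip \<and> (\<forall>b. 0 < b \<longrightarrow> b < w \<longrightarrow> (\<exists>C. \<forall>x y. \<bar>y\<bar> \<le> b \<longrightarrow>
     cmod (f (Complex x y)) \<le> C * exp (- a * b * \<bar>x\<bar> + a * max (- y) 0 * max x 0)))}"

text \<open>Exponential decay of unspecified rate on the real line: it ensures integrability, and
  the images under all five operators have it.\<close>

definition rapid :: "(real \<Rightarrow> complex) set" where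
  "rapid = {v. continuous_on UNIV v \<and> (\<exists>C d. d > 0 \<and> (\<forall>x. cmod (v x) \<le> C * exp (- d * \<bar>x\<bar>)))}"

lemma rapidI:
  "continuous_on UNIV v \<Longrightarrow> d > 0 \<Longrightarrow> (\<And>x. cmod (v x) \<le> C * exp (- d * \<bar>x\<bar>)) \<Longrightarrow> v \<in> rapid"
  unfolding rapid_def by blast

lemma rapid_integrable: "v \<in> rapid \<Longrightarrow> integrable lborel v"
  unfolding rapid_def using integrable_exp_bound by blast

lemma rapid_bounded:
  assumes "v \<in> rapid"
  obtains C where "\<And>x. cmod (v x) \<le> C"
proof -
  obtain C d where *: "d > 0" "\<And>x. cmod (v x) \<le> C * exp (- d * \<bar>x\<bar>)"
    using assms by (auto simp: rapid_def)
  have "0 \<le> C" using order_trans[OF norm_ge_zero *(2)[of 0]] by simp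
  then have "C * exp (- d * \<bar>x\<bar>) \<le> C * 1" for x
    using *(1) by (intro mult_left_mono) auto
  then show ?thesis using that[of C] *(2) order_trans by fastforce
qed

lemma rapid_square_integrable:
  assumes "v \<in> rapid"
  shows "square_integrable v"
proof -
  obtain C where C: "\<And>x. cmod (v x) \<le> C" using rapid_bounded[OF assms] by blast
  have C0: "0 \<le> C" using order_trans[OF norm_ge_zero C[of 0]] .
  note i = rapid_integrable[OF assms]
  note [measurable] = borel_measurable_integrable[OF i, simplified]
  have "integrable lborel (\<lambda>x. (cmod (v x))\<^sup>2)"
    by (rule Bochner_Integration.integrable_bound[OF integrable_mult_right[OF i, of "of_real C"]])
       (use C0 in \<open>auto simp: norm_mult power2_eq_square intro!: mult_right_mono C\<close>)
  then show ?thesis by (simp add: square_integrable_def)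
qed

lemma rapid_add:
  assumes "u \<in> rapid" "v \<in> rapid"
  shows "(\<lambda>x. u x + v x) \<in> rapid"
proof -
  obtain C d where u: "d > 0" "\<And>x. cmod (u x) \<le> C * exp (- d * \<bar>x\<bar>)"
    using assms by (auto simp: rapid_def)
  obtain D e where v: "e > 0" "\<And>x. cmod (v x) \<le> D * exp (- e * \<bar>x\<bar>)"
    using assms by (auto simp: rapid_def)
  have C0: "0 \<le> C" "0 \<le> D" using order_trans[OF norm_ge_zero u(2)[of 0]] order_trans[OF norm_ge_zero v(2)[of 0]] by simp_all
  have "cmod (u x + v x) \<le> (C + D) * exp (- min d e * \<bar>x\<bar>)" for x
  proof -
    have "cmod (u x + v x) \<le> C * exp (- d * \<bar>x\<bar>) + D * exp (- e * \<bar>x\<bar>)"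
      using norm_triangle_ineq[of "u x" "v x"] u(2)[of x] v(2)[of x] by linarith
    also have "\<dots> \<le> C * exp (- min d e * \<bar>x\<bar>) + D * exp (- min d e * \<bar>x\<bar>)"
      using C0 by (intro add_mono mult_left_mono) (auto intro!: mult_right_mono)
    finally show ?thesis by (simp add: algebra_simps)
  qed
  moreover have "min d e > 0" using u v by simp
  moreover have "continuous_on UNIV (\<lambda>x. u x + v x)"
    using assms by (auto simp: rapid_def intro!: continuous_intros)
  ultimately show ?thesis by (intro rapidI)
qed

lemma rapid_cmult:
  assumes "u \<in> rapid" shows "(\<lambda>x. c * u x) \<in> rapid"
proof -
  obtain C d where u: "d > 0" "\<And>x. cmod (u x) \<le> C * exp (- d * \<bar>x\<bar>)" "continuous_on UNIV u"
    using assms by (auto simp: rapid_def)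
  have "cmod (c * u x) \<le> (cmod c * C) * exp (- d * \<bar>x\<bar>)" for x
    using mult_left_mono[OF u(2)[of x], of "cmod c"] by (simp add: norm_mult mult.assoc)
  then show ?thesis using u(1,3) by (auto simp: rapid_def intro!: continuous_intros)
qed

lemma continuous_on_real_strip:
  assumes "f holomorphic_on strip" "\<And>x. \<bar>c\<bar> < w"
  shows "continuous_on UNIV (\<lambda>x. f (Complex x c))"
  by (rule continuous_on_compose2[OF holomorphic_on_imp_continuous_on[OF assms(1)]])
     (use assms(2) in \<open>auto intro!: continuous_intros\<close>)

lemma Phi_continuous: "continuous_on UNIV (\<lambda>x. \<Phi> (of_real x))"
  using continuous_on_real_strip[of \<Phi> 0] holo w
  by (simp add: strip_def complex_of_real_def)

lemma rapid_Phi: 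
  assumes "v \<in> rapid" shows "(\<lambda>x. \<Phi> (of_real x) * v x) \<in> rapid"
  using assms by (auto simp: rapid_def norm_mult unitary intro!: continuous_intros Phi_continuous)

text \<open>K before normalisation, as a function of a complex argument; if v is the restriction of
  a decaying function, it is holomorphic in the strip.\<close>

definition kop :: "(real \<Rightarrow> complex) \<Rightarrow> complex \<Rightarrow> complex" where
  "kop v z = fourier a (\<lambda>x. \<Phi> (of_real x) * v x) z"

definition restrict :: "(complex \<Rightarrow> complex) \<Rightarrow> real \<Rightarrow> complex" where
  "restrict u x = u (of_real x)"

lemma decaying_bound:
  assumes "u \<in> decaying" "0 < b" "b < w"
  obtains C where "0 \<le> C" "\<And>x y. \<bar>y\<bar> \<le> b \<Longrightarrow>
     cmod (u (Complex x y)) \<le> C * exp (- a * b * \<bar>x\<bar> + a * max (- y) 0 * max x 0)"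
proof -
  obtain C where C: "\<And>x y. \<bar>y\<bar> \<le> b \<Longrightarrow>
     cmod (u (Complex x y)) \<le> C * exp (- a * b * \<bar>x\<bar> + a * max (- y) 0 * max x 0)"
    using assms unfolding decaying_def by blast
  have "0 \<le> C" using order_trans[OF norm_ge_zero C[of 0 0]] assms(2) by simp
  then show ?thesis using C that by blast
qed

lemma Phi_decaying_bound:
  assumes "u \<in> decaying" "0 < b" "b < w"
  obtains C where "0 \<le> C" "\<And>x y. \<bar>y\<bar> \<le> b \<Longrightarrow>
     cmod (\<Phi> (Complex x y) * u (Complex x y)) \<le> C * exp (- a * b * \<bar>x\<bar> + a * max y 0 * max x 0)"
proof -
  obtain C where C: "0 \<le> C" "\<And>x y. \<bar>y\<bar> \<le> b \<Longrightarrow>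
     cmod (u (Complex x y)) \<le> C * exp (- a * b * \<bar>x\<bar> + a * max (- y) 0 * max x 0)"
    using decaying_bound[OF assms] by blast
  obtain D where D: "\<And>z. \<bar>Im z\<bar> \<le> b \<Longrightarrow> cmod (\<Phi> z) \<le> D * exp (a * Im z * max (Re z) 0)"
    using bound[OF assms(3)] by blast
  have D0: "0 \<le> D" using order_trans[OF norm_ge_zero D[of 0]] assms(2) by simp
  have "cmod (\<Phi> (Complex x y) * u (Complex x y)) \<le> (D * C) * exp (- a * b * \<bar>x\<bar> + a * max y 0 * max x 0)"
    if y: "\<bar>y\<bar> \<le> b" for x y
  proof -
    have "cmod (\<Phi> (Complex x y) * u (Complex x y)) \<le> (D * exp (a * y * max x 0)) * (C * exp (- a * b * \<bar>x\<bar> + a * max (- y) 0 * max x 0))"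
      unfolding norm_mult using D[of "Complex x y"] C D0 y by (intro mult_mono) auto
    also have "\<dots> = (D * C) * (exp (a * y * max x 0) * exp (- a * b * \<bar>x\<bar> + a * max (- y) 0 * max x 0))"
      by (simp add: mult_ac)
    also have "exp (a * y * max x 0) * exp (- a * b * \<bar>x\<bar> + a * max (- y) 0 * max x 0) = exp (- a * b * \<bar>x\<bar> + a * max y 0 * max x 0)"
      by (simp add: exp_add[symmetric] max_def algebra_simps)
    finally show ?thesis .
  qed
  then show ?thesis using that[of "D * C"] C(1) D0 by auto
qed

section \<open>Contour shifts and the invariance of the decaying functions\<close>

lemma fourier_shift:
  fixes g :: "complex \<Rightarrow> complex"
  assumes g: "g holomorphic_on {z. lo < Im z \<and> Im z < hi}" and t: "lo < 0" "0 < hi" "lo < t" "t < hi"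
    and d: "d > 0"
    and bd: "\<And>x y. y \<in> {min 0 t..max 0 t} \<Longrightarrow> cmod (g (Complex x y) * exp (\<i> * of_real a * Complex x y * z)) \<le> C * exp (- d * \<bar>x\<bar>)"
  shows "fourier a (restrict g) z = exp (- (of_real (a * t) * z)) * fourier a (\<lambda>x. g (Complex x t)) z"
proof -
  define f where "f p = g p * exp (\<i> * of_real a * p * z)" for p
  have holo: "f holomorphic_on {z. lo < Im z \<and> Im z < hi}"
    unfolding f_def by (intro holomorphic_intros g)
  have "(LINT x|lborel. f (Complex x 0)) = (LINT x|lborel. f (Complex x t))"
  proof (cases "0 \<le> t")
    case True
    show ?thesis
      by (rule integral_strip_shift[OF t(1) True t(4) d holo]) (use bd True in \<open>simp add: f_def\<close>)
  next
    case False
    then have "t \<le> 0" by simp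
    show ?thesis
      by (rule integral_strip_shift[OF t(3) \<open>t \<le> 0\<close> t(2) d holo, symmetric]) (use bd False in \<open>simp add: f_def\<close>)
  qed
  also have "(\<lambda>x. f (Complex x t)) = (\<lambda>x. exp (- (of_real (a * t) * z)) * (g (Complex x t) * exp (\<i> * of_real (a * x) * z)))"
  proof
    fix x
    have "\<i> * of_real a * Complex x t * z = - (of_real (a * t) * z) + \<i> * of_real (a * x) * z"
      by (simp add: Complex_eq algebra_simps)
    then have "exp (\<i> * of_real a * Complex x t * z) = exp (- (of_real (a * t) * z)) * exp (\<i> * of_real (a * x) * z)"
      by (simp only: exp_add)
    then show "f (Complex x t) = exp (- (of_real (a * t) * z)) * (g (Complex x t) * exp (\<i> * of_real (a * x) * z))"
      by (simp add: f_def)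
  qed
  also have "(LINT x|lborel. f (Complex x 0)) = fourier a (restrict g) z"
    by (simp add: f_def fourier_def restrict_def complex_of_real_def mult.assoc flip: complex_of_real_def)
  finally show ?thesis by (simp add: fourier_def)
qed

lemma exp_i_line:
  "cmod (exp (\<i> * of_real a * Complex x y * z)) = exp (- a * y * Re z) * exp (- a * x * Im z)"
  by (simp add: exp_add[symmetric] algebra_simps)

lemma kop_holomorphic:
  assumes u: "u \<in> decaying"
  shows "kop (restrict u) holomorphic_on strip"
proof (rule holomorphic_onI, rule field_differentiable_at_within)
  fix z assume z: "z \<in> strip"
  define b where "b = (\<bar>Im z\<bar> + w) / 2"
  have b: "\<bar>Im z\<bar> < b" "b < w" "0 < b" using z by (auto simp: strip_def b_def)
  define e where "e = a * (b - \<bar>Im z\<bar>) / 2"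
  have e: "e > 0" using a b by (simp add: e_def)
  obtain C where C: "0 \<le> C" "\<And>x y. \<bar>y\<bar> \<le> b \<Longrightarrow>
     cmod (\<Phi> (Complex x y) * u (Complex x y)) \<le> C * exp (- a * b * \<bar>x\<bar> + a * max y 0 * max x 0)"
    using Phi_decaying_bound[OF u b(3,2)] by blast
  define g where "g x = \<Phi> (of_real x) * u (of_real x)" for x
  have g: "cmod (g x) \<le> C * exp (- a * b * \<bar>x\<bar>)" for x
    using C(2)[of 0 x] b by (simp add: g_def complex_of_real_def)
  have gm [measurable]: "g \<in> borel_measurable borel"
  proof (rule borel_measurable_continuous_onI)
    have "u holomorphic_on strip" using u by (simp add: decaying_def)
    from continuous_on_real_strip[OF this, of 0] w
    have "continuous_on UNIV (\<lambda>x. u (of_real x))" by (simp add: complex_of_real_def)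
    then show "continuous_on UNIV g" unfolding g_def by (intro continuous_intros Phi_continuous)
  qed
  have "integrable lborel (\<lambda>t. of_real (cmod (g t) * exp (Re (\<i> * a * t * z) + e * \<bar>t\<bar>)) :: complex)"
  proof (rule integrable_real_exp_bound[OF _ e, of _ C])
    fix t :: real
    have "Re (\<i> * a * t * z) \<le> a * \<bar>Im z\<bar> * \<bar>t\<bar>"
      using abs_ge_minus_self[of "a * t * Im z"] a by (simp add: abs_mult mult_ac)
    then have "exp (Re (\<i> * a * t * z) + e * \<bar>t\<bar>) \<le> exp (a * \<bar>Im z\<bar> * \<bar>t\<bar> + e * \<bar>t\<bar>)" by simp
    then have "cmod (g t) * exp (Re (\<i> * a * t * z) + e * \<bar>t\<bar>)
       \<le> (C * exp (- a * b * \<bar>t\<bar>)) * exp (a * \<bar>Im z\<bar> * \<bar>t\<bar> + e * \<bar>t\<bar>)"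
      using g C(1) by (intro mult_mono) auto
    also have "\<dots> = C * exp (- e * \<bar>t\<bar>)"
    proof -
      have "2 * e = a * (b - \<bar>Im z\<bar>)" by (simp add: e_def)
      then have "a * b = a * \<bar>Im z\<bar> + 2 * e" by (simp add: algebra_simps)
      then have "- (a * b) * \<bar>t\<bar> + (a * \<bar>Im z\<bar> * \<bar>t\<bar> + e * \<bar>t\<bar>) = - e * \<bar>t\<bar>"
        by (simp add: algebra_simps)
      then show ?thesis by (simp add: mult.assoc exp_add[symmetric])
    qed
    finally show "cmod (of_real (cmod (g t) * exp (Re (\<i> * a * t * z) + e * \<bar>t\<bar>)) :: complex) \<le> C * exp (- e * \<bar>t\<bar>)"
      by (simp add: norm_mult)
  qed measurable
  then have "integrable lborel (\<lambda>t. cmod (g t) * exp (Re (\<i> * a * t * z) + e * \<bar>t\<bar>))"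
    by (simp only: complex_of_real_integrable_eq)
  from integral_exp_has_derivative(1)[OF gm e this]
  show "kop (restrict u) field_differentiable at z"
    by (auto simp: field_differentiable_def kop_def[abs_def] fourier_def g_def restrict_def mult.assoc[of \<i>])
qed

text \<open>Moving the contour to height t extracts the factor exp (- a t X); t is taken as high as
  possible for X \<ge> 0 and as low as possible for X < 0. The upper limit for t depends on Y
  through the growth of \<Phi> in the upper half strip, and this dependence is exactly the second
  term of the weight.\<close>

lemma kop_decaying:
  assumes u: "u \<in> decaying"
  shows "kop (restrict u) \<in> decaying"
  unfolding decaying_def
proof (intro CollectI conjI kop_holomorphic[OF u] allI impI)
  fix b assume b: "0 < b" "b < w"
  \<comment> \<open>The hypothesis on u is used at a rate between b and w; the surplus d makes the
    integrals converge.\<close>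
  define b2 where "b2 = (b + w) / 2"
  have b2: "b < b2" "b2 < w" "0 < b2" using b by (auto simp: b2_def)
  define d where "d = a * (b2 - b)"
  have d: "d > 0" using a b2 by (simp add: d_def)
  obtain C where C: "0 \<le> C" "\<And>x y. \<bar>y\<bar> \<le> b2 \<Longrightarrow>
     cmod (\<Phi> (Complex x y) * u (Complex x y)) \<le> C * exp (- a * b2 * \<bar>x\<bar> + a * max y 0 * max x 0)"
    using Phi_decaying_bound[OF u b2(3,2)] by blast
  define g where "g z = \<Phi> z * u z" for z
  have g: "g holomorphic_on {z. - w < Im z \<and> Im z < w}"
    unfolding g_def using holo u by (intro holomorphic_intros) (simp_all add: decaying_def strip_def)
  \<comment> \<open>|Y| \<le> b controls the integrand for x < 0, and the bound on
    \<open>max y 0 - Y\<close> controls it for x > 0, where the product of \<Phi> and u may grow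
    with y.\<close>
  have core: "cmod (g (Complex x y)) * exp (- a * x * Y) \<le> C * exp (- d * \<bar>x\<bar>)"
    if "\<bar>y\<bar> \<le> b" "\<bar>Y\<bar> \<le> b" "max y 0 - Y \<le> b" for x y Y
  proof -
    have "cmod (g (Complex x y)) * exp (- a * x * Y) \<le> (C * exp (- a * b2 * \<bar>x\<bar> + a * max y 0 * max x 0)) * exp (- a * x * Y)"
      unfolding g_def using C(2)[of y x] that b2 by (intro mult_right_mono) auto
    also have "\<dots> = C * exp (- a * b2 * \<bar>x\<bar> + a * max y 0 * max x 0 - a * x * Y)"
      by (simp add: mult.assoc exp_add[symmetric])
    also have "- a * b2 * \<bar>x\<bar> + a * max y 0 * max x 0 - a * x * Y \<le> - d * \<bar>x\<bar>"
    proof (cases "0 \<le> x")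
      case True
      have "a * x * (max y 0 - Y) \<le> a * x * b"
        using that(3) a True by (intro mult_left_mono) auto
      then show ?thesis using True by (simp add: d_def algebra_simps)
    next
      case False
      have "(a * (- x)) * Y \<le> (a * (- x)) * b"
        using that(2) a False by (intro mult_left_mono) (auto simp: mult_le_0_iff)
      then show ?thesis using False by (simp add: d_def algebra_simps)
    qed
    then have "C * exp (- a * b2 * \<bar>x\<bar> + a * max y 0 * max x 0 - a * x * Y) \<le> C * exp (- d * \<bar>x\<bar>)"
      using C(1) by (intro mult_left_mono) simp_all
    finally show ?thesis .
  qed
  define D where "D = C * (LINT x|lborel. exp (- d * \<bar>x\<bar>))"
  have main: "cmod (kop (restrict u) (Complex X Y)) \<le> exp (- a * t * X) * D"
    if t: "\<bar>t\<bar> \<le> b" and Y: "\<bar>Y\<bar> \<le> b" and tY: "max t 0 - Y \<le> b" for X Y t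
  proof -
    have "fourier a (restrict g) (Complex X Y) = exp (- (of_real (a * t) * Complex X Y)) * fourier a (\<lambda>x. g (Complex x t)) (Complex X Y)"
    proof (rule fourier_shift[OF g _ _ _ _ d])
      fix x y assume y: "y \<in> {min 0 t..max 0 t}"
      have yb: "\<bar>y\<bar> \<le> b" using y t by auto
      have "max y 0 - Y \<le> b" using y tY by auto
      note cr = core[OF yb Y this, of x]
      have "exp (- a * y * X) * (cmod (g (Complex x y)) * exp (- a * x * Y)) \<le> exp (a * b * \<bar>X\<bar>) * (C * exp (- d * \<bar>x\<bar>))"
      proof (rule mult_mono[OF _ cr])
        have "(- y) * X \<le> \<bar>y\<bar> * \<bar>X\<bar>" using abs_ge_self[of "(- y) * X"] by (simp add: abs_mult)
        also have "\<dots> \<le> b * \<bar>X\<bar>" using yb by (intro mult_right_mono) auto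
        finally have "a * ((- y) * X) \<le> a * (b * \<bar>X\<bar>)" using a by (intro mult_left_mono) auto
        then show "exp (- a * y * X) \<le> exp (a * b * \<bar>X\<bar>)" by simp
      qed auto
      then show "cmod (g (Complex x y) * exp (\<i> * of_real a * Complex x y * Complex X Y)) \<le> (exp (a * b * \<bar>X\<bar>) * C) * exp (- d * \<bar>x\<bar>)"
        unfolding norm_mult exp_i_line by (simp add: mult_ac)
    qed (use w b t in auto)
    moreover have "cmod (fourier a (\<lambda>x. g (Complex x t)) (Complex X Y)) \<le> D"
      unfolding fourier_def D_def integral_mult_right_zero[symmetric]
    proof (rule Bochner_Integration.integral_norm_bound_integral)
      have gt: "cmod (g (Complex x t) * exp (\<i> * of_real (a * x) * Complex X Y)) \<le> C * exp (- d * \<bar>x\<bar>)" for x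
        using core[OF t Y tY, of x] by (simp add: norm_mult)
      then show "cmod (g (Complex x t) * exp (\<i> * of_real (a * x) * Complex X Y)) \<le> C * exp (- d * \<bar>x\<bar>)" for x .
      have "continuous_on UNIV (\<lambda>x. g (Complex x t))"
        by (rule continuous_on_real_strip) (use g t b in \<open>auto simp: strip_def\<close>)
      then show "integrable lborel (\<lambda>x. g (Complex x t) * exp (\<i> * of_real (a * x) * Complex X Y))"
        by (intro integrable_exp_bound[OF _ d gt] continuous_intros)
      show "integrable lborel (\<lambda>x. C * exp (- d * \<bar>x\<bar>))"
        by (intro integrable_mult_right integrable_exp_minus_abs d)
    qed
    moreover have "kop (restrict u) (Complex X Y) = fourier a (restrict g) (Complex X Y)"
      by (simp add: kop_def restrict_def[abs_def] g_def)
    ultimately show ?thesis by (simp add: norm_mult mult_left_mono)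
  qed
  have "cmod (kop (restrict u) (Complex X Y)) \<le> D * exp (- a * b * \<bar>X\<bar> + a * max (- Y) 0 * max X 0)" if Y: "\<bar>Y\<bar> \<le> b" for X Y
  proof (cases "0 \<le> X")
    case True
    \<comment> \<open>The largest t with t \<le> b and t - Y \<le> b.\<close>
    have "cmod (kop (restrict u) (Complex X Y)) \<le> exp (- a * (b - max (- Y) 0) * X) * D"
      by (rule main) (use Y b in auto)
    also have "- a * (b - max (- Y) 0) * X = - a * b * \<bar>X\<bar> + a * max (- Y) 0 * max X 0"
      using True by (simp add: algebra_simps)
    finally show ?thesis by (simp add: mult.commute)
  next
    case False
    have "cmod (kop (restrict u) (Complex X Y)) \<le> exp (- a * (- b) * X) * D"
      by (rule main) (use Y b in auto)
    also have "- a * (- b) * X = - a * b * \<bar>X\<bar> + a * max (- Y) 0 * max X 0"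
      using False by simp
    finally show ?thesis by (simp add: mult.commute)
  qed
  then show "\<exists>C. \<forall>x y. \<bar>y\<bar> \<le> b \<longrightarrow> cmod (kop (restrict u) (Complex x y)) \<le> C * exp (- a * b * \<bar>x\<bar> + a * max (- y) 0 * max x 0)"
    by blast
qed

definition ex :: "complex \<Rightarrow> complex" where "ex p = exp (of_real (a * s) * p)"

lemma ex_nonzero [simp]: "ex p \<noteq> 0" by (simp add: ex_def)

lemma q_nonzero [simp]: "q \<noteq> 0" by (simp add: q_def)

lemma norm_ex [simp]: "cmod (ex (Complex x y)) = exp (a * s * x)" by (simp add: ex_def)

lemma norm_ex_real [simp]: "cmod (ex (of_real x)) = exp (a * s * x)" by (simp add: ex_def)

lemma ex_up: "ex (Complex x s) = q\<^sup>2 * ex (of_real x)"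
proof -
  have "of_real (a * s) * Complex x s = 2 * (\<i> * of_real (a * s\<^sup>2 / 2)) + of_real (a * s) * of_real x"
    by (simp add: complex_eq_iff power2_eq_square)
  then have "ex (Complex x s) = exp (2 * (\<i> * of_real (a * s\<^sup>2 / 2))) * ex (of_real x)"
    by (simp only: ex_def exp_add)
  also have "exp (2 * (\<i> * of_real (a * s\<^sup>2 / 2))) = q\<^sup>2"
    unfolding q_def by (rule exp_double)
  finally show ?thesis .
qed

lemma ex_down: "ex (Complex x (- s)) = ex (of_real x) / q\<^sup>2"
proof -
  have "of_real (a * s) * of_real x = 2 * (\<i> * of_real (a * s\<^sup>2 / 2)) + of_real (a * s) * Complex x (- s)"
    by (simp add: complex_eq_iff power2_eq_square)
  then have "ex (of_real x) = exp (2 * (\<i> * of_real (a * s\<^sup>2 / 2))) * ex (Complex x (- s))"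
    by (simp only: ex_def exp_add)
  also have "exp (2 * (\<i> * of_real (a * s\<^sup>2 / 2))) = q\<^sup>2"
    unfolding q_def by (rule exp_double)
  finally show ?thesis by simp
qed

lemma Phi_up: "\<Phi> (Complex x s) = (1 + q * ex (of_real x)) * \<Phi> (of_real x)"
proof -
  have "Complex x s = of_real x + \<i> * s" by (simp add: complex_eq_iff)
  then show ?thesis using functional[of "of_real x"] sw s by (simp add: ex_def)
qed

lemma Phi_down: "\<Phi> (of_real x) = (1 + ex (of_real x) / q) * \<Phi> (Complex x (- s))"
proof -
  have "of_real x = Complex x (- s) + \<i> * s" by (simp add: complex_eq_iff)
  moreover have "\<Phi> (Complex x (- s) + \<i> * s) = (1 + q * ex (Complex x (- s))) * \<Phi> (Complex x (- s))"
    using functional[of "Complex x (- s)"] sw s by (simp add: ex_def)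
  ultimately show ?thesis by (simp add: ex_down power2_eq_square)
qed

lemma fourier_shift_real:
  fixes g :: "complex \<Rightarrow> complex"
  assumes g: "g holomorphic_on strip" and t: "\<bar>t\<bar> < w"
    and d: "d > 0"
    and bd: "\<And>x y. y \<in> {min 0 t..max 0 t} \<Longrightarrow> cmod (g (Complex x y)) \<le> C * exp (- d * \<bar>x\<bar>)"
  shows "exp (of_real (a * t) * of_real z) * fourier a (restrict g) (of_real z) = fourier a (\<lambda>x. g (Complex x t)) (of_real z)"
proof -
  have "fourier a (restrict g) (of_real z) = exp (- (of_real (a * t) * of_real z)) * fourier a (\<lambda>x. g (Complex x t)) (of_real z)"
  proof (rule fourier_shift[of _ "- w" w, OF _ _ _ _ _ d])
    fix x y assume y: "y \<in> {min 0 t..max 0 t}"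
    have "(- y) * z \<le> \<bar>y\<bar> * \<bar>z\<bar>" using abs_ge_self[of "(- y) * z"] by (simp add: abs_mult)
    also have "\<dots> \<le> \<bar>t\<bar> * \<bar>z\<bar>" using y by (intro mult_right_mono) auto
    finally have "a * ((- y) * z) \<le> a * (\<bar>t\<bar> * \<bar>z\<bar>)" using a by (intro mult_left_mono) auto
    then have "exp (- a * y * z) \<le> exp (a * \<bar>t\<bar> * \<bar>z\<bar>)" by simp
    from mult_mono[OF bd[OF y] this, of x]
    show "cmod (g (Complex x y) * exp (\<i> * of_real a * Complex x y * of_real z)) \<le> (C * exp (a * \<bar>t\<bar> * \<bar>z\<bar>)) * exp (- d * \<bar>x\<bar>)"
      using order_trans[OF norm_ge_zero bd[OF y]] unfolding norm_mult exp_i_line by (simp add: mult_ac)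
  qed (use g w t in \<open>auto simp: strip_def\<close>)
  then show ?thesis by (simp add: exp_minus)
qed

section \<open>The five operators and their estimates\<close>

definition A0 :: "(complex \<Rightarrow> complex) \<Rightarrow> real \<Rightarrow> complex" where
  "A0 u x = u (Complex x (- s))"

definition A1 :: "(complex \<Rightarrow> complex) \<Rightarrow> real \<Rightarrow> complex" where
  "A1 u x = ex (of_real x) * u (of_real x)"

definition A2 :: "(complex \<Rightarrow> complex) \<Rightarrow> real \<Rightarrow> complex" where
  "A2 u x = u (Complex x s) + q * (ex (of_real x) * u (Complex x s))"

definition A3 :: "(complex \<Rightarrow> complex) \<Rightarrow> real \<Rightarrow> complex" where
  "A3 u x = u (of_real x) / ex (of_real x) + (1 / q * (u (Complex x s) / ex (of_real x)) + u (Complex x s))"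

definition A4 :: "(complex \<Rightarrow> complex) \<Rightarrow> real \<Rightarrow> complex" where
  "A4 u x = u (of_real x) / ex (of_real x) + q * (u (Complex x (- s)) / ex (of_real x))"

lemma ex_holomorphic [holomorphic_intros]: "f holomorphic_on U \<Longrightarrow> (\<lambda>p. ex (f p)) holomorphic_on U"
  unfolding ex_def by (intro holomorphic_intros)

lemma decaying_holomorphic: "u \<in> decaying \<Longrightarrow> u holomorphic_on strip"
  by (simp add: decaying_def)

lemma Phi_holomorphic: "\<Phi> holomorphic_on strip"
  using holo by (simp add: strip_def)

text \<open>Because s < w, a rate strictly between a s and a w is available. Its excess over a s is
  the rate d that survives a factor \<open>ex\<close> or its inverse, of modulus exp (a s x) or exp
  (- a s x), or a shift by s.\<close>

lemma shift_bounds: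
  assumes u: "u \<in> decaying"
  obtains C d where "0 \<le> C" "d > 0"
    and "\<And>x y. \<bar>y\<bar> \<le> s \<Longrightarrow> cmod (u (Complex x y)) \<le> C * exp (- (d + a * s) * \<bar>x\<bar> + a * max (- y) 0 * max x 0)"
    and "\<And>x y. \<bar>y\<bar> \<le> s \<Longrightarrow> cmod (\<Phi> (Complex x y) * u (Complex x y)) \<le> C * exp (- (d + a * s) * \<bar>x\<bar> + a * max y 0 * max x 0)"
proof -
  define b where "b = (s + w) / 2"
  have b: "s < b" "b < w" "0 < b" using s sw by (auto simp: b_def)
  define d where "d = a * (b - s)"
  have d: "d > 0" "- a * b = - (d + a * s)" using a b by (simp_all add: d_def algebra_simps)
  obtain C1 where C1: "0 \<le> C1" "\<And>x y. \<bar>y\<bar> \<le> b \<Longrightarrow>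
     cmod (u (Complex x y)) \<le> C1 * exp (- a * b * \<bar>x\<bar> + a * max (- y) 0 * max x 0)"
    using decaying_bound[OF u b(3,2)] by blast
  obtain C2 where C2: "0 \<le> C2" "\<And>x y. \<bar>y\<bar> \<le> b \<Longrightarrow>
     cmod (\<Phi> (Complex x y) * u (Complex x y)) \<le> C2 * exp (- a * b * \<bar>x\<bar> + a * max y 0 * max x 0)"
    using Phi_decaying_bound[OF u b(3,2)] by blast
  show ?thesis
  proof (rule that[of "C1 + C2" d])
    fix x y :: real assume y: "\<bar>y\<bar> \<le> s"
    then have yb: "\<bar>y\<bar> \<le> b" using b by simp
    show "cmod (u (Complex x y)) \<le> (C1 + C2) * exp (- (d + a * s) * \<bar>x\<bar> + a * max (- y) 0 * max x 0)"
      by (rule order_trans[OF C1(2)[OF yb, of x, unfolded d(2)] mult_right_mono]) (use C2(1) in auto)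
    show "cmod (\<Phi> (Complex x y) * u (Complex x y)) \<le> (C1 + C2) * exp (- (d + a * s) * \<bar>x\<bar> + a * max y 0 * max x 0)"
      by (rule order_trans[OF C2(2)[OF yb, of x, unfolded d(2)] mult_right_mono]) (use C1(1) in auto)
  qed (use C1 C2 d in auto)
qed

lemma exponent_bound:
  fixes A B C N d x :: real
  assumes "0 \<le> C" "N \<le> C * exp A" "A + B \<le> - d * \<bar>x\<bar>" "0 \<le> N"
  shows "exp B * N \<le> C * exp (- d * \<bar>x\<bar>)"
proof -
  have "exp B * N \<le> exp B * (C * exp A)" using assms by (intro mult_left_mono) auto
  also have "\<dots> = C * exp (A + B)" by (simp add: exp_add)
  also have "\<dots> \<le> C * exp (- d * \<bar>x\<bar>)" using assms by (intro mult_left_mono) auto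
  finally show ?thesis .
qed

text \<open>The combinations that occur. Where a growth term a y x is present, \<open>ex\<close>
  appears at most as a divisor, which counteracts the growth; a factor \<open>ex\<close> appears
  only where the growth term is absent.\<close>

lemma exponents:
  fixes d x y :: real
  assumes "0 \<le> y" "y \<le> s"
  shows "- (d + a * s) * \<bar>x\<bar> + a * y * max x 0 + 0 \<le> - d * \<bar>x\<bar>"
    and "- (d + a * s) * \<bar>x\<bar> + a * y * max x 0 + (- (a * s * x)) \<le> - d * \<bar>x\<bar>"
    and "- (d + a * s) * \<bar>x\<bar> + a * 0 * max x 0 + a * s * x \<le> - d * \<bar>x\<bar>"
    and "- (d + a * s) * \<bar>x\<bar> + a * 0 * max x 0 + (- (a * s * x)) \<le> - d * \<bar>x\<bar>"
    and "- (d + a * s) * \<bar>x\<bar> + a * 0 * max x 0 + 0 \<le> - d * \<bar>x\<bar>"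
proof -
  have p: "0 \<le> a * s * \<bar>x\<bar>" using a s by simp
  have ys: "a * y * max x 0 \<le> a * s * max x 0"
    using assms a by (intro mult_right_mono mult_left_mono) auto
  have e: "- (d + a * s) * \<bar>x\<bar> = - d * \<bar>x\<bar> - a * s * \<bar>x\<bar>" by (simp add: algebra_simps)
  have m: "a * s * max x 0 \<le> a * s * \<bar>x\<bar>" "a * s * x \<le> a * s * \<bar>x\<bar>" "- (a * s * x) \<le> a * s * \<bar>x\<bar>" "a * s * max x 0 - a * s * x \<le> a * s * \<bar>x\<bar>"
    using a s by (auto simp: max_def abs_if mult_le_0_iff zero_le_mult_iff)
  show "- (d + a * s) * \<bar>x\<bar> + a * y * max x 0 + 0 \<le> - d * \<bar>x\<bar>"
    "- (d + a * s) * \<bar>x\<bar> + a * y * max x 0 + (- (a * s * x)) \<le> - d * \<bar>x\<bar>"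
    "- (d + a * s) * \<bar>x\<bar> + a * 0 * max x 0 + a * s * x \<le> - d * \<bar>x\<bar>"
    "- (d + a * s) * \<bar>x\<bar> + a * 0 * max x 0 + (- (a * s * x)) \<le> - d * \<bar>x\<bar>"
    "- (d + a * s) * \<bar>x\<bar> + a * 0 * max x 0 + 0 \<le> - d * \<bar>x\<bar>"
    unfolding e using p ys m by auto
qed

lemma pieces_rapid:
  assumes u: "u \<in> decaying"
  shows "(\<lambda>x. u (of_real x)) \<in> rapid" "(\<lambda>x. ex (of_real x) * u (of_real x)) \<in> rapid"
    "(\<lambda>x. u (of_real x) / ex (of_real x)) \<in> rapid"
    "(\<lambda>x. u (Complex x s)) \<in> rapid" "(\<lambda>x. ex (of_real x) * u (Complex x s)) \<in> rapid"
    "(\<lambda>x. u (Complex x s) / ex (of_real x)) \<in> rapid"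
    "(\<lambda>x. u (Complex x (- s))) \<in> rapid" "(\<lambda>x. u (Complex x (- s)) / ex (of_real x)) \<in> rapid"
proof -
  obtain C d where C: "0 \<le> C" and d: "d > 0"
    and b: "\<And>x y. \<bar>y\<bar> \<le> s \<Longrightarrow> cmod (u (Complex x y)) \<le> C * exp (- (d + a * s) * \<bar>x\<bar> + a * max (- y) 0 * max x 0)"
    and "\<And>x y. \<bar>y\<bar> \<le> s \<Longrightarrow> cmod (\<Phi> (Complex x y) * u (Complex x y)) \<le> C * exp (- (d + a * s) * \<bar>x\<bar> + a * max y 0 * max x 0)"
    by (rule shift_bounds[OF u]) (rule that)
  note uh = decaying_holomorphic[OF u]
  have cont: "continuous_on UNIV (\<lambda>x. u (Complex x y))" if "\<bar>y\<bar> < w" for y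
    by (rule continuous_on_real_strip[OF uh that])
  have cex: "continuous_on UNIV (\<lambda>x. ex (of_real x))" unfolding ex_def by (intro continuous_intros)
  have cs: "continuous_on UNIV (\<lambda>x. u (Complex x s))" "continuous_on UNIV (\<lambda>x. u (Complex x (- s)))" "continuous_on UNIV (\<lambda>x. u (of_real x))"
    using cont[of s] cont[of "- s"] cont[of 0] s sw by (simp_all add: complex_of_real_def)
  have b0: "cmod (u (of_real x)) \<le> C * exp (- (d + a * s) * \<bar>x\<bar> + a * 0 * max x 0)" 
    and bp: "cmod (u (Complex x s)) \<le> C * exp (- (d + a * s) * \<bar>x\<bar> + a * 0 * max x 0)"
    and bm: "cmod (u (Complex x (- s))) \<le> C * exp (- (d + a * s) * \<bar>x\<bar> + a * s * max x 0)" for x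
    using b[of 0 x] b[of s x] b[of "- s" x] s by (simp_all add: complex_of_real_def)
  have ie: "cmod (v / ex (of_real x)) = exp (- (a * s * x)) * cmod v" for v x by (simp add: norm_divide exp_minus field_simps)
  note eb = exponent_bound[OF C _ _ norm_ge_zero]
  note s0 = order_refl[of "0::real"] less_imp_le[OF s]
  note ss = less_imp_le[OF s] order_refl[of s]
  show "(\<lambda>x. u (of_real x)) \<in> rapid" 
    by (rule rapidI[OF _ d]) (use cs eb[OF b0 exponents(5)[OF s0]] in simp_all)
  show "(\<lambda>x. ex (of_real x) * u (of_real x)) \<in> rapid"
    by (rule rapidI[OF _ d, of _ C]) (use cs cex eb[OF b0 exponents(3)[OF s0]] in \<open>auto intro!: continuous_intros simp: norm_mult\<close>)
  show "(\<lambda>x. u (of_real x) / ex (of_real x)) \<in> rapid"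
    by (rule rapidI[OF _ d, of _ C], intro continuous_intros cs cex, simp, unfold ie, rule eb[OF b0 exponents(4)[OF s0]])
  show "(\<lambda>x. u (Complex x s)) \<in> rapid" 
    by (rule rapidI[OF _ d]) (use cs eb[OF bp exponents(5)[OF s0]] in simp_all)
  show "(\<lambda>x. ex (of_real x) * u (Complex x s)) \<in> rapid"
    by (rule rapidI[OF _ d, of _ C]) (use cs cex eb[OF bp exponents(3)[OF s0]] in \<open>auto intro!: continuous_intros simp: norm_mult\<close>)
  show "(\<lambda>x. u (Complex x s) / ex (of_real x)) \<in> rapid"
    by (rule rapidI[OF _ d, of _ C], intro continuous_intros cs cex, simp, unfold ie, rule eb[OF bp exponents(4)[OF s0]])
  show "(\<lambda>x. u (Complex x (- s))) \<in> rapid" 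
    by (rule rapidI[OF _ d]) (use cs eb[OF bm exponents(1)[OF ss]] in simp_all)
  show "(\<lambda>x. u (Complex x (- s)) / ex (of_real x)) \<in> rapid"
    by (rule rapidI[OF _ d, of _ C], intro continuous_intros cs cex, simp, unfold ie, rule eb[OF bm exponents(2)[OF ss]])
qed

lemma A_rapid:
  assumes u: "u \<in> decaying"
  shows "restrict u \<in> rapid" "A0 u \<in> rapid" "A1 u \<in> rapid" "A2 u \<in> rapid" "A3 u \<in> rapid" "A4 u \<in> rapid"
  unfolding restrict_def[abs_def] A0_def[abs_def] A1_def[abs_def] A2_def[abs_def] A3_def[abs_def] A4_def[abs_def]
  by (intro rapid_add rapid_cmult pieces_rapid u)+

section \<open>The intertwining relations\<close>

lemma fourier_add_rapid:
  assumes "u \<in> rapid" "v \<in> rapid"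
  shows "fourier a (\<lambda>x. u x + v x) (of_real z) = fourier a u (of_real z) + fourier a v (of_real z)"
  using integrable_fourier[OF rapid_integrable[OF assms(1)]] integrable_fourier[OF rapid_integrable[OF assms(2)]]
  by (simp add: fourier_def distrib_right)

lemma fourier_cmult: "fourier a (\<lambda>x. c * u x) z = c * fourier a u z"
  unfolding fourier_def mult.assoc by (rule integral_mult_right_zero)

text \<open>Evaluating the transform at distance s from the real axis changes the integrand by a
  power of \<open>ex\<close>: an identity of kernels, without any contour shift.\<close>

lemma kop_up: "kop (restrict u) (Complex z s) = fourier a (\<lambda>x. \<Phi> (of_real x) * (u (of_real x) / ex (of_real x))) (of_real z)"
  unfolding kop_def fourier_def restrict_def
proof (intro Bochner_Integration.integral_cong refl)
  fix x
  have "\<i> * of_real (a * x) * Complex z s = \<i> * of_real (a * x) * of_real z - of_real (a * s) * of_real x"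
    by (simp add: complex_eq_iff)
  then have "exp (\<i> * of_real (a * x) * Complex z s) = exp (\<i> * of_real (a * x) * of_real z) / ex (of_real x)"
    by (simp only: exp_diff ex_def)
  then show "\<Phi> (of_real x) * u (of_real x) * exp (\<i> * of_real (a * x) * Complex z s)
     = \<Phi> (of_real x) * (u (of_real x) / ex (of_real x)) * exp (\<i> * of_real (a * x) * of_real z)" by simp
qed

lemma kop_down: "kop (restrict u) (Complex z (- s)) = fourier a (\<lambda>x. \<Phi> (of_real x) * (ex (of_real x) * u (of_real x))) (of_real z)"
  unfolding kop_def fourier_def restrict_def
proof (intro Bochner_Integration.integral_cong refl)
  fix x
  have "\<i> * of_real (a * x) * Complex z (- s) = \<i> * of_real (a * x) * of_real z + of_real (a * s) * of_real x"
    by (simp add: complex_eq_iff)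
  then have "exp (\<i> * of_real (a * x) * Complex z (- s)) = exp (\<i> * of_real (a * x) * of_real z) * ex (of_real x)"
    by (simp only: exp_add ex_def)
  then show "\<Phi> (of_real x) * u (of_real x) * exp (\<i> * of_real (a * x) * Complex z (- s))
     = \<Phi> (of_real x) * (ex (of_real x) * u (of_real x)) * exp (\<i> * of_real (a * x) * of_real z)" by simp
qed

lemma norm_mult_ex: "cmod (v * ex (Complex x y)) = exp (a * s * x) * cmod v"
  by (simp add: norm_mult)

lemma norm_divide_ex: "cmod (v / ex (Complex x y)) = exp (- (a * s * x)) * cmod v"
  by (simp add: norm_divide exp_minus inverse_eq_divide)

text \<open>The mechanism dual to \<open>kop_up\<close>: multiplying the transform by
  \<open>ex\<close> or its inverse moves the contour up or down by s.\<close>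

lemma shifts:
  assumes u: "u \<in> decaying"
  shows "ex (of_real z) * fourier a (\<lambda>x. \<Phi> (of_real x) * u (of_real x)) (of_real z)
      = fourier a (\<lambda>x. \<Phi> (Complex x s) * u (Complex x s)) (of_real z)"
    and "ex (of_real z) * fourier a (\<lambda>x. \<Phi> (of_real x) * u (of_real x) / ex (of_real x)) (of_real z)
      = fourier a (\<lambda>x. \<Phi> (Complex x s) * u (Complex x s) / ex (Complex x s)) (of_real z)"
    and "fourier a (\<lambda>x. \<Phi> (of_real x) * u (of_real x)) (of_real z) / ex (of_real z)
      = fourier a (\<lambda>x. \<Phi> (Complex x (- s)) * u (Complex x (- s))) (of_real z)"
    and "fourier a (\<lambda>x. \<Phi> (of_real x) * u (of_real x) / ex (of_real x)) (of_real z) / ex (of_real z)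
      = fourier a (\<lambda>x. \<Phi> (Complex x (- s)) * u (Complex x (- s)) / ex (Complex x (- s))) (of_real z)"
    and "fourier a (\<lambda>x. \<Phi> (of_real x) * u (of_real x) * ex (of_real x)) (of_real z) / ex (of_real z)
      = fourier a (\<lambda>x. \<Phi> (Complex x (- s)) * u (Complex x (- s)) * ex (Complex x (- s))) (of_real z)"
proof -
  obtain C d where C: "0 \<le> C" and d: "d > 0"
    and "\<And>x y. \<bar>y\<bar> \<le> s \<Longrightarrow> cmod (u (Complex x y)) \<le> C * exp (- (d + a * s) * \<bar>x\<bar> + a * max (- y) 0 * max x 0)"
    and b: "\<And>x y. \<bar>y\<bar> \<le> s \<Longrightarrow> cmod (\<Phi> (Complex x y) * u (Complex x y)) \<le> C * exp (- (d + a * s) * \<bar>x\<bar> + a * max y 0 * max x 0)"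
    by (rule shift_bounds[OF u]) (rule that)
  note eb = exponent_bound[OF C _ _ norm_ge_zero]
  note h = Phi_holomorphic decaying_holomorphic[OF u]
  have sw': "\<bar>s\<bar> < w" "\<bar>- s\<bar> < w" using s sw by auto
  have up: "cmod (\<Phi> (Complex x y) * u (Complex x y)) \<le> C * exp (- (d + a * s) * \<bar>x\<bar> + a * y * max x 0)"
     "0 \<le> y" "y \<le> s" if "y \<in> {min 0 s..max 0 s}" for x y
    using b[of y x] that s by auto
  have down: "cmod (\<Phi> (Complex x y) * u (Complex x y)) \<le> C * exp (- (d + a * s) * \<bar>x\<bar> + a * 0 * max x 0)"
     if "y \<in> {min 0 (- s)..max 0 (- s)}" for x y
    using b[of y x] that s by auto
  note s0 = order_refl[of "0::real"] less_imp_le[OF s]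
  have ex: "exp (of_real (a * s) * of_real z) = ex (of_real z)" by (simp add: ex_def)
  have ex': "exp (of_real (a * (- s)) * of_real z) = 1 / ex (of_real z)" by (simp add: ex_def exp_minus inverse_eq_divide)
  have "ex (of_real z) * fourier a (restrict (\<lambda>p. \<Phi> p * u p)) (of_real z) = fourier a (\<lambda>x. \<Phi> (Complex x s) * u (Complex x s)) (of_real z)"
    unfolding ex[symmetric]
  proof (rule fourier_shift_real[OF _ sw'(1) d])
    show "cmod (\<Phi> (Complex x y) * u (Complex x y)) \<le> C * exp (- d * \<bar>x\<bar>)" if "y \<in> {min 0 s..max 0 s}" for x y
      using eb[OF up(1)[OF that] exponents(1)[OF up(2,3)[OF that]]] by simp
  qed (intro holomorphic_intros h)
  then show "ex (of_real z) * fourier a (\<lambda>x. \<Phi> (of_real x) * u (of_real x)) (of_real z)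
      = fourier a (\<lambda>x. \<Phi> (Complex x s) * u (Complex x s)) (of_real z)"
    by (simp add: restrict_def[abs_def])
  have "ex (of_real z) * fourier a (restrict (\<lambda>p. \<Phi> p * u p / ex p)) (of_real z) = fourier a (\<lambda>x. \<Phi> (Complex x s) * u (Complex x s) / ex (Complex x s)) (of_real z)"
    unfolding ex[symmetric]
  proof (rule fourier_shift_real[OF _ sw'(1) d])
    show "cmod (\<Phi> (Complex x y) * u (Complex x y) / ex (Complex x y)) \<le> C * exp (- d * \<bar>x\<bar>)" if "y \<in> {min 0 s..max 0 s}" for x y
      unfolding norm_divide_ex by (rule eb[OF up(1)[OF that] exponents(2)[OF up(2,3)[OF that]]])
  qed (intro holomorphic_intros h, simp)
  then show "ex (of_real z) * fourier a (\<lambda>x. \<Phi> (of_real x) * u (of_real x) / ex (of_real x)) (of_real z)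
      = fourier a (\<lambda>x. \<Phi> (Complex x s) * u (Complex x s) / ex (Complex x s)) (of_real z)"
    by (simp add: restrict_def[abs_def])
  have "1 / ex (of_real z) * fourier a (restrict (\<lambda>p. \<Phi> p * u p)) (of_real z) = fourier a (\<lambda>x. \<Phi> (Complex x (- s)) * u (Complex x (- s))) (of_real z)"
    unfolding ex'[symmetric]
  proof (rule fourier_shift_real[OF _ sw'(2) d])
    show "cmod (\<Phi> (Complex x y) * u (Complex x y)) \<le> C * exp (- d * \<bar>x\<bar>)" if "y \<in> {min 0 (- s)..max 0 (- s)}" for x y
      using eb[OF down[OF that] exponents(5)[OF s0]] by simp
  qed (intro holomorphic_intros h)
  then show "fourier a (\<lambda>x. \<Phi> (of_real x) * u (of_real x)) (of_real z) / ex (of_real z)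
      = fourier a (\<lambda>x. \<Phi> (Complex x (- s)) * u (Complex x (- s))) (of_real z)"
    by (simp add: restrict_def[abs_def])
  have "1 / ex (of_real z) * fourier a (restrict (\<lambda>p. \<Phi> p * u p / ex p)) (of_real z) = fourier a (\<lambda>x. \<Phi> (Complex x (- s)) * u (Complex x (- s)) / ex (Complex x (- s))) (of_real z)"
    unfolding ex'[symmetric]
  proof (rule fourier_shift_real[OF _ sw'(2) d])
    show "cmod (\<Phi> (Complex x y) * u (Complex x y) / ex (Complex x y)) \<le> C * exp (- d * \<bar>x\<bar>)" if "y \<in> {min 0 (- s)..max 0 (- s)}" for x y
      unfolding norm_divide_ex by (rule eb[OF down[OF that] exponents(4)[OF s0]])
  qed (intro holomorphic_intros h, simp)
  then show "fourier a (\<lambda>x. \<Phi> (of_real x) * u (of_real x) / ex (of_real x)) (of_real z) / ex (of_real z)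
      = fourier a (\<lambda>x. \<Phi> (Complex x (- s)) * u (Complex x (- s)) / ex (Complex x (- s))) (of_real z)"
    by (simp add: restrict_def[abs_def])
  have "1 / ex (of_real z) * fourier a (restrict (\<lambda>p. \<Phi> p * u p * ex p)) (of_real z) = fourier a (\<lambda>x. \<Phi> (Complex x (- s)) * u (Complex x (- s)) * ex (Complex x (- s))) (of_real z)"
    unfolding ex'[symmetric]
  proof (rule fourier_shift_real[OF _ sw'(2) d])
    show "cmod (\<Phi> (Complex x y) * u (Complex x y) * ex (Complex x y)) \<le> C * exp (- d * \<bar>x\<bar>)" if "y \<in> {min 0 (- s)..max 0 (- s)}" for x y
      unfolding norm_mult_ex by (rule eb[OF down[OF that] exponents(3)[OF s0]])
  qed (intro holomorphic_intros h)
  then show "fourier a (\<lambda>x. \<Phi> (of_real x) * u (of_real x) * ex (of_real x)) (of_real z) / ex (of_real z)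
      = fourier a (\<lambda>x. \<Phi> (Complex x (- s)) * u (Complex x (- s)) * ex (Complex x (- s))) (of_real z)"
    by (simp add: restrict_def[abs_def])
qed

text \<open>Multiplication by X moves the contour up by s, and \<Phi> splits off the factor 1 + q X
  of \<open>A2\<close> there.\<close>

lemma intertwine_A1:
  assumes u: "u \<in> decaying"
  shows "A1 (kop (restrict u)) z = kop (A2 u) (of_real z)"
proof -
  have "A1 (kop (restrict u)) z = fourier a (\<lambda>x. \<Phi> (Complex x s) * u (Complex x s)) (of_real z)"
    by (simp add: A1_def kop_def restrict_def shifts(1)[OF u])
  also have "\<dots> = kop (A2 u) (of_real z)"
    unfolding kop_def A2_def by (simp add: Phi_up algebra_simps)
  finally show ?thesis .
qed

text \<open>P K is K X^-1 by \<open>kop_up\<close>. Multiplying it further by q X moves the contour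
  up; the factor 1 + q X from \<Phi>, divided by the shifted \<open>ex\<close>, yields the two terms
  of \<open>A3\<close> that contain P.\<close>

lemma intertwine_A2:
  assumes u: "u \<in> decaying"
  shows "A2 (kop (restrict u)) z = kop (A3 u) (of_real z)"
proof -
  define G where "G x = \<Phi> (of_real x) * (u (of_real x) / ex (of_real x))" for x
  define H where "H x = \<Phi> (of_real x) * (1 / q * (u (Complex x s) / ex (of_real x)) + u (Complex x s))" for x
  have Geq: "G = (\<lambda>x. \<Phi> (of_real x) * u (of_real x) / ex (of_real x))"
    by (simp add: G_def fun_eq_iff)
  have G: "G \<in> rapid" unfolding G_def by (intro rapid_Phi pieces_rapid u)
  have H: "H \<in> rapid" unfolding H_def by (intro rapid_Phi rapid_add rapid_cmult pieces_rapid u)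
  have "\<Phi> (Complex x s) * u (Complex x s) / ex (Complex x s) = 1 / q * H x" for x
    by (simp add: H_def Phi_up ex_up power2_eq_square divide_simps) (simp add: algebra_simps)
  then have "ex (of_real z) * fourier a G (of_real z) = 1 / q * fourier a H (of_real z)"
    using shifts(2)[OF u, of z] by (simp only: Geq fourier_cmult)
  then have "q * (ex (of_real z) * fourier a G (of_real z)) = fourier a H (of_real z)" by simp
  moreover have "A2 (kop (restrict u)) z = fourier a G (of_real z) + q * (ex (of_real z) * fourier a G (of_real z))"
    by (simp add: A2_def kop_up Geq)
  ultimately have "A2 (kop (restrict u)) z = fourier a (\<lambda>x. G x + H x) (of_real z)"
    by (simp add: fourier_add_rapid G H)
  also have "\<dots> = kop (A3 u) (of_real z)"
    by (simp add: kop_def A3_def G_def H_def distrib_left)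
  finally show ?thesis .
qed

lemma down_rapid:
  assumes u: "u \<in> decaying"
  shows "(\<lambda>x. \<Phi> (Complex x (- s)) * u (Complex x (- s))) \<in> rapid"
    "(\<lambda>x. \<Phi> (Complex x (- s)) * u (Complex x (- s)) / ex (of_real x)) \<in> rapid"
    "(\<lambda>x. \<Phi> (Complex x (- s)) * u (Complex x (- s)) * ex (of_real x)) \<in> rapid"
proof -
  obtain C d where C: "0 \<le> C" and d: "d > 0"
    and "\<And>x y. \<bar>y\<bar> \<le> s \<Longrightarrow> cmod (u (Complex x y)) \<le> C * exp (- (d + a * s) * \<bar>x\<bar> + a * max (- y) 0 * max x 0)"
    and b: "\<And>x y. \<bar>y\<bar> \<le> s \<Longrightarrow> cmod (\<Phi> (Complex x y) * u (Complex x y)) \<le> C * exp (- (d + a * s) * \<bar>x\<bar> + a * max y 0 * max x 0)"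
    by (rule shift_bounds[OF u]) (rule that)
  note eb = exponent_bound[OF C _ _ norm_ge_zero]
  have down: "cmod (\<Phi> (Complex x (- s)) * u (Complex x (- s))) \<le> C * exp (- (d + a * s) * \<bar>x\<bar> + a * 0 * max x 0)" for x
    using b[of "- s" x] s by simp
  note s0 = order_refl[of "0::real"] less_imp_le[OF s]
  have "(\<lambda>p. \<Phi> p * u p) holomorphic_on strip"
    by (intro holomorphic_intros Phi_holomorphic decaying_holomorphic[OF u])
  from continuous_on_real_strip[OF this, of "- s"] s sw
  have cont: "continuous_on UNIV (\<lambda>x. \<Phi> (Complex x (- s)) * u (Complex x (- s)))" by simp
  have cex: "continuous_on UNIV (\<lambda>x. ex (of_real x))" unfolding ex_def by (intro continuous_intros)
  have ie: "cmod (v / ex (of_real x)) = exp (- (a * s * x)) * cmod v" "cmod (v * ex (of_real x)) = exp (a * s * x) * cmod v" for v x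
    using norm_divide_ex[of v x 0] norm_mult_ex[of v x 0] by (simp_all add: complex_of_real_def)
  show "(\<lambda>x. \<Phi> (Complex x (- s)) * u (Complex x (- s))) \<in> rapid"
    by (rule rapidI[OF cont d]) (use eb[OF down exponents(5)[OF s0]] in simp)
  show "(\<lambda>x. \<Phi> (Complex x (- s)) * u (Complex x (- s)) / ex (of_real x)) \<in> rapid"
    by (rule rapidI[OF _ d, of _ C], rule continuous_on_divide[OF cont cex], simp, unfold ie, rule eb[OF down exponents(4)[OF s0]])
  show "(\<lambda>x. \<Phi> (Complex x (- s)) * u (Complex x (- s)) * ex (of_real x)) \<in> rapid"
    by (rule rapidI[OF _ d, of _ C], rule continuous_on_mult[OF cont cex], unfold ie, rule eb[OF down exponents(3)[OF s0]])
qed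

text \<open>Two of the three terms move the contour down by s. Their sum has the factor \<Phi> (x -
  i s) (1 + q / X), which the functional equation collapses to q \<Phi> x / X, as required for the
  P^-1 term of \<open>A4\<close>; the third term is K X^-1.\<close>

lemma intertwine_A3:
  assumes u: "u \<in> decaying"
  shows "A3 (kop (restrict u)) z = kop (A4 u) (of_real z)"
proof -
  define G where "G x = \<Phi> (of_real x) * (u (of_real x) / ex (of_real x))" for x
  define H where "H x = \<Phi> (Complex x (- s)) * u (Complex x (- s))" for x
  define H' where "H' x = q * (H x / ex (of_real x))" for x
  have Geq: "G = (\<lambda>x. \<Phi> (of_real x) * u (of_real x) / ex (of_real x))"
    by (simp add: G_def fun_eq_iff)
  have G: "G \<in> rapid" unfolding G_def by (intro rapid_Phi pieces_rapid u)
  have H: "H \<in> rapid" unfolding H_def by (rule down_rapid[OF u])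
  have H': "H' \<in> rapid" unfolding H'_def H_def by (intro rapid_cmult down_rapid[OF u])
  have Phi: "\<Phi> (Complex x (- s)) + q * (\<Phi> (Complex x (- s)) / ex (of_real x)) = q * (\<Phi> (of_real x) / ex (of_real x))" for x
    unfolding Phi_down[of x] by (simp add: field_simps)
  have HH: "H x + H' x = \<Phi> (of_real x) * (q * (u (Complex x (- s)) / ex (of_real x)))" for x
  proof -
    have "H x + H' x = (\<Phi> (Complex x (- s)) + q * (\<Phi> (Complex x (- s)) / ex (of_real x))) * u (Complex x (- s))"
      by (simp add: H_def H'_def algebra_simps)
    also have "\<dots> = \<Phi> (of_real x) * (q * (u (Complex x (- s)) / ex (of_real x)))"
      unfolding Phi by simp
    finally show ?thesis .
  qed
  have "\<Phi> (Complex x (- s)) * u (Complex x (- s)) / ex (Complex x (- s)) = q * H' x" for x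
    by (simp add: H'_def H_def ex_down power2_eq_square)
  then have "fourier a G (of_real z) / ex (of_real z) = q * fourier a H' (of_real z)"
    using shifts(4)[OF u, of z] by (simp only: Geq fourier_cmult)
  moreover have "kop (restrict u) (of_real z) / ex (of_real z) = fourier a H (of_real z)"
    using shifts(3)[OF u, of z] by (simp add: kop_def restrict_def H_def[abs_def])
  moreover have "A3 (kop (restrict u)) z = kop (restrict u) (of_real z) / ex (of_real z)
     + (1 / q * (fourier a G (of_real z) / ex (of_real z)) + fourier a G (of_real z))"
    by (simp add: A3_def kop_up Geq)
  ultimately have "A3 (kop (restrict u)) z = fourier a H (of_real z) + (fourier a H' (of_real z) + fourier a G (of_real z))"
    by simp
  also have "\<dots> = fourier a (\<lambda>x. G x + (H x + H' x)) (of_real z)"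
    by (simp add: fourier_add_rapid G H H' rapid_add)
  also have "\<dots> = kop (A4 u) (of_real z)"
    unfolding HH by (simp add: kop_def A4_def G_def distrib_left)
  finally show ?thesis .
qed

text \<open>Both terms move the contour down by s, and the resulting factor \<Phi> (x - i s) (1 + X
  / q) is \<Phi> x.\<close>

lemma intertwine_A4:
  assumes u: "u \<in> decaying"
  shows "A4 (kop (restrict u)) z = kop (A0 u) (of_real z)"
proof -
  define H where "H x = \<Phi> (Complex x (- s)) * u (Complex x (- s))" for x
  define H' where "H' x = 1 / q * (H x * ex (of_real x))" for x
  have H: "H \<in> rapid" unfolding H_def by (rule down_rapid[OF u])
  have H': "H' \<in> rapid" unfolding H'_def H_def by (intro rapid_cmult down_rapid[OF u])
  have "\<Phi> (Complex x (- s)) * u (Complex x (- s)) * ex (Complex x (- s)) = 1 / q * H' x" for x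
    by (simp add: H'_def H_def ex_down power2_eq_square)
  then have "fourier a (\<lambda>x. \<Phi> (of_real x) * u (of_real x) * ex (of_real x)) (of_real z) / ex (of_real z) = 1 / q * fourier a H' (of_real z)"
    using shifts(5)[OF u, of z] by (simp only: fourier_cmult)
  moreover have "kop (restrict u) (Complex z (- s)) = fourier a (\<lambda>x. \<Phi> (of_real x) * u (of_real x) * ex (of_real x)) (of_real z)"
    unfolding kop_down by (simp only: mult_ac)
  moreover have "kop (restrict u) (of_real z) / ex (of_real z) = fourier a H (of_real z)"
    using shifts(3)[OF u, of z] by (simp add: kop_def restrict_def H_def[abs_def])
  ultimately have "A4 (kop (restrict u)) z = fourier a H (of_real z) + fourier a H' (of_real z)"
    by (simp add: A4_def)
  also have "\<dots> = fourier a (\<lambda>x. H x + H' x) (of_real z)"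
    by (simp add: fourier_add_rapid H H')
  also have "\<dots> = kop (A0 u) (of_real z)"
    unfolding kop_def A0_def Phi_down by (simp add: H_def H'_def algebra_simps)
  finally show ?thesis .
qed

text \<open>Read off from the kernel: a factor \<open>ex\<close> under the transform is an
  evaluation at z - i s.\<close>

lemma intertwine_A0: "A0 (kop (restrict u)) z = kop (A1 u) (of_real z)"
  unfolding A0_def kop_down by (simp add: kop_def A1_def)

end

section \<open>Operators commuting with multiplications\<close>

lemma norm_mult_l2_le:
  assumes u: "u \<in> borel_measurable borel" "\<And>x. cmod (u x) \<le> C"
  shows "norm (mult_l2 u v) \<le> C * norm v"
proof -
  obtain f where f: "v = abs_l2 f" "square_integrable f" by (rule l2_cases)
  note mu = mult_abs_l2[OF _ assms] square_integrable_mult[OF _ assms]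
  have C: "0 \<le> C" using norm_ge_zero assms(2) order_trans by blast
  have "(norm (mult_l2 u v))\<^sup>2 = (LINT x|lborel. (cmod (u x * f x))\<^sup>2)"
    by (simp add: f mu norm_abs_l2_power2)
  also have "\<dots> \<le> (LINT x|lborel. C\<^sup>2 * (cmod (f x))\<^sup>2)"
  proof (intro integral_mono)
    fix x
    have "(cmod (u x * f x))\<^sup>2 \<le> (C * cmod (f x))\<^sup>2"
      using assms(2)[of x] by (intro power_mono) (auto simp: norm_mult mult_right_mono)
    then show "(cmod (u x * f x))\<^sup>2 \<le> C\<^sup>2 * (cmod (f x))\<^sup>2" by (simp add: power_mult_distrib)
  qed (use mu(2)[OF f(2)] f in \<open>auto simp: square_integrable_def\<close>)
  also have "\<dots> = (C * norm v)\<^sup>2" by (simp add: f norm_abs_l2_power2 power_mult_distrib)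
  finally show ?thesis
    by (rule power2_le_imp_le) (use C in simp)
qed

definition multiplier :: "(real \<Rightarrow> complex) \<Rightarrow> bool" where
  "multiplier u \<longleftrightarrow> u \<in> borel_measurable borel \<and> (\<exists>C. \<forall>x. cmod (u x) \<le> C)"

lemma multiplierI: "u \<in> borel_measurable borel \<Longrightarrow> (\<And>x. cmod (u x) \<le> C) \<Longrightarrow> multiplier u"
  by (auto simp: multiplier_def)

lemma multiplier_abs_l2:
  assumes "multiplier u" "square_integrable f"
  shows "square_integrable (\<lambda>x. u x * f x)" "mult_l2 u (abs_l2 f) = abs_l2 (\<lambda>x. u x * f x)"
  using assms unfolding multiplier_def by (auto intro: square_integrable_mult mult_abs_l2)

lemma multiplier_const: "multiplier (\<lambda>x. c)"
  by (rule multiplierI[of _ "cmod c"]) auto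

lemma multiplier_add:
  assumes "multiplier u" "multiplier v"
  shows "multiplier (\<lambda>x. u x + v x)"
proof -
  obtain C D where "\<And>x. cmod (u x) \<le> C" "\<And>x. cmod (v x) \<le> D" 
    using assms by (auto simp: multiplier_def)
  then have "cmod (u x + v x) \<le> C + D" for x
    using norm_triangle_ineq[of "u x" "v x"] by (meson add_mono order_trans)
  then show ?thesis using assms by (intro multiplierI[of _ "C + D"]) (auto simp: multiplier_def)
qed

lemma multiplier_mult:
  assumes "multiplier u" "multiplier v"
  shows "multiplier (\<lambda>x. u x * v x)"
proof -
  obtain C D where *: "\<And>x. cmod (u x) \<le> C" "\<And>x. cmod (v x) \<le> D" 
    using assms by (auto simp: multiplier_def)
  have "0 \<le> C" using order_trans[OF norm_ge_zero *(1)[of 0]] .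
  then have "cmod (u x * v x) \<le> C * D" for x
    unfolding norm_mult using * by (intro mult_mono) auto
  then show ?thesis using assms by (intro multiplierI[of _ "C * D"]) (auto simp: multiplier_def)
qed

lemma mult_l2_add:
  assumes "multiplier u" "multiplier v"
  shows "mult_l2 (\<lambda>x. u x + v x) w = mult_l2 u w + mult_l2 v w"
proof -
  obtain f where f: "w = abs_l2 f" "square_integrable f" by (rule l2_cases)
  show ?thesis
    using multiplier_abs_l2[OF assms(1) f(2)] multiplier_abs_l2[OF assms(2) f(2)]
      multiplier_abs_l2[OF multiplier_add[OF assms] f(2)]
    by (simp add: f plus_abs_l2 distrib_right)
qed

lemma mult_l2_times:
  assumes "multiplier u" "multiplier v"
  shows "mult_l2 (\<lambda>x. u x * v x) w = mult_l2 u (mult_l2 v w)"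
proof -
  obtain f where f: "w = abs_l2 f" "square_integrable f" by (rule l2_cases)
  show ?thesis
    using multiplier_abs_l2[OF assms(2) f(2)] multiplier_abs_l2[OF multiplier_mult[OF assms] f(2)]
      multiplier_abs_l2(2)[OF assms(1) multiplier_abs_l2(1)[OF assms(2) f(2)]]
    by (simp add: f mult.assoc)
qed

lemma mult_l2_const: "mult_l2 (\<lambda>x. c) w = scale_l2 c w"
proof -
  obtain f where f: "w = abs_l2 f" "square_integrable f" by (rule l2_cases)
  show ?thesis using multiplier_abs_l2[OF multiplier_const f(2)] by (simp add: f scale_abs_l2)
qed

lemma mult_l2_bounded_linear: "multiplier u \<Longrightarrow> bounded_linear (mult_l2 u)"
  unfolding multiplier_def using bounded_linear_mult_l2 by blast

lemma mult_l2_tendsto_uniform: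
  assumes "\<And>n. multiplier (u n)" "multiplier v" "\<And>n x. cmod (u n x - v x) \<le> e n" "e \<longlonglongrightarrow> 0"
  shows "(\<lambda>n. mult_l2 (u n) w) \<longlonglongrightarrow> mult_l2 v w"
proof -
  have m: "multiplier (\<lambda>x. u n x - v x)" for n
    using multiplier_add[OF assms(1)[of n] multiplier_mult[OF multiplier_const[of "- 1"] assms(2)]] by simp
  have "norm (mult_l2 (u n) w - mult_l2 v w) \<le> e n * norm w" for n
  proof -
    have "mult_l2 (u n) w = mult_l2 (\<lambda>x. u n x - v x) w + mult_l2 v w"
      using mult_l2_add[OF m assms(2), of n w] by simp
    then have "mult_l2 (u n) w - mult_l2 v w = mult_l2 (\<lambda>x. u n x - v x) w" by simp
    then show ?thesis
      using norm_mult_l2_le[OF _ assms(3)] m by (simp add: multiplier_def)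
  qed
  then have "\<forall>n. norm (mult_l2 (u n) w - mult_l2 v w) \<le> e n * norm w" by blast
  from Lim_null_comparison[OF always_eventually[OF this] tendsto_mult_left_zero[OF assms(4)]]
  have "(\<lambda>n. mult_l2 (u n) w - mult_l2 v w) \<longlonglongrightarrow> 0" .
  then show ?thesis by (rule LIM_zero_cancel)
qed

text \<open>Bounded pointwise convergence of multipliers gives convergence on each vector. This
  serves for cutoffs, which need not converge uniformly.\<close>

lemma mult_l2_tendsto_pointwise:
  assumes "\<And>n. multiplier (u n)" "multiplier v" "\<And>n x. cmod (u n x) \<le> C" "\<And>x. (\<lambda>n. u n x) \<longlonglongrightarrow> v x"
  shows "(\<lambda>n. mult_l2 (u n) w) \<longlonglongrightarrow> mult_l2 v w"
proof -
  obtain f where f: "w = abs_l2 f" "square_integrable f" by (rule l2_cases)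
  note [measurable] = square_integrable_measurable[OF f(2)]
  have [measurable]: "u n \<in> borel_measurable borel" "v \<in> borel_measurable borel" for n
    using assms(1,2) by (auto simp: multiplier_def)
  have C: "0 \<le> C" using order_trans[OF norm_ge_zero assms(3)[of 0 0]] .
  have "(\<lambda>n. abs_l2 (\<lambda>x. u n x * f x)) \<longlonglongrightarrow> abs_l2 (\<lambda>x. v x * f x)"
  proof (rule tendsto_l2_dominated[OF square_integrable_cmult[OF f(2), of "of_real C"]])
    show "AE x in lborel. cmod (u n x * f x) \<le> cmod (of_real C * f x)" for n
      using assms(3) C by (intro AE_I2) (simp add: norm_mult mult_right_mono)
    show "AE x in lborel. (\<lambda>n. u n x * f x) \<longlonglongrightarrow> v x * f x"
      by (intro AE_I2 tendsto_mult assms(4) tendsto_const)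
  qed measurable
  then show ?thesis
    using assms(1,2) f by (simp add: multiplier_abs_l2)
qed

section \<open>Multipliers that commute with a fixed operator\<close>

locale l2_operator =
  fixes S :: "l2 \<Rightarrow> l2"
  assumes bounded_linear: "bounded_linear S"
    and scale: "\<And>c v. S (scale_l2 c v) = scale_l2 c (S v)"
begin

definition commuting :: "(real \<Rightarrow> complex) set" where
  "commuting = {u. multiplier u \<and> (\<forall>v. S (mult_l2 u v) = mult_l2 u (S v))}"

lemma commuting_const: "(\<lambda>x. c) \<in> commuting"
  by (simp add: commuting_def multiplier_const mult_l2_const scale)

lemma commuting_add: "u \<in> commuting \<Longrightarrow> v \<in> commuting \<Longrightarrow> (\<lambda>x. u x + v x) \<in> commuting"
  using linear_add[OF bounded_linear.linear[OF bounded_linear]]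
  by (simp add: commuting_def multiplier_add mult_l2_add)

lemma commuting_mult: "u \<in> commuting \<Longrightarrow> v \<in> commuting \<Longrightarrow> (\<lambda>x. u x * v x) \<in> commuting"
  by (simp add: commuting_def multiplier_mult mult_l2_times)

lemma commuting_sum:
  "finite I \<Longrightarrow> (\<And>i. i \<in> I \<Longrightarrow> u i \<in> commuting) \<Longrightarrow> (\<lambda>x. \<Sum>i\<in>I. u i x) \<in> commuting"
  by (induction I rule: finite_induct) (auto intro: commuting_const commuting_add)

lemma commuting_power: "u \<in> commuting \<Longrightarrow> (\<lambda>x. u x ^ n) \<in> commuting"
  by (induction n) (auto intro: commuting_const commuting_mult)

lemma commuting_limit:
  assumes "\<And>n. u n \<in> commuting" "multiplier v" and lim: "\<And>w. (\<lambda>n. mult_l2 (u n) w) \<longlonglongrightarrow> mult_l2 v w"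
  shows "v \<in> commuting"
proof -
  have "S (mult_l2 v w) = mult_l2 v (S w)" for w
  proof (rule LIMSEQ_unique)
    show "(\<lambda>n. S (mult_l2 (u n) w)) \<longlonglongrightarrow> S (mult_l2 v w)"
      by (rule bounded_linear.tendsto[OF bounded_linear lim])
    have "S (mult_l2 (u n) w) = mult_l2 (u n) (S w)" for n
      using assms(1) by (simp add: commuting_def)
    then show "(\<lambda>n. S (mult_l2 (u n) w)) \<longlonglongrightarrow> mult_l2 v (S w)"
      using lim[of "S w"] by simp
  qed
  then show ?thesis using assms(2) by (simp add: commuting_def)
qed

context
  fixes \<beta> :: real
  assumes \<beta>: "\<beta> > 0"
    and logistic: "(\<lambda>x. of_real (1 / (1 + exp (\<beta> * x)))) \<in> commuting"
begin

definition logistic :: "real \<Rightarrow> real" where "logistic x = 1 / (1 + exp (\<beta> * x))"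

lemma logistic_bounds: "0 < logistic x" "logistic x < 1"
proof -
  have *: "0 < 1 + exp (\<beta> * x)" by (simp add: add_pos_pos)
  then show "0 < logistic x" by (simp add: logistic_def)
  show "logistic x < 1" using * by (simp add: logistic_def divide_less_eq)
qed

lemma measurable_logistic [measurable]: "logistic \<in> borel_measurable borel"
  unfolding logistic_def by measurable

text \<open>S commutes with polynomials in the logistic function. Its values lie in (0, 1), so the
  Bernstein polynomials of g, evaluated at it, converge uniformly on the whole line.\<close>

lemma commuting_comp_logistic:
  fixes g :: "real \<Rightarrow> real"
  assumes g: "continuous_on UNIV g"
  shows "(\<lambda>x. of_real (g (logistic x))) \<in> commuting"
proof -
  have l: "(\<lambda>x. of_real (logistic x)) \<in> commuting"
    using logistic by (simp add: logistic_def)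
  have l': "(\<lambda>x. 1 + of_real (- 1) * of_real (logistic x)) \<in> commuting"
    by (intro commuting_add commuting_mult commuting_const l)
  have g01: "continuous_on {0..1} g" by (rule continuous_on_subset[OF g]) simp
  define B where "B n x = (\<Sum>k\<le>n. g (k / n) * Bernstein n k (logistic x))" for n :: nat and x
  have Bc: "(\<lambda>x. of_real (B n x)) \<in> commuting" for n
  proof -
    have "(\<lambda>x. \<Sum>k\<le>n. of_real (g (k / n)) * (of_nat (n choose k) * of_real (logistic x) ^ k * (1 + of_real (- 1) * of_real (logistic x)) ^ (n - k))) \<in> commuting"
      by (intro commuting_sum commuting_mult commuting_power commuting_const l l') auto
    then show ?thesis by (simp add: B_def Bernstein_def)
  qed
  have "\<exists>n. \<forall>x. \<bar>g (logistic x) - B n x\<bar> \<le> 1 / real (Suc m)" for m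
  proof -
    obtain N where "\<And>n x. N \<le> n \<Longrightarrow> x \<in> {0..1} \<Longrightarrow> \<bar>g x - (\<Sum>k\<le>n. g (k / n) * Bernstein n k x)\<bar> < 1 / real (Suc m)"
      using Bernstein_Weierstrass[OF g01, of "1 / real (Suc m)"] by auto
    from this[OF order_refl] logistic_bounds have "\<bar>g (logistic x) - B N x\<bar> < 1 / real (Suc m)" for x
      by (simp add: B_def less_imp_le)
    then show ?thesis by (meson less_imp_le)
  qed
  then obtain N where N: "\<And>m x. \<bar>g (logistic x) - B (N m) x\<bar> \<le> 1 / real (Suc m)" by metis
  have "bounded (g ` {0..1})" by (intro compact_imp_bounded compact_continuous_image g01) simp
  then obtain C where C: "\<forall>t\<in>{0..1}. \<bar>g t\<bar> \<le> C" by (auto simp: bounded_iff)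
  have [measurable]: "g \<in> borel_measurable borel" by (rule borel_measurable_continuous_onI[OF g])
  have m: "multiplier (\<lambda>x. of_real (g (logistic x)))"
    by (rule multiplierI[of _ C]) (use C logistic_bounds in \<open>auto simp: less_imp_le\<close>)
  show ?thesis
  proof (rule commuting_limit[OF Bc[of "N m" for m] m mult_l2_tendsto_uniform[where e = "\<lambda>m. 1 / real (Suc m)"]])
    show "multiplier (\<lambda>x. of_real (B (N m) x))" for m using Bc by (simp add: commuting_def)
    show "cmod (of_real (B (N m) x) - of_real (g (logistic x))) \<le> 1 / real (Suc m)" for m x
      using N[of x m] by (simp add: abs_minus_commute flip: of_real_diff)
    show "(\<lambda>m. 1 / real (Suc m)) \<longlonglongrightarrow> 0" using LIMSEQ_inverse_real_of_nat by (simp add: inverse_eq_divide)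
  qed (rule m)
qed

text \<open>The logistic function is injective, so k is a function g of it. Its inverse is singular
  at 0 and 1; therefore the argument of g is clamped to a compact subinterval, which leaves k
  unchanged because k vanishes beyond the corresponding points.\<close>

lemma commuting_compactly_supported_real:
  fixes k :: "real \<Rightarrow> real"
  assumes k: "continuous_on UNIV k" and R: "\<And>x. R \<le> \<bar>x\<bar> \<Longrightarrow> k x = 0"
  shows "(\<lambda>x. of_real (k x)) \<in> commuting"
proof -
  \<comment> \<open>\<open>R'\<close> is positive and beyond R, so that \<open>lo\<close> \<le>
    \<open>hi\<close> and k is zero at both ends of the clamped interval.\<close>
  define R' where "R' = \<bar>R\<bar> + 1"
  define lo hi where "lo = logistic R'" and "hi = logistic (- R')"
  have anti: "logistic y \<le> logistic x \<longleftrightarrow> x \<le> y" for x y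
  proof -
    have "0 < 1 + exp (\<beta> * x)" "0 < 1 + exp (\<beta> * y)" by (simp_all add: add_pos_pos)
    then show ?thesis using \<beta> by (simp add: logistic_def divide_simps mult_le_cancel_left)
  qed
  define inv where "inv t = ln (1 / t - 1) / \<beta>" for t :: real
  have inv: "inv (logistic x) = x" for x using \<beta> by (simp add: inv_def logistic_def)
  define c where "c t = max lo (min hi t)" for t
  define g where "g t = k (inv (c t))" for t
  have lh: "lo \<le> hi" using anti by (simp add: lo_def hi_def R'_def)
  have c: "lo \<le> c t" "c t \<le> hi" for t using lh by (auto simp: c_def)
  have lo0: "0 < lo" and hi1: "hi < 1" using logistic_bounds by (auto simp: lo_def hi_def)
  have "continuous_on UNIV g"
    unfolding g_def
  proof (rule continuous_on_compose2[OF k])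
    show "continuous_on UNIV (\<lambda>t. inv (c t))"
      unfolding inv_def
    proof (intro continuous_intros)
      show "continuous_on UNIV c" unfolding c_def by (intro continuous_intros)
      show "\<forall>t\<in>UNIV. c t \<noteq> 0" using c lo0 by (metis less_le_trans less_irrefl)
      have "1 / c t - 1 > 0" for t
      proof -
        have "0 < c t" "c t < 1" using c[of t] lo0 hi1 by linarith+
        then show ?thesis by simp
      qed
      then show "\<forall>t\<in>UNIV. 1 / c t - 1 \<noteq> 0" by (metis less_irrefl)
    qed (use \<beta> in auto)
  qed auto
  moreover have "g (logistic x) = k x" for x
  proof -
    consider "\<bar>x\<bar> \<le> R'" | "x > R'" | "x < - R'" by linarith
    then show ?thesis
    proof cases
      case 1
      then have "lo \<le> logistic x" "logistic x \<le> hi" by (auto simp: lo_def hi_def anti)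
      then have "c (logistic x) = logistic x" by (simp add: c_def)
      then show ?thesis by (simp add: g_def inv)
    next
      case 2
      then have "logistic x \<le> lo" using anti by (simp add: lo_def)
      then have "c (logistic x) = lo" using lh by (simp add: c_def)
      then show ?thesis using 2 R[of x] R[of R'] by (simp add: g_def lo_def inv R'_def)
    next
      case 3
      then have "hi \<le> logistic x" using anti by (simp add: hi_def)
      then have "c (logistic x) = hi" using lh by (simp add: c_def)
      then show ?thesis using 3 R[of x] R[of "- R'"] by (simp add: g_def hi_def inv R'_def)
    qed
  qed
  ultimately show ?thesis using commuting_comp_logistic[of g] by simp
qed

text \<open>Real and imaginary parts are cut off to compact support, and the cutoffs are removed by
  bounded pointwise convergence. This generality is used for \<Phi> and for the exponentials that
  produce translations.\<close>

lemma commuting_bounded_continuous: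
  fixes u :: "real \<Rightarrow> complex"
  assumes u: "continuous_on UNIV u" and C: "\<And>x. cmod (u x) \<le> C"
  shows "u \<in> commuting"
proof -
  have m: "multiplier u" by (rule multiplierI[OF borel_measurable_continuous_onI[OF u] C])
  define cut :: "nat \<Rightarrow> real \<Rightarrow> real" where "cut n x = max 0 (min 1 (real n - \<bar>x\<bar>))" for n x
  have cut: "continuous_on UNIV (cut n)" for n unfolding cut_def by (intro continuous_intros)
  have cut0: "cut n x = 0" if "real n \<le> \<bar>x\<bar>" for n x using that by (simp add: cut_def)
  have parts: "(\<lambda>x. of_real (cut n x * Re (u x)) + \<i> * of_real (cut n x * Im (u x))) \<in> commuting" for n
    by (intro commuting_add commuting_mult commuting_const commuting_compactly_supported_real[of _ "real n"] continuous_intros u cut)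
       (simp_all add: cut0)
  have eq: "of_real (cut n x * Re (u x)) + \<i> * of_real (cut n x * Im (u x)) = of_real (cut n x) * u x" for n x
    by (simp add: complex_eq_iff)
  have cut_comm: "(\<lambda>x. of_real (cut n x) * u x) \<in> commuting" for n using parts[of n] unfolding eq .
  show ?thesis
  proof (rule commuting_limit[OF cut_comm m mult_l2_tendsto_pointwise])
    show "multiplier (\<lambda>x. of_real (cut n x) * u x)" for n using cut_comm[of n] by (simp add: commuting_def)
    show "cmod (of_real (cut n x) * u x) \<le> C" for n x
    proof -
      have "\<bar>cut n x\<bar> \<le> 1" by (simp add: cut_def)
      then have "\<bar>cut n x\<bar> * cmod (u x) \<le> 1 * C" using C by (intro mult_mono) auto
      then show ?thesis by (simp add: norm_mult)
    qed
    show "(\<lambda>n. of_real (cut n x) * u x) \<longlonglongrightarrow> u x" for x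
    proof (rule tendsto_eventually)
      obtain N where N: "\<bar>x\<bar> + 1 \<le> real N" using real_arch_simple by blast
      show "\<forall>\<^sub>F n in sequentially. of_real (cut n x) * u x = u x"
        using eventually_ge_at_top[of N] by eventually_elim (use N in \<open>auto simp: cut_def\<close>)
    qed
  qed (rule m)
qed

end

end

section \<open>Density of decaying functions\<close>

lemma integrable_compactly_supported_continuous:
  assumes "k \<in> compactly_supported_continuous"
  shows "integrable lborel k"
proof -
  obtain C R where C: "\<And>x. cmod (k x) \<le> C" and R: "\<And>x. R < \<bar>x\<bar> \<Longrightarrow> k x = 0" "R > 0" "C > 0"
    using bounded_compactly_supported_continuous[OF assms] by metis
  have "cmod (k x) \<le> (C * exp R) * exp (- 1 * \<bar>x\<bar>)" for x
  proof (cases "R < \<bar>x\<bar>")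
    case False
    then have "C * 1 \<le> C * exp (R - \<bar>x\<bar>)" using R by (intro mult_left_mono) auto
    with C[of x] have "cmod (k x) \<le> C * exp (R + - 1 * \<bar>x\<bar>)" by simp
    then show ?thesis by (simp only: exp_add mult.assoc)
  qed (use R in simp)
  then show ?thesis
    using assms by (intro integrable_exp_bound[of k 1]) (auto simp: compactly_supported_continuous_def)
qed

lemma compactly_supported_continuous_mult:
  assumes "k \<in> compactly_supported_continuous" "continuous_on UNIV g"
  shows "(\<lambda>x. g x * k x) \<in> compactly_supported_continuous"
  using assms by (auto simp: compactly_supported_continuous_def intro!: continuous_intros)

text \<open>
  Convolution with a Gaussian density of standard deviation \<open>1 / N\<close>, as an entire function.
\<close>

definition mollify :: "real \<Rightarrow> (real \<Rightarrow> complex) \<Rightarrow> complex \<Rightarrow> complex" where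
  "mollify N k z = of_real (N / sqrt (2 * pi)) * exp (- (of_real (N\<^sup>2) * z\<^sup>2 / 2)) *
     (LINT t|lborel. k t * of_real (gauss N t) * exp (of_real (N\<^sup>2) * of_real t * z))"

text \<open>The convolution itself. In the form of the definition, exp (N^2 t z) is the only factor
  under the integral that contains z, as \<open>integral_exp_has_derivative\<close>
  requires.\<close>

lemma mollify_eq:
  "mollify N k z = of_real (N / sqrt (2 * pi)) *
     (LINT t|lborel. k t * exp (- (of_real (N\<^sup>2) * (z - of_real t)\<^sup>2 / 2)))"
proof -
  have "exp (- (of_real (N\<^sup>2) * z\<^sup>2 / 2)) * (k t * of_real (gauss N t) * exp (of_real (N\<^sup>2) * of_real t * z))
    = k t * exp (- (of_real (N\<^sup>2) * (z - of_real t)\<^sup>2 / 2))" for t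
  proof -
    have "- (of_real (N\<^sup>2) * (z - of_real t)\<^sup>2 / 2)
      = - (of_real (N\<^sup>2) * z\<^sup>2 / 2) + of_real (- (N * t)\<^sup>2 / 2) + of_real (N\<^sup>2) * of_real t * z"
      by (simp add: power2_eq_square field_simps)
    then have "exp (- (of_real (N\<^sup>2) * (z - of_real t)\<^sup>2 / 2))
      = exp (- (of_real (N\<^sup>2) * z\<^sup>2 / 2)) * of_real (gauss N t) * exp (of_real (N\<^sup>2) * of_real t * z)"
      unfolding gauss_def exp_of_real[symmetric] by (simp only: exp_add)
    then show ?thesis by (simp add: mult_ac)
  qed
  then have "exp (- (of_real (N\<^sup>2) * z\<^sup>2 / 2)) * (LINT t|lborel. k t * of_real (gauss N t) * exp (of_real (N\<^sup>2) * of_real t * z))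
    = (LINT t|lborel. k t * exp (- (of_real (N\<^sup>2) * (z - of_real t)\<^sup>2 / 2)))"
    by (simp only: integral_mult_right_zero[symmetric])
  then show ?thesis unfolding mollify_def by (simp only: mult.assoc)
qed

lemma mollify_real:
  assumes "N > 0"
  shows "mollify N k (of_real x) = (LINT t|lborel. k (x - t / N) * of_real (std_normal_density t))"
proof -
  have "of_real (N / sqrt (2 * pi)) * (\<bar>- 1 / N\<bar> *\<^sub>R (k (x + - 1 / N * t) * exp (- (of_real (N\<^sup>2) * (of_real x - of_real (x + - 1 / N * t))\<^sup>2 / 2))))
    = k (x - t / N) * of_real (std_normal_density t)" for t
  proof -
    have "- (of_real (N\<^sup>2) * (of_real x - of_real (x + - 1 / N * t))\<^sup>2 / 2) = complex_of_real (- t\<^sup>2 / 2)"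
      using assms by (simp add: power2_eq_square)
    then have "exp (- (of_real (N\<^sup>2) * (of_real x - of_real (x + - 1 / N * t))\<^sup>2 / 2)) = complex_of_real (exp (- t\<^sup>2 / 2))"
      by (simp only: exp_of_real)
    then show ?thesis
      using assms by (simp add: std_normal_density_def scaleR_conv_of_real field_simps)
  qed
  then show ?thesis
    unfolding mollify_eq
    by (subst lborel_integral_real_affine[of "- 1 / N" _ x])
       (use assms in \<open>simp_all add: integral_mult_right_zero[symmetric] integral_scaleR_right[symmetric] del: integral_mult_right_zero integral_scaleR_right\<close>)
qed

lemma integrable_exp_abs_normal:
  "integrable lborel (\<lambda>t. exp (\<beta> * \<bar>t\<bar>) * std_normal_density t)"
proof (rule Bochner_Integration.integrable_bound[OF integrable_mult_right[OF integrable_exp_minus_abs[of 1], of "exp ((\<beta> + 1)\<^sup>2 / 2)"]])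
  have "exp (\<beta> * \<bar>t\<bar>) * std_normal_density t \<le> exp ((\<beta> + 1)\<^sup>2 / 2) * exp (- 1 * \<bar>t\<bar>)" for t
  proof -
    have "2 \<le> 2 * pi" using pi_ge_two by linarith
    then have "1 \<le> sqrt (2 * pi)" by simp
    then have "std_normal_density t \<le> exp (- t\<^sup>2 / 2)"
      by (simp add: std_normal_density_def field_simps)
    then have "exp (\<beta> * \<bar>t\<bar>) * std_normal_density t \<le> exp (\<beta> * \<bar>t\<bar>) * exp (- t\<^sup>2 / 2)"
      by (intro mult_left_mono) auto
    also have "\<dots> = exp (\<beta> * \<bar>t\<bar> - t\<^sup>2 / 2)" by (simp add: exp_add[symmetric])
    also have "\<beta> * \<bar>t\<bar> - t\<^sup>2 / 2 \<le> (\<beta> + 1)\<^sup>2 / 2 - \<bar>t\<bar>"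
    proof -
      have "0 \<le> (\<bar>t\<bar> - (\<beta> + 1))\<^sup>2" by simp
      moreover have "(\<bar>t\<bar> - (\<beta> + 1))\<^sup>2 = t\<^sup>2 - 2 * \<beta> * \<bar>t\<bar> - 2 * \<bar>t\<bar> + (\<beta> + 1)\<^sup>2"
        by (simp add: power2_eq_square algebra_simps)
      ultimately show ?thesis by linarith
    qed
    then have "exp (\<beta> * \<bar>t\<bar> - t\<^sup>2 / 2) \<le> exp ((\<beta> + 1)\<^sup>2 / 2 - \<bar>t\<bar>)" by simp
    finally show ?thesis by (simp add: exp_add[symmetric])
  qed
  then show "AE t in lborel. norm (exp (\<beta> * \<bar>t\<bar>) * std_normal_density t) \<le> norm (exp ((\<beta> + 1)\<^sup>2 / 2) * exp (- 1 * \<bar>t\<bar>))"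
    by (intro AE_I2) (simp add: normal_density_nonneg)
qed simp_all

text \<open>The bound is uniform in N \<ge> 1, since |t / N| \<le> |t|; it provides the majorant as
  N grows.\<close>

lemma norm_mollify_real_le:
  assumes N: "N \<ge> 1" and \<beta>: "\<beta> \<ge> 0" and k: "continuous_on UNIV k" "\<And>x. cmod (k x) \<le> C * exp (- \<beta> * \<bar>x\<bar>)"
  shows "cmod (mollify N k (of_real x)) \<le> C * exp (- \<beta> * \<bar>x\<bar>) * (LINT t|lborel. exp (\<beta> * \<bar>t\<bar>) * std_normal_density t)"
proof -
  have C: "0 \<le> C" using order_trans[OF norm_ge_zero k(2)[of 0]] by simp
  have [measurable]: "k \<in> borel_measurable borel" by (rule borel_measurable_continuous_onI[OF k(1)])
  have bd: "cmod (k (x - t / N) * of_real (std_normal_density t)) \<le> C * exp (- \<beta> * \<bar>x\<bar>) * (exp (\<beta> * \<bar>t\<bar>) * std_normal_density t)" for t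
  proof -
    have "\<bar>t\<bar> * 1 \<le> \<bar>t\<bar> * N" using N by (intro mult_left_mono) auto
    then have "\<bar>t / N\<bar> \<le> \<bar>t\<bar>" using N by (simp add: divide_le_eq)
    then have "\<bar>x\<bar> - \<bar>t\<bar> \<le> \<bar>x - t / N\<bar>" by linarith
    then have "\<beta> * (\<bar>x\<bar> - \<bar>t\<bar>) \<le> \<beta> * \<bar>x - t / N\<bar>" using \<beta> by (rule mult_left_mono)
    then have "exp (- \<beta> * \<bar>x - t / N\<bar>) \<le> exp (- \<beta> * \<bar>x\<bar> + \<beta> * \<bar>t\<bar>)" by (simp add: algebra_simps)
    then have "C * exp (- \<beta> * \<bar>x - t / N\<bar>) \<le> C * exp (- \<beta> * \<bar>x\<bar> + \<beta> * \<bar>t\<bar>)" using C by (rule mult_left_mono)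
    with k(2)[of "x - t / N"] have "cmod (k (x - t / N)) \<le> C * exp (- \<beta> * \<bar>x\<bar> + \<beta> * \<bar>t\<bar>)" by linarith
    from mult_right_mono[OF this, of "std_normal_density t"]
    have "cmod (k (x - t / N)) * std_normal_density t \<le> C * exp (- \<beta> * \<bar>x\<bar> + \<beta> * \<bar>t\<bar>) * std_normal_density t"
      by (simp add: normal_density_nonneg)
    then have "cmod (k (x - t / N)) * std_normal_density t \<le> C * exp (- \<beta> * \<bar>x\<bar>) * (exp (\<beta> * \<bar>t\<bar>) * std_normal_density t)"
      by (simp only: exp_add mult.assoc)
    then show ?thesis by (simp add: norm_mult normal_density_nonneg)
  qed
  have i: "integrable lborel (\<lambda>t. C * exp (- \<beta> * \<bar>x\<bar>) * (exp (\<beta> * \<bar>t\<bar>) * std_normal_density t))"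
    by (intro integrable_mult_right integrable_exp_abs_normal)
  have N0: "N > 0" using N by simp
  show ?thesis
    unfolding mollify_real[OF N0] integral_mult_right_zero[symmetric]
  proof (rule Bochner_Integration.integral_norm_bound_integral[OF _ i bd])
    show "integrable lborel (\<lambda>t. k (x - t / N) * of_real (std_normal_density t))"
    proof (rule Bochner_Integration.integrable_bound[OF i])
      show "AE t in lborel. cmod (k (x - t / N) * of_real (std_normal_density t)) \<le> norm (C * exp (- \<beta> * \<bar>x\<bar>) * (exp (\<beta> * \<bar>t\<bar>) * std_normal_density t))"
        using bd by (intro AE_I2) (smt (verit) real_norm_def)
    qed measurable
  qed
qed

lemma mollify_tendsto:
  assumes k: "continuous_on UNIV k" and C: "\<And>x. cmod (k x) \<le> C"
  shows "(\<lambda>n. mollify (real (Suc n)) k (of_real x)) \<longlonglongrightarrow> k x"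
proof -
  have [measurable]: "k \<in> borel_measurable borel" by (rule borel_measurable_continuous_onI[OF k])
  have ni: "integrable lborel std_normal_density" using integrable_std_normal_moment[of 0] by simp
  have "(\<lambda>n. LINT t|lborel. k (x - t / real (Suc n)) * of_real (std_normal_density t)) \<longlonglongrightarrow> (LINT t|lborel. k x * of_real (std_normal_density t))"
  proof (rule integral_dominated_convergence[where w = "\<lambda>t. C * std_normal_density t"])
    show "AE t in lborel. (\<lambda>n. k (x - t / real (Suc n)) * of_real (std_normal_density t)) \<longlonglongrightarrow> k x * of_real (std_normal_density t)"
    proof (intro AE_I2 tendsto_mult tendsto_const)
      fix t :: real
      have "(\<lambda>n. x - t * inverse (real (Suc n))) \<longlonglongrightarrow> x - t * 0"
        by (intro tendsto_intros LIMSEQ_inverse_real_of_nat)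
      then have "(\<lambda>n. x - t / real (Suc n)) \<longlonglongrightarrow> x" by (simp add: divide_inverse)
      then show "(\<lambda>n. k (x - t / real (Suc n))) \<longlonglongrightarrow> k x"
        using k by (intro isCont_tendsto_compose[of _ k]) (auto simp: continuous_on_eq_continuous_at)
    qed
    show "AE t in lborel. cmod (k (x - t / real (Suc n)) * of_real (std_normal_density t)) \<le> C * std_normal_density t" for n
      using C by (intro AE_I2) (auto simp: norm_mult normal_density_nonneg intro!: mult_right_mono)
    show "integrable lborel (\<lambda>t. C * std_normal_density t)" by (intro integrable_mult_right ni)
  qed measurable
  moreover have "(LINT t|lborel. k x * of_real (std_normal_density t)) = k x"
    using integral_std_normal_moment_even[of 0] by simp
  ultimately show ?thesis by (simp add: mollify_real)
qed

lemma mollify_holomorphic: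
  assumes k: "k \<in> compactly_supported_continuous"
  shows "mollify N k holomorphic_on U"
proof -
  define I where "I z = (LINT t|lborel. k t * of_real (gauss N t) * exp (of_real (N\<^sup>2) * of_real t * z))" for z
  have "I field_differentiable at z" for z
  proof -
    have "(\<lambda>t. of_real (cmod (k t * of_real (gauss N t)) * exp (Re (of_real (N\<^sup>2) * of_real t * z) + 1 * \<bar>t\<bar>)) :: complex) \<in> compactly_supported_continuous"
      using k unfolding gauss_def compactly_supported_continuous_def by (auto intro!: continuous_intros)
    from integrable_compactly_supported_continuous[OF this]
    have "integrable lborel (\<lambda>t. cmod (k t * of_real (gauss N t)) * exp (Re (of_real (N\<^sup>2) * of_real t * z) + 1 * \<bar>t\<bar>))"
      by (simp only: complex_of_real_integrable_eq)
    moreover have "(\<lambda>t. k t * of_real (gauss N t)) \<in> borel_measurable borel"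
      using k by (intro borel_measurable_times borel_measurable_continuous_onI[of k]) (auto simp: compactly_supported_continuous_def)
    ultimately show ?thesis
      using integral_exp_has_derivative(1)[of "\<lambda>t. k t * of_real (gauss N t)" 1 "of_real (N\<^sup>2)" z]
      by (auto simp: field_differentiable_def I_def[abs_def])
  qed
  then have "I holomorphic_on U" unfolding holomorphic_on_def using field_differentiable_at_within by blast
  then show ?thesis
    unfolding mollify_def[abs_def] I_def[symmetric] by (intro holomorphic_intros) auto
qed

text \<open>For fixed N the Gaussian beats every exponential rate, uniformly for |y| \<le> b. Here D
  may depend on N, as it serves only for membership in \<open>decaying\<close>.\<close>

lemma norm_mollify_le:
  assumes k: "k \<in> compactly_supported_continuous" and N: "N > 0"
  obtains D where "\<And>x y. \<bar>y\<bar> \<le> b \<Longrightarrow> cmod (mollify N k (Complex x y)) \<le> D * exp (- \<beta> * \<bar>x\<bar>)"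
proof -
  obtain C R where R: "\<And>x. R < \<bar>x\<bar> \<Longrightarrow> k x = 0" "R > 0"
    using bounded_compactly_supported_continuous[OF k] by metis
  define E where "E = exp (\<bar>\<beta>\<bar> * R + \<beta>\<^sup>2 / (2 * N\<^sup>2) + N\<^sup>2 * b\<^sup>2 / 2)"
  have ik: "integrable lborel (\<lambda>t. cmod (k t))" 
    using integrable_norm[OF integrable_compactly_supported_continuous[OF k]] .
  have [measurable]: "k \<in> borel_measurable borel"
    using k by (intro borel_measurable_continuous_onI) (simp add: compactly_supported_continuous_def)
  have "cmod (mollify N k (Complex x y)) \<le> (N / sqrt (2 * pi) * (E * (LINT t|lborel. cmod (k t)))) * exp (- \<beta> * \<bar>x\<bar>)"
    if y: "\<bar>y\<bar> \<le> b" for x y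
  proof -
    have e: "cmod (exp (- (of_real (N\<^sup>2) * (Complex x y - of_real t)\<^sup>2 / 2))) \<le> E * exp (- \<beta> * \<bar>x\<bar>)"
      if t: "\<bar>t\<bar> \<le> R" for t
    proof -
      have "Re (- (of_real (N\<^sup>2) * (Complex x y - of_real t)\<^sup>2 / 2)) = - (N\<^sup>2 * ((x - t)\<^sup>2 - y\<^sup>2) / 2)"
        by (simp add: Complex_eq power2_eq_square algebra_simps)
      also have "\<dots> \<le> (\<bar>\<beta>\<bar> * R + \<beta>\<^sup>2 / (2 * N\<^sup>2) + N\<^sup>2 * b\<^sup>2 / 2) - \<beta> * \<bar>x\<bar>"
      proof -
        have "\<bar>y\<bar>\<^sup>2 \<le> b\<^sup>2" using y by (intro power_mono) auto
        then have 1: "N\<^sup>2 * y\<^sup>2 \<le> N\<^sup>2 * b\<^sup>2" by (intro mult_left_mono) auto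
        \<comment> \<open>Completing the square bounds the linear term by the quadratic one.\<close>
        have "0 \<le> (N * \<bar>x - t\<bar> - \<bar>\<beta>\<bar> / N)\<^sup>2" by simp
        also have "\<dots> = N\<^sup>2 * (x - t)\<^sup>2 - 2 * (\<bar>\<beta>\<bar> * \<bar>x - t\<bar>) + \<beta>\<^sup>2 / N\<^sup>2"
          using N by (simp add: power2_diff power_mult_distrib power_divide)
        finally have 2: "2 * (\<bar>\<beta>\<bar> * \<bar>x - t\<bar>) \<le> N\<^sup>2 * (x - t)\<^sup>2 + \<beta>\<^sup>2 / N\<^sup>2" by simp
        have "\<bar>x\<bar> \<le> \<bar>x - t\<bar> + R" using t by linarith
        then have "\<bar>\<beta>\<bar> * \<bar>x\<bar> \<le> \<bar>\<beta>\<bar> * (\<bar>x - t\<bar> + R)" by (intro mult_left_mono) auto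
        moreover have "\<beta> * \<bar>x\<bar> \<le> \<bar>\<beta>\<bar> * \<bar>x\<bar>" by (intro mult_right_mono) auto
        ultimately have 3: "\<beta> * \<bar>x\<bar> \<le> \<bar>\<beta>\<bar> * \<bar>x - t\<bar> + \<bar>\<beta>\<bar> * R" by (simp add: algebra_simps)
        have 4: "\<beta>\<^sup>2 / (2 * N\<^sup>2) = \<beta>\<^sup>2 / N\<^sup>2 / 2" by simp
        have "N\<^sup>2 * ((x - t)\<^sup>2 - y\<^sup>2) = N\<^sup>2 * (x - t)\<^sup>2 - N\<^sup>2 * y\<^sup>2"
          by (simp add: right_diff_distrib)
        then show ?thesis using 1 2 3 4 by linarith
      qed
      finally have "exp (Re (- (of_real (N\<^sup>2) * (Complex x y - of_real t)\<^sup>2 / 2))) \<le> exp ((\<bar>\<beta>\<bar> * R + \<beta>\<^sup>2 / (2 * N\<^sup>2) + N\<^sup>2 * b\<^sup>2 / 2) - \<beta> * \<bar>x\<bar>)"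
        by (simp only: exp_le_cancel_iff)
      then show ?thesis unfolding norm_exp_eq_Re E_def by (simp only: exp_diff exp_minus divide_inverse mult_minus_left)
    qed
    have bd: "cmod (k t * exp (- (of_real (N\<^sup>2) * (Complex x y - of_real t)\<^sup>2 / 2))) \<le> (E * exp (- \<beta> * \<bar>x\<bar>)) * cmod (k t)" for t
    proof (cases "R < \<bar>t\<bar>")
      case False
      then have "cmod (k t) * cmod (exp (- (of_real (N\<^sup>2) * (Complex x y - of_real t)\<^sup>2 / 2))) \<le> cmod (k t) * (E * exp (- \<beta> * \<bar>x\<bar>))"
        by (intro mult_left_mono e) auto
      then show ?thesis by (simp only: norm_mult mult.commute)
    qed (simp add: R)
    have i: "integrable lborel (\<lambda>t. (E * exp (- \<beta> * \<bar>x\<bar>)) * cmod (k t))" by (intro integrable_mult_right ik)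
    have "cmod (LINT t|lborel. k t * exp (- (of_real (N\<^sup>2) * (Complex x y - of_real t)\<^sup>2 / 2))) \<le> (LINT t|lborel. (E * exp (- \<beta> * \<bar>x\<bar>)) * cmod (k t))"
    proof (rule Bochner_Integration.integral_norm_bound_integral[OF _ i bd])
      show "integrable lborel (\<lambda>t. k t * exp (- (of_real (N\<^sup>2) * (Complex x y - of_real t)\<^sup>2 / 2)))"
      proof (rule Bochner_Integration.integrable_bound[OF i])
        show "AE t in lborel. cmod (k t * exp (- (of_real (N\<^sup>2) * (Complex x y - of_real t)\<^sup>2 / 2))) \<le> norm ((E * exp (- \<beta> * \<bar>x\<bar>)) * cmod (k t))"
          using bd by (intro AE_I2) (smt (verit) real_norm_def)
      qed measurable
    qed
    then have "cmod (mollify N k (Complex x y)) \<le> N / sqrt (2 * pi) * ((E * exp (- \<beta> * \<bar>x\<bar>)) * (LINT t|lborel. cmod (k t)))"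
      unfolding mollify_eq norm_mult using N by (simp add: norm_divide divide_right_mono)
    then show ?thesis by (simp only: mult_ac)
  qed
  then show ?thesis by (rule that)
qed

section \<open>Density of the functions (1 + X) f\<close>

context quantum_dilogarithm
begin

lemma mollify_decaying:
  assumes k: "k \<in> compactly_supported_continuous" and N: "N > 0"
  shows "mollify N k \<in> decaying"
  unfolding decaying_def
proof (intro CollectI conjI mollify_holomorphic[OF k] allI impI)
  fix b assume b: "0 < b" "b < w"
  obtain D where D: "\<And>x y. \<bar>y\<bar> \<le> b \<Longrightarrow> cmod (mollify N k (Complex x y)) \<le> D * exp (- (a * b) * \<bar>x\<bar>)"
    using norm_mollify_le[OF k N] by blast
  have D0: "0 \<le> D" using order_trans[OF norm_ge_zero D[of 0 0]] b by simp
  have "cmod (mollify N k (Complex x y)) \<le> D * exp (- a * b * \<bar>x\<bar> + a * max (- y) 0 * max x 0)" if "\<bar>y\<bar> \<le> b" for x y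
  proof -
    have "D * exp (- (a * b) * \<bar>x\<bar>) \<le> D * exp (- a * b * \<bar>x\<bar> + a * max (- y) 0 * max x 0)"
      using D0 a by (intro mult_left_mono) auto
    then show ?thesis using D[OF that, of x] by linarith
  qed
  then show "\<exists>C. \<forall>x y. \<bar>y\<bar> \<le> b \<longrightarrow> cmod (mollify N k (Complex x y)) \<le> C * exp (- a * b * \<bar>x\<bar> + a * max (- y) 0 * max x 0)"
    by blast
qed

text \<open>To approximate k, the function k / (1 + X) is mollified and then multiplied by 1 + X. On
  the real line the decay of the mollified functions is independent of n and outweighs the growth of
  1 + X.\<close>

lemma dense_decaying:
  "closure (abs_l2 ` (\<lambda>f x. restrict f x + A1 f x) ` decaying) = UNIV"
proof -
  let ?D = "closure (abs_l2 ` (\<lambda>f x. restrict f x + A1 f x) ` decaying)"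
  have "abs_l2 k \<in> ?D" if k: "k \<in> compactly_supported_continuous" for k
  proof -
    define l where "l x = of_real (1 / (1 + exp (a * s * x))) * k x" for x
    have pos: "1 + exp (a * s * x) \<noteq> 0" for x using exp_gt_zero[of "a * s * x"] by linarith
    have l: "l \<in> compactly_supported_continuous"
      unfolding l_def using pos by (intro compactly_supported_continuous_mult k continuous_intros) auto
    have lcont: "continuous_on UNIV l" using l by (simp add: compactly_supported_continuous_def)
    obtain C R where C: "\<And>x. cmod (l x) \<le> C" "C > 0" and R: "\<And>x. R < \<bar>x\<bar> \<Longrightarrow> l x = 0" "R > 0"
      using bounded_compactly_supported_continuous[OF l] by metis
    \<comment> \<open>One more than the growth rate of 1 + X, so that a factor exp (- |x|)
      remains.\<close>
    define \<beta> where "\<beta> = a * s + 1"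
    have \<beta>: "\<beta> \<ge> 0" using a s by (simp add: \<beta>_def)
    have le: "cmod (l x) \<le> (C * exp (\<beta> * R)) * exp (- \<beta> * \<bar>x\<bar>)" for x
    proof (cases "R < \<bar>x\<bar>")
      case False
      then have "\<beta> * \<bar>x\<bar> \<le> \<beta> * R" using \<beta> by (intro mult_left_mono) auto
      then have "C * 1 \<le> C * exp (\<beta> * R + - \<beta> * \<bar>x\<bar>)" using C(2) by (intro mult_left_mono) auto
      with C(1)[of x] have "cmod (l x) \<le> C * exp (\<beta> * R + - \<beta> * \<bar>x\<bar>)" by linarith
      then show ?thesis by (simp only: exp_add mult.assoc)
    qed (use R C in simp)
    define M where "M = C * exp (\<beta> * R) * (LINT t|lborel. exp (\<beta> * \<bar>t\<bar>) * std_normal_density t)"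
    define f where "f n = mollify (real (Suc n)) l" for n
    have fd: "f n \<in> decaying" for n unfolding f_def by (rule mollify_decaying[OF l]) simp
    have fb: "cmod (f n (of_real x)) \<le> M * exp (- \<beta> * \<bar>x\<bar>)" for n x
      using norm_mollify_real_le[OF _ \<beta> lcont le, of "real (Suc n)" x] by (simp add: f_def M_def mult_ac)
    have M: "0 \<le> M" using order_trans[OF norm_ge_zero fb[of 0 0]] by simp
    have eq: "restrict (f n) x + A1 (f n) x = of_real (1 + exp (a * s * x)) * f n (of_real x)" for n x
      by (simp add: restrict_def A1_def ex_def exp_of_real[symmetric] algebra_simps del: exp_of_real)
    have w: "(\<lambda>x. of_real (2 * M * exp (- 1 * \<bar>x\<bar>))) \<in> rapid"
      by (rule rapidI[of _ 1 "2 * M"]) (use M in \<open>auto intro!: continuous_intros simp: norm_mult\<close>)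
    have "(\<lambda>n. abs_l2 (\<lambda>x. restrict (f n) x + A1 (f n) x)) \<longlonglongrightarrow> abs_l2 k"
    proof (rule tendsto_l2_dominated[OF rapid_square_integrable[OF w]])
      show "(\<lambda>x. restrict (f n) x + A1 (f n) x) \<in> borel_measurable borel" for n
        using rapid_add[OF A_rapid(1,3)[OF fd]] by (intro borel_measurable_continuous_onI) (simp add: rapid_def)
      show "k \<in> borel_measurable borel"
        using k by (intro borel_measurable_continuous_onI) (simp add: compactly_supported_continuous_def)
      have "cmod (restrict (f n) x + A1 (f n) x) \<le> 2 * M * exp (- 1 * \<bar>x\<bar>)" for n x
      proof -
        have p: "0 \<le> a * s * \<bar>x\<bar>" "a * s * x \<le> a * s * \<bar>x\<bar>" using a s by (simp_all add: mult_left_mono)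
        have e1: "1 \<le> exp (a * s * \<bar>x\<bar>)" "exp (a * s * x) \<le> exp (a * s * \<bar>x\<bar>)" using p by simp_all
        have "\<bar>1 + exp (a * s * x)\<bar> = 1 + exp (a * s * x)" using exp_gt_zero[of "a * s * x"] by linarith
        with e1 have "\<bar>1 + exp (a * s * x)\<bar> \<le> 2 * exp (a * s * \<bar>x\<bar>)" by linarith
        then have "cmod (restrict (f n) x + A1 (f n) x) \<le> (2 * exp (a * s * \<bar>x\<bar>)) * (M * exp (- \<beta> * \<bar>x\<bar>))"
          unfolding eq norm_mult norm_of_real using fb[of n x] by (rule mult_mono) auto
        also have "\<dots> = 2 * M * exp (a * s * \<bar>x\<bar> + - \<beta> * \<bar>x\<bar>)" by (simp only: exp_add mult_ac)
        also have "a * s * \<bar>x\<bar> + - \<beta> * \<bar>x\<bar> = - 1 * \<bar>x\<bar>" by (simp add: \<beta>_def algebra_simps)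
        finally show ?thesis .
      qed
      then show "AE x in lborel. cmod (restrict (f n) x + A1 (f n) x) \<le> cmod (of_real (2 * M * exp (- 1 * \<bar>x\<bar>)))" for n
        using M by (intro AE_I2) (simp add: norm_mult)
      have "(\<lambda>n. restrict (f n) x + A1 (f n) x) \<longlonglongrightarrow> of_real (1 + exp (a * s * x)) * l x" for x
        unfolding eq unfolding f_def by (intro tendsto_mult tendsto_const mollify_tendsto[OF lcont C(1)])
      moreover have "of_real (1 + exp (a * s * x)) * l x = k x" for x
        unfolding l_def using pos[of x] by (simp add: mult.assoc[symmetric] of_real_mult[symmetric] del: of_real_mult of_real_add of_real_divide)
      ultimately show "AE x in lborel. (\<lambda>n. restrict (f n) x + A1 (f n) x) \<longlonglongrightarrow> k x"
        by simp
    qed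
    moreover have "abs_l2 (\<lambda>x. restrict (f n) x + A1 (f n) x) \<in> abs_l2 ` (\<lambda>f x. restrict f x + A1 f x) ` decaying" for n
      using fd by (intro imageI)
    ultimately show ?thesis
      unfolding closure_sequential by (intro exI conjI allI)
  qed
  then have "closure (abs_l2 ` compactly_supported_continuous) \<subseteq> ?D"
    by (intro closure_minimal) auto
  then show ?thesis using dense_compactly_supported_continuous by auto
qed

end

section \<open>The fifth power is scalar\<close>

lemma continuous_eq_on_dense:
  fixes f g :: "'a::topological_space \<Rightarrow> 'b::t2_space"
  assumes "continuous_on UNIV f" "continuous_on UNIV g" "closure A = UNIV" "\<And>x. x \<in> A \<Longrightarrow> f x = g x"
  shows "f x = g x"
proof -
  have "closure A \<subseteq> {x. f x = g x}"
    using assms(4) by (intro closure_minimal closed_Collect_eq assms(1,2)) auto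
  then show ?thesis using assms(3) by auto
qed

lemma l2_eq_on_dense:
  assumes "bounded_linear S" "bounded_linear R" "closure (abs_l2 ` A) = UNIV" "\<And>f. f \<in> A \<Longrightarrow> S (abs_l2 f) = R (abs_l2 f)"
  shows "S v = R v"
  by (rule continuous_eq_on_dense[OF _ _ assms(3)])
     (use assms(4) bounded_linear.continuous_on[OF assms(1) continuous_on_id] bounded_linear.continuous_on[OF assms(2) continuous_on_id] in auto)

lemma bounded_linear_funpow:
  fixes f :: "'a::real_normed_vector \<Rightarrow> 'a"
  assumes "bounded_linear f"
  shows "bounded_linear (f ^^ n)"
proof (induction n)
  case (Suc n)
  then show ?case using bounded_linear_compose[OF assms] by (simp add: o_def)
qed (simp add: bounded_linear_ident id_def)

text \<open>The exceptional null set depends on t. Fubini's theorem exchanges the quantifiers and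
  provides a single x with m (x + t) = m x for almost every t.\<close>

lemma AE_translation_invariant_const:
  fixes m :: "real \<Rightarrow> complex"
  assumes [measurable]: "m \<in> borel_measurable borel" and inv: "\<And>t. AE x in lborel. m (x + t) = m x"
  obtains c where "AE x in lborel. m x = c"
proof -
  have "AE t in lborel. AE x in lborel. m (x + t) = m x" by (rule AE_I2) (rule inv)
  moreover have "Measurable.pred (lborel \<Otimes>\<^sub>M lborel) (\<lambda>x. m (snd x + fst x) = m (snd x))"
    by measurable
  then have "{x \<in> space (lborel \<Otimes>\<^sub>M lborel). m (snd x + fst x) = m (snd x)} \<in> sets (lborel \<Otimes>\<^sub>M lborel)"
    by (simp only: pred_def)
  note lborel_pair.AE_commute[where P = "\<lambda>t x. m (x + t) = m x", OF this]
  ultimately have "AE x in lborel. AE t in lborel. m (x + t) = m x" by blast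
  then have "\<exists>x. AE t in lborel. m (x + t) = m x"
    by (rule eventually_happens'[rotated]) (simp add: ae_filter_eq_bot_iff)
  then obtain x where "AE t in lborel. m (x + t) = m x" by blast
  from AE_borel_affine[OF _ _ this, of 1 "- x"] have "AE t in lborel. m t = m x" by simp
  then show ?thesis by (rule that)
qed

lemma mult_l2_scale:
  assumes "multiplier g"
  shows "mult_l2 g (scale_l2 c v) = scale_l2 c (mult_l2 g v)"
  using mult_l2_times[OF assms multiplier_const[of c], of v] mult_l2_times[OF multiplier_const[of c] assms, of v]
  by (simp add: mult_l2_const mult.commute)

text \<open>The normalised operator for an arbitrary multiplier; h and u are parameters so that both
  can vary in the limit h -> 1.\<close>

definition mult_fourier :: "real \<Rightarrow> (real \<Rightarrow> complex) \<Rightarrow> l2 \<Rightarrow> l2" where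
  "mult_fourier h u v = scale_l2 (inverse (of_real (2 * pi * sqrt h))) (fourier_l2 h (mult_l2 u v))"

context
  fixes h :: real and u :: "real \<Rightarrow> complex"
  assumes h: "h > 0" and u: "continuous_on UNIV u" "\<And>x. cmod (u x) = 1"
begin

lemma multiplier_unimodular: "multiplier u"
  by (rule multiplierI[OF borel_measurable_continuous_onI[OF u(1)], of 1]) (simp add: u)

lemma bounded_linear_mult_fourier: "bounded_linear (mult_fourier h u)"
  unfolding mult_fourier_def[abs_def]
  by (intro bounded_linear_compose[OF bounded_linear_scale_l2] bounded_linear_compose[OF bounded_linear_fourier_l2[OF h]]
      mult_l2_bounded_linear multiplier_unimodular)

lemma mult_fourier_scale: "mult_fourier h u (scale_l2 c v) = scale_l2 c (mult_fourier h u v)"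
  by (simp add: mult_fourier_def mult_l2_scale[OF multiplier_unimodular] fourier_l2_scale[OF h] scale_l2_scale mult.commute)

lemma mult_fourier_abs_l2:
  assumes f: "continuous_on UNIV f" "integrable lborel f" "\<And>x. cmod (f x) \<le> C" "square_integrable f"
  shows "mult_fourier h u (abs_l2 f) = scale_l2 (inverse (of_real (2 * pi * sqrt h)))
           (abs_l2 (\<lambda>z. fourier (freq h) (\<lambda>x. u x * f x) (of_real z)))"
    and "square_integrable (\<lambda>z. fourier (freq h) (\<lambda>x. u x * f x) (of_real z))"
    and "norm (mult_fourier h u (abs_l2 f)) = norm (abs_l2 f)"
proof -
  note [measurable] = borel_measurable_continuous_onI[OF f(1)] borel_measurable_continuous_onI[OF u(1)]
  have c: "continuous_on UNIV (\<lambda>x. u x * f x)" by (intro continuous_intros u f)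
  have i: "integrable lborel (\<lambda>x. u x * f x)"
    by (rule Bochner_Integration.integrable_bound[OF f(2)]) (auto simp: norm_mult u)
  note m = multiplier_abs_l2[OF multiplier_unimodular f(4)]
  show eq: "mult_fourier h u (abs_l2 f) = scale_l2 (inverse (of_real (2 * pi * sqrt h)))
           (abs_l2 (\<lambda>z. fourier (freq h) (\<lambda>x. u x * f x) (of_real z)))"
    by (simp add: mult_fourier_def m(2) fourier_l2_integrable[OF h m(1) i])
  show "square_integrable (\<lambda>z. fourier (freq h) (\<lambda>x. u x * f x) (of_real z))"
    by (rule fourier_square_integrable[OF h m(1) i])
  have "norm (abs_l2 (\<lambda>z. fourier (freq h) (\<lambda>x. u x * f x) (of_real z))) = 2 * pi * sqrt h * norm (abs_l2 (\<lambda>x. u x * f x))"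
    by (rule norm_fourier_eq[OF h i c, of C]) (simp add: norm_mult u f(3))
  moreover have "norm (abs_l2 (\<lambda>x. u x * f x)) = norm (abs_l2 f)"
    by (rule power2_eq_imp_eq[OF _ norm_ge_zero norm_ge_zero])
       (simp add: norm_abs_l2_power2 m(1) f(4) norm_mult u)
  ultimately show "norm (mult_fourier h u (abs_l2 f)) = norm (abs_l2 f)"
    using h unfolding eq norm_scale_l2 norm_inverse norm_of_real by (simp add: field_simps)
qed

text \<open>The Plancherel equality is known for bounded continuous integrable functions; density
  and continuity of the norm do the rest.\<close>

lemma norm_mult_fourier: "norm (mult_fourier h u v) = norm v"
proof (rule continuous_eq_on_dense[OF _ _ dense_compactly_supported_continuous])
  show "continuous_on UNIV (\<lambda>v. norm (mult_fourier h u v))"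
    by (intro continuous_on_norm bounded_linear.continuous_on[OF bounded_linear_mult_fourier] continuous_on_id)
  show "continuous_on UNIV (\<lambda>v::l2. norm v)" by (intro continuous_intros)
  fix v assume "v \<in> abs_l2 ` compactly_supported_continuous"
  then obtain k where v: "v = abs_l2 k" and k: "k \<in> compactly_supported_continuous" by blast
  obtain C R where "\<And>x. cmod (k x) \<le> C" "\<And>x. R < \<bar>x\<bar> \<Longrightarrow> k x = 0"
    using bounded_compactly_supported_continuous[OF k] by metis
  then show "norm (mult_fourier h u v) = norm v"
    unfolding v using k
    by (intro mult_fourier_abs_l2(3) integrable_compactly_supported_continuous square_integrable_compactly_supported_continuous)
       (auto simp: compactly_supported_continuous_def)
qed

lemma norm_mult_fourier_funpow: "norm ((mult_fourier h u ^^ n) v) = norm v"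
  by (induction n) (simp_all add: norm_mult_fourier)

lemma mult_fourier_funpow_scale: "(mult_fourier h u ^^ n) (scale_l2 c v) = scale_l2 c ((mult_fourier h u ^^ n) v)"
  by (induction n) (simp_all add: mult_fourier_scale)

end

section \<open>What commutes with the fifth power\<close>

locale quantum_dilogarithm_operator = quantum_dilogarithm +
  fixes h :: real
  assumes h: "h > 0" and freq: "a = freq h"
begin

definition phi :: "real \<Rightarrow> complex" where "phi x = \<Phi> (of_real x)"
definition T :: "l2 \<Rightarrow> l2" where "T = mult_fourier h phi"
definition S :: "l2 \<Rightarrow> l2" where "S = T ^^ 5"
definition c :: complex where "c = inverse (of_real (2 * pi * sqrt h))"

lemma phi: "continuous_on UNIV phi" "cmod (phi x) = 1"
  using Phi_continuous unitary by (simp_all add: phi_def[abs_def])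

lemma c_nonzero: "c \<noteq> 0" using h by (simp add: c_def)

sublocale l2_operator S
proof (rule l2_operator.intro)
  show "bounded_linear S"
    unfolding S_def T_def by (intro bounded_linear_funpow bounded_linear_mult_fourier h phi)
  show "S (scale_l2 d v) = scale_l2 d (S v)" for d v
    unfolding S_def T_def by (intro mult_fourier_funpow_scale h phi)
qed

lemma T_rapid:
  assumes v: "v \<in> rapid"
  shows "T (abs_l2 v) = scale_l2 c (abs_l2 (\<lambda>z. kop v (of_real z)))"
proof -
  obtain C where "\<And>x. cmod (v x) \<le> C" using rapid_bounded[OF v] by blast
  then show ?thesis
    using mult_fourier_abs_l2(1)[OF h phi _ rapid_integrable[OF v] _ rapid_square_integrable[OF v], of C] v
    by (simp add: T_def c_def kop_def freq[symmetric] phi_def[abs_def] rapid_def)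
qed

lemma T_scale: "T (scale_l2 d v) = scale_l2 d (T v)"
  unfolding T_def by (rule mult_fourier_scale[OF h phi])

text \<open>Each application of \<open>T\<close> lowers the index of the operator by one modulo
  five, so \<open>A1\<close> passes through \<open>A0\<close>, \<open>A4\<close>, \<open>A3\<close>,
  \<open>A2\<close> and returns. One and the same g serves for f and for X f, which expresses S X =
  X S.\<close>

lemma S_decaying:
  assumes f: "f \<in> decaying"
  obtains g where "g \<in> decaying"
    "S (abs_l2 (restrict f)) = scale_l2 (c ^ 5) (abs_l2 (restrict g))"
    "S (abs_l2 (A1 f)) = scale_l2 (c ^ 5) (abs_l2 (A1 g))"
proof -
  define k where "k u = kop (restrict u)" for u
  have k: "k u \<in> decaying" if "u \<in> decaying" for u unfolding k_def using that by (rule kop_decaying)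
  note d = f k[OF f] k[OF k[OF f]] k[OF k[OF k[OF f]]] k[OF k[OF k[OF k[OF f]]]]
  have T0: "T (abs_l2 (restrict u)) = scale_l2 c (abs_l2 (restrict (k u)))" if "u \<in> decaying" for u
    using T_rapid[OF A_rapid(1)[OF that]] by (simp add: k_def restrict_def[abs_def])
  have T1: "T (abs_l2 (A1 u)) = scale_l2 c (abs_l2 (A0 (k u)))" "T (abs_l2 (A0 u)) = scale_l2 c (abs_l2 (A4 (k u)))"
    "T (abs_l2 (A4 u)) = scale_l2 c (abs_l2 (A3 (k u)))" "T (abs_l2 (A3 u)) = scale_l2 c (abs_l2 (A2 (k u)))"
    "T (abs_l2 (A2 u)) = scale_l2 c (abs_l2 (A1 (k u)))" if "u \<in> decaying" for u
    using T_rapid[OF A_rapid(2)[OF that]] T_rapid[OF A_rapid(3)[OF that]] T_rapid[OF A_rapid(4)[OF that]]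
      T_rapid[OF A_rapid(5)[OF that]] T_rapid[OF A_rapid(6)[OF that]]
      intertwine_A0[of u, folded k_def, symmetric] intertwine_A1[OF that, folded k_def, symmetric] intertwine_A2[OF that, folded k_def, symmetric]
      intertwine_A3[OF that, folded k_def, symmetric] intertwine_A4[OF that, folded k_def, symmetric]
    by simp_all
  have S: "S v = T (T (T (T (T v))))" for v by (simp add: S_def numeral_eq_Suc)
  have c5: "c * (c * (c * (c * c))) = c ^ 5" by (simp add: numeral_eq_Suc)
  show ?thesis
  proof (rule that[of "k (k (k (k (k f))))"])
    show "S (abs_l2 (restrict f)) = scale_l2 (c ^ 5) (abs_l2 (restrict (k (k (k (k (k f)))))))"
      unfolding S c5[symmetric] by (simp only: T0 d T_scale scale_l2_scale mult.assoc)
    show "S (abs_l2 (A1 f)) = scale_l2 (c ^ 5) (abs_l2 (A1 (k (k (k (k (k f)))))))"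
      unfolding S c5[symmetric] by (simp only: T1 d T_scale scale_l2_scale mult.assoc)
  qed (intro k d)
qed

text \<open>On a vector (1 + X) f both sides equal S f: the multiplier undoes 1 + X, and S maps (1 +
  X) f to a multiple of (1 + X) e, where S f is the same multiple of e. Such vectors are dense, and
  both sides are bounded operators.\<close>

lemma logistic_commuting: "(\<lambda>x. of_real (1 / (1 + exp (a * s * x)))) \<in> commuting"
proof -
  let ?r = "\<lambda>x. complex_of_real (1 / (1 + exp (a * s * x)))"
  have pos: "0 < 1 + exp (a * s * x)" for x by (simp add: add_pos_pos)
  have m: "multiplier ?r"
  proof (rule multiplierI[of _ 1])
    have "0 \<le> 1 / (1 + exp (a * s * x))" "1 / (1 + exp (a * s * x)) \<le> 1" for x using pos[of x] by simp_all
    then show "cmod (?r x) \<le> 1" for x unfolding norm_of_real by (simp only: abs_of_nonneg)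
  qed measurable
  have mult: "mult_l2 ?r (abs_l2 (\<lambda>x. restrict f x + A1 f x)) = abs_l2 (restrict f)" if "f \<in> decaying" for f
  proof -
    have "?r x * (restrict f x + A1 f x) = restrict f x" for x
    proof -
      have "restrict f x + A1 f x = of_real (1 + exp (a * s * x)) * restrict f x"
        by (simp add: restrict_def A1_def ex_def exp_of_real[symmetric] algebra_simps del: exp_of_real)
      then show ?thesis using pos[of x] by (simp add: mult.assoc[symmetric] of_real_mult[symmetric] del: of_real_mult of_real_add of_real_divide)
    qed
    then show ?thesis
      using multiplier_abs_l2(2)[OF m rapid_square_integrable[OF rapid_add[OF A_rapid(1,3)[OF that]]]] by simp
  qed
  have sum: "abs_l2 (\<lambda>x. restrict f x + A1 f x) = abs_l2 (restrict f) + abs_l2 (A1 f)" if "f \<in> decaying" for f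
    using plus_abs_l2[OF rapid_square_integrable[OF A_rapid(1)[OF that]] rapid_square_integrable[OF A_rapid(3)[OF that]]] by simp
  have "S (mult_l2 ?r v) = mult_l2 ?r (S v)" for v
  proof (rule l2_eq_on_dense[where S = "\<lambda>v. S (mult_l2 ?r v)" and R = "\<lambda>v. mult_l2 ?r (S v)", OF _ _ dense_decaying])
    show "bounded_linear (\<lambda>v. S (mult_l2 ?r v))" "bounded_linear (\<lambda>v. mult_l2 ?r (S v))"
      by (intro bounded_linear_compose[OF bounded_linear] bounded_linear_compose[OF mult_l2_bounded_linear[OF m]]
          mult_l2_bounded_linear[OF m] bounded_linear)+
    fix g assume "g \<in> (\<lambda>f x. restrict f x + A1 f x) ` decaying"
    then obtain f where g: "g = (\<lambda>x. restrict f x + A1 f x)" and f: "f \<in> decaying" by blast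
    obtain e where e: "e \<in> decaying" "S (abs_l2 (restrict f)) = scale_l2 (c ^ 5) (abs_l2 (restrict e))"
      "S (abs_l2 (A1 f)) = scale_l2 (c ^ 5) (abs_l2 (A1 e))"
      by (rule S_decaying[OF f])
    have "S (abs_l2 g) = scale_l2 (c ^ 5) (abs_l2 (\<lambda>x. restrict e x + A1 e x))"
      unfolding g sum[OF f] sum[OF e(1)] linear_add[OF bounded_linear.linear[OF bounded_linear]] e(2,3) scale_l2_add ..
    then have "mult_l2 ?r (S (abs_l2 g)) = scale_l2 (c ^ 5) (abs_l2 (restrict e))"
      by (simp only: mult_l2_scale[OF m] mult[OF e(1)])
    then show "S (mult_l2 ?r (abs_l2 g)) = mult_l2 ?r (S (abs_l2 g))"
      unfolding g mult[OF f] e(2) by simp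
  qed
  then show ?thesis using m by (simp add: commuting_def)
qed

lemma commuting_bounded:
  assumes "continuous_on UNIV u" "\<And>x. cmod (u x) \<le> C"
  shows "S (mult_l2 u v) = mult_l2 u (S v)"
  using commuting_bounded_continuous[OF _ logistic_commuting assms] a s by (simp add: commuting_def)

text \<open>\<open>T\<close> commutes with its own power S, and S commutes with multiplication by
  \<Phi>. Since |\<Phi>| = 1 on the real line, that multiplication is invertible and can be split
  off from \<open>T\<close>.\<close>

lemma S_fourier: "S (fourier_l2 h v) = fourier_l2 h (S v)"
proof -
  define v' where "v' = mult_l2 (\<lambda>x. cnj (phi x)) v"
  have m: "multiplier phi" "multiplier (\<lambda>x. cnj (phi x))"
    using phi by (auto intro!: multiplierI[of _ 1] borel_measurable_continuous_onI continuous_intros)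
  have one: "phi x * cnj (phi x) = 1" for x using complex_norm_square[of "phi x"] phi(2)[of x] by simp
  have v: "mult_l2 phi v' = v" 
    using mult_l2_times[OF m, of v] mult_l2_const[of 1 v] by (simp add: v'_def one)
  have T: "T w = scale_l2 c (fourier_l2 h (mult_l2 phi w))" for w by (simp add: T_def mult_fourier_def c_def)
  have "S (T v') = T (S v')" unfolding S_def by (rule funpow_swap1[symmetric])
  then have "scale_l2 c (S (fourier_l2 h v)) = scale_l2 c (fourier_l2 h (S v))"
    using commuting_bounded[OF phi(1), of 1 v'] phi(2) v by (simp add: T scale)
  then have "scale_l2 (inverse c) (scale_l2 c (S (fourier_l2 h v))) = scale_l2 (inverse c) (scale_l2 c (fourier_l2 h (S v)))"
    by simp
  then show ?thesis using c_nonzero by (simp add: scale_l2_scale)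
qed

text \<open>
  \<open>S\<close> commutes with multiplications, so it is a multiplication; it commutes with the Fourier transform,
  so with translations, and the multiplier is constant.  Both are tested on a Gaussian.
\<close>

lemma S_scalar: obtains lam where "cmod lam = 1" "\<And>v. S v = scale_l2 lam v"
proof -
  \<comment> \<open>A Gaussian and its transform: g is positive everywhere, so division by it is
    possible, and bounded continuous, so S commutes with multiplication by it and by its
    translates.\<close>
  define g0 where "g0 x = complex_of_real (gauss 1 x)" for x
  define p where "p x = 2 * pi * std_normal_density (freq h * x)" for x
  define g where "g x = complex_of_real (p x)" for x
  have g0i: "integrable lborel g0"
    using fourier_gauss(1)[of 1] by (simp add: g0_def[abs_def])
  have g0s: "square_integrable g0"
  proof -
    have "integrable lborel (\<lambda>x. (cmod (g0 x))\<^sup>2)"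
      by (rule Bochner_Integration.integrable_bound[OF g0i])
         (auto simp: g0_def gauss_def power2_eq_square mult_le_one)
    then show ?thesis by (simp add: square_integrable_def g0_def[abs_def])
  qed
  have Fg0: "fourier_l2 h (abs_l2 g0) = abs_l2 g" and gs: "square_integrable g"
    using fourier_l2_integrable[OF h g0s g0i] fourier_square_integrable(1)[OF h g0s g0i] fourier_gauss(2)[of 1 "freq h"]
    by (simp_all add: g_def[abs_def] p_def g0_def[abs_def])
  have p: "0 < p x" for x by (simp add: p_def std_normal_density_def)
  have pc: "continuous_on UNIV p" unfolding p_def std_normal_density_def by (intro continuous_intros) auto
  have pb: "p x \<le> 2 * pi" for x
  proof -
    have "2 \<le> 2 * pi" using pi_ge_two by linarith
    then have "1 / sqrt (2 * pi) \<le> 1" by simp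
    then have "std_normal_density (freq h * x) \<le> 1"
      unfolding std_normal_density_def by (rule mult_le_one) simp_all
    then show ?thesis by (simp add: p_def)
  qed
  note [measurable] = borel_measurable_continuous_onI[OF pc]
  \<comment> \<open>Modulations; the Fourier transform turns them into translations by t.\<close>
  define e where "e t x = exp (\<i> * of_real (freq h * x) * of_real t)" for t x :: real
  have em: "multiplier (e t)" for t by (rule multiplierI[of _ 1]) (auto simp: e_def[abs_def])
  have ec: "continuous_on UNIV (e t)" for t unfolding e_def by (intro continuous_intros)
  have eb: "cmod (e t x) \<le> 1" for t x by (simp add: e_def)
  obtain \<psi>0 where \<psi>0: "S (abs_l2 g0) = abs_l2 \<psi>0" "square_integrable \<psi>0" by (rule l2_cases)
  obtain \<psi> where \<psi>: "fourier_l2 h (abs_l2 \<psi>0) = abs_l2 \<psi>" "square_integrable \<psi>" by (rule l2_cases)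
  note [measurable] = square_integrable_measurable[OF \<psi>(2)]
  have gt: "S (abs_l2 (\<lambda>x. g (x + t))) = abs_l2 (\<lambda>x. \<psi> (x + t))" for t
  proof -
    have "abs_l2 (\<lambda>x. g (x + t)) = fourier_l2 h (mult_l2 (e t) (abs_l2 g0))"
      using fourier_l2_modulate[OF h g0s gs Fg0, of t] by (simp add: multiplier_abs_l2[OF em g0s] e_def)
    also have "S \<dots> = fourier_l2 h (mult_l2 (e t) (abs_l2 \<psi>0))"
      unfolding S_fourier commuting_bounded[OF ec eb] \<psi>0(1) ..
    also have "\<dots> = abs_l2 (\<lambda>x. \<psi> (x + t))"
      using fourier_l2_modulate[OF h \<psi>0(2) \<psi>(2,1), of t] by (simp add: multiplier_abs_l2[OF em \<psi>0(2)] e_def)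
    finally show ?thesis .
  qed
  have Sg: "S (abs_l2 g) = abs_l2 \<psi>" using gt[of 0] by simp
  have gc: "continuous_on UNIV (\<lambda>x. g (x + t))" for t
    unfolding g_def by (intro continuous_intros continuous_on_compose2[OF pc]) auto
  have gb: "cmod (g (x + t)) \<le> 2 * pi" for x t using p[of "x + t"] pb[of "x + t"] by (simp add: g_def)
  have gm: "multiplier (\<lambda>x. g (x + t))" for t
    by (rule multiplierI[OF borel_measurable_continuous_onI[OF gc] gb])
  have gm0: "multiplier g" using gm[of 0] by simp
  note gts = square_integrable_shift(1)[OF h gs] square_integrable_shift(1)[OF h \<psi>(2)]
  \<comment> \<open>The only possible multiplier. Computing S on the product of g and its translate
    by t in two ways shows that m is invariant under translation by t, almost everywhere.\<close>
  define m where "m x = \<psi> x / g x" for x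
  have "AE x in lborel. m (x + t) = m x" for t
  proof -
    have "abs_l2 (\<lambda>x. g x * \<psi> (x + t)) = mult_l2 g (S (abs_l2 (\<lambda>x. g (x + t))))"
      by (simp add: gt multiplier_abs_l2[OF gm0 gts(2)])
    also have "\<dots> = S (mult_l2 g (abs_l2 (\<lambda>x. g (x + t))))"
      using commuting_bounded[OF gc[of 0] gb[of _ 0]] by simp
    also have "\<dots> = S (abs_l2 (\<lambda>x. g x * g (x + t)))"
      unfolding multiplier_abs_l2(2)[OF gm0 gts(1)] ..
    also have "\<dots> = S (mult_l2 (\<lambda>x. g (x + t)) (abs_l2 g))"
      by (simp add: multiplier_abs_l2[OF gm gs] mult.commute)
    also have "\<dots> = abs_l2 (\<lambda>x. g (x + t) * \<psi> x)"
      unfolding commuting_bounded[OF gc gb] Sg by (simp add: multiplier_abs_l2[OF gm \<psi>(2)])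
    finally have "AE x in lborel. g x * \<psi> (x + t) = g (x + t) * \<psi> x"
      using multiplier_abs_l2(1)[OF gm0 gts(2)] multiplier_abs_l2(1)[OF gm \<psi>(2)] by (simp add: abs_l2_eq_iff)
    then show ?thesis
    proof eventually_elim
      case (elim x)
      then show ?case using p[of x] p[of "x + t"] by (simp add: m_def g_def field_simps)
    qed
  qed
  moreover have "m \<in> borel_measurable borel" unfolding m_def g_def by measurable
  ultimately obtain lam where "AE x in lborel. m x = lam" using AE_translation_invariant_const by metis
  then have "AE x in lborel. \<psi> x = lam * g x"
  proof eventually_elim
    case (elim x)
    then show ?case using p[of x] by (simp add: m_def g_def field_simps)
  qed
  then have S_g: "S (abs_l2 g) = scale_l2 lam (abs_l2 g)"
    unfolding Sg scale_abs_l2[OF gs] using \<psi>(2) square_integrable_cmult[OF gs] by (simp add: abs_l2_eq_iff)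
  have eq: "S v = scale_l2 lam v" for v
  proof (rule l2_eq_on_dense[OF bounded_linear bounded_linear_scale_l2 dense_compactly_supported_continuous])
    fix k assume k: "k \<in> compactly_supported_continuous"
    \<comment> \<open>Division by the positive function p exhibits k as a bounded continuous
      multiple of g, on which S is already known.\<close>
    define l where "l x = of_real (1 / p x) * k x" for x
    have l: "l \<in> compactly_supported_continuous"
      unfolding l_def using p by (intro compactly_supported_continuous_mult[OF k] continuous_intros pc) (metis less_irrefl)
    obtain C R where C: "\<And>x. cmod (l x) \<le> C" "\<And>x. R < \<bar>x\<bar> \<Longrightarrow> l x = 0"
      using bounded_compactly_supported_continuous[OF l] by metis
    have lc: "continuous_on UNIV l" using l by (simp add: compactly_supported_continuous_def)
    have lm: "multiplier l" by (rule multiplierI[OF borel_measurable_continuous_onI[OF lc] C(1)])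
    have "l x * g x = k x" for x using p[of x] by (simp add: l_def g_def)
    then have "mult_l2 l (abs_l2 g) = abs_l2 k" by (simp add: multiplier_abs_l2[OF lm gs])
    then show "S (abs_l2 k) = scale_l2 lam (abs_l2 k)"
      using commuting_bounded[OF lc C(1), of "abs_l2 g"] by (simp add: S_g mult_l2_scale[OF lm])
  qed
  \<comment> \<open>A nonzero vector, on which the isometry of S determines the modulus of the
    scalar.\<close>
  have "norm (abs_l2 g) \<noteq> 0"
  proof
    assume "norm (abs_l2 g) = 0"
    then have "(LINT x|lborel. (cmod (g x))\<^sup>2) = 0" using norm_abs_l2_power2[OF gs] by simp
    then have "AE x in lborel. (cmod (g x))\<^sup>2 = 0"
      using gs by (subst (asm) integral_nonneg_eq_0_iff_AE) (auto simp: square_integrable_def)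
    then have "AE x in (lborel :: real measure). False"
      by eventually_elim (use p in \<open>simp add: g_def less_imp_neq[symmetric]\<close>)
    then show False by (simp add: ae_filter_eq_bot_iff eventually_False)
  qed
  moreover have "norm (S (abs_l2 g)) = norm (abs_l2 g)"
    unfolding S_def T_def by (rule norm_mult_fourier_funpow[OF h phi])
  ultimately have "cmod lam = 1" by (simp add: S_g norm_scale_l2)
  then show ?thesis using eq by (rule that)
qed

end

section \<open>Continuity in the parameter\<close>

text \<open>Equality of the norms replaces a square-integrable majorant: Scheffe's lemma, applied to
  the squared moduli, excludes a loss of mass at infinity or in peaks.\<close>

lemma tendsto_abs_l2:
  assumes G: "\<And>n. square_integrable (G n)" and g: "square_integrable g"
    and lim: "\<And>x. (\<lambda>n. G n x) \<longlonglongrightarrow> g x" and norm: "\<And>n. norm (abs_l2 (G n)) = norm (abs_l2 g)"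
  shows "(\<lambda>n. abs_l2 (G n)) \<longlonglongrightarrow> abs_l2 g"
proof -
  note [measurable] = square_integrable_measurable[OF G] square_integrable_measurable[OF g]
  define D where "D n x = \<bar>(cmod (G n x))\<^sup>2 - (cmod (g x))\<^sup>2\<bar>" for n x
  define X where "X n x = (cmod (G n x - g x))\<^sup>2" for n x
  have iG: "integrable lborel (\<lambda>x. (cmod (G n x))\<^sup>2)" for n using G by (simp add: square_integrable_def)
  have ig: "integrable lborel (\<lambda>x. (cmod (g x))\<^sup>2)" using g by (simp add: square_integrable_def)
  have iX: "integrable lborel (X n)" for n
    using square_integrable_diff[OF G[of n] g] by (simp add: square_integrable_def X_def[abs_def])
  have iD: "integrable lborel (D n)" for n unfolding D_def[abs_def] using iG ig by auto
  have "(\<lambda>n. \<integral>\<^sup>+ x. ennreal (norm ((cmod (G n x))\<^sup>2 - (cmod (g x))\<^sup>2)) \<partial>lborel) \<longlonglongrightarrow> 0"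
  proof (rule Scheffe_lemma1[OF iG ig])
    show "AE x in lborel. (\<lambda>n. (cmod (G n x))\<^sup>2) \<longlonglongrightarrow> (cmod (g x))\<^sup>2"
      by (intro AE_I2 tendsto_intros lim)
    show "limsup (\<lambda>n. \<integral>\<^sup>+ x. ennreal (norm ((cmod (G n x))\<^sup>2)) \<partial>lborel) \<le> (\<integral>\<^sup>+ x. ennreal (norm ((cmod (g x))\<^sup>2)) \<partial>lborel)"
      by (simp add: nn_integral_square_integrable G g norm Limsup_const)
  qed
  moreover have "(\<integral>\<^sup>+ x. ennreal (norm ((cmod (G n x))\<^sup>2 - (cmod (g x))\<^sup>2)) \<partial>lborel) = ennreal (LINT x|lborel. D n x)" for n
    using nn_integral_eq_integral[OF iD, of n] by (simp add: D_def[abs_def])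
  moreover have D0: "0 \<le> (LINT x|lborel. D n x)" for n by (intro integral_nonneg_AE AE_I2) (simp add: D_def)
  ultimately have D: "(\<lambda>n. LINT x|lborel. D n x) \<longlonglongrightarrow> 0"
    by (simp add: ennreal_tendsto_0_iff)
  have iM: "integrable lborel (\<lambda>x. min (X n x) (4 * (cmod (g x))\<^sup>2))" for n
    using iX[of n] ig by (intro integrable_min) auto
  have M: "(\<lambda>n. LINT x|lborel. min (X n x) (4 * (cmod (g x))\<^sup>2)) \<longlonglongrightarrow> (LINT x|(lborel :: real measure). 0)"
  proof (rule integral_dominated_convergence[where w = "\<lambda>x. 4 * (cmod (g x))\<^sup>2"])
    have "(\<lambda>n. min (X n x) (4 * (cmod (g x))\<^sup>2)) \<longlonglongrightarrow> min ((cmod (g x - g x))\<^sup>2) (4 * (cmod (g x))\<^sup>2)" for x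
      unfolding X_def by (intro tendsto_intros lim)
    then show "AE x in lborel. (\<lambda>n. min (X n x) (4 * (cmod (g x))\<^sup>2)) \<longlonglongrightarrow> 0" by simp
  qed (use ig iM in \<open>auto simp: X_def\<close>)
  \<comment> \<open>|G - g|^2 \<le> 2 |G|^2 + 2 |g|^2 \<le> 2 D + 4 |g|^2. Hence, up to the Scheffe
    term 2 D, the integrand may be truncated at 4 |g|^2, where dominated convergence
    applies.\<close>
  have le: "(norm (abs_l2 (G n) - abs_l2 g))\<^sup>2 \<le> 2 * (LINT x|lborel. D n x) + (LINT x|lborel. min (X n x) (4 * (cmod (g x))\<^sup>2))" for n
  proof -
    have "(norm (abs_l2 (G n) - abs_l2 g))\<^sup>2 = (LINT x|lborel. X n x)"
      by (simp add: minus_abs_l2 G g norm_abs_l2_power2 square_integrable_diff X_def)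
    also have "\<dots> \<le> (LINT x|lborel. 2 * D n x + min (X n x) (4 * (cmod (g x))\<^sup>2))"
    proof (rule integral_mono[OF iX])
      show "integrable lborel (\<lambda>x. 2 * D n x + min (X n x) (4 * (cmod (g x))\<^sup>2))"
        using iD iM by (intro Bochner_Integration.integrable_add integrable_mult_right)
      fix x
      have "X n x \<le> (cmod (G n x) + cmod (g x))\<^sup>2"
        unfolding X_def by (intro power_mono norm_triangle_ineq4) simp
      also have "\<dots> \<le> 2 * (cmod (G n x))\<^sup>2 + 2 * (cmod (g x))\<^sup>2"
        using zero_le_power2[of "cmod (G n x) - cmod (g x)"] by (simp add: power2_eq_square algebra_simps)
      finally have "X n x \<le> 2 * (cmod (G n x))\<^sup>2 + 2 * (cmod (g x))\<^sup>2" .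
      moreover have "(cmod (G n x))\<^sup>2 - (cmod (g x))\<^sup>2 \<le> D n x" unfolding D_def by (rule abs_ge_self)
      ultimately have "X n x \<le> 2 * D n x + 4 * (cmod (g x))\<^sup>2" by argo
      moreover have "0 \<le> D n x" by (simp add: D_def)
      ultimately show "X n x \<le> 2 * D n x + min (X n x) (4 * (cmod (g x))\<^sup>2)" by linarith
    qed
    finally show ?thesis using iD iM by simp
  qed
  have "(\<lambda>n. 2 * (LINT x|lborel. D n x) + (LINT x|lborel. min (X n x) (4 * (cmod (g x))\<^sup>2))) \<longlonglongrightarrow> 2 * 0 + (LINT x|(lborel :: real measure). 0)"
    by (intro tendsto_intros D M)
  then have "(\<lambda>n. 2 * (LINT x|lborel. D n x) + (LINT x|lborel. min (X n x) (4 * (cmod (g x))\<^sup>2))) \<longlonglongrightarrow> 0" by simp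
  from tendsto_sandwich[OF _ _ tendsto_const this, of "\<lambda>n. (norm (abs_l2 (G n) - abs_l2 g))\<^sup>2"] le
  have "(\<lambda>n. (norm (abs_l2 (G n) - abs_l2 g))\<^sup>2) \<longlonglongrightarrow> 0" by simp
  from tendsto_real_sqrt[OF this] have "(\<lambda>n. norm (abs_l2 (G n) - abs_l2 g)) \<longlonglongrightarrow> 0" by simp
  then have "(\<lambda>n. abs_l2 (G n) - abs_l2 g) \<longlonglongrightarrow> 0" by (rule tendsto_norm_zero_cancel)
  then show ?thesis by (rule LIM_zero_cancel)
qed

lemma tendsto_on_dense:
  fixes L :: "nat \<Rightarrow> 'a::real_normed_vector \<Rightarrow> 'a"
  assumes lin: "\<And>n. bounded_linear (L n)" "bounded_linear M" and norm: "\<And>n v. norm (L n v) = norm v" "\<And>v. norm (M v) = norm v"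
    and dense: "closure A = UNIV" and lim: "\<And>v. v \<in> A \<Longrightarrow> (\<lambda>n. L n v) \<longlonglongrightarrow> M v"
  shows "(\<lambda>n. L n v) \<longlonglongrightarrow> M v"
proof (rule LIMSEQ_I)
  fix e :: real assume e: "0 < e"
  obtain y where y: "y \<in> A" "dist y v < e / 3"
    using dense e closure_approachable[of v A] by (metis UNIV_I divide_pos_pos zero_less_numeral)
  have yv: "norm (v - y) < e / 3" using y(2) by (simp add: dist_norm norm_minus_commute)
  obtain N where N: "\<And>n. n \<ge> N \<Longrightarrow> norm (L n y - M y) < e / 3"
    using LIMSEQ_D[OF lim[OF y(1)], of "e / 3"] e by auto
  have "norm (L n v - M v) < e" if n: "n \<ge> N" for n
  proof -
    have d: "L n (v - y) = L n v - L n y" "M (v - y) = M v - M y"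
      using lin by (simp_all add: linear_diff bounded_linear.linear)
    have "L n v - M v = L n (v - y) + (L n y - M y) - M (v - y)" by (simp add: d)
    then have "norm (L n v - M v) \<le> norm (L n (v - y)) + norm (L n y - M y) + norm (M (v - y))"
      using norm_triangle_ineq4[of "L n (v - y) + (L n y - M y)" "M (v - y)"]
        norm_triangle_ineq[of "L n (v - y)" "L n y - M y"] by simp
    then show ?thesis using N[OF n] yv by (simp add: norm)
  qed
  then show "\<exists>N. \<forall>n\<ge>N. norm (L n v - M v) < e" by blast
qed

text \<open>An isometry carries the error of the previous power along without enlarging it.\<close>

lemma tendsto_funpow:
  fixes L :: "nat \<Rightarrow> 'a::real_normed_vector \<Rightarrow> 'a"
  assumes lin: "\<And>n. bounded_linear (L n)" and norm: "\<And>n v. norm (L n v) = norm v"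
    and lim: "\<And>v. (\<lambda>n. L n v) \<longlonglongrightarrow> M v"
  shows "(\<lambda>n. (L n ^^ m) v) \<longlonglongrightarrow> (M ^^ m) v"
proof (induction m)
  case (Suc m)
  let ?w = "(M ^^ m) v"
  have "norm (L n ((L n ^^ m) v) - L n ?w) = norm ((L n ^^ m) v - ?w)" for n
    using norm[of n "(L n ^^ m) v - ?w"] lin[of n] by (simp add: linear_diff bounded_linear.linear)
  moreover have "(\<lambda>n. norm ((L n ^^ m) v - ?w)) \<longlonglongrightarrow> 0"
    by (intro tendsto_norm_zero LIM_zero Suc.IH)
  ultimately have "(\<lambda>n. L n ((L n ^^ m) v) - L n ?w) \<longlonglongrightarrow> 0"
    by (intro tendsto_norm_zero_cancel[of "\<lambda>n. L n ((L n ^^ m) v) - L n ?w"]) simp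
  from tendsto_add[OF this lim[of ?w]] show ?case by simp
qed simp

text \<open>For compactly supported functions the transforms converge at every point by dominated
  convergence, and their norms agree because all the operators are isometric;
  \<open>tendsto_abs_l2\<close> gives convergence in norm.\<close>

lemma mult_fourier_tendsto:
  assumes h: "\<And>n. h n > 0" "H > 0" "h \<longlonglongrightarrow> H"
    and u: "\<And>n. continuous_on UNIV (u n)" "\<And>n x. cmod (u n x) = 1"
    and U: "continuous_on UNIV U" "\<And>x. cmod (U x) = 1" and lim: "\<And>x. (\<lambda>n. u n x) \<longlonglongrightarrow> U x"
  shows "(\<lambda>n. mult_fourier (h n) (u n) v) \<longlonglongrightarrow> mult_fourier H U v"
proof (rule tendsto_on_dense[where L = "\<lambda>n. mult_fourier (h n) (u n)" and M = "mult_fourier H U", OF _ _ _ _ dense_compactly_supported_continuous])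
  show "bounded_linear (mult_fourier (h n) (u n))" for n by (rule bounded_linear_mult_fourier[OF h(1) u])
  show "bounded_linear (mult_fourier H U)" by (rule bounded_linear_mult_fourier[OF h(2) U])
  show "norm (mult_fourier (h n) (u n) v) = norm v" for n v by (rule norm_mult_fourier[OF h(1) u])
  show "norm (mult_fourier H U v) = norm v" for v by (rule norm_mult_fourier[OF h(2) U])
  fix v assume "v \<in> abs_l2 ` compactly_supported_continuous"
  then obtain k where v: "v = abs_l2 k" and k: "k \<in> compactly_supported_continuous" by blast
  obtain C R where C: "\<And>x. cmod (k x) \<le> C" "\<And>x. R < \<bar>x\<bar> \<Longrightarrow> k x = 0"
    using bounded_compactly_supported_continuous[OF k] by metis
  have kc: "continuous_on UNIV k" using k by (simp add: compactly_supported_continuous_def)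
  note ki = integrable_compactly_supported_continuous[OF k]
  note ks = square_integrable_compactly_supported_continuous[OF k]
  note [measurable] = borel_measurable_continuous_onI[OF kc] borel_measurable_continuous_onI[OF u(1)] borel_measurable_continuous_onI[OF U(1)]
  note mn = mult_fourier_abs_l2[OF h(1) u kc ki C(1) ks] and m = mult_fourier_abs_l2[OF h(2) U kc ki C(1) ks]
  define G where "G n z = inverse (of_real (2 * pi * sqrt (h n))) * fourier (freq (h n)) (\<lambda>x. u n x * k x) (of_real z)" for n z
  define g where "g z = inverse (of_real (2 * pi * sqrt H)) * fourier (freq H) (\<lambda>x. U x * k x) (of_real z)" for z
  have G: "mult_fourier (h n) (u n) v = abs_l2 (G n)" "square_integrable (G n)" for n
    using mn[of n] by (simp_all add: v G_def[abs_def] scale_abs_l2 square_integrable_cmult del: inverse_mult_distrib of_real_mult)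
  have g: "mult_fourier H U v = abs_l2 g" "square_integrable g"
    using m by (simp_all add: v g_def[abs_def] scale_abs_l2 square_integrable_cmult del: inverse_mult_distrib of_real_mult)
  have fr: "(\<lambda>n. freq (h n)) \<longlonglongrightarrow> freq H"
    unfolding freq_def using h(2) by (intro tendsto_intros h(3)) simp
  have "(\<lambda>n. abs_l2 (G n)) \<longlonglongrightarrow> abs_l2 g"
  proof (rule tendsto_abs_l2[OF G(2) g(2)])
    show "norm (abs_l2 (G n)) = norm (abs_l2 g)" for n
      unfolding G(1)[symmetric] g(1)[symmetric] norm_mult_fourier[OF h(1) u] norm_mult_fourier[OF h(2) U] ..
    fix z
    have "(\<lambda>n. fourier (freq (h n)) (\<lambda>x. u n x * k x) (of_real z)) \<longlonglongrightarrow> fourier (freq H) (\<lambda>x. U x * k x) (of_real z)"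
      unfolding fourier_def
    proof (rule integral_dominated_convergence[where w = "\<lambda>x. cmod (k x)"])
      show "AE x in lborel. (\<lambda>n. u n x * k x * exp (\<i> * of_real (freq (h n) * x) * of_real z)) \<longlonglongrightarrow> U x * k x * exp (\<i> * of_real (freq H * x) * of_real z)"
        by (intro AE_I2 tendsto_intros lim fr)
      show "AE x in lborel. cmod (u n x * k x * exp (\<i> * of_real (freq (h n) * x) * of_real z)) \<le> cmod (k x)" for n
        by (intro AE_I2) (simp add: norm_mult u)
      show "integrable lborel (\<lambda>x. cmod (k x))" using ki by simp
    qed measurable
    then show "(\<lambda>n. G n z) \<longlonglongrightarrow> g z"
      unfolding G_def g_def using h(2) by (intro tendsto_intros h(3)) simp_all
  qed
  then show "(\<lambda>n. mult_fourier (h n) (u n) v) \<longlonglongrightarrow> mult_fourier H U v" by (simp add: G(1) g(1))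
qed

lemma qdilog_continuous:
  assumes "h > 0" shows "continuous_on UNIV (\<lambda>x. qdilog h (of_real x))"
proof (rule continuous_on_compose2[OF holomorphic_on_imp_continuous_on[OF qdilog_holomorphic[OF assms]]])
  show "continuous_on UNIV complex_of_real" by (intro continuous_intros)
qed (use assms in \<open>auto simp: add_pos_pos\<close>)

text \<open>The radius in the definition varies with the parameter, so the contour is moved to Im p
  = 1 / 4, which is admissible for all parameters in [1, 2] at once. On this line both sines are at
  least sin (pi / 4), which yields a common majorant.\<close>

lemma qdilog_tendsto_1:
  assumes h: "\<And>n. 1 \<le> h n" "\<And>n. h n \<le> 2" "h \<longlonglongrightarrow> 1"
  shows "(\<lambda>n. qdilog (h n) (of_real x)) \<longlonglongrightarrow> qdilog 1 (of_real x)"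
proof -
  have line: "qdilog_integral k (of_real x) = (LINT t|lborel. qdilog_integrand k (of_real x) (Complex t (1 / 4)))"
    if "1 \<le> k" "k \<le> 2" for k
    by (rule qdilog_integral_eq_line) (use that in \<open>auto simp: field_simps add_pos_pos\<close>)
  define C where "C = exp (1 / 4 * x) * (4 / sin (pi / 4) * (4 / sin (pi / 4)) / (1 / 4))"
  have s0: "0 < sin (pi / 4)" by (intro sin_gt_zero) auto
  have C0: "0 \<le> C" using s0 by (simp add: C_def)
  have bd: "cmod (qdilog_integrand k (of_real x) (Complex t (1 / 4))) \<le> C * exp (- 1 * \<bar>t\<bar>)" if k: "1 \<le> k" "k \<le> 2" for k t
  proof -
    have "pi / 4 \<le> pi * k * (1 / 4)" "pi * k * (1 / 4) \<le> pi / 2" using k by (simp_all add: field_simps)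
    then have "sin (pi / 4) \<le> sin (pi * k * (1 / 4))" using pi_gt_zero by (intro sin_monotone_2pi_le) linarith+
    then have s: "sin (pi / 4) \<le> \<bar>sin (pi * k * (1 / 4))\<bar>" by linarith
    have "cmod (qdilog_integrand k (of_real x) (Complex t (1 / 4))) \<le> exp (1 / 4 * Re (of_real x)) *
       (4 / \<bar>sin (pi * 1 * (1 / 4))\<bar> * (4 / \<bar>sin (pi * k * (1 / 4))\<bar>) / \<bar>1 / 4\<bar>) * exp (- (pi * (1 + k) - 0) * \<bar>t\<bar>)"
      by (rule qdilog_integrand_line) (use k in \<open>auto simp: field_simps\<close>)
    also have "\<dots> \<le> C * exp (- 1 * \<bar>t\<bar>)"
    proof (rule mult_mono)
      have "4 / \<bar>sin (pi * k * (1 / 4))\<bar> \<le> 4 / sin (pi / 4)" using s s0 by (intro divide_left_mono) auto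
      then have "4 / sin (pi / 4) * (4 / \<bar>sin (pi * k * (1 / 4))\<bar>) \<le> 4 / sin (pi / 4) * (4 / sin (pi / 4))"
        using s0 by (intro mult_left_mono) auto
      then have le: "exp (1 / 4 * x) * (4 / sin (pi / 4) * (4 / \<bar>sin (pi * k * (1 / 4))\<bar>) / (1 / 4)) \<le> C"
        unfolding C_def by (intro mult_left_mono[OF divide_right_mono]) simp_all
      have "exp (1 / 4 * Re (of_real x)) * (4 / \<bar>sin (pi * 1 * (1 / 4))\<bar> * (4 / \<bar>sin (pi * k * (1 / 4))\<bar>) / \<bar>1 / 4\<bar>)
        = exp (1 / 4 * x) * (4 / sin (pi / 4) * (4 / \<bar>sin (pi * k * (1 / 4))\<bar>) / (1 / 4))"
        using s0 by simp
      with le show "exp (1 / 4 * Re (of_real x)) * (4 / \<bar>sin (pi * 1 * (1 / 4))\<bar> * (4 / \<bar>sin (pi * k * (1 / 4))\<bar>) / \<bar>1 / 4\<bar>) \<le> C"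
        by (simp only:)
      have "1 \<le> pi * (1 + k) - 0"
      proof -
        have "1 * 1 \<le> pi * (1 + k)" using pi_ge_two k by (intro mult_mono) auto
        then show ?thesis by simp
      qed
      then have "1 * \<bar>t\<bar> \<le> (pi * (1 + k) - 0) * \<bar>t\<bar>" by (rule mult_right_mono) simp
      then show "exp (- (pi * (1 + k) - 0) * \<bar>t\<bar>) \<le> exp (- 1 * \<bar>t\<bar>)" by simp
    qed (use C0 in auto)
    finally show ?thesis .
  qed
  have "(\<lambda>n. LINT t|lborel. qdilog_integrand (h n) (of_real x) (Complex t (1 / 4)))
      \<longlonglongrightarrow> (LINT t|lborel. qdilog_integrand 1 (of_real x) (Complex t (1 / 4)))"
  proof (rule integral_dominated_convergence[where w = "\<lambda>t. C * exp (- 1 * \<bar>t\<bar>)"])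
    show "AE t in lborel. (\<lambda>n. qdilog_integrand (h n) (of_real x) (Complex t (1 / 4))) \<longlonglongrightarrow> qdilog_integrand 1 (of_real x) (Complex t (1 / 4))"
    proof (rule AE_I2)
      fix t :: real
      have "sinh (of_real pi * Complex t (1 / 4)) \<noteq> 0"
        using norm_sinh_ge_sin[of "of_real pi * Complex t (1 / 4)"] s0 by auto
      then have nz: "sinh (of_real pi * Complex t (1 / 4)) * sinh (of_real pi * of_real 1 * Complex t (1 / 4)) \<noteq> 0"
        by simp
      have p: "Complex t (1 / 4) \<noteq> 0" by (simp add: complex_eq_iff)
      have "(\<lambda>n. sinh (of_real pi * of_real (h n) * Complex t (1 / 4))) \<longlonglongrightarrow> sinh (of_real pi * of_real 1 * Complex t (1 / 4))"
        unfolding sinh_def by (intro tendsto_intros h(3))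
      from tendsto_divide[OF tendsto_divide[OF tendsto_const tendsto_mult[OF tendsto_const this] nz] tendsto_const p]
      show "(\<lambda>n. qdilog_integrand (h n) (of_real x) (Complex t (1 / 4))) \<longlonglongrightarrow> qdilog_integrand 1 (of_real x) (Complex t (1 / 4))"
        unfolding qdilog_integrand_def .
    qed
    show "AE t in lborel. cmod (qdilog_integrand (h n) (of_real x) (Complex t (1 / 4))) \<le> C * exp (- 1 * \<bar>t\<bar>)" for n
      by (intro AE_I2 bd h)
    show "integrable lborel (\<lambda>t::real. C * exp (- 1 * \<bar>t\<bar>))"
      by (intro integrable_mult_right integrable_exp_minus_abs) simp
  qed measurable
  then show ?thesis
    unfolding qdilog_def using h(1,2) by (simp only: line order_refl one_le_numeral) (intro tendsto_intros)
qed

section \<open>The fifth power for the quantum dilogarithm\<close>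

lemma qdilog_power5_generic:
  assumes h: "h > 0" "h \<noteq> 1"
  obtains lam where "cmod lam = 1" "\<And>v. (mult_fourier h (\<lambda>x. qdilog h (of_real x)) ^^ 5) v = scale_l2 lam v"
proof -
  \<comment> \<open>With the smaller period for the shift, s = 2 pi b lies below the half width pi
    (b + c) of the strip precisely because h \<noteq> 1.\<close>
  define b c where "b = min 1 h" and "c = max 1 h"
  have bc: "b = 1 \<and> c = h \<or> b = h \<and> c = 1" "b < c" "0 < b" "0 < c" "b + c = 1 + h" "b * c = h"
    using h by (auto simp: b_def c_def min_def max_def)
  define s where "s = 2 * pi * b"
  have fs: "freq h * s = 1 / c" using bc(3,4) bc(6)[symmetric] by (simp add: freq_def s_def)
  have w: "pi * (1 + h) = pi * b + pi * c" unfolding bc(5)[symmetric] by (rule distrib_left)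
  interpret quantum_dilogarithm_operator "freq h" s "pi * (1 + h)" "exp (\<i> * of_real (freq h * s\<^sup>2 / 2))" "qdilog h" h
  proof
    show "s < pi * (1 + h)" unfolding w s_def using bc(2) by simp
    show "qdilog h holomorphic_on {z. - (pi * (1 + h)) < Im z \<and> Im z < pi * (1 + h)}"
      by (rule qdilog_holomorphic[OF h(1)])
    show "\<exists>C. \<forall>z. \<bar>Im z\<bar> \<le> e \<longrightarrow> cmod (qdilog h z) \<le> C * exp (freq h * Im z * max (Re z) 0)" if "e < pi * (1 + h)" for e
      using norm_qdilog_le[OF h(1) that] by metis
    show "qdilog h (z + \<i> * of_real s) = (1 + exp (\<i> * of_real (freq h * s\<^sup>2 / 2)) * exp (of_real (freq h * s) * z)) * qdilog h z"
      if z: "- (pi * (1 + h)) < Im z" "Im z < pi * (1 + h) - s" for z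
    proof -
      \<comment> \<open>The functional equation is applied at the midpoint of z and z + i s; the
        offset i pi b becomes the phase q = exp (i pi b / c).\<close>
      have "\<bar>Im (z + \<i> * pi * b)\<bar> < pi * c" using z unfolding w s_def by (simp add: abs_less_iff)
      from qdilog_functional_equation[OF h(1) bc(1) this]
      have "qdilog h (z + \<i> * pi * b + \<i> * pi * b) = qdilog h z * (1 + exp ((z + \<i> * pi * b) / c))" by simp
      moreover have "z + \<i> * pi * b + \<i> * pi * b = z + \<i> * of_real s" by (simp add: s_def)
      moreover have "(z + \<i> * pi * b) / c = \<i> * of_real (freq h * s\<^sup>2 / 2) + of_real (freq h * s) * z"
      proof -
        have "freq h * s\<^sup>2 / 2 = (freq h * s) * (s / 2)" by (simp add: power2_eq_square)
        also have "\<dots> = pi * b / c" unfolding fs by (simp add: s_def)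
        finally have e: "freq h * s\<^sup>2 / 2 = pi * b / c" .
        show ?thesis unfolding e fs using bc(4) by (simp add: field_simps)
      qed
      ultimately show ?thesis by (simp only: exp_add mult.commute)
    qed
    show "cmod (qdilog h (of_real x)) = 1" for x by (rule norm_qdilog_real[OF h(1)])
  qed (use h bc(3) in \<open>simp_all add: freq_pos s_def\<close>)
  obtain lam where "cmod lam = 1" "\<And>v. S v = scale_l2 lam v" by (rule S_scalar) (rule that)
  then show ?thesis by (intro that) (simp_all add: S_def T_def phi_def[abs_def])
qed

text \<open>
  For \<open>h = 1\<close> the two functional equations of the quantum dilogarithm both shift by the full half width
  of the strip, which leaves no room for the contour shifts; this case is obtained from \<open>h \<longrightarrow> 1\<close>.
\<close>

lemma qdilog_power5:
  assumes h: "h > 0"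
  obtains lam where "cmod lam = 1" "\<And>v. (mult_fourier h (\<lambda>x. qdilog h (of_real x)) ^^ 5) v = scale_l2 lam v"
proof (cases "h = 1")
  case False
  then show ?thesis using qdilog_power5_generic[OF h] that by metis
next
  case True
  define k where "k n = 1 + inverse (real (Suc n))" for n
  define L where "L n = mult_fourier (k n) (\<lambda>x. qdilog (k n) (of_real x))" for n
  define M where "M = mult_fourier 1 (\<lambda>x. qdilog 1 (of_real x))"
  have k: "1 \<le> k n" "k n \<le> 2" "0 < k n" "k n \<noteq> 1" for n
    by (auto simp: k_def field_simps add_pos_pos)
  have klim: "k \<longlonglongrightarrow> 1"
    unfolding k_def using tendsto_add[OF tendsto_const LIMSEQ_inverse_real_of_nat, of 1] by simp
  have L: "(\<lambda>n. L n v) \<longlonglongrightarrow> M v" for v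
    unfolding L_def M_def
    by (intro mult_fourier_tendsto k klim qdilog_continuous norm_qdilog_real qdilog_tendsto_1 zero_less_one)
  have lim: "(\<lambda>n. (L n ^^ 5) v) \<longlonglongrightarrow> (M ^^ 5) v" for v
  proof (rule tendsto_funpow[OF _ _ L])
    show "bounded_linear (L n)" for n
      unfolding L_def by (intro bounded_linear_mult_fourier k qdilog_continuous norm_qdilog_real)
    show "norm (L n v) = norm v" for n v
      unfolding L_def by (intro norm_mult_fourier k qdilog_continuous norm_qdilog_real)
  qed
  have "\<exists>lam. cmod lam = 1 \<and> (\<forall>v. (L n ^^ 5) v = scale_l2 lam v)" for n
    using qdilog_power5_generic[OF k(3,4)[of n]] unfolding L_def by metis
  then obtain lam where lam: "\<And>n. cmod (lam n) = 1" "\<And>n v. (L n ^^ 5) v = scale_l2 (lam n) v" by metis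
  \<comment> \<open>Convergence of the scalars is not given in advance; compactness of the unit
    circle provides a subsequence along which they converge.\<close>
  have "compact (sphere (0::complex) 1)" by simp
  then obtain l r where l: "l \<in> sphere 0 1" "strict_mono (r :: nat \<Rightarrow> nat)" "(lam \<circ> r) \<longlonglongrightarrow> l"
    unfolding compact_def using lam(1) by (metis mem_sphere_0)
  have "(M ^^ 5) v = scale_l2 l v" for v
  proof (rule LIMSEQ_unique)
    show "(\<lambda>n. (L (r n) ^^ 5) v) \<longlonglongrightarrow> (M ^^ 5) v"
      using LIMSEQ_subseq_LIMSEQ[OF lim l(2)] by (simp add: o_def)
    have "(\<lambda>n. cmod (lam (r n) - l) * norm v) \<longlonglongrightarrow> 0"
      using l(3) by (intro tendsto_mult_left_zero tendsto_norm_zero LIM_zero) (simp add: o_def)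
    then have "(\<lambda>n. norm (scale_l2 (lam (r n)) v - scale_l2 l v)) \<longlonglongrightarrow> 0"
      by (simp only: norm_scale_l2 flip: scale_l2_diff_left)
    then have "(\<lambda>n. scale_l2 (lam (r n)) v - scale_l2 l v) \<longlonglongrightarrow> 0" by (rule tendsto_norm_zero_cancel)
    then show "(\<lambda>n. (L (r n) ^^ 5) v) \<longlonglongrightarrow> scale_l2 l v"
      unfolding lam(2) by (rule LIM_zero_cancel)
  qed
  then show ?thesis using l(1) that[of l] True by (simp add: M_def)
qed

theorem theorem1p1:
  fixes h :: real
  assumes "h > 0"
  shows "\<exists>lam :: complex. cmod lam = 1 \<and>
           ((\<lambda>f. scale_l2 (inverse (of_real (2 * pi * sqrt h))) (K_op h f)) ^^ 5)
             = (\<lambda>f. scale_l2 lam f)"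
proof -
  obtain lam where "cmod lam = 1" "\<And>v. (mult_fourier h (\<lambda>x. qdilog h (of_real x)) ^^ 5) v = scale_l2 lam v"
    by (rule qdilog_power5[OF assms]) (rule that)
  moreover have "(\<lambda>f. scale_l2 (inverse (of_real (2 * pi * sqrt h))) (K_op h f)) = mult_fourier h (\<lambda>x. qdilog h (of_real x))"
    by (rule ext) (simp only: K_op_def mult_fourier_def)
  ultimately show ?thesis by auto
qed

end
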